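(* Let $P,Q\in L_1(0,\pi)$ be complex-valued and let $A=(a_{jk})$ be a complex $2\times4$ matrix with linearly independent rows. Let $\mathbb{L}$ be the Dirac operator in $\mathbb{H}=L_2(0,\pi)\oplus L_2(0,\pi)$ generated by $B\mathbf{y}'+V\mathbf{y}$ and the boundary conditions $U_1(\mathbf{y})=U_2(\mathbf{y})=0$ (see context). Suppose that $A_{14}A_{32}=A_{13}=A_{24}=0$ and that one of the following two conditions is satisfied: (i) $A_{14}\ne0$, and there exist numbers $\rho_5>0$, $\rho_7>0$ and complex numbers $\nu_5\neq 0$, $\nu_7\neq 0$ such that $$\lim_{h\to0}\frac{\int_0^hP(x)\,dx}{h^{\rho_5}}=\nu_5,\qquad \lim_{h\to0}\frac{\int_{\pi-h}^{\pi}Q(x)\,dx}{h^{\rho_7}}=\nu_7;$$ (ii) $A_{32}\ne0$, and there exist numbers $\rho_4>0$, $\rho_6>0$ and complex numbers $\nu_4\neq 0$, $\nu_6\neq 0$ such that $$\lim_{h\to0}\frac{\int_{\pi-h}^{\pi}P(x)\,dx}{h^{\rho_4}}=\nu_4,\qquad \lim_{h\to0}\frac{\int_0^hQ(x)\,dx}{h^{\rho_6}}=\nu_6.$$ Then the root function system of the problem $B\mathbf{y}'+V\mathbf{y}=\lambda\mathbf{y}$, $U_1(\mathbf{y})=U_2(\mathbf{y})=0$ (that is, of the operator $\mathbb{L}$) is complete and minimal in $\mathbb{H}$.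
   Context: Here $\mathbf{y}=\mathrm{col}(y_1(x),y_2(x))$, $x\in[0,\pi]$, $$B=\begin{pmatrix}-i&0\\0&i\end{pmatrix},\qquad V=\begin{pmatrix}0&P(x)\\Q(x)&0\end{pmatrix}.$$ The boundary forms are $$U_j(\mathbf{y})=a_{j1}y_1(0)+a_{j2}y_2(0)+a_{j3}y_1(\pi)+a_{j4}y_2(\pi),\qquad j=1,2,$$ where $a_{jk}\in\mathbb{C}$ and the rows of the $2\times4$ matrix $A=(a_{jk})$ are linearly independent. $A_{jk}$ denotes the determinant of the $2\times 2$ matrix composed of the $j$th and $k$th columns of $A$, in this order (so $A_{kj}=-A_{jk}$). The operator $\mathbb{L}\mathbf{y}=B\mathbf{y}'+V\mathbf{y}$ acts in $\mathbb{H}=L_2(0,\pi)\oplus L_2(0,\pi)$ with domain $D(\mathbb{L})=\{\mathbf{y}\in W_1^1[0,\pi]\oplus W_1^1[0,\pi]:\ \mathbb{L}\mathbf{y}\in\mathbb{H},\ U_1(\mathbf{y})=U_2(\mathbf{y})=0\}$, where $W_1^1[0,\pi]$ is the space of absolutely continuous functions on $[0,\pi]$. The root function system of $\mathbb{L}$ is the system of its eigenfunctions and associated functions (generalized eigenvectors), i.e. the union over all eigenvalues of bases of the corresponding root subspaces. A system is complete in $\mathbb{H}$ if its linear span is dense in $\mathbb{H}$; it is minimal if no element lies in the closed linear span of the others. In the limits, $h>0$. *)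

theory Defs
  imports "HOL-Analysis.Analysis" "HOL-Library.Function_Algebras"
begin

section \<open>The Hilbert space\<close>

(* Elements of L_2(0,pi) + L_2(0,pi) are represented by functions; two representatives of the same
   element are at l2_norm-distance 0.  Values outside [0,pi] play no role. *)

definition L2_space :: "(real \<Rightarrow> complex^2) set" where
  "L2_space = {f. f \<in> borel_measurable (lebesgue_on {0..pi}) \<and>
                  integrable (lebesgue_on {0..pi}) (\<lambda>x. (norm (f x))\<^sup>2)}"

definition l2_norm :: "(real \<Rightarrow> complex^2) \<Rightarrow> real" where
  "l2_norm f = sqrt (LINT x|lebesgue_on {0..pi}. (norm (f x))\<^sup>2)"

definition l2_closure :: "(real \<Rightarrow> complex^2) set \<Rightarrow> (real \<Rightarrow> complex^2) set" where
  "l2_closure S = {f \<in> L2_space. \<forall>\<epsilon>>0. \<exists>g\<in>S. l2_norm (f - g) < \<epsilon>}"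

definition fun_scale :: "complex \<Rightarrow> (real \<Rightarrow> complex^2) \<Rightarrow> (real \<Rightarrow> complex^2)" where
  "fun_scale c f = (\<lambda>x. c *s f x)"

global_interpretation cfun: vector_space fun_scale
  by unfold_locales (simp_all add: fun_scale_def fun_eq_iff algebra_simps vec_eq_iff)

definition complete_system :: "(real \<Rightarrow> complex^2) set \<Rightarrow> bool" where
  "complete_system S \<longleftrightarrow> S \<subseteq> L2_space \<and> L2_space \<subseteq> l2_closure (cfun.span S)"

definition minimal_system :: "(real \<Rightarrow> complex^2) set \<Rightarrow> bool" where
  "minimal_system S \<longleftrightarrow> S \<subseteq> L2_space \<and> (\<forall>f\<in>S. f \<notin> l2_closure (cfun.span (S - {f})))"


section \<open>The Dirac operator\<close>

(* The usual epsilon-delta definition: the members of D are non-overlapping compact intervals. *)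
definition absolutely_continuous_on_interval :: "real \<Rightarrow> real \<Rightarrow> (real \<Rightarrow> complex) \<Rightarrow> bool" where
  "absolutely_continuous_on_interval a b f \<longleftrightarrow>
     (\<forall>\<epsilon>>0. \<exists>\<delta>>0. \<forall>D T. D division_of T \<and> T \<subseteq> {a..b} \<and> (\<Sum>K\<in>D. Sup K - Inf K) < \<delta>
        \<longrightarrow> (\<Sum>K\<in>D. norm (f (Sup K) - f (Inf K))) < \<epsilon>)"

definition B_mat :: "complex^2^2" where
  "B_mat = vector [vector [- \<i>, 0], vector [0, \<i>]]"

definition V_mat :: "(real \<Rightarrow> complex) \<Rightarrow> (real \<Rightarrow> complex) \<Rightarrow> real \<Rightarrow> complex^2^2" where
  "V_mat P Q x = vector [vector [0, P x], vector [Q x, 0]]"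

(* For absolutely continuous y this is meaningful at almost every x in [0,pi] only;
   it is used below only up to null sets. *)
definition dirac_expr ::
  "(real \<Rightarrow> complex) \<Rightarrow> (real \<Rightarrow> complex) \<Rightarrow> (real \<Rightarrow> complex^2) \<Rightarrow> real \<Rightarrow> complex^2" where
  "dirac_expr P Q y x = B_mat *v vector_derivative y (at x) + V_mat P Q x *v y x"

definition bform :: "complex^4^2 \<Rightarrow> 2 \<Rightarrow> (real \<Rightarrow> complex^2) \<Rightarrow> complex" where
  "bform A j y = A$j$1 * y 0 $ 1 + A$j$2 * y 0 $ 2 + A$j$3 * y pi $ 1 + A$j$4 * y pi $ 2"

definition col_minor :: "complex^4^2 \<Rightarrow> 4 \<Rightarrow> 4 \<Rightarrow> complex" where
  "col_minor A j k = det (\<chi> r c. A $ r $ (if c = 1 then j else k) :: complex^2^2)"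

(* The rows are independent as a family; independence of the set "rows A" alone would
   not exclude equal rows. *)
definition independent_rows :: "complex^4^2 \<Rightarrow> bool" where
  "independent_rows A \<longleftrightarrow> row 1 A \<noteq> row 2 A \<and> vec.independent (rows A)"

(* Functions on [0,pi] are extended by 0, so that an element of the domain is determined
   as a function by its class in H. *)
definition dirac_domain ::
  "(real \<Rightarrow> complex) \<Rightarrow> (real \<Rightarrow> complex) \<Rightarrow> complex^4^2 \<Rightarrow> (real \<Rightarrow> complex^2) set" where
  "dirac_domain P Q A = {y.
     (\<forall>i. absolutely_continuous_on_interval 0 pi (\<lambda>x. y x $ i)) \<and>
     (\<forall>x. x \<notin> {0..pi} \<longrightarrow> y x = 0) \<and>
     dirac_expr P Q y \<in> L2_space \<and>
     (\<forall>j. bform A j y = 0)}"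


section \<open>Root functions\<close>

(* root_kernel P Q A \<mu> n is the kernel of (L - \<mu>)^n on its natural domain. *)
primrec root_kernel ::
  "(real \<Rightarrow> complex) \<Rightarrow> (real \<Rightarrow> complex) \<Rightarrow> complex^4^2 \<Rightarrow> complex \<Rightarrow> nat \<Rightarrow> (real \<Rightarrow> complex^2) set"
where
  "root_kernel P Q A \<mu> 0 = {0}"
| "root_kernel P Q A \<mu> (Suc n) = {y \<in> dirac_domain P Q A. \<exists>z\<in>root_kernel P Q A \<mu> n.
     AE x in lebesgue_on {0..pi}. dirac_expr P Q y x - \<mu> *s y x = z x}"

definition root_subspace ::
  "(real \<Rightarrow> complex) \<Rightarrow> (real \<Rightarrow> complex) \<Rightarrow> complex^4^2 \<Rightarrow> complex \<Rightarrow> (real \<Rightarrow> complex^2) set" where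
  "root_subspace P Q A \<mu> = (\<Union>n. root_kernel P Q A \<mu> n)"

definition eigenvalues ::
  "(real \<Rightarrow> complex) \<Rightarrow> (real \<Rightarrow> complex) \<Rightarrow> complex^4^2 \<Rightarrow> complex set" where
  "eigenvalues P Q A = {\<mu>. \<exists>y\<in>dirac_domain P Q A. y \<noteq> 0 \<and>
     (AE x in lebesgue_on {0..pi}. dirac_expr P Q y x = \<mu> *s y x)}"

(* The system depends on the choice of a basis in each root subspace. *)
definition root_function_system ::
  "(real \<Rightarrow> complex) \<Rightarrow> (real \<Rightarrow> complex) \<Rightarrow> complex^4^2 \<Rightarrow> (real \<Rightarrow> complex^2) set \<Rightarrow> bool" where
  "root_function_system P Q A S \<longleftrightarrow>
     (\<exists>b. (\<forall>\<mu>\<in>eigenvalues P Q A.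
             cfun.independent (b \<mu>) \<and> cfun.span (b \<mu>) = root_subspace P Q A \<mu>) \<and>
          S = (\<Union>\<mu>\<in>eigenvalues P Q A. b \<mu>))"

end

theory Submission
  imports Defs "HOL-Complex_Analysis.Complex_Analysis" "HOL-Real_Asymp.Real_Asymp"
begin

text \<open>Let \<open>\<Delta>\<close> be the characteristic determinant. For a bounded functional \<open>L\<close> that annihilates all root functions,
  \<open>L (\<Delta>(\<lambda>) (\<L> - \<lambda>)\<^sup>-\<^sup>1 g)\<close> vanishes at the zeros of \<open>\<Delta>\<close> to the order of \<open>\<Delta>\<close>, hence equals \<open>\<Delta> H\<close> with \<open>H\<close> entire
  of exponential type. The boundary conditions make the resolvent bounded in one of the half planes
  \<open>\<plusminus> Im \<lambda> \<ge> s\<close> and small along its imaginary half axis; the behaviour of \<open>P\<close> and \<open>Q\<close> at the end points bounds it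
  polynomially on the opposite half axis. By Phragmen--Lindelof \<open>H\<close> is constant, so \<open>H = 0\<close>, which means that \<open>L\<close> vanishes
  on the functions with zero boundary values, and these are dense.

  For minimality, the first \<open>m\<close> Taylor coefficients at a zero \<open>\<mu>\<close> of \<open>\<Delta>\<close> of order \<open>m\<close> of \<open>\<Delta>(\<lambda>) (\<L> - \<lambda>)\<^sup>-\<^sup>1 g\<close>, evaluated
  at \<open>0\<close>, are bounded functionals of \<open>g\<close> which vanish on the other root subspaces and separate the points of the root
  subspace of \<open>\<mu>\<close>.\<close>

section \<open>Absolutely continuous functions\<close>

text \<open>Solved for end values, the boundary conditions read u1(0) = \<alpha> u1(pi), u2(pi) =
  \<beta> u2(0), with the components exchanged in case (ii); the Pluecker relation between the
  minors gives \<alpha> \<beta> = 0. In one half plane these conditions feed exponentially damped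
  end values back into the system, whence the bounded resolvent. On the opposite side the
  determinant of the boundary problem has leading term \<alpha> \<beta>, so that for zero potential
  only exponentially small terms would remain. The potential adds the product of two reflection
  coefficients, to leading order Laplace transforms of P and Q taken from the end points; the
  assumed power laws bound this product below by a power of the parameter. This bound is proved on a
  single ray only. Hence H has to be known to be of exponential type, by a division theorem for
  entire functions, before Phragmen-Lindelof applies in the two quadrants on either side of the ray.
  The domain is defined by epsilon-delta absolute continuity, whereas every estimate works with
  integral equations; the passage between the two is the reason for the section on
  densities.\<close>

definition has_ac_deriv :: "(real \<Rightarrow> 'a::euclidean_space) \<Rightarrow> (real \<Rightarrow> 'a) \<Rightarrow> real \<Rightarrow> real \<Rightarrow> bool" where
  "has_ac_deriv f f' a b \<longleftrightarrow> f' absolutely_integrable_on {a..b} \<and>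
     (\<forall>x\<in>{a..b}. (f' has_integral (f x - f a)) {a..x})"

lemma has_ac_deriv_diff:
  assumes "has_ac_deriv f f' a b" "a \<le> x" "x \<le> y" "y \<le> b"
  shows "(f' has_integral (f y - f x)) {x..y}"
proof -
  have x: "(f' has_integral (f x - f a)) {a..x}" and y: "(f' has_integral (f y - f a)) {a..y}"
    using assms by (auto simp: has_ac_deriv_def)
  have "f' integrable_on {x..y}"
    by (rule integrable_subinterval_real[OF has_integral_integrable[OF y]]) (use assms in auto)
  then have i: "(f' has_integral integral {x..y} f') {x..y}" by blast
  have "(f' has_integral ((f x - f a) + integral {x..y} f')) {a..y}"
    using has_integral_combine[OF assms(2,3) x i] .
  with y have "(f x - f a) + integral {x..y} f' = f y - f a"
    using has_integral_unique by blast
  then have "integral {x..y} f' = f y - f x" by (simp add: algebra_simps)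
  with i show ?thesis by simp
qed

section \<open>Differentiation of indefinite integrals almost everywhere\<close>

text \<open>The differentiation theorem for cubes with a corner at \<open>x\<close> is, on the line,
  a statement about right-hand averages; left-hand ones are obtained afterwards by
  reflection.\<close>

lemma indefinite_integral_right_derivative_ae:
  fixes f :: "real \<Rightarrow> 'a::euclidean_space"
  assumes "\<And>a b. f integrable_on {a..b}"
  obtains N where "negligible N"
    "\<And>x. x \<notin> N \<Longrightarrow> ((\<lambda>h. integral {x..x+h} f /\<^sub>R h) \<longlongrightarrow> f x) (at_right 0)"
proof -
  obtain N where N: "negligible N"
    "\<And>x e. \<lbrakk>x \<notin> N; 0 < e\<rbrakk> \<Longrightarrow> \<exists>d>0. \<forall>h. 0 < h \<and> h < d \<longrightarrow>
       norm(integral (cbox x (x + h *\<^sub>R One)) f /\<^sub>R h ^ DIM(real) - f x) < e"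
    using integrable_ccontinuous_explicit[of f] assms by auto
  show ?thesis
  proof (rule that[OF N(1)])
    fix x assume x: "x \<notin> N"
    show "((\<lambda>h. integral {x..x+h} f /\<^sub>R h) \<longlongrightarrow> f x) (at_right 0)"
    proof (rule tendstoI)
      fix e :: real assume "e > 0"
      from N(2)[OF x this] obtain d where d: "d > 0" "\<forall>h. 0 < h \<and> h < d \<longrightarrow>
       norm(integral (cbox x (x + h *\<^sub>R One)) f /\<^sub>R h ^ DIM(real) - f x) < e" by blast
      show "eventually (\<lambda>h. dist (integral {x..x+h} f /\<^sub>R h) (f x) < e) (at_right 0)"
        unfolding eventually_at_right_field
        using d by (intro exI[of _ d]) (auto simp: dist_norm)
    qed
  qed
qed

text \<open>A left difference quotient at \<open>x\<close> is a right-hand average of the reflected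
  density at \<open>-x\<close>. Off both exceptional sets, the second one reflected back, the two
  one-sided limits agree.\<close>

lemma has_ac_deriv_ae_derivative:
  fixes f :: "real \<Rightarrow> 'a::euclidean_space"
  assumes ac: "has_ac_deriv f f' a b"
  obtains N where "negligible N"
    "\<And>x. x \<in> {a<..<b} - N \<Longrightarrow> (f has_vector_derivative f' x) (at x)"
proof -
  define g where "g x = (if x \<in> {a..b} then f' x else 0)" for x
  have ai: "f' absolutely_integrable_on {a..b}" using ac by (simp add: has_ac_deriv_def)
  have g: "g absolutely_integrable_on UNIV"
    unfolding g_def using ai absolutely_integrable_restrict_UNIV[of "{a..b}" f'] by simp
  have gi: "g integrable_on {c..d}" for c d
    by (rule integrable_on_subinterval[OF absolutely_integrable_on_def[THEN iffD1, THEN conjunct1, OF g]]) auto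
  obtain N where N: "negligible N"
    "\<And>x. x \<notin> N \<Longrightarrow> ((\<lambda>h. integral {x..x+h} g /\<^sub>R h) \<longlongrightarrow> g x) (at_right 0)"
    using indefinite_integral_right_derivative_ae[of g] gi by metis
  have gi': "(\<lambda>x. g (-x)) integrable_on {c..d}" for c d
    using Henstock_Kurzweil_Integration.integrable_reflect_real[where a="-d" and b="-c" and f=g] gi[of "-d" "-c"] by simp
  obtain M where M: "negligible M"
    "\<And>x. x \<notin> M \<Longrightarrow> ((\<lambda>h. integral {x..x+h} (\<lambda>x. g (-x)) /\<^sub>R h) \<longlongrightarrow> g (-x)) (at_right 0)"
    using indefinite_integral_right_derivative_ae[of "\<lambda>x. g (-x)"] gi' by metis
  have "negligible (uminus ` M)"
    by (rule negligible_differentiable_image_negligible[OF _ M(1)])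
      (auto intro!: derivative_intros simp: differentiable_on_def)
  then have neg: "negligible (N \<union> uminus ` M)" using N(1) by simp
  show ?thesis
  proof (rule that[OF neg])
    fix x assume x: "x \<in> {a<..<b} - (N \<union> uminus ` M)"
    then have xx: "a < x" "x < b" "x \<notin> N" "-x \<notin> M" by (auto simp: image_iff)
    have gx: "g x = f' x" using xx by (simp add: g_def)
    have int: "integral {u..v} g = f v - f u" if "a \<le> u" "u \<le> v" "v \<le> b" for u v
    proof -
      have "integral {u..v} g = integral {u..v} f'"
        by (rule integral_cong) (use that in \<open>auto simp: g_def\<close>)
      then show ?thesis using has_ac_deriv_diff[OF ac that] by (simp add: integral_unique)
    qed
    have r: "((\<lambda>h. (f (x+h) - f x) /\<^sub>R h) \<longlongrightarrow> f' x) (at_right 0)"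
    proof (rule Lim_transform_eventually[OF N(2)[OF xx(3), unfolded gx]])
      show "\<forall>\<^sub>F h in at_right 0. integral {x..x + h} g /\<^sub>R h = (f (x + h) - f x) /\<^sub>R h"
        unfolding eventually_at_right_field
        by (intro exI[of _ "b-x"]) (use xx int[of x] in auto)
    qed
    have "((\<lambda>h. (f x - f (x - h)) /\<^sub>R h) \<longlongrightarrow> f' x) (at_right 0)"
    proof (rule Lim_transform_eventually[OF M(2)[OF xx(4), unfolded minus_minus gx]])
      have *: "integral {-x..-x + h} (\<lambda>x. g (-x)) = integral {x - h..x} g" for h
        using Henstock_Kurzweil_Integration.integral_reflect_real[where a="x-h" and b=x and f=g] by (simp add: algebra_simps)
      show "\<forall>\<^sub>F h in at_right 0. integral {-x..-x + h} (\<lambda>x. g (-x)) /\<^sub>R h = (f x - f (x - h)) /\<^sub>R h"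
        unfolding eventually_at_right_field *
        by (intro exI[of _ "x-a"]) (use xx in \<open>auto simp: int\<close>)
    qed
    then have l: "((\<lambda>h. (f (x+h) - f x) /\<^sub>R h) \<longlongrightarrow> f' x) (at_left 0)"
      unfolding filterlim_at_left_to_right[where a="0::real"]
      by (simp add: scaleR_diff_right algebra_simps)
    have "((\<lambda>h. (f (x+h) - f x) /\<^sub>R h) \<longlongrightarrow> f' x) (at 0)"
      by (rule filterlim_split_at[OF l r])
    then have "((\<lambda>h. norm ((f (x+h) - f x) /\<^sub>R h - f' x)) \<longlongrightarrow> 0) (at 0)"
      by (simp add: tendsto_norm_zero_iff LIM_zero)
    then have "((\<lambda>h. norm (f (x+h) - f x - h *\<^sub>R f' x) / norm h) \<longlongrightarrow> 0) (at 0)"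
    proof (rule Lim_transform_eventually)
      show "\<forall>\<^sub>F h in at 0. norm ((f (x + h) - f x) /\<^sub>R h - f' x) =
        norm (f (x + h) - f x - h *\<^sub>R f' x) / norm h"
        unfolding eventually_at_filter
      proof (intro always_eventually allI impI)
        fix h :: real assume h: "h \<noteq> 0"
        have "(f (x + h) - f x) /\<^sub>R h - f' x = (f (x + h) - f x - h *\<^sub>R f' x) /\<^sub>R h"
          using h by (simp add: scaleR_diff_right)
        then show "norm ((f (x + h) - f x) /\<^sub>R h - f' x) =
            norm (f (x + h) - f x - h *\<^sub>R f' x) / norm h" by (simp add: divide_inverse)
      qed
    qed
    then show "(f has_vector_derivative f' x) (at x)"
      by (simp add: has_vector_derivative_def has_derivative_at bounded_linear_scaleR_left)
  qed
qed

lemma division_of_interval: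
  fixes D :: "real set set"
  assumes "D division_of T" "K \<in> D"
  obtains c d where "K = {c..d}" "c \<le> d"
proof -
  obtain c d where "K = cbox c d" using division_ofD(4)[OF assms] by blast
  moreover have "K \<noteq> {}" using division_ofD(3)[OF assms] .
  ultimately show ?thesis using that by auto
qed

text \<open>Uniform integrability by truncation at level \<open>n\<close>: the excess over
  \<open>n\<close> has small integral by dominated convergence, and the rest contributes at most
  \<open>n\<close> times the total length of the intervals.\<close>

lemma absolutely_integrable_small_sets:
  fixes f :: "real \<Rightarrow> 'a::euclidean_space"
  assumes "f absolutely_integrable_on {a..b}" "\<epsilon> > 0"
  obtains \<delta> where "\<delta> > 0"
    "\<And>D T. D division_of T \<Longrightarrow> T \<subseteq> {a..b} \<Longrightarrow> (\<Sum>K\<in>D. Sup K - Inf K) < \<delta> \<Longrightarrow>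
       (\<Sum>K\<in>D. integral K (\<lambda>x. norm (f x))) < \<epsilon>"
proof -
  define g where "g n x = max (norm (f x) - real n) 0" for n x
  have nf: "(\<lambda>x. norm (f x)) absolutely_integrable_on {a..b}"
    using absolutely_integrable_norm[OF assms(1)] by (simp add: o_def)
  have g: "g n absolutely_integrable_on {a..b}" for n
    unfolding g_def using nf
    by (intro absolutely_integrable_max_1 set_integral_diff absolutely_integrable_on_const) auto
  have gi: "g n integrable_on {a..b}" for n using g[of n] by (simp add: absolutely_integrable_on_def)
  have lim: "(\<lambda>n. integral {a..b} (g n)) \<longlonglongrightarrow> integral {a..b} (\<lambda>x. 0)"
  proof (rule dominated_convergence(2))
    show "g n integrable_on {a..b}" for n by (rule gi)
    show "(\<lambda>x. norm (f x)) integrable_on {a..b}" using nf by (simp add: absolutely_integrable_on_def)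
    show "norm (g n x) \<le> norm (f x)" if "x \<in> {a..b}" for n x by (auto simp: g_def)
    show "(\<lambda>n. g n x) \<longlonglongrightarrow> 0" if "x \<in> {a..b}" for x
    proof (rule tendsto_eventually)
      obtain N where "norm (f x) \<le> real N" using real_arch_simple by blast
      then show "\<forall>\<^sub>F n in sequentially. g n x = 0"
        unfolding eventually_sequentially g_def by (intro exI[of _ N]) (auto simp: max_def)
    qed
  qed
  then have "\<forall>\<^sub>F n in sequentially. dist (integral {a..b} (g n)) 0 < \<epsilon> / 2"
    using tendstoD[OF lim half_gt_zero[OF assms(2)]] by (simp only: integral_0)
  then obtain n where "dist (integral {a..b} (g n)) 0 < \<epsilon> / 2"
    by (auto simp: eventually_sequentially)
  then have n: "integral {a..b} (g n) < \<epsilon> / 2" by (simp add: dist_real_def)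
  have g0: "0 \<le> g n x" for x by (simp add: g_def)
  have fg: "norm (f x) \<le> g n x + real n" for x by (simp add: g_def)
  show ?thesis
  \<comment> \<open>Half of \<epsilon> goes to the excess; the other half covers \<open>n\<close>
    times the length. The \<open>+ 1\<close> keeps the denominator positive for
    \<open>n = 0\<close>.\<close>
  proof (rule that[of "\<epsilon> / (2 * (real n + 1))"])
    show "0 < \<epsilon> / (2 * (real n + 1))" using assms(2) by simp
    fix D T assume D: "D division_of T" "T \<subseteq> {a..b}" "(\<Sum>K\<in>D. Sup K - Inf K) < \<epsilon> / (2 * (real n + 1))"
    have K: "\<exists>c d. K = {c..d} \<and> c \<le> d" if "K \<in> D" for K
      using division_of_interval[OF D(1) that] by metis
    have sub: "K \<subseteq> {a..b}" if "K \<in> D" for K using division_ofD(2)[OF D(1) that] D(2) by blast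
    have gK: "g n integrable_on K" if "K \<in> D" for K
      using K[OF that] sub[OF that] integrable_on_subinterval[OF gi] by metis
    have nK: "(\<lambda>x. norm (f x)) integrable_on K" if "K \<in> D" for K
      using K[OF that] sub[OF that] integrable_on_subinterval[OF set_lebesgue_integral_eq_integral(1)[OF nf]] by metis
    have "integral K (\<lambda>x. norm (f x)) \<le> integral K (g n) + real n * (Sup K - Inf K)" if k: "K \<in> D" for K
    proof -
      from K[OF k] obtain c d where cd: "K = {c..d}" "c \<le> d" by blast
      have "integral K (\<lambda>x. norm (f x)) \<le> integral K (\<lambda>x. g n x + real n)"
        using gK[OF k] nK[OF k] fg cd by (intro integral_le integrable_add) auto
      also have "\<dots> = integral K (g n) + integral K (\<lambda>x. real n)"
        using gK[OF k] cd by (intro integral_add) auto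
      finally show ?thesis using cd by (simp add: mult.commute)
    qed
    then have "(\<Sum>K\<in>D. integral K (\<lambda>x. norm (f x))) \<le> (\<Sum>K\<in>D. integral K (g n)) + real n * (\<Sum>K\<in>D. Sup K - Inf K)"
      unfolding sum_distrib_left sum.distrib[symmetric] by (rule sum_mono)
    also have "(\<Sum>K\<in>D. integral K (g n)) = integral T (g n)"
    proof (rule sym, rule integral_combine_division_bottomup[OF D(1)])
      show "\<And>k. k \<in> D \<Longrightarrow> g n integrable_on k" by (rule gK)
    qed
    also have "integral T (g n) \<le> integral {a..b} (g n)"
      by (intro integral_subset_le D(2) gi integrable_combine_division[OF D(1)] gK ballI g0)
    also have "\<dots> < \<epsilon> / 2" by (rule n)
    also have "real n * (\<Sum>K\<in>D. Sup K - Inf K) \<le> real n * (\<epsilon> / (2 * (real n + 1)))"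
      using D(3) by (intro mult_left_mono) auto
    also have "\<dots> \<le> \<epsilon> / 2"
      using assms(2) by (simp add: field_simps)
    finally show "(\<Sum>K\<in>D. integral K (\<lambda>x. norm (f x))) < \<epsilon>" by simp
  qed
qed

lemma has_ac_deriv_imp_absolutely_continuous:
  assumes ac: "has_ac_deriv f f' a b"
  shows "absolutely_continuous_on_interval a b f"
  unfolding absolutely_continuous_on_interval_def
proof (intro allI impI)
  fix \<epsilon> :: real assume "\<epsilon> > 0"
  have ai: "f' absolutely_integrable_on {a..b}" using ac by (simp add: has_ac_deriv_def)
  obtain \<delta> where \<delta>: "\<delta> > 0" "\<And>D T. D division_of T \<Longrightarrow> T \<subseteq> {a..b} \<Longrightarrow> (\<Sum>K\<in>D. Sup K - Inf K) < \<delta> \<Longrightarrow>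
       (\<Sum>K\<in>D. integral K (\<lambda>x. norm (f' x))) < \<epsilon>"
    using absolutely_integrable_small_sets[OF ai \<open>\<epsilon> > 0\<close>] by blast
  show "\<exists>\<delta>>0. \<forall>D T. D division_of T \<and> T \<subseteq> {a..b} \<and> (\<Sum>K\<in>D. Sup K - Inf K) < \<delta>
        \<longrightarrow> (\<Sum>K\<in>D. norm (f (Sup K) - f (Inf K))) < \<epsilon>"
  proof (intro exI[of _ \<delta>] conjI allI impI \<delta>(1))
    fix D T assume D: "D division_of T \<and> T \<subseteq> {a..b} \<and> (\<Sum>K\<in>D. Sup K - Inf K) < \<delta>"
    have "norm (f (Sup K) - f (Inf K)) \<le> integral K (\<lambda>x. norm (f' x))" if k: "K \<in> D" for K
    proof -
      obtain c d where cd: "K = {c..d}" "c \<le> d"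
        using division_of_interval[OF conjunct1[OF D] k] by metis
      have sub: "{c..d} \<subseteq> {a..b}" using division_ofD(2)[OF conjunct1[OF D] k] D cd by blast
      then have "(f' has_integral (f d - f c)) {c..d}"
        using cd by (intro has_ac_deriv_diff[OF ac]) auto
      moreover have "(\<lambda>x. norm (f' x)) integrable_on {c..d}"
        using integrable_on_subinterval[OF set_lebesgue_integral_eq_integral(1)[OF absolutely_integrable_norm[OF ai]] sub]
        by (simp add: o_def)
      ultimately have "norm (f d - f c) \<le> integral {c..d} (\<lambda>x. norm (f' x))"
        using integral_norm_bound_integral[of f' "{c..d}" "\<lambda>x. norm (f' x)"]
        by (simp add: has_integral_integrable integral_unique)
      then show ?thesis using cd by simp
    qed
    then have "(\<Sum>K\<in>D. norm (f (Sup K) - f (Inf K))) \<le> (\<Sum>K\<in>D. integral K (\<lambda>x. norm (f' x)))"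
      by (rule sum_mono)
    also have "\<dots> < \<epsilon>" using \<delta>(2) D by blast
    finally show "(\<Sum>K\<in>D. norm (f (Sup K) - f (Inf K))) < \<epsilon>" .
  qed
qed

section \<open>From epsilon-delta absolute continuity to an integrable density\<close>

text \<open>Families of intervals are kept as sets of end point pairs instead of divisions: uniting,
  cutting and refining them then becomes arithmetic on end points. Touching intervals are allowed,
  degenerate ones are not.\<close>

definition nonoverlapping :: "(real \<times> real) set \<Rightarrow> real \<Rightarrow> real \<Rightarrow> bool" where
  "nonoverlapping E a b \<longleftrightarrow> finite E \<and> (\<forall>p\<in>E. a \<le> fst p \<and> fst p < snd p \<and> snd p \<le> b) \<and>
     (\<forall>p\<in>E. \<forall>q\<in>E. p \<noteq> q \<longrightarrow> snd p \<le> fst q \<or> snd q \<le> fst p)"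

text \<open>The increments carry their sign, so that the supremum over families is a positive
  variation.\<close>

definition increments :: "(real \<Rightarrow> real) \<Rightarrow> (real \<times> real) set \<Rightarrow> real" where
  "increments f E = (\<Sum>p\<in>E. f (snd p) - f (fst p))"

text \<open>Only the open interiors have to lie in \<open>U\<close>: they are disjoint and carry the
  whole length. This serves both for the full interval and for a small open neighbourhood of a null
  set.\<close>

lemma nonoverlapping_length_le:
  assumes E: "nonoverlapping E a b" and U: "\<And>p. p \<in> E \<Longrightarrow> {fst p<..<snd p} \<subseteq> U" "U \<in> sets lborel"
  shows "ennreal (increments (\<lambda>x. x) E) \<le> emeasure lborel U"
proof -
  have fin: "finite E" using E by (simp add: nonoverlapping_def)
  have "ennreal (increments (\<lambda>x. x) E) = (\<Sum>p\<in>E. ennreal (snd p - fst p))"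
    unfolding increments_def using E by (subst sum_ennreal) (auto simp: nonoverlapping_def less_imp_le)
  also have "\<dots> = (\<Sum>p\<in>E. emeasure lborel {fst p<..<snd p})"
    using E by (intro sum.cong refl) (auto simp: nonoverlapping_def less_imp_le)
  also have "\<dots> = emeasure lborel (\<Union>p\<in>E. {fst p<..<snd p})"
  proof (rule sum_emeasure)
    show "disjoint_family_on (\<lambda>p. {fst p<..<snd p}) E"
      unfolding disjoint_family_on_def
    proof (intro ballI impI)
      fix p q assume "p \<in> E" "q \<in> E" "p \<noteq> q"
      then have "snd p \<le> fst q \<or> snd q \<le> fst p" using E unfolding nonoverlapping_def by blast
      then show "{fst p<..<snd p} \<inter> {fst q<..<snd q} = {}" by auto
    qed
  qed (use fin in auto)
  also have "\<dots> \<le> emeasure lborel U" using U by (intro emeasure_mono) auto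
  finally show ?thesis .
qed

lemma nonoverlapping_length_le_interval:
  assumes E: "nonoverlapping E a b" "a \<le> b"
  shows "increments (\<lambda>x. x) E \<le> b - a"
proof -
  have "ennreal (increments (\<lambda>x. x) E) \<le> emeasure lborel {a..b}"
    using E by (intro nonoverlapping_length_le[OF E(1)]) (force simp: nonoverlapping_def)+
  then show ?thesis using E by simp
qed

text \<open>A one-sided condition on signed increments; two-sided control comes from imposing it on
  \<open>f\<close> and on \<open>- f\<close>. In this form it passes to the positive
  variation.\<close>

definition ac_real :: "(real \<Rightarrow> real) \<Rightarrow> real \<Rightarrow> real \<Rightarrow> bool" where
  "ac_real f a b \<longleftrightarrow> (\<forall>\<epsilon>>0. \<exists>\<delta>>0. \<forall>E. nonoverlapping E a b \<and> increments (\<lambda>x. x) E < \<delta> \<longrightarrow> increments f E < \<epsilon>)"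

text \<open>\<open>L\<close> stands for plus or minus the real or imaginary part, and the bound on
  \<open>L z - L w\<close> is the one-sided contraction property that these share.\<close>

lemma absolutely_continuous_imp_ac_real:
  assumes ac: "absolutely_continuous_on_interval a b f" and L: "\<And>z w. L z - L w \<le> norm (z - w :: complex)"
  shows "ac_real (\<lambda>x. L (f x)) a b"
  unfolding ac_real_def
proof (intro allI impI)
  fix \<epsilon> :: real assume "\<epsilon> > 0"
  then obtain \<delta> where \<delta>: "\<delta> > 0" "\<forall>D T. D division_of T \<and> T \<subseteq> {a..b} \<and> (\<Sum>K\<in>D. Sup K - Inf K) < \<delta>
        \<longrightarrow> (\<Sum>K\<in>D. norm (f (Sup K) - f (Inf K))) < \<epsilon>"
    using ac unfolding absolutely_continuous_on_interval_def by meson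
  show "\<exists>\<delta>>0. \<forall>E. nonoverlapping E a b \<and> increments (\<lambda>x. x) E < \<delta> \<longrightarrow> increments (\<lambda>x. L (f x)) E < \<epsilon>"
  proof (intro exI[of _ \<delta>] conjI allI impI \<delta>(1))
    fix E assume E: "nonoverlapping E a b \<and> increments (\<lambda>x. x) E < \<delta>"
    let ?I = "\<lambda>p::real\<times>real. {fst p..snd p}"
    have lt: "fst p < snd p" "a \<le> fst p" "snd p \<le> b" if "p \<in> E" for p
      using E that by (auto simp: nonoverlapping_def)
    have inj: "inj_on ?I E"
    proof (rule inj_onI)
      fix p q assume "p \<in> E" "q \<in> E" "?I p = ?I q"
      then show "p = q" using lt[of p] lt[of q] by (auto simp: Icc_eq_Icc prod_eq_iff)
    qed
    have div: "?I ` E division_of \<Union>(?I ` E)"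
    proof (rule division_ofI)
      show "finite (?I ` E)" using E by (simp add: nonoverlapping_def)
      show "K \<noteq> {}" if "K \<in> ?I ` E" for K using that lt by (force simp: not_less)
      show "\<exists>a b. K = cbox a b" if "K \<in> ?I ` E" for K using that by (auto intro: box_real(2)[symmetric])
      fix K1 K2 assume "K1 \<in> ?I ` E" "K2 \<in> ?I ` E" "K1 \<noteq> K2"
      then obtain p q where "p \<in> E" "q \<in> E" "p \<noteq> q" "K1 = ?I p" "K2 = ?I q" by auto
      moreover from this have "snd p \<le> fst q \<or> snd q \<le> fst p" using E unfolding nonoverlapping_def by blast
      ultimately show "interior K1 \<inter> interior K2 = {}" by auto
    qed auto
    have S: "Sup (?I p) = snd p" "Inf (?I p) = fst p" if "p \<in> E" for p
      using lt[OF that] by auto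
    have "(\<Sum>K\<in>?I ` E. Sup K - Inf K) = increments (\<lambda>x. x) E"
      unfolding increments_def by (subst sum.reindex[OF inj]) (auto intro!: sum.cong simp: S)
    moreover have "\<Union>(?I ` E) \<subseteq> {a..b}" using lt by force
    ultimately have "(\<Sum>K\<in>?I ` E. norm (f (Sup K) - f (Inf K))) < \<epsilon>"
      using \<delta>(2)[rule_format, OF conjI, OF div conjI] E by simp
    moreover have "increments (\<lambda>x. L (f x)) E \<le> (\<Sum>K\<in>?I ` E. norm (f (Sup K) - f (Inf K)))"
      unfolding increments_def by (subst sum.reindex[OF inj]) (auto intro!: sum_mono simp: S L)
    ultimately show "increments (\<lambda>x. L (f x)) E < \<epsilon>" by simp
  qed
qed

lemma nonoverlapping_split:
  assumes E: "nonoverlapping E a b" and m: "a \<le> m" "m \<le> b"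
  obtains E1 E2 where "nonoverlapping E1 a m" "nonoverlapping E2 m b"
    "\<And>f. increments f E = increments f E1 + increments f E2"
proof -
  have fin: "finite E" and lt: "\<And>p. p \<in> E \<Longrightarrow> a \<le> fst p \<and> fst p < snd p \<and> snd p \<le> b"
    and dj: "\<And>p q. p \<in> E \<Longrightarrow> q \<in> E \<Longrightarrow> p \<noteq> q \<Longrightarrow> snd p \<le> fst q \<or> snd q \<le> fst p"
    using E by (auto simp: nonoverlapping_def)
  define F1 F2 where "F1 = {p\<in>E. fst p < m}" and "F2 = {p\<in>E. m < snd p}"
  define l r where "l p = (fst p, min (snd p) m)" and "r p = (max (fst p) m, snd p)" for p :: "real \<times> real"
  have inj1: "inj_on l F1"
  proof (rule inj_onI)
    fix p q assume "p \<in> F1" "q \<in> F1" "l p = l q"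
    then show "p = q" using lt[of p] lt[of q] dj[of p q] by (force simp: F1_def l_def)
  qed
  have inj2: "inj_on r F2"
  proof (rule inj_onI)
    fix p q assume "p \<in> F2" "q \<in> F2" "r p = r q"
    then show "p = q" using lt[of p] lt[of q] dj[of p q] by (force simp: F2_def r_def)
  qed
  show ?thesis
  proof (rule that[of "l ` F1" "r ` F2"])
    have d1: "snd p \<le> fst q \<or> snd q \<le> fst p" if pq: "p \<in> l ` F1" "q \<in> l ` F1" "p \<noteq> q" for p q
    proof -
      obtain p' q' where "p' \<in> F1" "q' \<in> F1" "p = l p'" "q = l q'" using pq by blast
      moreover from this have "p' \<noteq> q'" using pq by auto
      ultimately show ?thesis using dj[of p' q'] by (auto simp: F1_def l_def)
    qed
    show "nonoverlapping (l ` F1) a m"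
      unfolding nonoverlapping_def
    proof (intro conjI ballI impI)
      show "finite (l ` F1)" using fin by (simp add: F1_def)
      fix p assume "p \<in> l ` F1"
      then obtain p' where "p' \<in> E" "fst p' < m" "p = l p'" by (auto simp: F1_def)
      then show "a \<le> fst p" "fst p < snd p" "snd p \<le> m" using lt[of p'] by (auto simp: l_def)
    qed (use d1 in blast)
    have d2: "snd p \<le> fst q \<or> snd q \<le> fst p" if pq: "p \<in> r ` F2" "q \<in> r ` F2" "p \<noteq> q" for p q
    proof -
      obtain p' q' where "p' \<in> F2" "q' \<in> F2" "p = r p'" "q = r q'" using pq by blast
      moreover from this have "p' \<noteq> q'" using pq by auto
      ultimately show ?thesis using dj[of p' q'] by (auto simp: F2_def r_def)
    qed
    show "nonoverlapping (r ` F2) m b"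
      unfolding nonoverlapping_def
    proof (intro conjI ballI impI)
      show "finite (r ` F2)" using fin by (simp add: F2_def)
      fix p assume "p \<in> r ` F2"
      then obtain p' where "p' \<in> E" "m < snd p'" "p = r p'" by (auto simp: F2_def)
      then show "m \<le> fst p" "fst p < snd p" "snd p \<le> b" using lt[of p'] by (auto simp: r_def)
    qed (use d2 in blast)
    fix f
    \<comment> \<open>Rests on f x + f m = f (min x m) + f (max x m): an interval straddling
      \<open>m\<close> contributes to both sums, any other interval to just one of them.\<close>
    have "increments f E = (\<Sum>p\<in>E. f (min (snd p) m) - f (min (fst p) m)) + (\<Sum>p\<in>E. f (max (snd p) m) - f (max (fst p) m))"
      unfolding increments_def sum.distrib[symmetric]
      by (intro sum.cong refl) (auto simp: min_def max_def)
    also have "(\<Sum>p\<in>E. f (min (snd p) m) - f (min (fst p) m)) = (\<Sum>p\<in>F1. f (snd (l p)) - f (fst (l p)))"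
    proof (rule sum.mono_neutral_cong_right[OF fin])
      show "\<forall>p\<in>E - F1. f (min (snd p) m) - f (min (fst p) m) = 0"
      proof
        fix p assume "p \<in> E - F1"
        then have "m \<le> fst p" "m \<le> snd p" using lt[of p] by (auto simp: F1_def)
        then show "f (min (snd p) m) - f (min (fst p) m) = 0" by (simp add: min_def)
      qed
    qed (auto simp: F1_def l_def min_def)
    also have "\<dots> = increments f (l ` F1)" unfolding increments_def by (simp add: sum.reindex[OF inj1])
    also have "(\<Sum>p\<in>E. f (max (snd p) m) - f (max (fst p) m)) = (\<Sum>p\<in>F2. f (snd (r p)) - f (fst (r p)))"
    proof (rule sum.mono_neutral_cong_right[OF fin])
      show "\<forall>p\<in>E - F2. f (max (snd p) m) - f (max (fst p) m) = 0"
      proof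
        fix p assume "p \<in> E - F2"
        then have "fst p \<le> m" "snd p \<le> m" using lt[of p] by (auto simp: F2_def)
        then show "f (max (snd p) m) - f (max (fst p) m) = 0" by (simp add: max_def)
      qed
    qed (auto simp: F2_def r_def max_def)
    also have "\<dots> = increments f (r ` F2)" unfolding increments_def by (simp add: sum.reindex[OF inj2])
    finally show "increments f E = increments f (l ` F1) + increments f (r ` F2)" .
  qed
qed

lemma nonoverlapping_empty [simp]: "nonoverlapping {} a b"
  by (simp add: nonoverlapping_def)

lemma nonoverlapping_trivial: "nonoverlapping E a a \<Longrightarrow> E = {}"
  by (force simp: nonoverlapping_def)

lemma nonoverlapping_Un:
  assumes E: "nonoverlapping E a x" and F: "nonoverlapping F x y" and "a \<le> x" "x \<le> y"
  shows "nonoverlapping (E \<union> F) a y"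
  unfolding nonoverlapping_def
proof (intro conjI ballI impI)
  show "finite (E \<union> F)" using E F by (simp add: nonoverlapping_def)
  have e: "a \<le> fst p \<and> fst p < snd p \<and> snd p \<le> x" if "p \<in> E" for p using E that by (auto simp: nonoverlapping_def)
  have f: "x \<le> fst p \<and> fst p < snd p \<and> snd p \<le> y" if "p \<in> F" for p using F that by (auto simp: nonoverlapping_def)
  fix p assume p: "p \<in> E \<union> F"
  then show "a \<le> fst p" "fst p < snd p" "snd p \<le> y" using e[of p] f[of p] assms(3,4) by auto
  fix q assume q: "q \<in> E \<union> F" "p \<noteq> q"
  consider "p \<in> E" "q \<in> E" | "p \<in> F" "q \<in> F" | "p \<in> E" "q \<in> F" | "p \<in> F" "q \<in> E" using p q by blast
  then show "snd p \<le> fst q \<or> snd q \<le> fst p"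
  proof cases
    case 1 then show ?thesis using E q unfolding nonoverlapping_def by blast
  next
    case 2 then show ?thesis using F q unfolding nonoverlapping_def by blast
  next
    case 3 then show ?thesis using e[of p] f[of q] by auto
  next
    case 4 then show ?thesis using e[of q] f[of p] by auto
  qed
qed

text \<open>The interval is exhausted by steps of length \<delta>/2, and each step adds less than 1
  to the increments. Half of \<delta> is used so that a piece is strictly shorter than
  \<delta>.\<close>

lemma ac_real_bounded_variation:
  assumes "ac_real f a b"
  obtains B where "\<And>E x. nonoverlapping E a x \<Longrightarrow> a \<le> x \<Longrightarrow> x \<le> b \<Longrightarrow> increments f E \<le> B"
proof -
  obtain \<delta> where \<delta>: "\<delta> > 0" "\<And>E. nonoverlapping E a b \<Longrightarrow> increments (\<lambda>x. x) E < \<delta> \<Longrightarrow> increments f E < 1"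
    using assms unfolding ac_real_def by (metis zero_less_one)
  have *: "\<forall>x E. a \<le> x \<longrightarrow> x \<le> b \<longrightarrow> x \<le> a + real n * (\<delta>/2) \<longrightarrow> nonoverlapping E a x \<longrightarrow> increments f E \<le> real n" for n
  proof (induction n)
    case 0
    show ?case by (auto dest!: nonoverlapping_trivial antisym simp: increments_def)
  next
    case (Suc n)
    show ?case
    proof (intro allI impI)
      fix x E assume x: "a \<le> x" "x \<le> b" "x \<le> a + real (Suc n) * (\<delta>/2)" and E: "nonoverlapping E a x"
      show "increments f E \<le> real (Suc n)"
      proof (cases "x \<le> a + real n * (\<delta>/2)")
        case True then have "increments f E \<le> real n" using Suc x E by blast
        then show ?thesis by simp
      next
        case False
        define m where "m = a + real n * (\<delta>/2)"
        have m: "a \<le> m" "m \<le> x" "x - m < \<delta>" using \<delta>(1) False x(3) by (auto simp: m_def field_simps)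
        obtain E1 E2 where E12: "nonoverlapping E1 a m" "nonoverlapping E2 m x"
          "\<And>f. increments f E = increments f E1 + increments f E2"
          using nonoverlapping_split[OF E m(1,2)] by blast
        have "increments f E1 \<le> real n"
          using Suc[rule_format, OF m(1) order_trans[OF m(2) x(2)] _ E12(1)] by (simp add: m_def)
        moreover have "increments f E2 < 1"
        proof (rule \<delta>(2))
          show "nonoverlapping E2 a b" using E12(2) m x by (force simp: nonoverlapping_def)
          show "increments (\<lambda>x. x) E2 < \<delta>"
            using nonoverlapping_length_le_interval[OF E12(2)] m by linarith
        qed
        ultimately show ?thesis using E12(3)[of f] by simp
      qed
    qed
  qed
  obtain n where "(b - a) / (\<delta>/2) \<le> real n" using real_arch_simple by blast
  then have n: "b \<le> a + real n * (\<delta>/2)" using \<delta>(1) by (simp add: field_simps)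
  show ?thesis
    by (rule that[of "real n"]) (use *[of n] n in auto)
qed

definition positive_variation :: "(real \<Rightarrow> real) \<Rightarrow> real \<Rightarrow> real \<Rightarrow> real" where
  "positive_variation f a x = Sup (increments f ` {E. nonoverlapping E a x})"

text \<open>The two halves of the additivity of positive variation over adjacent intervals. The
  variation over [x, y] itself never has to be named: it enters through its lower bounds
  \<open>increments f E\<close> and its upper bounds \<open>W\<close>.\<close>

lemma
  assumes ac: "ac_real f a b" and xy: "a \<le> x" "x \<le> y" "y \<le> b"
  shows positive_variation_ge: "nonoverlapping E x y \<Longrightarrow> positive_variation f a x + increments f E \<le> positive_variation f a y"
    and positive_variation_le: "(\<And>E. nonoverlapping E x y \<Longrightarrow> increments f E \<le> W) \<Longrightarrow>
      positive_variation f a y \<le> positive_variation f a x + W"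
proof -
  obtain B where B: "\<And>E x. nonoverlapping E a x \<Longrightarrow> a \<le> x \<Longrightarrow> x \<le> b \<Longrightarrow> increments f E \<le> B"
    using ac_real_bounded_variation[OF ac] by blast
  have bdd: "bdd_above (increments f ` {E. nonoverlapping E a z})" if "a \<le> z" "z \<le> b" for z
    using B that by (intro bdd_aboveI[of _ B]) auto
  have ne: "increments f ` {E. nonoverlapping E a z} \<noteq> {}" for z
    using nonoverlapping_empty by blast
  have up: "increments f E \<le> positive_variation f a z" if "nonoverlapping E a z" "a \<le> z" "z \<le> b" for E z
    unfolding positive_variation_def using that by (intro cSup_upper bdd) auto
  { assume E: "nonoverlapping E x y"
    have "positive_variation f a x \<le> positive_variation f a y - increments f E"
      unfolding positive_variation_def[of f a x]
    proof (rule cSup_least[OF ne])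
      fix s assume "s \<in> increments f ` {E. nonoverlapping E a x}"
      then obtain E' where E': "nonoverlapping E' a x" "s = increments f E'" by blast
      have "snd p \<le> x" if "p \<in> E'" for p using E' that by (auto simp: nonoverlapping_def)
      moreover have "x < snd p" if "p \<in> E" for p
        using E that unfolding nonoverlapping_def by (metis order_le_less_trans)
      ultimately have "E' \<inter> E = {}" by fastforce
      then have "increments f (E' \<union> E) = s + increments f E"
        using E E' by (auto simp: increments_def nonoverlapping_def sum.union_disjoint)
      moreover have "nonoverlapping (E' \<union> E) a y"
        by (rule nonoverlapping_Un[OF E'(1) E xy(1,2)])
      ultimately show "s \<le> positive_variation f a y - increments f E"
        using up[of "E' \<union> E" y] xy by simp
    qed
    then show "positive_variation f a x + increments f E \<le> positive_variation f a y" by simp }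
  { assume W: "\<And>E. nonoverlapping E x y \<Longrightarrow> increments f E \<le> W"
    show "positive_variation f a y \<le> positive_variation f a x + W"
      unfolding positive_variation_def[of f a y]
    proof (rule cSup_least[OF ne])
      fix s assume "s \<in> increments f ` {E. nonoverlapping E a y}"
      then obtain E where E: "nonoverlapping E a y" "s = increments f E" by blast
      obtain E1 E2 where E12: "nonoverlapping E1 a x" "nonoverlapping E2 x y"
          "increments f E = increments f E1 + increments f E2"
        using nonoverlapping_split[OF E(1) xy(1,2)] by metis
      then show "s \<le> positive_variation f a x + W"
        using up[OF E12(1)] W[OF E12(2)] xy E(2) by simp
    qed }
qed

text \<open>Inside every interval of \<open>E\<close> a family is chosen whose increments nearly
  exhaust the growth of the variation there. The union of these families is no longer than
  \<open>E\<close>, so the condition on \<open>f\<close> applies to it.\<close>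

lemma ac_real_positive_variation:
  assumes ac: "ac_real f a b"
  shows "ac_real (positive_variation f a) a b"
  unfolding ac_real_def
proof (intro allI impI)
  fix \<epsilon> :: real assume e: "\<epsilon> > 0"
  then obtain \<delta> where \<delta>: "\<delta> > 0" "\<And>E. nonoverlapping E a b \<Longrightarrow> increments (\<lambda>x. x) E < \<delta> \<Longrightarrow> increments f E < \<epsilon>/2"
    using ac unfolding ac_real_def by (metis half_gt_zero)
  let ?P = "positive_variation f a"
  show "\<exists>\<delta>>0. \<forall>E. nonoverlapping E a b \<and> increments (\<lambda>x. x) E < \<delta> \<longrightarrow> increments ?P E < \<epsilon>"
  proof (intro exI[of _ \<delta>] conjI allI impI \<delta>(1))
    fix E assume E: "nonoverlapping E a b \<and> increments (\<lambda>x. x) E < \<delta>"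
    have fin: "finite E" and lt: "\<And>p. p \<in> E \<Longrightarrow> a \<le> fst p \<and> fst p < snd p \<and> snd p \<le> b"
      and dj: "\<And>p q. p \<in> E \<Longrightarrow> q \<in> E \<Longrightarrow> p \<noteq> q \<Longrightarrow> snd p \<le> fst q \<or> snd q \<le> fst p"
      using E by (auto simp: nonoverlapping_def)
    \<comment> \<open>The accumulated error, one \<eta> for each interval of \<open>E\<close>, stays
      below \<epsilon>/4.\<close>
    define \<eta> where "\<eta> = \<epsilon> / (4 * (real (card E) + 1))"
    have \<eta>: "\<eta> > 0" using e by (simp add: \<eta>_def)
    have "\<exists>F. nonoverlapping F (fst p) (snd p) \<and> ?P (snd p) - ?P (fst p) - \<eta> < increments f F" if p: "p \<in> E" for p
    proof (rule ccontr)
      assume "\<not> ?thesis"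
      then have "?P (snd p) \<le> ?P (fst p) + (?P (snd p) - ?P (fst p) - \<eta>)"
        using lt[OF p] by (intro positive_variation_le[OF ac]) (auto simp: not_less)
      then show False using \<eta> by simp
    qed
    then obtain F where F: "\<And>p. p \<in> E \<Longrightarrow> nonoverlapping (F p) (fst p) (snd p)"
        "\<And>p. p \<in> E \<Longrightarrow> ?P (snd p) - ?P (fst p) - \<eta> < increments f (F p)" by metis
    have Fd: "\<And>p q. p \<in> E \<Longrightarrow> q \<in> F p \<Longrightarrow> fst p \<le> fst q \<and> fst q < snd q \<and> snd q \<le> snd p"
      using F(1) by (auto simp: nonoverlapping_def)
    have disj: "F p \<inter> F q = {}" if "p \<in> E" "q \<in> E" "p \<noteq> q" for p q
    proof (rule ccontr)
      assume "F p \<inter> F q \<noteq> {}"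
      then obtain r where "r \<in> F p" "r \<in> F q" by blast
      then show False using Fd[OF that(1), of r] Fd[OF that(2), of r] dj[OF that] by auto
    qed
    define G where "G = (\<Union>p\<in>E. F p)"
    have finF: "\<forall>p\<in>E. finite (F p)" using F(1) by (simp add: nonoverlapping_def)
    have inc: "increments g G = (\<Sum>p\<in>E. increments g (F p))" for g
      unfolding increments_def G_def using fin finF disj by (intro sum.UNION_disjoint) auto
    have "nonoverlapping G a b"
      unfolding nonoverlapping_def
    proof (intro conjI ballI impI)
      show "finite G" using fin finF by (simp add: G_def)
      fix p assume "p \<in> G"
      then obtain p' where p': "p' \<in> E" "p \<in> F p'" by (auto simp: G_def)
      show "a \<le> fst p" "fst p < snd p" "snd p \<le> b" using Fd[OF p'] lt[OF p'(1)] by auto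
      fix q assume "q \<in> G" "p \<noteq> q"
      then obtain q' where q': "q' \<in> E" "q \<in> F q'" by (auto simp: G_def)
      show "snd p \<le> fst q \<or> snd q \<le> fst p"
      proof (cases "p' = q'")
        case True then show ?thesis using F(1)[OF p'(1)] p' q' \<open>p \<noteq> q\<close> by (auto simp: nonoverlapping_def)
      next
        case False then show ?thesis using dj[OF p'(1) q'(1)] Fd[OF p'] Fd[OF q'] by auto
      qed
    qed
    moreover have "increments (\<lambda>x. x) G \<le> increments (\<lambda>x. x) E"
      unfolding inc increments_def[of _ E]
      by (intro sum_mono nonoverlapping_length_le_interval F(1)) (use lt in \<open>auto simp: less_imp_le\<close>)
    ultimately have "increments f G < \<epsilon>/2" using \<delta>(2) E by auto
    have "increments ?P E \<le> (\<Sum>p\<in>E. increments f (F p) + \<eta>)"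
      unfolding increments_def[of _ E] using F(2) by (intro sum_mono) fastforce
    also have "\<dots> = increments f G + real (card E) * \<eta>" by (simp add: inc sum.distrib)
    also have "real (card E) * \<eta> \<le> \<epsilon>/4" using e by (simp add: \<eta>_def field_simps)
    finally show "increments ?P E < \<epsilon>" using \<open>increments f G < \<epsilon>/2\<close> e by simp
  qed
qed

lemma ac_real_continuous:
  assumes ac: "ac_real g a b" and mono: "mono_on {a..b} g"
  shows "continuous_on {a..b} g"
  unfolding continuous_on_iff
proof (intro ballI allI impI)
  fix x e :: real assume x: "x \<in> {a..b}" and e: "e > 0"
  obtain \<delta> where \<delta>: "\<delta> > 0" "\<And>E. nonoverlapping E a b \<Longrightarrow> increments (\<lambda>x. x) E < \<delta> \<Longrightarrow> increments g E < e"
    using ac e unfolding ac_real_def by metis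
  have *: "g v - g u < e" if "u \<in> {a..b}" "v \<in> {a..b}" "u < v" "v - u < \<delta>" for u v
    using \<delta>(2)[of "{(u,v)}"] that by (simp add: nonoverlapping_def increments_def)
  show "\<exists>d>0. \<forall>x'\<in>{a..b}. dist x' x < d \<longrightarrow> dist (g x') (g x) < e"
  proof (intro exI[of _ \<delta>] conjI ballI impI \<delta>(1))
    fix y assume y: "y \<in> {a..b}" "dist y x < \<delta>"
    show "dist (g y) (g x) < e"
    proof (cases x y rule: linorder_cases)
      case less then show ?thesis using *[of x y] x y mono_onD[OF mono, of x y] by (auto simp: dist_real_def)
    next
      case greater then show ?thesis using *[of y x] x y mono_onD[OF mono, of y x] by (auto simp: dist_real_def)
    qed (use e in auto)
  qed
qed

text \<open>A Lebesgue null set is enclosed in an open set of measure below \<delta> and covered by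
  countably many nonoverlapping intervals inside that set. Every finite subfamily has Stieltjes
  measure at most \<epsilon>, and continuity from below extends this bound to the whole
  cover.\<close>

lemma interval_measure_absolutely_continuous:
  assumes ac: "ac_real g a b" and mono: "mono_on {a..b} g" and ab: "a < b"
    and F: "F = (\<lambda>x. g (max a (min b x)))"
  shows "absolutely_continuous lborel (interval_measure F)"
proof -
  let ?M = "interval_measure F"
  have Fmono: "F x \<le> F y" if "x \<le> y" for x y
    unfolding F using that ab by (intro mono_onD[OF mono]) auto
  have Fcont: "continuous_on UNIV F"
    unfolding F by (intro continuous_on_compose2[OF ac_real_continuous[OF ac mono]] continuous_intros) (use ab in auto)
  then have Fc: "isCont F x" for x by (simp add: continuous_on_eq_continuous_at)
  then have Fr: "continuous (at_right x) F" for x by (simp add: continuous_at_imp_continuous_at_within)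
  have Ioc: "emeasure ?M {c<..d} = F d - F c" if "c \<le> d" for c d
    by (rule emeasure_interval_measure_Ioc[OF that Fmono Fr])
  have Icc: "emeasure ?M {c..d} = F d - F c" if "c \<le> d" for c d
    by (rule emeasure_interval_measure_Icc[OF that Fmono Fcont])
  have Fa: "F x = g a" if "x \<le> a" for x using that ab by (simp add: F max_def min_def)
  have Fb: "F x = g b" if "b \<le> x" for x using that ab by (simp add: F max_def min_def)
  \<comment> \<open>\<open>F\<close> is constant outside [a, b], hence the Stieltjes measure carries
    no mass there, and by continuity none at the end points.\<close>
  have left: "{..a} \<in> null_sets ?M"
  proof -
    have "(\<Union>n. {a - real n..a}) \<in> null_sets ?M"
      by (intro null_sets_UN) (auto simp: null_sets_def Icc Fa)
    moreover have "(\<Union>n. {a - real n..a}) = {..a}"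
    proof (intro set_eqI iffI)
      fix x assume "x \<in> {..a}"
      moreover obtain n where "a - x \<le> real n" using real_arch_simple by blast
      ultimately show "x \<in> (\<Union>n. {a - real n..a})" by (intro UN_I[of n]) auto
    qed auto
    ultimately show ?thesis by simp
  qed
  have right: "{b..} \<in> null_sets ?M"
  proof -
    have "(\<Union>n. {b..b + real n}) \<in> null_sets ?M"
      by (intro null_sets_UN) (auto simp: null_sets_def Icc Fb)
    moreover have "(\<Union>n. {b..b + real n}) = {b..}"
    proof (intro set_eqI iffI)
      fix x assume "x \<in> {b..}"
      moreover obtain n where "x - b \<le> real n" using real_arch_simple by blast
      ultimately show "x \<in> (\<Union>n. {b..b + real n})" by (intro UN_I[of n]) auto
    qed auto
    ultimately show ?thesis by simp
  qed
  show ?thesis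
    unfolding absolutely_continuous_def
  proof
    fix N assume N: "N \<in> null_sets (lborel::real measure)"
    define N' where "N' = N \<inter> {a<..<b}"
    have N'b: "N' \<in> sets borel" using N by (auto simp: N'_def null_sets_def)
    have N'0: "emeasure lborel N' = 0" 
      using null_sets_subset[OF N, of N'] N'b by (auto simp: N'_def null_sets_def)
    have "emeasure ?M N' \<le> 0"
    proof (rule ennreal_le_epsilon)
      fix e :: real assume e: "e > 0"
      obtain \<delta> where \<delta>: "\<delta> > 0" "\<And>E. nonoverlapping E a b \<Longrightarrow> increments (\<lambda>x. x) E < \<delta> \<Longrightarrow> increments g E < e"
        using ac e unfolding ac_real_def by metis
      obtain U where U: "open U" "N' \<subseteq> U" "emeasure lborel (U - N') < \<delta>"
        using outer_regular_lborel[OF N'b \<delta>(1)] by auto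
      have Us: "U \<in> sets lborel" using U(1) by auto
      have "emeasure lborel U \<le> emeasure lborel (U - N') + emeasure lborel N'"
        using N'b Us emeasure_subadditive[of "U - N'" lborel N'] emeasure_mono[of U "(U-N') \<union> N'" lborel] by auto
      then have mU: "emeasure lborel U < \<delta>" using U(3) N'0 by simp
      \<comment> \<open>Every covering interval is subordinate to this gauge at a point of
        \<open>N'\<close>, which lies in \<open>U\<close>; the interval is therefore contained in
        \<open>U\<close>.\<close>
      have gau: "gauge (\<lambda>x. if x \<in> U then U else UNIV)"
        using U(1) by (auto simp: gauge_def)
      obtain \<D> where D: "countable \<D>" "\<Union>\<D> \<subseteq> cbox a b"
        "\<And>K. K \<in> \<D> \<Longrightarrow> interior K \<noteq> {} \<and> (\<exists>c d. K = cbox c d)"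
        "pairwise (\<lambda>A B. interior A \<inter> interior B = {}) \<D>"
        "\<And>K. K \<in> \<D> \<Longrightarrow> \<exists>x \<in> N' \<inter> K. K \<subseteq> (if x \<in> U then U else UNIV)"
        "N' \<subseteq> \<Union>\<D>"
      proof (rule covering_lemma[OF _ _ gau, of N' a b])
        show "N' \<subseteq> cbox a b" "box a b \<noteq> {}" using ab by (auto simp: N'_def)
      qed blast
      have DU: "K \<subseteq> U" if "K \<in> \<D>" for K using D(5)[OF that] U(2) by (auto split: if_splits)
      have DK: "\<exists>c d. K = {c..d} \<and> c < d \<and> a \<le> c \<and> d \<le> b" if K: "K \<in> \<D>" for K
      proof -
        obtain c d where cd: "K = {c..d}" using D(3)[OF K] by auto
        moreover have "c < d" using D(3)[OF K] cd by auto
        moreover have "K \<subseteq> {a..b}" using D(2) K by auto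
        ultimately show ?thesis by auto
      qed
      have fin: "emeasure ?M (\<Union>F') \<le> e" if F': "finite F'" "F' \<subseteq> \<D>" for F'
      proof -
        define E where "E = (\<lambda>K. (Inf K, Sup K)) ` F'"
        have inj: "inj_on (\<lambda>K. (Inf K, Sup K)) F'"
        proof (rule inj_onI)
          fix K L assume KL: "K \<in> F'" "L \<in> F'" "(Inf K, Sup K) = (Inf L, Sup L)"
          obtain c d where "K = {c..d}" "c < d" using DK[of K] F'(2) KL(1) by blast
          moreover obtain u v where "L = {u..v}" "u < v" using DK[of L] F'(2) KL(2) by blast
          ultimately show "K = L" using KL(3) by simp
        qed
        have E: "nonoverlapping E a b"
          unfolding nonoverlapping_def
        proof (intro conjI ballI impI)
          show "finite E" using F' by (simp add: E_def)
          fix p assume "p \<in> E"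
          then obtain K where K: "K \<in> F'" "p = (Inf K, Sup K)" by (auto simp: E_def)
          then obtain c d where cd: "K = {c..d}" "c < d" "a \<le> c" "d \<le> b" using DK F'(2) by blast
          then show "a \<le> fst p" "fst p < snd p" "snd p \<le> b" using K by auto
          fix q assume "q \<in> E" "p \<noteq> q"
          then obtain L where L: "L \<in> F'" "q = (Inf L, Sup L)" by (auto simp: E_def)
          then obtain u v where uv: "L = {u..v}" "u < v" using DK F'(2) by blast
          have "K \<noteq> L" using \<open>p \<noteq> q\<close> K L by auto
          then have "interior K \<inter> interior L = {}" using D(4) K(1) L(1) F'(2) by (auto simp: pairwise_def)
          then have "{max c u<..<min d v} = {}" using cd uv by auto
          then have "d \<le> u \<or> v \<le> c" using cd uv by (auto simp: max_def min_def split: if_splits)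
          then show "snd p \<le> fst q \<or> snd q \<le> fst p" using K L cd uv by auto
        qed
        have sub: "{fst p<..<snd p} \<subseteq> U" if "p \<in> E" for p
        proof -
          obtain K where K: "K \<in> F'" "p = (Inf K, Sup K)" using \<open>p \<in> E\<close> by (auto simp: E_def)
          then obtain c d where cd: "K = {c..d}" "c < d" using DK F'(2) by blast
          have "K \<subseteq> U" using DU K(1) F'(2) by blast
          then show ?thesis using cd K by auto
        qed
        have "ennreal (increments (\<lambda>x. x) E) < ennreal \<delta>"
          using nonoverlapping_length_le[OF E sub Us] mU by (rule order_le_less_trans)
        then have "increments (\<lambda>x. x) E < \<delta>" using \<delta>(1) by (meson ennreal_leI leD leI)
        then have "increments g E < e" using \<delta>(2) E by blast
        have "emeasure ?M (\<Union>F') \<le> (\<Sum>K\<in>F'. emeasure ?M K)"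
          using emeasure_subadditive_finite[OF F'(1), of "\<lambda>K. K" ?M] DK F'(2) by fastforce
        also have "\<dots> = (\<Sum>K\<in>F'. ennreal (F (Sup K) - F (Inf K)))"
        proof (rule sum.cong)
          fix K assume "K \<in> F'"
          then obtain c d where "K = {c..d}" "c < d" using DK F'(2) by blast
          then show "emeasure ?M K = ennreal (F (Sup K) - F (Inf K))" using Icc[of c d] by simp
        qed simp
        also have "\<dots> = ennreal (\<Sum>K\<in>F'. F (Sup K) - F (Inf K))"
        proof (rule sum_ennreal)
          fix K assume "K \<in> F'"
          then obtain c d where "K = {c..d}" "c < d" using DK F'(2) by blast
          then show "0 \<le> F (Sup K) - F (Inf K)" using Fmono[of c d] by simp
        qed
        also have "(\<Sum>K\<in>F'. F (Sup K) - F (Inf K)) = increments F E"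
          unfolding increments_def E_def by (simp add: sum.reindex[OF inj])
        also have "increments F E = increments g E"
          unfolding increments_def using E by (intro sum.cong refl) (auto simp: F nonoverlapping_def)
        finally show ?thesis using \<open>increments g E < e\<close> by (meson ennreal_leI less_imp_le order_trans)
      qed
      have "emeasure ?M N' \<le> e"
      proof (cases "\<D> = {}")
        case True then show ?thesis using D(6) by simp
      next
        case False
        define A where "A n = \<Union>(from_nat_into \<D> ` {..n})" for n
        have fd: "from_nat_into \<D> n \<in> \<D>" for n using False by (rule from_nat_into)
        have Ab: "A n \<in> sets borel" for n
        proof -
          have "from_nat_into \<D> i \<in> sets borel" for i using DK[OF fd[of i]] by auto
          then show ?thesis by (auto simp: A_def)
        qed
        have "N' \<subseteq> (\<Union>n. A n)"
        proof
          fix x assume "x \<in> N'"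
          then obtain K where K: "K \<in> \<D>" "x \<in> K" using D(6) by blast
          then obtain n where "K = from_nat_into \<D> n" using from_nat_into_surj[OF D(1) K(1)] by metis
          then show "x \<in> (\<Union>n. A n)" using K by (auto simp: A_def)
        qed
        then have "emeasure ?M N' \<le> emeasure ?M (\<Union>n. A n)" using Ab by (intro emeasure_mono) auto
        also have "\<dots> = (SUP n. emeasure ?M (A n))"
        proof (rule SUP_emeasure_incseq[symmetric])
          show "range A \<subseteq> sets ?M" using Ab by auto
          show "incseq A" unfolding incseq_def A_def by (intro allI impI Union_mono image_mono) auto
        qed
        also have "\<dots> \<le> e"
          by (intro SUP_least) (auto simp: A_def intro!: fin fd)
        finally show ?thesis .
      qed
      then show "emeasure ?M N' \<le> 0 + ennreal e" by simp
    qed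
    then have "N' \<in> null_sets ?M" using N'b by (auto simp: null_sets_def)
    moreover have "N \<subseteq> {..a} \<union> {b..} \<union> N'" by (auto simp: N'_def)
    ultimately show "N \<in> null_sets ?M"
      using null_sets_subset[of "{..a} \<union> {b..} \<union> N'" ?M N] left right null_setsD2[OF N] by auto
  qed
qed

text \<open>The density is the Radon-Nikodym derivative of the Stieltjes measure of \<open>g\<close>
  with respect to Lebesgue measure.\<close>

lemma ac_real_mono_has_ac_deriv:
  assumes ac: "ac_real g a b" and mono: "mono_on {a..b} g" and ab: "a < b"
  shows "\<exists>g'. has_ac_deriv g g' a b"
proof -
  define F where "F = (\<lambda>x. g (max a (min b x)))"
  let ?M = "interval_measure F"
  have Fmono: "F x \<le> F y" if "x \<le> y" for x y
    unfolding F_def using that ab by (intro mono_onD[OF mono]) auto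
  have Fcont: "continuous_on UNIV F"
    unfolding F_def by (intro continuous_on_compose2[OF ac_real_continuous[OF ac mono]] continuous_intros) (use ab in auto)
  then have Fc: "isCont F x" for x by (simp add: continuous_on_eq_continuous_at)
  then have Fr: "continuous (at_right x) F" for x by (simp add: continuous_at_imp_continuous_at_within)
  have Icc: "emeasure ?M {c..d} = F d - F c" if "c \<le> d" for c d
    by (rule emeasure_interval_measure_Icc[OF that Fmono Fcont])
  obtain f where f: "f \<in> borel_measurable lborel" "density lborel f = ?M"
    using sigma_finite_measure.Radon_Nikodym[OF sigma_finite_lborel interval_measure_absolutely_continuous[OF ac mono ab F_def]] by auto
  have nn: "(\<integral>\<^sup>+t. f t * indicator {a..x} t \<partial>lborel) = ennreal (g x - g a)" if "x \<in> {a..b}" for x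
  proof -
    have "(\<integral>\<^sup>+t. f t * indicator {a..x} t \<partial>lborel) = emeasure (density lborel f) {a..x}"
      using f(1) by (subst emeasure_density) auto
    then show ?thesis using Icc[of a x] that ab f(2) by (simp add: F_def)
  qed
  \<comment> \<open>The Radon-Nikodym density takes extended values; it is finite almost everywhere
    on [a, b] because its integral there is, so \<open>enn2real\<close> changes it on a null set
    only.\<close>
  have fin: "AE t in lborel. t \<in> {a..b} \<longrightarrow> f t \<noteq> \<infinity>"
  proof -
    have "(\<integral>\<^sup>+t. f t * indicator {a..b} t \<partial>lborel) \<noteq> \<infinity>" using nn[of b] ab by simp
    then have "AE t in lborel. f t * indicator {a..b} t \<noteq> \<infinity>"
      using f(1) by (intro nn_integral_PInf_AE) auto
    then show ?thesis by eventually_elim (auto simp: indicator_def)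
  qed
  define g' where "g' t = enn2real (f t)" for t
  have hi: "(g' has_integral (g x - g a)) {a..x}" if x: "x \<in> {a..b}" for x
  proof -
    have "(\<integral>\<^sup>+t. ennreal (g' t * indicator {a..x} t) \<partial>lborel) = (\<integral>\<^sup>+t. f t * indicator {a..x} t \<partial>lborel)"
    proof (rule nn_integral_cong_AE)
      show "AE t in lborel. ennreal (g' t * indicator {a..x} t) = f t * indicator {a..x} t"
        using fin by eventually_elim (use x in \<open>auto simp: g'_def indicator_def ennreal_enn2real less_top\<close>)
    qed
    then have "((\<lambda>t. g' t * indicator {a..x} t) has_integral (g x - g a)) UNIV"
      using nn[OF x] f(1) x mono_onD[OF mono, of a x]
      by (intro nn_integral_has_integral) (auto simp: g'_def)
    then have "((\<lambda>t. if t \<in> {a..x} then g' t else 0) has_integral (g x - g a)) UNIV"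
      by (rule has_integral_eq[rotated]) (auto simp: indicator_def)
    then show ?thesis by (simp only: has_integral_restrict_UNIV)
  qed
  have "g' absolutely_integrable_on {a..b}"
    using hi[of b] ab by (intro nonnegative_absolutely_integrable_1) (auto simp: g'_def has_integral_integrable_integral)
  then show ?thesis using hi by (auto simp: has_ac_deriv_def)
qed

section \<open>Calculus of absolutely continuous functions\<close>

lemma has_ac_deriv_linear:
  assumes "has_ac_deriv f f' a b" "bounded_linear h"
  shows "has_ac_deriv (\<lambda>x. h (f x)) (\<lambda>x. h (f' x)) a b"
proof -
  have "((\<lambda>x. h (f' x)) has_integral h (f x - f a)) {a..x}" if "x \<in> {a..b}" for x
    using has_integral_linear[OF _ assms(2), of f' "f x - f a" "{a..x}"] assms(1) that
    by (auto simp: has_ac_deriv_def o_def)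
  moreover have "(\<lambda>x. h (f' x)) absolutely_integrable_on {a..b}"
    using absolutely_integrable_linear[OF _ assms(2), of "{a..b}" f'] assms(1) by (simp add: has_ac_deriv_def o_def)
  ultimately show ?thesis
    using linear_diff[OF bounded_linear.linear[OF assms(2)]] by (simp add: has_ac_deriv_def)
qed

lemma has_ac_deriv_add:
  assumes "has_ac_deriv f f' a b" "has_ac_deriv g g' a b"
  shows "has_ac_deriv (\<lambda>x. f x + g x) (\<lambda>x. f' x + g' x) a b"
  unfolding has_ac_deriv_def
proof (intro conjI ballI)
  show "(\<lambda>x. f' x + g' x) absolutely_integrable_on {a..b}"
    using assms unfolding has_ac_deriv_def by (intro set_integral_add) auto
  fix x assume "x \<in> {a..b}"
  then have "((\<lambda>x. f' x + g' x) has_integral (f x - f a) + (g x - g a)) {a..x}"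
    using assms by (intro has_integral_add) (auto simp: has_ac_deriv_def)
  then show "((\<lambda>x. f' x + g' x) has_integral (f x + g x - (f a + g a))) {a..x}"
    by (simp add: algebra_simps)
qed

lemma has_ac_deriv_diff':
  assumes "has_ac_deriv f f' a b" "has_ac_deriv g g' a b"
  shows "has_ac_deriv (\<lambda>x. f x - g x) (\<lambda>x. f' x - g' x) a b"
  using has_ac_deriv_add[OF assms(1) has_ac_deriv_linear[OF assms(2) bounded_linear_minus[OF bounded_linear_ident]]] by simp

lemma ac_real_add:
  assumes "ac_real f a b" "ac_real g a b"
  shows "ac_real (\<lambda>x. f x + g x) a b"
  unfolding ac_real_def
proof (intro allI impI)
  fix \<epsilon> :: real assume "\<epsilon> > 0"
  then have h: "\<epsilon>/2 > 0" by simp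
  obtain d1 where d1: "d1 > 0" "\<And>E. nonoverlapping E a b \<Longrightarrow> increments (\<lambda>x. x) E < d1 \<Longrightarrow> increments f E < \<epsilon>/2"
    using assms(1) h unfolding ac_real_def by metis
  obtain d2 where d2: "d2 > 0" "\<And>E. nonoverlapping E a b \<Longrightarrow> increments (\<lambda>x. x) E < d2 \<Longrightarrow> increments g E < \<epsilon>/2"
    using assms(2) h unfolding ac_real_def by metis
  have "increments (\<lambda>x. f x + g x) E = increments f E + increments g E" for E
    by (simp add: increments_def sum.distrib[symmetric] algebra_simps)
  then show "\<exists>\<delta>>0. \<forall>E. nonoverlapping E a b \<and> increments (\<lambda>x. x) E < \<delta> \<longrightarrow> increments (\<lambda>x. f x + g x) E < \<epsilon>"
    using d1 d2 by (intro exI[of _ "min d1 d2"]) fastforce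
qed

text \<open>Jordan decomposition: \<open>f\<close> is the difference of its positive variation and
  of positive variation minus \<open>f\<close>. Both are monotone and inherit the epsilon-delta
  condition, the second one by the assumption on \<open>- f\<close>.\<close>

lemma ac_real_has_ac_deriv:
  assumes ac: "ac_real f a b" "ac_real (\<lambda>x. - f x) a b" and ab: "a < b"
  shows "\<exists>f'. has_ac_deriv f f' a b"
proof -
  let ?P = "positive_variation f a"
  have e: "increments f {(x,y)} = f y - f x" for x y by (simp add: increments_def)
  have "?P x \<le> ?P y" if "a \<le> x" "x \<le> y" "y \<le> b" for x y
    using positive_variation_ge[OF ac(1) that, of "{}"] by (simp add: increments_def)
  then have m1: "mono_on {a..b} ?P" by (auto intro: mono_onI)
  have "?P x + (f y - f x) \<le> ?P y" if "a \<le> x" "x < y" "y \<le> b" for x y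
    using positive_variation_ge[OF ac(1), of x y "{(x,y)}"] that by (simp add: e nonoverlapping_def)
  then have "?P x - f x \<le> ?P y - f y" if "a \<le> x" "x \<le> y" "y \<le> b" for x y
    using that by (cases "x = y") (auto simp: algebra_simps less_le)
  then have m2: "mono_on {a..b} (\<lambda>x. ?P x + - f x)" by (auto intro: mono_onI)
  obtain p where p: "has_ac_deriv ?P p a b"
    using ac_real_mono_has_ac_deriv[OF ac_real_positive_variation[OF ac(1)] m1 ab] by blast
  obtain q where q: "has_ac_deriv (\<lambda>x. ?P x + - f x) q a b"
    using ac_real_mono_has_ac_deriv[OF ac_real_add[OF ac_real_positive_variation[OF ac(1)] ac(2)] m2 ab] by blast
  show ?thesis using has_ac_deriv_diff'[OF p q] by auto
qed

lemma absolutely_continuous_has_ac_deriv: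
  assumes ac: "absolutely_continuous_on_interval a b f" and ab: "a < b"
  shows "\<exists>f'. has_ac_deriv f f' a b"
proof -
  have R: "Re z - Re w \<le> norm (z - w)" "- Re z - - Re w \<le> norm (z - w)"
    "Im z - Im w \<le> norm (z - w)" "- Im z - - Im w \<le> norm (z - w)" for z w
    using abs_Re_le_cmod[of "z - w"] abs_Im_le_cmod[of "z - w"] by auto
  obtain u where u: "has_ac_deriv (\<lambda>x. Re (f x)) u a b"
    using ac_real_has_ac_deriv[OF absolutely_continuous_imp_ac_real[OF ac, of Re]
        absolutely_continuous_imp_ac_real[OF ac, of "\<lambda>z. - Re z"] ab] R(1,2) by blast
  obtain v where v: "has_ac_deriv (\<lambda>x. Im (f x)) v a b"
    using ac_real_has_ac_deriv[OF absolutely_continuous_imp_ac_real[OF ac, of Im]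
        absolutely_continuous_imp_ac_real[OF ac, of "\<lambda>z. - Im z"] ab] R(3,4) by blast
  have "bounded_linear (\<lambda>r. \<i> * complex_of_real r)"
    by (rule bounded_linear_compose[OF bounded_linear_mult_right bounded_linear_of_real])
  from has_ac_deriv_add[OF has_ac_deriv_linear[OF u bounded_linear_of_real] has_ac_deriv_linear[OF v this]]
  have "has_ac_deriv f (\<lambda>x. of_real (u x) + \<i> * of_real (v x)) a b"
    by (simp add: complex_eq[symmetric])
  then show ?thesis by blast
qed

lemma has_ac_deriv_continuous_on:
  assumes "has_ac_deriv f f' a b"
  shows "continuous_on {a..b} f"
proof -
  have "f' integrable_on {a..b}" using assms by (simp add: has_ac_deriv_def absolutely_integrable_on_def)
  then have "continuous_on {a..b} (\<lambda>x. f a + integral {a..x} f')"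
    by (intro continuous_intros indefinite_integral_continuous_1)
  then show ?thesis
    by (rule continuous_on_eq) (use assms in \<open>auto simp: has_ac_deriv_def dest!: bspec integral_unique\<close>)
qed

text \<open>Some density exists already, and it is almost everywhere the derivative of
  \<open>f\<close>; any integrable function with that property agrees with it off a null set and may
  replace it.\<close>

lemma has_ac_derivI_ae:
  assumes ac: "absolutely_continuous_on_interval a b f" and ab: "a < b"
    and f': "f' absolutely_integrable_on {a..b}"
    and N: "negligible N" "\<And>x. x \<in> {a<..<b} - N \<Longrightarrow> (f has_vector_derivative f' x) (at x)"
  shows "has_ac_deriv f f' a b"
proof -
  obtain g where g: "has_ac_deriv f g a b" using absolutely_continuous_has_ac_deriv[OF ac ab] by blast
  obtain M where M: "negligible M" "\<And>x. x \<in> {a<..<b} - M \<Longrightarrow> (f has_vector_derivative g x) (at x)"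
    using has_ac_deriv_ae_derivative[OF g] by blast
  have neg: "negligible (N \<union> M \<union> {a,b})" using N M by simp
  have eq: "f' x = g x" if "x \<in> {a..b} - (N \<union> M \<union> {a,b})" for x
    by (rule vector_derivative_unique_at[OF N(2) M(2)]) (use that in auto)
  have "(f' has_integral (f x - f a)) {a..x}" if "x \<in> {a..b}" for x
    using has_integral_spike[OF neg, of "{a..x}" f' g] eq g that by (auto simp: has_ac_deriv_def)
  then show ?thesis using f' by (simp add: has_ac_deriv_def)
qed

lemma absolutely_integrable_mult_continuous:
  fixes f g :: "real \<Rightarrow> complex"
  assumes "f absolutely_integrable_on {a..b}" "continuous_on {a..b} g"
  shows "(\<lambda>x. f x * g x) absolutely_integrable_on {a..b}" "(\<lambda>x. g x * f x) absolutely_integrable_on {a..b}"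
proof -
  show 1: "(\<lambda>x. g x * f x) absolutely_integrable_on {a..b}"
  proof (rule absolutely_integrable_bounded_measurable_product[OF bilinear_times _ _ _ assms(1)])
    show "g \<in> borel_measurable (lebesgue_on {a..b})"
      by (intro continuous_imp_measurable_on_sets_lebesgue assms(2)) auto
    show "bounded (g ` {a..b})"
      by (intro compact_imp_bounded compact_continuous_image assms(2)) auto
  qed auto
  then show "(\<lambda>x. f x * g x) absolutely_integrable_on {a..b}" by (simp add: mult.commute)
qed

text \<open>The pointwise product rule holds almost everywhere, and the product is again
  epsilon-delta absolutely continuous since both factors are bounded; together these give the
  integral form, which is what integration by parts requires.\<close>

lemma has_ac_deriv_mult:
  fixes f g :: "real \<Rightarrow> complex"
  assumes f: "has_ac_deriv f f' a b" and g: "has_ac_deriv g g' a b" and ab: "a < b"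
  shows "has_ac_deriv (\<lambda>x. f x * g x) (\<lambda>x. f' x * g x + f x * g' x) a b"
proof -
  have cf: "continuous_on {a..b} f" and cg: "continuous_on {a..b} g"
    using f g has_ac_deriv_continuous_on by blast+
  have 1: "(\<lambda>x. f' x * g x + f x * g' x) absolutely_integrable_on {a..b}"
    using f g cf cg by (intro set_integral_add absolutely_integrable_mult_continuous) (auto simp: has_ac_deriv_def)
  obtain N where N: "negligible N" "\<And>x. x \<in> {a<..<b} - N \<Longrightarrow> (f has_vector_derivative f' x) (at x)"
    using has_ac_deriv_ae_derivative[OF f] by blast
  obtain M where M: "negligible M" "\<And>x. x \<in> {a<..<b} - M \<Longrightarrow> (g has_vector_derivative g' x) (at x)"
    using has_ac_deriv_ae_derivative[OF g] by blast
  have 2: "negligible (N \<union> M)" using N M by simp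
  have 3: "((\<lambda>x. f x * g x) has_vector_derivative f' x * g x + f x * g' x) (at x)" if "x \<in> {a<..<b} - (N \<union> M)" for x
    using has_vector_derivative_mult[OF N(2) M(2), of x] that by (auto simp: add.commute)
  have "bounded (f ` {a..b} \<union> g ` {a..b})"
    unfolding bounded_Un by (intro conjI compact_imp_bounded compact_continuous_image cf cg) auto
  then obtain B where B: "\<And>z. z \<in> f ` {a..b} \<union> g ` {a..b} \<Longrightarrow> norm z \<le> B" and B0: "B > 0"
    unfolding bounded_pos by blast
  have "absolutely_continuous_on_interval a b (\<lambda>x. f x * g x)"
    unfolding absolutely_continuous_on_interval_def
  proof (intro allI impI)
    fix \<epsilon> :: real assume "\<epsilon> > 0"
    then have e: "\<epsilon> / (2 * B) > 0" using B0 by simp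
    obtain d1 where d1: "d1 > 0" "\<forall>D T. D division_of T \<and> T \<subseteq> {a..b} \<and> (\<Sum>K\<in>D. Sup K - Inf K) < d1
        \<longrightarrow> (\<Sum>K\<in>D. norm (f (Sup K) - f (Inf K))) < \<epsilon> / (2 * B)"
      using has_ac_deriv_imp_absolutely_continuous[OF f] e unfolding absolutely_continuous_on_interval_def by meson
    obtain d2 where d2: "d2 > 0" "\<forall>D T. D division_of T \<and> T \<subseteq> {a..b} \<and> (\<Sum>K\<in>D. Sup K - Inf K) < d2
        \<longrightarrow> (\<Sum>K\<in>D. norm (g (Sup K) - g (Inf K))) < \<epsilon> / (2 * B)"
      using has_ac_deriv_imp_absolutely_continuous[OF g] e unfolding absolutely_continuous_on_interval_def by meson
    show "\<exists>\<delta>>0. \<forall>D T. D division_of T \<and> T \<subseteq> {a..b} \<and> (\<Sum>K\<in>D. Sup K - Inf K) < \<delta>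
        \<longrightarrow> (\<Sum>K\<in>D. norm (f (Sup K) * g (Sup K) - f (Inf K) * g (Inf K))) < \<epsilon>"
    proof (intro exI[of _ "min d1 d2"] conjI allI impI)
      show "min d1 d2 > 0" using d1 d2 by simp
      fix D T assume D: "D division_of T \<and> T \<subseteq> {a..b} \<and> (\<Sum>K\<in>D. Sup K - Inf K) < min d1 d2"
      have "norm (f (Sup K) * g (Sup K) - f (Inf K) * g (Inf K)) \<le>
          B * norm (f (Sup K) - f (Inf K)) + B * norm (g (Sup K) - g (Inf K))" if k: "K \<in> D" for K
      proof -
        obtain c d where cd: "K = {c..d}" "c \<le> d"
          using division_of_interval[OF conjunct1[OF D] k] by metis
        have "K \<subseteq> {a..b}" using division_ofD(2)[OF conjunct1[OF D] k] D by blast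
        then have i: "c \<in> {a..b}" "d \<in> {a..b}" using cd by auto
        have "f d * g d - f c * g c = (f d - f c) * g d + f c * (g d - g c)" by (simp add: algebra_simps)
        then have "norm (f d * g d - f c * g c) \<le> norm (f d - f c) * norm (g d) + norm (f c) * norm (g d - g c)"
          by (metis norm_mult norm_triangle_ineq)
        also have "\<dots> \<le> norm (f d - f c) * B + B * norm (g d - g c)"
          using B i by (intro add_mono mult_left_mono mult_right_mono) auto
        finally show ?thesis using cd by (simp add: mult.commute)
      qed
      then have "(\<Sum>K\<in>D. norm (f (Sup K) * g (Sup K) - f (Inf K) * g (Inf K))) \<le>
          B * (\<Sum>K\<in>D. norm (f (Sup K) - f (Inf K))) + B * (\<Sum>K\<in>D. norm (g (Sup K) - g (Inf K)))"
        unfolding sum_distrib_left sum.distrib[symmetric] by (rule sum_mono)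
      also have "\<dots> < B * (\<epsilon> / (2 * B)) + B * (\<epsilon> / (2 * B))"
      proof (intro add_strict_mono mult_strict_left_mono B0)
        show "(\<Sum>K\<in>D. norm (f (Sup K) - f (Inf K))) < \<epsilon> / (2 * B)" using d1(2) D by (metis min_less_iff_conj)
        show "(\<Sum>K\<in>D. norm (g (Sup K) - g (Inf K))) < \<epsilon> / (2 * B)" using d2(2) D by (metis min_less_iff_conj)
      qed
      also have "\<dots> = \<epsilon>" using B0 by simp
      finally show "(\<Sum>K\<in>D. norm (f (Sup K) * g (Sup K) - f (Inf K) * g (Inf K))) < \<epsilon>" .
    qed
  qed
  from has_ac_derivI_ae[OF this ab 1 2 3] show ?thesis .
qed

section \<open>The Dirac system\<close>

text \<open>Truncation at level \<open>n\<close>: the excess has a small integral, and the bounded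
  part contributes at most n / s. This gives smallness uniformly in \<open>x\<close> although
  \<open>k\<close> is merely integrable.\<close>

lemma weighted_kernel_small:
  fixes k :: "real \<Rightarrow> real"
  assumes k: "k absolutely_integrable_on {0..T}" "\<And>t. t \<in> {0..T} \<Longrightarrow> 0 \<le> k t" and e: "\<epsilon> > 0"
  obtains s0 where "s0 > 0"
    "\<And>s x. s \<ge> s0 \<Longrightarrow> x \<in> {0..T} \<Longrightarrow> integral {0..x} (\<lambda>t. exp (- s * (x - t)) * k t) \<le> \<epsilon>"
proof -
  define h where "h n x = max (k x - real n) 0" for n x
  have h: "h n absolutely_integrable_on {0..T}" for n
    unfolding h_def using k
    by (intro absolutely_integrable_max_1 set_integral_diff absolutely_integrable_on_const) auto
  have hi: "h n integrable_on {0..T}" for n using h[of n] by (simp add: absolutely_integrable_on_def)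
  have ki: "k integrable_on {0..T}" using k(1) by (simp add: absolutely_integrable_on_def)
  have lim: "(\<lambda>n. integral {0..T} (h n)) \<longlonglongrightarrow> integral {0..T} (\<lambda>x. 0)"
  proof (rule dominated_convergence(2))
    show "h n integrable_on {0..T}" for n by (rule hi)
    show "k integrable_on {0..T}" by (rule ki)
    show "norm (h n x) \<le> k x" if "x \<in> {0..T}" for n x using k(2)[OF that] by (auto simp: h_def)
    show "(\<lambda>n. h n x) \<longlonglongrightarrow> 0" if "x \<in> {0..T}" for x
    proof (rule tendsto_eventually)
      obtain N where "k x \<le> real N" using real_arch_simple by blast
      then show "\<forall>\<^sub>F n in sequentially. h n x = 0"
        unfolding eventually_sequentially h_def by (intro exI[of _ N]) (auto simp: max_def)
    qed
  qed
  then have "\<forall>\<^sub>F n in sequentially. dist (integral {0..T} (h n)) 0 < \<epsilon> / 2"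
    using tendstoD[OF lim half_gt_zero[OF e]] by (simp only: integral_0)
  then obtain n where "dist (integral {0..T} (h n)) 0 < \<epsilon> / 2"
    by (auto simp: eventually_sequentially)
  then have n: "integral {0..T} (h n) < \<epsilon> / 2" by (simp add: dist_real_def)
  show ?thesis
  proof (rule that[of "2 * (real n + 1) / \<epsilon>"])
    show s0: "2 * (real n + 1) / \<epsilon> > 0" using e by simp
    fix s x assume s: "s \<ge> 2 * (real n + 1) / \<epsilon>" and x: "x \<in> {0..T}"
    have s1: "s > 0" using s s0 by linarith
    have c: "continuous_on S (\<lambda>t. exp (- s * (x - t)))" for S by (intro continuous_intros)
    have hx: "h n integrable_on {0..x}" using integrable_on_subinterval[OF hi] x by auto
    have kx: "k absolutely_integrable_on {0..x}" using absolutely_integrable_on_subinterval[OF k(1)] x by auto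
    have E: "((\<lambda>t. exp (- s * (x - t))) has_integral (exp (- s * (x - x)) / s - exp (- s * (x - 0)) / s)) {0..x}"
      using x s1 by (intro fundamental_theorem_of_calculus)
        (auto intro!: derivative_eq_intros simp: has_real_derivative_iff_has_vector_derivative[symmetric])
    have ke: "(\<lambda>t. exp (- s * (x - t)) * k t) integrable_on {0..x}"
    proof -
      have "(\<lambda>t. exp (- s * (x - t)) * k t) absolutely_integrable_on {0..x}"
      proof (rule absolutely_integrable_bounded_measurable_product_real[OF _ _ _ kx])
        show "(\<lambda>t. exp (- s * (x - t))) \<in> borel_measurable (lebesgue_on {0..x})"
          by (intro continuous_imp_measurable_on_sets_lebesgue c) auto
        show "bounded ((\<lambda>t. exp (- s * (x - t))) ` {0..x})"
          by (intro compact_imp_bounded compact_continuous_image c) auto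
      qed auto
      then show ?thesis by (simp add: absolutely_integrable_on_def)
    qed
    have "integral {0..x} (\<lambda>t. exp (- s * (x - t)) * k t) \<le> integral {0..x} (\<lambda>t. h n t + exp (- s * (x - t)) * real n)"
    proof (rule integral_le[OF ke])
      show "(\<lambda>t. h n t + exp (- s * (x - t)) * real n) integrable_on {0..x}"
        using hx E by (intro integrable_add integrable_on_mult_left) auto
      fix t assume t: "t \<in> {0..x}"
      have "exp (- s * (x - t)) \<le> 1" using t s1 by (simp add: mult_nonneg_nonneg)
      have "exp (- s * (x - t)) * k t \<le> exp (- s * (x - t)) * (h n t + real n)"
        by (intro mult_left_mono) (auto simp: h_def)
      also have "\<dots> \<le> 1 * h n t + exp (- s * (x - t)) * real n"
        using \<open>exp (- s * (x - t)) \<le> 1\<close> mult_right_mono[of "exp (- s * (x - t))" 1 "h n t"]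
        by (simp add: ring_distribs h_def)
      finally show "exp (- s * (x - t)) * k t \<le> h n t + exp (- s * (x - t)) * real n" by simp
    qed
    also have "\<dots> = integral {0..x} (h n) + integral {0..x} (\<lambda>t. exp (- s * (x - t))) * real n"
      using hx E by (subst integral_add) (auto intro!: integrable_on_mult_left)
    also have "integral {0..x} (h n) \<le> integral {0..T} (h n)"
      using hi hx x by (intro integral_subset_le) (auto simp: h_def)
    also have "integral {0..x} (\<lambda>t. exp (- s * (x - t))) * real n \<le> (1 / s) * real n"
      unfolding integral_unique[OF E] using s1 by (intro mult_right_mono) auto
    also have "(1 / s) * real n \<le> \<epsilon> / 2"
    proof -
      have "2 * (real n + 1) \<le> s * \<epsilon>" using s e by (simp add: field_simps)
      then show ?thesis using s1 by (simp add: field_simps)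
    qed
    finally show "integral {0..x} (\<lambda>t. exp (- s * (x - t)) * k t) \<le> \<epsilon>" using n by simp
  qed
qed

lemma absolutely_integrable_mult_continuous_real:
  fixes f g :: "real \<Rightarrow> real"
  assumes "f absolutely_integrable_on {a..b}" "continuous_on {a..b} g"
  shows "(\<lambda>x. f x * g x) absolutely_integrable_on {a..b}"
proof -
  have "(\<lambda>x. g x * f x) absolutely_integrable_on {a..b}"
  proof (rule absolutely_integrable_bounded_measurable_product_real[OF _ _ _ assms(1)])
    show "g \<in> borel_measurable (lebesgue_on {a..b})"
      by (intro continuous_imp_measurable_on_sets_lebesgue assms(2)) auto
    show "bounded (g ` {a..b})"
      by (intro compact_imp_bounded compact_continuous_image assms(2)) auto
  qed auto
  then show ?thesis by (simp add: mult.commute)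
qed

text \<open>With M the maximum of exp (- s t) u(t), the integral operator has norm at most 1/2 in
  the weighted supremum norm, so M \<le> A + M/2. The rate \<open>s\<close> thus takes the place of
  the integral of \<kappa> in the usual exponent.\<close>

lemma weighted_gronwall:
  fixes u \<kappa> :: "real \<Rightarrow> real"
  assumes u: "continuous_on {0..T} u" "\<And>x. x \<in> {0..T} \<Longrightarrow> 0 \<le> u x"
    and \<kappa>: "\<kappa> absolutely_integrable_on {0..T}" "\<And>x. x \<in> {0..T} \<Longrightarrow> 0 \<le> \<kappa> x"
    and le: "\<And>x. x \<in> {0..T} \<Longrightarrow> u x \<le> A + integral {0..x} (\<lambda>t. \<kappa> t * u t)"
    and small: "\<And>x. x \<in> {0..T} \<Longrightarrow> integral {0..x} (\<lambda>t. exp (- s * (x - t)) * \<kappa> t) \<le> 1/2"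
    and s: "s \<ge> 0" and A: "A \<ge> 0" and x: "x \<in> {0..T}"
  shows "u x \<le> 2 * A * exp (s * x)"
proof -
  have "continuous_on {0..T} (\<lambda>t. exp (- s * t) * u t)" by (intro continuous_intros u)
  then obtain t0 where t0: "t0 \<in> {0..T}" "\<And>t. t \<in> {0..T} \<Longrightarrow> exp (- s * t) * u t \<le> exp (- s * t0) * u t0"
    using continuous_attains_sup[of "{0..T}" "\<lambda>t. exp (- s * t) * u t"] x by auto
  define M where "M = exp (- s * t0) * u t0"
  have M0: "0 \<le> M" using u(2)[OF t0(1)] by (simp add: M_def)
  have uM: "u t \<le> M * exp (s * t)" if "t \<in> {0..T}" for t
  proof -
    have "u t = exp (s * t) * (exp (- s * t) * u t)" by (simp flip: exp_add mult.assoc)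
    also have "\<dots> \<le> exp (s * t) * M" using t0(2)[OF that] by (intro mult_left_mono) (auto simp: M_def)
    finally show ?thesis by (simp add: mult.commute)
  qed
  have \<kappa>0: "\<kappa> absolutely_integrable_on {0..t0}" using absolutely_integrable_on_subinterval[OF \<kappa>(1)] t0 by auto
  have u0: "continuous_on {0..t0} u" using continuous_on_subset[OF u(1)] t0 by auto
  have i1: "(\<lambda>t. \<kappa> t * u t) integrable_on {0..t0}"
    using absolutely_integrable_mult_continuous_real[OF \<kappa>0 u0] by (simp add: absolutely_integrable_on_def)
  have i2: "(\<lambda>t. \<kappa> t * (M * exp (s * t))) integrable_on {0..t0}"
    by (rule set_lebesgue_integral_eq_integral(1)) (intro absolutely_integrable_mult_continuous_real \<kappa>0 continuous_intros)
  have "M \<le> exp (- s * t0) * (A + integral {0..t0} (\<lambda>t. \<kappa> t * u t))"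
    unfolding M_def using le[OF t0(1)] by (intro mult_left_mono) auto
  also have "integral {0..t0} (\<lambda>t. \<kappa> t * u t) \<le> integral {0..t0} (\<lambda>t. \<kappa> t * (M * exp (s * t)))"
    using t0 \<kappa>(2) uM by (intro integral_le i1 i2 mult_left_mono) auto
  also have "integral {0..t0} (\<lambda>t. \<kappa> t * (M * exp (s * t))) = integral {0..t0} (\<lambda>t. (M * exp (s * t0)) * (exp (- s * (t0 - t)) * \<kappa> t))"
    by (intro integral_cong) (simp add: algebra_simps flip: exp_add)
  also have "\<dots> = (M * exp (s * t0)) * integral {0..t0} (\<lambda>t. exp (- s * (t0 - t)) * \<kappa> t)"
    by (rule integral_mult_right)
  also have "\<dots> \<le> (M * exp (s * t0)) * (1/2)"
    using small[OF t0(1)] M0 by (intro mult_left_mono) auto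
  finally have "M \<le> exp (- s * t0) * A + M / 2"
    by (simp add: ring_distribs mult.left_commute[of "exp (- (s * t0))"] flip: exp_add)
  moreover have "exp (- s * t0) * A \<le> 1 * A" using t0 s A by (intro mult_right_mono) auto
  ultimately have "M \<le> 2 * A" by simp
  then have "M * exp (s * x) \<le> 2 * A * exp (s * x)" by (intro mult_right_mono) auto
  with uM[OF x] show ?thesis by linarith
qed

lemma bounded_linear_axis: "bounded_linear (\<lambda>z::complex. axis i z :: complex^2)"
  by (rule linear_conv_bounded_linear[THEN iffD1]) (auto intro!: linearI simp: vec_eq_iff axis_def)

lemma vec2_axis: "v = axis 1 (v $ 1) + axis 2 (v $ 2)" for v :: "complex^2"
  by (simp add: vec_eq_iff forall_2 axis_def)

lemma norm_vec2_le: "norm v \<le> norm (v $ 1) + norm (v $ 2)" for v :: "complex^2"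
  unfolding norm_vec_def using L2_set_le_sum[of UNIV "\<lambda>i. norm (v $ i)"] by (simp add: UNIV_2)

lemma absolutely_integrable_vec2:
  fixes f :: "real \<Rightarrow> complex^2"
  assumes "(\<lambda>x. f x $ 1) absolutely_integrable_on S" "(\<lambda>x. f x $ 2) absolutely_integrable_on S"
  shows "f absolutely_integrable_on S"
proof -
  have "(\<lambda>x. axis 1 (f x $ 1) + axis 2 (f x $ 2) :: complex^2) absolutely_integrable_on S"
    using absolutely_integrable_linear[OF assms(1) bounded_linear_axis[of 1]]
      absolutely_integrable_linear[OF assms(2) bounded_linear_axis[of 2]]
    by (intro set_integral_add) (auto simp: o_def)
  then show ?thesis by (simp flip: vec2_axis)
qed

lemma absolutely_integrable_vec_nth:
  fixes f :: "real \<Rightarrow> complex^2"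
  assumes "f absolutely_integrable_on S"
  shows "(\<lambda>x. f x $ i) absolutely_integrable_on S"
  using absolutely_integrable_linear[OF assms bounded_linear_vec_nth[of i]] by (simp add: o_def)

lemma has_ac_deriv_vec2:
  fixes f f' :: "real \<Rightarrow> complex^2"
  assumes "has_ac_deriv (\<lambda>x. f x $ 1) (\<lambda>x. f' x $ 1) a b" "has_ac_deriv (\<lambda>x. f x $ 2) (\<lambda>x. f' x $ 2) a b"
  shows "has_ac_deriv f f' a b"
  using has_ac_deriv_add[OF has_ac_deriv_linear[OF assms(1) bounded_linear_axis[of 1]] has_ac_deriv_linear[OF assms(2) bounded_linear_axis[of 2]]]
  by (simp flip: vec2_axis)

lemma bounded_linear_smult_vec: "bounded_linear (\<lambda>v::complex^2. c *s v)"
  by (rule linear_conv_bounded_linear[THEN iffD1]) (auto intro!: linearI simp: vec_eq_iff algebra_simps)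

lemma norm_smult_vec2: "norm (c *s v) = norm c * norm v" for v :: "complex^2"
  unfolding norm_vec_def by (simp add: norm_mult L2_set_right_distrib)

text \<open>The equation B y' + V y = l y solved for y'; a source g adds \<open>inv_B\<close> g,
  where \<open>inv_B\<close> is the inverse diag(i, -i) of B.\<close>

definition dirac_rhs :: "(real \<Rightarrow> complex) \<Rightarrow> (real \<Rightarrow> complex) \<Rightarrow> complex \<Rightarrow> real \<Rightarrow> complex^2 \<Rightarrow> complex^2" where
  "dirac_rhs P Q l t v = vector [\<i> * (l * v $ 1 - P t * v $ 2), - \<i> * (l * v $ 2 - Q t * v $ 1)]"

definition inv_B :: "complex^2 \<Rightarrow> complex^2" where
  "inv_B v = vector [\<i> * v $ 1, - \<i> * v $ 2]"

lemma dirac_rhs_nth [simp]: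
  "dirac_rhs P Q l t v $ 1 = \<i> * (l * v $ 1 - P t * v $ 2)"
  "dirac_rhs P Q l t v $ 2 = - \<i> * (l * v $ 2 - Q t * v $ 1)"
  by (simp_all add: dirac_rhs_def)

lemma inv_B_nth [simp]: "inv_B v $ 1 = \<i> * v $ 1" "inv_B v $ 2 = - \<i> * v $ 2"
  by (simp_all add: inv_B_def)

lemma norm_inv_B_le: "norm (inv_B v) \<le> 2 * norm v"
  using norm_vec2_le[of "inv_B v"] Finite_Cartesian_Product.norm_nth_le[of v 1] Finite_Cartesian_Product.norm_nth_le[of v 2]
  by (simp add: norm_mult)

lemma absolutely_integrable_inv_B:
  fixes f :: "real \<Rightarrow> complex^2"
  shows "f absolutely_integrable_on S \<Longrightarrow> (\<lambda>t. inv_B (f t)) absolutely_integrable_on S"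
  by (rule absolutely_integrable_vec2; unfold inv_B_nth; intro set_integrable_mult_right absolutely_integrable_vec_nth)

lemma norm_dirac_rhs_le:
  "norm (dirac_rhs P Q l t v) \<le> (2 * norm l + norm (P t) + norm (Q t)) * norm v"
proof -
  have "norm (dirac_rhs P Q l t v) \<le> norm (l * v $ 1 - P t * v $ 2) + norm (l * v $ 2 - Q t * v $ 1)"
    using norm_vec2_le[of "dirac_rhs P Q l t v"] by (simp add: norm_mult)
  also have "\<dots> \<le> (norm l * norm (v $ 1) + norm (P t) * norm (v $ 2)) + (norm l * norm (v $ 2) + norm (Q t) * norm (v $ 1))"
    by (intro add_mono order_trans[OF norm_triangle_ineq4]) (auto simp: norm_mult)
  also have "\<dots> \<le> (norm l * norm v + norm (P t) * norm v) + (norm l * norm v + norm (Q t) * norm v)"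
    by (intro add_mono mult_left_mono Finite_Cartesian_Product.norm_nth_le) auto
  finally show ?thesis by (simp add: algebra_simps)
qed

section \<open>Existence, uniqueness and growth of solutions\<close>

locale dirac_potential =
  fixes P Q :: "real \<Rightarrow> complex"
  assumes P: "P absolutely_integrable_on {0..pi}" and Q: "Q absolutely_integrable_on {0..pi}"
begin

text \<open>\<open>dirac_solution l g y\<close> expresses \<open>B y' + V y = l y + g\<close> a.e. on \<open>[0, \<pi>]\<close> for absolutely continuous \<open>y\<close>.\<close>

definition dirac_solution :: "complex \<Rightarrow> (real \<Rightarrow> complex^2) \<Rightarrow> (real \<Rightarrow> complex^2) \<Rightarrow> bool" where
  "dirac_solution l g y \<longleftrightarrow> (\<forall>x. x \<notin> {0..pi} \<longrightarrow> y x = 0) \<and>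
     has_ac_deriv y (\<lambda>t. dirac_rhs P Q l t (y t) + inv_B (g t)) 0 pi"

lemma dirac_solution_cong:
  "dirac_solution l g y \<Longrightarrow> (\<And>t. t \<in> {0..pi} \<Longrightarrow> g t = h t) \<Longrightarrow> dirac_solution l h y"
  unfolding dirac_solution_def has_ac_deriv_def
proof safe
  assume *: "\<And>t. t \<in> {0..pi} \<Longrightarrow> g t = h t"
  { assume "(\<lambda>t. dirac_rhs P Q l t (y t) + inv_B (g t)) absolutely_integrable_on {0..pi}"
    then show "(\<lambda>t. dirac_rhs P Q l t (y t) + inv_B (h t)) absolutely_integrable_on {0..pi}"
      by (rule absolutely_integrable_spike[where S="{}"]) (auto simp: *) }
  fix x assume 1: "\<forall>x\<in>{0..pi}. ((\<lambda>t. dirac_rhs P Q l t (y t) + inv_B (g t)) has_integral y x - y 0) {0..x}" "x \<in> {0..pi}"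
  show "((\<lambda>t. dirac_rhs P Q l t (y t) + inv_B (h t)) has_integral y x - y 0) {0..x}"
    by (rule has_integral_eq[OF _ bspec[OF 1]]) (use 1(2) * in auto)
qed

lemma dirac_solution_continuous: "dirac_solution l g y \<Longrightarrow> continuous_on {0..pi} y"
  by (auto simp: dirac_solution_def dest: has_ac_deriv_continuous_on)

lemma dirac_rhs_integrable:
  assumes y: "continuous_on {0..pi} y"
  shows "(\<lambda>t. dirac_rhs P Q l t (y t)) absolutely_integrable_on {0..pi}"
proof (rule absolutely_integrable_vec2)
  have c: "continuous_on {0..pi} (\<lambda>x. y x $ i)" for i by (intro continuous_intros y)
  have i: "(\<lambda>t. l * y t $ i) absolutely_integrable_on {0..pi}" for i
    by (intro absolutely_integrable_continuous_real continuous_intros y)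
  show "(\<lambda>t. dirac_rhs P Q l t (y t) $ 1) absolutely_integrable_on {0..pi}"
    unfolding dirac_rhs_nth by (intro set_integrable_mult_right set_integral_diff i absolutely_integrable_mult_continuous P c)
  show "(\<lambda>t. dirac_rhs P Q l t (y t) $ 2) absolutely_integrable_on {0..pi}"
    unfolding dirac_rhs_nth by (intro set_integrable_mult_right set_integral_diff i absolutely_integrable_mult_continuous Q c)
qed

lemma dirac_solution_linear:
  assumes "dirac_solution l g y" "dirac_solution l h z"
  shows "dirac_solution l (\<lambda>t. a *s g t + b *s h t) (\<lambda>t. a *s y t + b *s z t)"
proof -
  have "a *s (dirac_rhs P Q l t (y t) + inv_B (g t)) + b *s (dirac_rhs P Q l t (z t) + inv_B (h t)) =
     dirac_rhs P Q l t (a *s y t + b *s z t) + inv_B (a *s g t + b *s h t)" for t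
    by (simp add: vec_eq_iff forall_2 algebra_simps)
  moreover have "has_ac_deriv (\<lambda>t. a *s y t + b *s z t)
     (\<lambda>t. a *s (dirac_rhs P Q l t (y t) + inv_B (g t)) + b *s (dirac_rhs P Q l t (z t) + inv_B (h t))) 0 pi"
    using assms by (intro has_ac_deriv_add has_ac_deriv_linear[OF _ bounded_linear_smult_vec]) (auto simp: dirac_solution_def)
  ultimately show ?thesis using assms by (simp add: dirac_solution_def)
qed

text \<open>A change of the spectral parameter is moved into the source. This is the resolvent
  identity in disguise; it yields the power series in the parameter and the recurrences for the
  jets.\<close>

lemma dirac_solution_shift:
  "dirac_solution l g y \<longleftrightarrow> dirac_solution (l + w) (\<lambda>t. g t - w *s y t) y"
proof -
  have "dirac_rhs P Q (l + w) t (y t) + inv_B (g t - w *s y t) = dirac_rhs P Q l t (y t) + inv_B (g t)" for t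
    by (simp add: vec_eq_iff forall_2 algebra_simps)
  then show ?thesis by (simp add: dirac_solution_def)
qed

text \<open>The threshold is selected once for the potential and does not depend on
  \<open>l\<close>. It makes \<open>growth_rate\<close> affine in the modulus of \<open>l\<close>,
  which is the source of all exponential type bounds below.\<close>

definition growth_offset :: real where
  "growth_offset = (SOME s0. s0 > 0 \<and> (\<forall>s x. s \<ge> s0 \<longrightarrow> x \<in> {0..pi} \<longrightarrow>
      integral {0..x} (\<lambda>t. exp (- s * (x - t)) * (norm (P t) + norm (Q t))) \<le> 1/4))"

lemma abs_PQ: "(\<lambda>t. norm (P t) + norm (Q t)) absolutely_integrable_on {0..pi}"
  using absolutely_integrable_norm[OF P] absolutely_integrable_norm[OF Q]
  by (intro set_integral_add) (auto simp: o_def)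

lemma growth_offset: "growth_offset > 0"
  "s \<ge> growth_offset \<Longrightarrow> x \<in> {0..pi} \<Longrightarrow>
      integral {0..x} (\<lambda>t. exp (- s * (x - t)) * (norm (P t) + norm (Q t))) \<le> 1/4"
proof -
  have "\<exists>s0. s0 > 0 \<and> (\<forall>s x. s \<ge> s0 \<longrightarrow> x \<in> {0..pi} \<longrightarrow>
      integral {0..x} (\<lambda>t. exp (- s * (x - t)) * (norm (P t) + norm (Q t))) \<le> 1/4)"
  proof -
    obtain s0 where "s0 > 0" "\<And>s x. s \<ge> s0 \<Longrightarrow> x \<in> {0..pi} \<Longrightarrow>
      integral {0..x} (\<lambda>t. exp (- s * (x - t)) * (norm (P t) + norm (Q t))) \<le> 1/4"
      by (rule weighted_kernel_small[OF abs_PQ, of "1/4"]) auto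
    then show ?thesis by blast
  qed
  from someI_ex[OF this] show "growth_offset > 0"
    "s \<ge> growth_offset \<Longrightarrow> x \<in> {0..pi} \<Longrightarrow>
      integral {0..x} (\<lambda>t. exp (- s * (x - t)) * (norm (P t) + norm (Q t))) \<le> 1/4"
    unfolding growth_offset_def by blast+
qed

text \<open>The factor 8 makes the part 2 |l| of \<open>kern\<close> contribute at most 1/4 to the
  weighted integral; the potential contributes the other 1/4.\<close>

definition growth_rate :: "complex \<Rightarrow> real" where "growth_rate l = 8 * norm l + growth_offset"

lemma growth_rate_pos: "growth_rate l > 0"
  using growth_offset(1) by (simp add: growth_rate_def add_nonneg_pos)

definition kern :: "complex \<Rightarrow> real \<Rightarrow> real" where
  "kern l t = 2 * norm l + norm (P t) + norm (Q t)"

lemma kern_integrable: "kern l absolutely_integrable_on {0..pi}"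
  using set_integral_add(1)[OF absolutely_integrable_on_const[of "{0..pi}" "2 * norm l"] abs_PQ]
  by (auto simp: kern_def[abs_def] add.assoc)

lemma kern_nonneg: "0 \<le> kern l t" by (simp add: kern_def)

lemma exp_mult_integrable:
  assumes "k absolutely_integrable_on {0..pi}" "x \<in> {0..pi}"
  shows "(\<lambda>t. exp (- s * (x - t)) * k t) integrable_on {0..x}"
proof -
  have "(\<lambda>t. k t * exp (- s * (x - t))) absolutely_integrable_on {0..x}"
    using assms absolutely_integrable_on_subinterval[OF assms(1), of 0 x]
    by (intro absolutely_integrable_mult_continuous_real continuous_intros) auto
  then show ?thesis by (simp add: absolutely_integrable_on_def mult.commute)
qed

lemma kern_small:
  assumes x: "x \<in> {0..pi}"
  shows "integral {0..x} (\<lambda>t. exp (- growth_rate l * (x - t)) * kern l t) \<le> 1/2"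
proof -
  let ?s = "growth_rate l"
  have s: "?s > 0" by (rule growth_rate_pos)
  have E: "((\<lambda>t. exp (- ?s * (x - t))) has_integral (exp (- ?s * (x - x)) / ?s - exp (- ?s * (x - 0)) / ?s)) {0..x}"
    using x s by (intro fundamental_theorem_of_calculus)
      (auto intro!: derivative_eq_intros simp: has_real_derivative_iff_has_vector_derivative[symmetric])
  have "integral {0..x} (\<lambda>t. exp (- ?s * (x - t)) * kern l t) =
      integral {0..x} (\<lambda>t. exp (- ?s * (x - t)) * (2 * norm l) + exp (- ?s * (x - t)) * (norm (P t) + norm (Q t)))"
    by (intro integral_cong) (simp add: kern_def algebra_simps)
  also have "\<dots> = integral {0..x} (\<lambda>t. exp (- ?s * (x - t))) * (2 * norm l) + integral {0..x} (\<lambda>t. exp (- ?s * (x - t)) * (norm (P t) + norm (Q t)))"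
    by (simp only: integral_add[OF integrable_on_mult_left[OF has_integral_integrable[OF E]] exp_mult_integrable[OF abs_PQ x]]
        integral_mult_left)
  also have "\<dots> \<le> 1 / ?s * (2 * norm l) + 1/4"
  proof (intro add_mono mult_right_mono)
    show "integral {0..x} (\<lambda>t. exp (- ?s * (x - t))) \<le> 1 / ?s"
      unfolding integral_unique[OF E] using s by simp
    show "integral {0..x} (\<lambda>t. exp (- ?s * (x - t)) * (norm (P t) + norm (Q t))) \<le> 1/4"
      by (rule growth_offset(2)[OF _ x]) (simp add: growth_rate_def)
  qed auto
  also have "1 / ?s * (2 * norm l) \<le> 1/4"
    using s growth_offset(1) by (simp add: growth_rate_def field_simps)
  finally show ?thesis by simp
qed

lemma dirac_solution_bound:
  assumes y: "dirac_solution l g y" and g: "g absolutely_integrable_on {0..pi}" and x: "x \<in> {0..pi}"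
  shows "norm (y x) \<le> 2 * (norm (y 0) + 2 * integral {0..pi} (\<lambda>t. norm (g t))) * exp (growth_rate l * x)"
proof -
  have ng: "(\<lambda>t. norm (g t)) absolutely_integrable_on {0..pi}"
    using absolutely_integrable_norm[OF g] by (simp add: o_def)
  have cy: "continuous_on {0..pi} (\<lambda>x. norm (y x))" using dirac_solution_continuous[OF y] by (intro continuous_intros)
  have 1: "norm (y x) \<le> norm (y 0) + 2 * integral {0..pi} (\<lambda>t. norm (g t)) + integral {0..x} (\<lambda>t. kern l t * norm (y t))"
    if x: "x \<in> {0..pi}" for x
  proof -
    have i: "((\<lambda>t. dirac_rhs P Q l t (y t) + inv_B (g t)) has_integral (y x - y 0)) {0..x}"
      using y x by (auto simp: dirac_solution_def has_ac_deriv_def)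
    have k: "(\<lambda>t. kern l t * norm (y t)) integrable_on {0..x}"
      using absolutely_integrable_on_subinterval[OF absolutely_integrable_mult_continuous_real[OF kern_integrable cy], of 0 x l] x
      by (auto simp: absolutely_integrable_on_def)
    have gx: "(\<lambda>t. 2 * norm (g t)) integrable_on {0..x}"
      using absolutely_integrable_on_subinterval[OF ng, of 0 x] x
      by (intro integrable_on_mult_right) (auto simp: absolutely_integrable_on_def)
    have "norm (y x - y 0) \<le> integral {0..x} (\<lambda>t. kern l t * norm (y t) + 2 * norm (g t))"
      unfolding integral_unique[OF i, symmetric]
    proof (rule integral_norm_bound_integral)
      show "norm (dirac_rhs P Q l t (y t) + inv_B (g t)) \<le> kern l t * norm (y t) + 2 * norm (g t)" for t
        unfolding kern_def by (intro order_trans[OF norm_triangle_ineq] add_mono norm_dirac_rhs_le norm_inv_B_le)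
    qed (use i k gx in \<open>auto intro: integrable_add\<close>)
    also have "\<dots> = integral {0..x} (\<lambda>t. kern l t * norm (y t)) + integral {0..x} (\<lambda>t. 2 * norm (g t))"
      by (rule integral_add[OF k gx])
    also have "integral {0..x} (\<lambda>t. 2 * norm (g t)) \<le> integral {0..pi} (\<lambda>t. 2 * norm (g t))"
      using x gx ng by (intro integral_subset_le integrable_on_mult_right) (auto simp: absolutely_integrable_on_def)
    finally show ?thesis using norm_triangle_ineq[of "y x - y 0" "y 0"] by simp
  qed
  have "0 \<le> norm (y 0) + 2 * integral {0..pi} (\<lambda>t. norm (g t))"
    by (intro add_nonneg_nonneg mult_nonneg_nonneg integral_nonneg) (use ng in \<open>auto simp: absolutely_integrable_on_def\<close>)
  from weighted_gronwall[OF cy norm_ge_zero kern_integrable kern_nonneg 1 kern_small less_imp_le[OF growth_rate_pos] this x]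
  show ?thesis .
qed

lemma dirac_solution_unique:
  assumes "dirac_solution l g y" "dirac_solution l g z" "y 0 = z 0"
  shows "y = z"
proof
  fix x
  have "dirac_solution l (\<lambda>t. 1 *s g t + (-1) *s g t) (\<lambda>t. 1 *s y t + (-1) *s z t)"
    by (rule dirac_solution_linear[OF assms(1,2)])
  then have d: "dirac_solution l (\<lambda>t. 0) (\<lambda>t. y t - z t)" by (simp add: vec_eq_iff)
  show "y x = z x"
  proof (cases "x \<in> {0..pi}")
    case True
    from dirac_solution_bound[OF d _ True] assms(3) show ?thesis by simp
  next
    case False then show ?thesis using assms by (simp add: dirac_solution_def)
  qed
qed

text \<open>Picard iteration written as a Neumann series. In the norm with weight exp (-
  \<open>growth_rate l\<close> x) every application of the integral operator halves the bound, so
  the series converges uniformly.\<close>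

lemma dirac_solution_exists:
  assumes g: "g absolutely_integrable_on {0..pi}"
  shows "\<exists>y. dirac_solution l g y \<and> y 0 = c"
proof -
  define I where "I h x = integral {0..x} h" for h :: "real \<Rightarrow> complex^2" and x :: real
  have Icont: "continuous_on {0..pi} (I h)" if "h absolutely_integrable_on {0..pi}" for h
    unfolding I_def using that by (intro indefinite_integral_continuous_1) (simp add: absolutely_integrable_on_def)
  define f where "f = rec_nat (\<lambda>x. c + I (\<lambda>t. inv_B (g t)) x) (\<lambda>n fn x. I (\<lambda>t. dirac_rhs P Q l t (fn t)) x)"
  have f0: "f 0 = (\<lambda>x. c + I (\<lambda>t. inv_B (g t)) x)" and fS: "f (Suc n) = (\<lambda>x. I (\<lambda>t. dirac_rhs P Q l t (f n t)) x)" for n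
    by (simp_all add: f_def)
  have gB: "(\<lambda>t. inv_B (g t)) absolutely_integrable_on {0..pi}" by (rule absolutely_integrable_inv_B[OF g])
  have fc: "continuous_on {0..pi} (f n)" for n
    by (induction n) (auto simp: f0 fS intro!: continuous_intros Icont gB dirac_rhs_integrable)
  let ?s = "growth_rate l"
  obtain A where A: "A > 0" "\<And>x. x \<in> {0..pi} \<Longrightarrow> norm (f 0 x) \<le> A"
  proof -
    have "bounded (f 0 ` {0..pi})" by (intro compact_imp_bounded compact_continuous_image fc) auto
    then show ?thesis using that unfolding bounded_pos by blast
  qed
  have bound: "norm (f n x) \<le> A * (1/2)^n * exp (?s * x)" if "x \<in> {0..pi}" for n x
    using that
  proof (induction n arbitrary: x)
    case 0
    have "A * 1 \<le> A * exp (?s * x)" using growth_rate_pos[of l] 0 A(1) by (intro mult_left_mono) auto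
    then show ?case using A(2)[OF 0] by simp
  next
    case (Suc n)
    have i1: "(\<lambda>t. dirac_rhs P Q l t (f n t)) integrable_on {0..x}"
      using absolutely_integrable_on_subinterval[OF dirac_rhs_integrable[OF fc], of 0 x] Suc.prems by (auto simp: absolutely_integrable_on_def)
    have i2: "(\<lambda>t. A * (1/2)^n * exp (?s * x) * (exp (- ?s * (x - t)) * kern l t)) integrable_on {0..x}"
      by (intro integrable_on_mult_right exp_mult_integrable kern_integrable Suc.prems)
    have "norm (f (Suc n) x) \<le> integral {0..x} (\<lambda>t. A * (1/2)^n * exp (?s * x) * (exp (- ?s * (x - t)) * kern l t))"
      unfolding fS I_def
    proof (rule integral_norm_bound_integral[OF i1 i2])
      fix t assume t: "t \<in> {0..x}"
      have "norm (dirac_rhs P Q l t (f n t)) \<le> kern l t * norm (f n t)"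
        unfolding kern_def by (rule norm_dirac_rhs_le)
      also have "\<dots> \<le> kern l t * (A * (1/2)^n * exp (?s * t))"
        using Suc.IH[of t] t Suc.prems by (intro mult_left_mono kern_nonneg) auto
      also have "\<dots> = A * (1/2)^n * exp (?s * x) * (exp (- ?s * (x - t)) * kern l t)"
        by (simp add: algebra_simps flip: exp_add)
      finally show "norm (dirac_rhs P Q l t (f n t)) \<le> A * (1/2)^n * exp (?s * x) * (exp (- ?s * (x - t)) * kern l t)" .
    qed
    also have "\<dots> = A * (1/2)^n * exp (?s * x) * integral {0..x} (\<lambda>t. exp (- ?s * (x - t)) * kern l t)"
      by (rule integral_mult_right)
    also have "\<dots> \<le> A * (1/2)^n * exp (?s * x) * (1/2)"
      using A(1) by (intro mult_left_mono kern_small Suc.prems) auto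
    finally show ?case by simp
  qed
  have bound': "norm (f n x) \<le> A * exp (?s * pi) * (1/2)^n" if x: "x \<in> {0..pi}" for n x
  proof -
    have "A * (1/2)^n * exp (?s * x) \<le> A * (1/2)^n * exp (?s * pi)"
      using x A(1) growth_rate_pos[of l] by (intro mult_left_mono) auto
    then show ?thesis using bound[OF x, of n] by (simp add: mult_ac)
  qed
  define S where "S n x = (\<Sum>i<n. f i x)" for n x
  define y where "y x = (\<Sum>i. f i x)" for x
  have ul: "uniform_limit {0..pi} S y sequentially"
    unfolding S_def y_def
    by (rule Weierstrass_m_test[of _ _ "\<lambda>n. A * exp (?s * pi) * (1/2)^n"]) (auto intro!: bound' summable_mult summable_geometric)
  have Sc: "continuous_on {0..pi} (S n)" for n unfolding S_def by (intro continuous_intros fc)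
  have yc: "continuous_on {0..pi} y"
    by (rule uniform_limit_theorem[OF _ ul]) (auto intro: Sc always_eventually)
  have SS: "S (Suc n) x = c + I (\<lambda>t. inv_B (g t)) x + I (\<lambda>t. dirac_rhs P Q l t (S n t)) x" if x: "x \<in> {0..pi}" for n x
  proof (induction n)
    case 0
    have "dirac_rhs P Q l t 0 = 0" for t by (simp add: vec_eq_iff forall_2)
    then show ?case by (simp add: S_def f0 I_def)
  next
    case (Suc n)
    have i: "(\<lambda>t. dirac_rhs P Q l t (h t)) integrable_on {0..x}" if "continuous_on {0..pi} h" for h
      using absolutely_integrable_on_subinterval[OF dirac_rhs_integrable[OF that], of 0 x] x by (auto simp: absolutely_integrable_on_def)
    have "dirac_rhs P Q l t (S (Suc n) t) = dirac_rhs P Q l t (S n t) + dirac_rhs P Q l t (f n t)" for t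
      by (simp add: S_def vec_eq_iff forall_2 algebra_simps)
    then have "I (\<lambda>t. dirac_rhs P Q l t (S (Suc n) t)) x = I (\<lambda>t. dirac_rhs P Q l t (S n t)) x + f (Suc n) x"
      unfolding fS I_def using integral_add[OF i[OF Sc[of n]] i[OF fc[of n]]] by simp
    then show ?case using Suc by (simp add: S_def)
  qed
  have lim: "(\<lambda>n. I (\<lambda>t. dirac_rhs P Q l t (S n t)) x) \<longlonglongrightarrow> I (\<lambda>t. dirac_rhs P Q l t (y t)) x" if x: "x \<in> {0..pi}" for x
  proof (rule tendstoI)
    fix e :: real assume e: "e > 0"
    have i: "(\<lambda>t. dirac_rhs P Q l t (h t)) integrable_on {0..x}" if "continuous_on {0..pi} h" for h
      using absolutely_integrable_on_subinterval[OF dirac_rhs_integrable[OF that], of 0 x] x by (auto simp: absolutely_integrable_on_def)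
    have ki: "kern l integrable_on {0..x}"
      using absolutely_integrable_on_subinterval[OF kern_integrable, of 0 x] x by (auto simp: absolutely_integrable_on_def)
    define K where "K = integral {0..x} (kern l)"
    have K: "K \<ge> 0" unfolding K_def by (intro integral_nonneg ki kern_nonneg)
    define d where "d = e / (K + 1)"
    have d: "d > 0" using e K by (simp add: d_def)
    from uniform_limitD[OF ul d] show "\<forall>\<^sub>F n in sequentially. dist (I (\<lambda>t. dirac_rhs P Q l t (S n t)) x) (I (\<lambda>t. dirac_rhs P Q l t (y t)) x) < e"
    proof eventually_elim
      case (elim n)
      have eq: "dirac_rhs P Q l t (S n t) - dirac_rhs P Q l t (y t) = dirac_rhs P Q l t (S n t - y t)" for t
        by (simp add: vec_eq_iff forall_2 algebra_simps)
      have "I (\<lambda>t. dirac_rhs P Q l t (S n t)) x - I (\<lambda>t. dirac_rhs P Q l t (y t)) x = integral {0..x} (\<lambda>t. dirac_rhs P Q l t (S n t - y t))"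
        unfolding I_def eq[symmetric] by (rule integral_diff[symmetric, OF i[OF Sc] i[OF yc]])
      also have "norm \<dots> \<le> integral {0..x} (\<lambda>t. d * kern l t)"
      proof (rule integral_norm_bound_integral)
        show "(\<lambda>t. dirac_rhs P Q l t (S n t - y t)) integrable_on {0..x}" by (intro i continuous_on_diff Sc yc)
        show "(\<lambda>t. d * kern l t) integrable_on {0..x}" by (intro integrable_on_mult_right ki)
        fix t assume t: "t \<in> {0..x}"
        have "norm (dirac_rhs P Q l t (S n t - y t)) \<le> kern l t * norm (S n t - y t)"
          unfolding kern_def by (rule norm_dirac_rhs_le)
        also have "\<dots> \<le> kern l t * d"
          using elim t x by (intro mult_left_mono kern_nonneg) (auto simp: dist_norm less_imp_le)
        finally show "norm (dirac_rhs P Q l t (S n t - y t)) \<le> d * kern l t" by (simp add: mult.commute)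
      qed
      also have "\<dots> = d * K" unfolding K_def by (rule integral_mult_right)
      also have "\<dots> < e" using K e by (simp add: d_def field_simps)
      finally show ?case by (simp add: dist_norm)
    qed
  qed
  have yeq: "y x = c + I (\<lambda>t. inv_B (g t)) x + I (\<lambda>t. dirac_rhs P Q l t (y t)) x" if x: "x \<in> {0..pi}" for x
  proof (rule LIMSEQ_unique)
    show "(\<lambda>n. S (Suc n) x) \<longlonglongrightarrow> y x"
      by (rule LIMSEQ_Suc) (rule tendsto_uniform_limitI[OF ul x])
    show "(\<lambda>n. S (Suc n) x) \<longlonglongrightarrow> c + I (\<lambda>t. inv_B (g t)) x + I (\<lambda>t. dirac_rhs P Q l t (y t)) x"
      unfolding SS[OF x] by (intro tendsto_intros lim x)
  qed
  \<comment> \<open>Extension by zero, as \<open>dirac_solution\<close> demands: solutions are then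
    determined as functions on the whole line.\<close>
  define Y where "Y x = (if x \<in> {0..pi} then y x else 0)" for x
  have Yc: "continuous_on {0..pi} Y" by (rule continuous_on_eq[OF yc]) (simp add: Y_def)
  have R: "(\<lambda>t. dirac_rhs P Q l t (Y t)) absolutely_integrable_on {0..pi}" by (rule dirac_rhs_integrable[OF Yc])
  have y0: "Y 0 = c" using yeq[of 0] by (simp add: Y_def I_def)
  have "dirac_solution l g Y"
    unfolding dirac_solution_def has_ac_deriv_def
  proof (intro conjI ballI)
    show "(\<lambda>t. dirac_rhs P Q l t (Y t) + inv_B (g t)) absolutely_integrable_on {0..pi}"
      by (intro set_integral_add R gB)
    fix x assume x: "x \<in> {0..pi}"
    have 1: "(\<lambda>t. dirac_rhs P Q l t (Y t)) integrable_on {0..x}"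
      using absolutely_integrable_on_subinterval[OF R, of 0 x] x by (auto simp: absolutely_integrable_on_def)
    have 2: "(\<lambda>t. inv_B (g t)) integrable_on {0..x}"
      using absolutely_integrable_on_subinterval[OF gB, of 0 x] x by (auto simp: absolutely_integrable_on_def)
    have "I (\<lambda>t. dirac_rhs P Q l t (Y t)) x = I (\<lambda>t. dirac_rhs P Q l t (y t)) x"
      unfolding I_def by (rule integral_cong) (use x in \<open>auto simp: Y_def\<close>)
    then have "Y x - Y 0 = integral {0..x} (\<lambda>t. dirac_rhs P Q l t (Y t)) + integral {0..x} (\<lambda>t. inv_B (g t))"
      using yeq[OF x] x y0 by (simp add: Y_def I_def)
    then show "((\<lambda>t. dirac_rhs P Q l t (Y t) + inv_B (g t)) has_integral (Y x - Y 0)) {0..x}"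
      using has_integral_add[OF integrable_integral[OF 1] integrable_integral[OF 2]] by simp
  qed (simp add: Y_def)
  with y0 show ?thesis by blast
qed

end

section \<open>Holomorphic dependence on the spectral parameter\<close>

context dirac_potential
begin

definition sol :: "complex \<Rightarrow> complex^2 \<Rightarrow> (real \<Rightarrow> complex^2) \<Rightarrow> (real \<Rightarrow> complex^2)" where
  "sol l c g = (THE y. dirac_solution l g y \<and> y 0 = c)"

lemma sol_eqI:
  assumes "dirac_solution l g y" "y 0 = c"
  shows "sol l c g = y"
  unfolding sol_def using assms dirac_solution_unique by (intro the_equality) auto

lemma sol:
  assumes "g absolutely_integrable_on {0..pi}"
  shows "dirac_solution l g (sol l c g)" "sol l c g 0 = c"
proof -
  obtain y where y: "dirac_solution l g y" "y 0 = c" using dirac_solution_exists[OF assms] by blast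
  from sol_eqI[OF y] y show "dirac_solution l g (sol l c g)" "sol l c g 0 = c" by auto
qed

lemma dirac_solution_integrable: "dirac_solution l g y \<Longrightarrow> y absolutely_integrable_on {0..pi}"
  by (intro absolutely_integrable_continuous_real dirac_solution_continuous)

lemma dirac_solution_zero: "dirac_solution l (\<lambda>t. 0) (\<lambda>t. 0)"
proof -
  have "dirac_rhs P Q l t 0 + inv_B 0 = 0" for t by (simp add: vec_eq_iff forall_2)
  then show ?thesis by (simp add: dirac_solution_def has_ac_deriv_def)
qed

lemma dirac_solution_sum:
  assumes "finite I" "\<And>i. i \<in> I \<Longrightarrow> dirac_solution l (g i) (y i)"
  shows "dirac_solution l (\<lambda>t. \<Sum>i\<in>I. a i *s g i t) (\<lambda>t. \<Sum>i\<in>I. a i *s y i t)"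
  using assms
proof (induction I rule: finite_induct)
  case empty then show ?case by (simp add: dirac_solution_zero)
next
  case (insert j I)
  have "dirac_solution l (\<lambda>t. a j *s g j t + 1 *s (\<Sum>i\<in>I. a i *s g i t)) (\<lambda>t. a j *s y j t + 1 *s (\<Sum>i\<in>I. a i *s y i t))"
    using insert by (intro dirac_solution_linear) auto
  then show ?case using insert by simp
qed

text \<open>Taylor coefficients of the solution in the spectral parameter at \<open>m\<close>:
  comparing powers of w in the equation at m + w makes each coefficient the source of the next. The
  initial value sits in the zeroth coefficient alone.\<close>

primrec sol_coeff :: "complex \<Rightarrow> complex^2 \<Rightarrow> (real \<Rightarrow> complex^2) \<Rightarrow> nat \<Rightarrow> (real \<Rightarrow> complex^2)" where
  "sol_coeff m c g 0 = sol m c g"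
| "sol_coeff m c g (Suc n) = sol m 0 (sol_coeff m c g n)"

lemma sol_coeff:
  assumes g: "g absolutely_integrable_on {0..pi}"
  shows "dirac_solution m (if n = 0 then g else sol_coeff m c g (n-1)) (sol_coeff m c g n)"
    and "sol_coeff m c g n 0 = (if n = 0 then c else 0)"
    and "sol_coeff m c g n absolutely_integrable_on {0..pi}"
proof -
  have *: "dirac_solution m (if n = 0 then g else sol_coeff m c g (n-1)) (sol_coeff m c g n) \<and> sol_coeff m c g n 0 = (if n = 0 then c else 0)"
  proof (induction n)
    case 0 then show ?case using sol[OF g] by simp
  next
    case (Suc n)
    then have "sol_coeff m c g n absolutely_integrable_on {0..pi}" using dirac_solution_integrable by blast
    then show ?case using sol by simp
  qed
  then show "dirac_solution m (if n = 0 then g else sol_coeff m c g (n-1)) (sol_coeff m c g n)"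
     "sol_coeff m c g n 0 = (if n = 0 then c else 0)" by auto
  then show "sol_coeff m c g n absolutely_integrable_on {0..pi}" using dirac_solution_integrable by blast
qed

definition growth_factor :: "complex \<Rightarrow> real" where
  "growth_factor l = 4 * exp (growth_rate l * pi)"

lemma growth_factor_pos: "growth_factor l > 0" by (simp add: growth_factor_def)

lemma dirac_solution_bound':
  assumes y: "dirac_solution l g y" and g: "g absolutely_integrable_on {0..pi}" and x: "x \<in> {0..pi}"
  shows "norm (y x) \<le> growth_factor l * (norm (y 0) + integral {0..pi} (\<lambda>t. norm (g t)))"
proof -
  have G: "0 \<le> integral {0..pi} (\<lambda>t. norm (g t))"
    using absolutely_integrable_norm[OF g] by (intro integral_nonneg) (auto simp: absolutely_integrable_on_def o_def)
  have "norm (y x) \<le> 2 * (norm (y 0) + 2 * integral {0..pi} (\<lambda>t. norm (g t))) * exp (growth_rate l * x)"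
    by (rule dirac_solution_bound[OF y g x])
  also have "\<dots> \<le> (4 * (norm (y 0) + integral {0..pi} (\<lambda>t. norm (g t)))) * exp (growth_rate l * pi)"
  proof (rule mult_mono)
    show "exp (growth_rate l * x) \<le> exp (growth_rate l * pi)" using x growth_rate_pos[of l] by simp
  qed (use G in auto)
  finally show ?thesis by (simp add: growth_factor_def algebra_simps)
qed

lemma sol_coeff_bound:
  assumes g: "g absolutely_integrable_on {0..pi}"
  obtains B where "B > 0" "\<And>n x. x \<in> {0..pi} \<Longrightarrow> norm (sol_coeff m c g n x) \<le> B * (growth_factor m * pi) ^ n"
proof -
  have "bounded (sol m c g ` {0..pi})"
    using sol(1)[OF g] by (intro compact_imp_bounded compact_continuous_image dirac_solution_continuous) auto
  then obtain B where B: "B > 0" "\<And>x. x \<in> {0..pi} \<Longrightarrow> norm (sol m c g x) \<le> B"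
    unfolding bounded_pos by blast
  show ?thesis
  proof (rule that[OF B(1)])
    fix n x assume "x \<in> {0..pi}"
    then show "norm (sol_coeff m c g n x) \<le> B * (growth_factor m * pi) ^ n"
    proof (induction n arbitrary: x)
      case 0 then show ?case using B by simp
    next
      case (Suc n)
      have i: "sol_coeff m c g n absolutely_integrable_on {0..pi}" by (rule sol_coeff(3)[OF g])
      have "norm (sol_coeff m c g (Suc n) x) \<le> growth_factor m * (norm (sol_coeff m c g (Suc n) 0) + integral {0..pi} (\<lambda>t. norm (sol_coeff m c g n t)))"
        using dirac_solution_bound'[OF sol_coeff(1)[OF g, of m "Suc n"] _ Suc.prems] i by simp
      also have "sol_coeff m c g (Suc n) 0 = 0" using sol_coeff(2)[OF g, of m c "Suc n"] by simp
      also have "integral {0..pi} (\<lambda>t. norm (sol_coeff m c g n t)) \<le> integral {0..pi} (\<lambda>t. B * (growth_factor m * pi) ^ n)"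
        using Suc.IH absolutely_integrable_norm[OF i] by (intro integral_le) (auto simp: absolutely_integrable_on_def o_def)
      also have "\<dots> = pi * (B * (growth_factor m * pi) ^ n)" by simp
      finally show ?case using growth_factor_pos[of m] by (simp add: algebra_simps)
    qed
  qed
qed

text \<open>Boundedness in the supremum norm is the common property of point evaluations, boundary
  forms and bounded functionals on the Hilbert space; one expansion theorem then covers all
  three.\<close>

definition sup_functional :: "((real \<Rightarrow> complex^2) \<Rightarrow> complex) \<Rightarrow> bool" where
  "sup_functional L \<longleftrightarrow>
     (\<forall>y z a b. continuous_on {0..pi} y \<longrightarrow> continuous_on {0..pi} z \<longrightarrow> (\<forall>x. x \<notin> {0..pi} \<longrightarrow> y x = 0 \<and> z x = 0) \<longrightarrow>
        L (\<lambda>t. a *s y t + b *s z t) = a * L y + b * L z) \<and>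
     (\<exists>C. \<forall>y M. continuous_on {0..pi} y \<longrightarrow> (\<forall>x. x \<notin> {0..pi} \<longrightarrow> y x = 0) \<longrightarrow> (\<forall>x\<in>{0..pi}. norm (y x) \<le> M) \<longrightarrow> norm (L y) \<le> C * M)"

lemma sup_functional_linear:
  assumes "sup_functional L" "dirac_solution l g y" "dirac_solution l' h z"
  shows "L (\<lambda>t. a *s y t + b *s z t) = a * L y + b * L z"
  using assms dirac_solution_continuous[OF assms(2)] dirac_solution_continuous[OF assms(3)]
  unfolding sup_functional_def dirac_solution_def by blast

lemma sup_functional_zero: "sup_functional L \<Longrightarrow> L (\<lambda>t. 0) = 0"
  using sup_functional_linear[OF _ dirac_solution_zero dirac_solution_zero, of L 0 0] by simp

lemma sup_functional_sum:
  assumes L: "sup_functional L" and "finite I" "\<And>i. i \<in> I \<Longrightarrow> dirac_solution l (g i) (y i)"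
  shows "L (\<lambda>t. \<Sum>i\<in>I. a i *s y i t) = (\<Sum>i\<in>I. a i * L (y i))"
  using assms(2,3)
proof (induction I rule: finite_induct)
  case empty then show ?case using sup_functional_zero[OF L] by simp
next
  case (insert j I)
  have "L (\<lambda>t. a j *s y j t + 1 *s (\<Sum>i\<in>I. a i *s y i t)) = a j * L (y j) + 1 * L (\<lambda>t. \<Sum>i\<in>I. a i *s y i t)"
    by (rule sup_functional_linear[OF L insert(4) dirac_solution_sum]) (use insert in auto)
  then show ?case using insert by simp
qed

lemma sup_functional_bound:
  assumes "sup_functional L"
  obtains C where "C \<ge> 0" "\<And>l g y M. dirac_solution l g y \<Longrightarrow> (\<And>x. x \<in> {0..pi} \<Longrightarrow> norm (y x) \<le> M) \<Longrightarrow> norm (L y) \<le> C * M"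
proof -
  obtain C where C: "\<And>y M. continuous_on {0..pi} y \<Longrightarrow> (\<forall>x. x \<notin> {0..pi} \<longrightarrow> y x = 0) \<Longrightarrow> (\<forall>x\<in>{0..pi}. norm (y x) \<le> M) \<Longrightarrow> norm (L y) \<le> C * M"
    using assms unfolding sup_functional_def by blast
  show ?thesis
  proof (rule that[of "max C 0"])
    fix l g y M assume y: "dirac_solution l g y" "\<And>x. x \<in> {0..pi} \<Longrightarrow> norm (y x) \<le> M"
    have "norm (y 0) \<le> M" by (rule y(2)) simp
    then have "0 \<le> M" by (rule order_trans[OF norm_ge_zero])
    have "norm (L y) \<le> C * M"
      using y dirac_solution_continuous[OF y(1)] by (intro C) (auto simp: dirac_solution_def)
    also have "\<dots> \<le> max C 0 * M" using \<open>0 \<le> M\<close> by (intro mult_right_mono) auto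
    finally show "norm (L y) \<le> max C 0 * M" .
  qed auto
qed

text \<open>The N-th partial sum solves the equation at \<open>m + w\<close> up to the source error
  w^(N+1) times the N-th coefficient. The growth bound for solutions turns this error into a
  geometric sequence.\<close>

lemma sol_has_fps_expansion:
  assumes L: "sup_functional L" and g: "g absolutely_integrable_on {0..pi}"
  shows "(\<lambda>w. L (sol (m + w) c g)) has_fps_expansion Abs_fps (\<lambda>n. L (sol_coeff m c g n))"
proof (rule has_fps_expansionI)
  let ?Y = "sol_coeff m c g"
  obtain B where B: "B > 0" "\<And>n x. x \<in> {0..pi} \<Longrightarrow> norm (?Y n x) \<le> B * (growth_factor m * pi) ^ n"
    using sol_coeff_bound[OF g] by blast
  obtain C where C: "C \<ge> 0" "\<And>l g y M. dirac_solution l g y \<Longrightarrow> (\<And>x. x \<in> {0..pi} \<Longrightarrow> norm (y x) \<le> M) \<Longrightarrow> norm (L y) \<le> C * M"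
    using sup_functional_bound[OF L] by blast
  define q where "q = growth_factor m * pi"
  have q: "q > 0" using growth_factor_pos[of m] by (simp add: q_def)
  have "(\<lambda>n. L (?Y n) * w ^ n) sums L (sol (m + w) c g)" if w: "norm w * q < 1" for w
  proof -
    define s where "s N t = (\<Sum>i\<le>N. w ^ i *s ?Y i t)" for N t
    \<comment> \<open>Telescoping: the shift sends w times the newest coefficient into the source,
      where adding the next term cancels it.\<close>
    have s: "dirac_solution (m + w) (\<lambda>t. g t - w ^ Suc N *s ?Y N t) (s N)" for N
    proof (induction N)
      case 0
      show ?case using dirac_solution_shift[of m g "?Y 0" w] sol_coeff(1)[OF g, of m 0 c] by (simp add: s_def)
    next
      case (Suc N)
      have "dirac_solution (m + w) (\<lambda>t. ?Y N t - w *s ?Y (Suc N) t) (?Y (Suc N))"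
        using dirac_solution_shift[of m "?Y N" "?Y (Suc N)" w] sol_coeff(1)[OF g, of m "Suc N" c] by simp
      note A = dirac_solution_linear[OF Suc this, of 1 "w ^ Suc N"]
      have e1: "(\<lambda>t. 1 *s s N t + w ^ Suc N *s ?Y (Suc N) t) = s (Suc N)" by (simp add: s_def fun_eq_iff)
      have e2: "(\<lambda>t. 1 *s (g t - w ^ Suc N *s ?Y N t) + w ^ Suc N *s (?Y N t - w *s ?Y (Suc N) t)) = (\<lambda>t. g t - w ^ Suc (Suc N) *s ?Y (Suc N) t)"
        by (simp add: vec_eq_iff fun_eq_iff algebra_simps)
      show ?case using A unfolding e1 e2 .
    qed
    have s0: "s N 0 = c" for N
    proof -
      have "s N 0 = (\<Sum>i\<le>N. if i = 0 then c else 0)"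
        unfolding s_def by (intro sum.cong) (auto simp: sol_coeff(2)[OF g])
      then show ?thesis by simp
    qed
    let ?S = "sol (m + w) c g"
    have S: "dirac_solution (m + w) g ?S" "?S 0 = c" using sol[OF g] by auto
    define K where "K = C * (growth_factor (m + w) * (pi * B))"
    have diff: "norm (L ?S - L (s N)) \<le> K * norm w * (norm w * q) ^ N" for N
    proof -
      have d: "dirac_solution (m + w) (\<lambda>t. w ^ Suc N *s ?Y N t) (\<lambda>t. 1 *s ?S t + (-1) *s s N t)"
        using dirac_solution_linear[OF S(1) s[of N], of 1 "-1"] by simp
      have i: "?Y N absolutely_integrable_on {0..pi}" by (rule sol_coeff(3)[OF g])
      have i': "(\<lambda>t. w ^ Suc N *s ?Y N t) absolutely_integrable_on {0..pi}"
        using absolutely_integrable_linear[OF i bounded_linear_smult_vec[of "w ^ Suc N"]] by (simp add: o_def)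
      have "norm (1 *s ?S x + (-1) *s s N x) \<le> growth_factor (m + w) * (pi * (norm w ^ Suc N * (B * q ^ N)))" if x: "x \<in> {0..pi}" for x
      proof -
        have "norm (1 *s ?S x + (-1) *s s N x) \<le> growth_factor (m + w) * (norm (1 *s ?S 0 + (-1) *s s N 0) + integral {0..pi} (\<lambda>t. norm (w ^ Suc N *s ?Y N t)))"
          by (rule dirac_solution_bound'[OF d i' x])
        also have "1 *s ?S 0 + (-1) *s s N 0 = 0" using S(2) s0 by simp
        also have "integral {0..pi} (\<lambda>t. norm (w ^ Suc N *s ?Y N t)) \<le> integral {0..pi} (\<lambda>t. norm w ^ Suc N * (B * q ^ N))"
          using absolutely_integrable_norm[OF i'] B(2)
          by (intro integral_le) (auto simp: absolutely_integrable_on_def o_def norm_smult_vec2 norm_power q_def norm_mult intro!: mult_left_mono)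
        also have "integral {0..pi} (\<lambda>t. norm w ^ Suc N * (B * q ^ N)) = pi * (norm w ^ Suc N * (B * q ^ N))"
          unfolding integral_const_real by simp
        finally show ?thesis using growth_factor_pos[of "m + w"] by (simp only: norm_zero add_0 mult_left_mono less_imp_le)
      qed
      from C(2)[OF d this] have "norm (L (\<lambda>t. 1 *s ?S t + (-1) *s s N t)) \<le> C * (growth_factor (m + w) * (pi * (norm w ^ Suc N * (B * q ^ N))))" .
      moreover have "L (\<lambda>t. 1 *s ?S t + (-1) *s s N t) = L ?S - L (s N)"
        using sup_functional_linear[OF L S(1) s[of N], of 1 "-1"] by simp
      moreover have "C * (growth_factor (m + w) * (pi * (norm w ^ Suc N * (B * q ^ N)))) = K * norm w * (norm w * q) ^ N"
        by (simp add: K_def power_mult_distrib)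
      ultimately show ?thesis by (simp only:)
    qed
    have lim: "(\<lambda>N. K * norm w * (norm w * q) ^ N) \<longlonglongrightarrow> K * norm w * 0"
      using w q by (intro tendsto_mult tendsto_const LIMSEQ_power_zero) auto
    have "(\<lambda>N. L ?S - L (s N)) \<longlonglongrightarrow> 0"
      by (rule Lim_null_comparison[OF always_eventually[OF allI[OF diff]]]) (use lim in simp)
    from tendsto_diff[OF tendsto_const this, of "L ?S"] have "(\<lambda>N. L (s N)) \<longlonglongrightarrow> L ?S" by simp
    moreover have "L (s N) = (\<Sum>i\<le>N. L (?Y i) * w ^ i)" for N
    proof -
      have "L (\<lambda>t. \<Sum>i\<le>N. w ^ i *s ?Y i t) = (\<Sum>i\<le>N. w ^ i * L (?Y i))"
        by (rule sup_functional_sum[OF L finite_atMost sol_coeff(1)[OF g]])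
      then show ?thesis by (simp add: s_def[abs_def] mult.commute)
    qed
    ultimately show ?thesis unfolding sums_def_le by (simp only:)
  qed
  moreover have "\<forall>\<^sub>F w in nhds 0. norm w * q < 1"
    unfolding eventually_nhds_metric
    using q by (intro exI[of _ "1 / q"]) (auto simp: dist_norm field_simps)
  ultimately show "\<forall>\<^sub>F w in nhds 0. (\<lambda>n. fps_nth (Abs_fps (\<lambda>n. L (?Y n))) n * w ^ n) sums L (sol (m + w) c g)"
    by (auto elim: eventually_mono)
qed

lemma sol_holomorphic:
  assumes "sup_functional L" "g absolutely_integrable_on {0..pi}"
  shows "(\<lambda>l. L (sol l c g)) holomorphic_on UNIV"
proof -
  have "(\<lambda>l. L (sol l c g)) analytic_on {z}" for z
    by (rule has_fps_expansion_imp_analytic[OF sol_has_fps_expansion[OF assms]])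
  then show ?thesis using analytic_imp_holomorphic analytic_on_analytic_at by blast
qed

lemma sup_functional_nth:
  assumes "x \<in> {0..pi}"
  shows "sup_functional (\<lambda>y. y x $ i)"
  unfolding sup_functional_def
proof (intro conjI exI[of _ 1] allI impI)
  fix y :: "real \<Rightarrow> complex^2" and M assume "\<forall>x\<in>{0..pi}. norm (y x) \<le> M"
  then have "norm (y x) \<le> M" using assms by blast
  then show "norm (y x $ i) \<le> 1 * M" using Finite_Cartesian_Product.norm_nth_le[of "y x" i] by simp
qed simp

lemma sup_functional_bform: "sup_functional (bform A j)"
  unfolding sup_functional_def
proof (intro conjI allI impI exI[of _ "norm (A$j$1) + norm (A$j$2) + norm (A$j$3) + norm (A$j$4)"])
  fix y :: "real \<Rightarrow> complex^2" and M assume "\<forall>x\<in>{0..pi}. norm (y x) \<le> M"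
  then have "norm (y 0) \<le> M" "norm (y pi) \<le> M" by auto
  then have n: "norm (y 0 $ i) \<le> M" "norm (y pi $ i) \<le> M" for i
    using Finite_Cartesian_Product.norm_nth_le[of "y 0" i] Finite_Cartesian_Product.norm_nth_le[of "y pi" i] by auto
  have "norm (bform A j y) \<le> norm (A$j$1) * norm (y 0 $ 1) + norm (A$j$2) * norm (y 0 $ 2) + norm (A$j$3) * norm (y pi $ 1) + norm (A$j$4) * norm (y pi $ 2)"
    unfolding bform_def by (intro norm_triangle_le add_mono) (auto simp: norm_mult)
  also have "\<dots> \<le> norm (A$j$1) * M + norm (A$j$2) * M + norm (A$j$3) * M + norm (A$j$4) * M"
    by (intro add_mono mult_left_mono n) auto
  finally show "norm (bform A j y) \<le> (norm (A$j$1) + norm (A$j$2) + norm (A$j$3) + norm (A$j$4)) * M"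
    by (simp add: algebra_simps)
qed (simp add: bform_def algebra_simps)

end

section \<open>The characteristic determinant\<close>

locale dirac_problem = dirac_potential +
  fixes A :: "complex^4^2"
begin

definition fund :: "complex \<Rightarrow> 2 \<Rightarrow> real \<Rightarrow> complex^2" where
  "fund l j = sol l (axis j 1) (\<lambda>t. 0)"

definition part :: "complex \<Rightarrow> (real \<Rightarrow> complex^2) \<Rightarrow> real \<Rightarrow> complex^2" where
  "part l g = sol l 0 g"

text \<open>The determinant of the boundary forms applied to the fundamental system; a zero means a
  nontrivial solution that satisfies both conditions.\<close>

definition char_det :: "complex \<Rightarrow> complex" where
  "char_det l = bform A 1 (fund l 1) * bform A 2 (fund l 2) - bform A 1 (fund l 2) * bform A 2 (fund l 1)"

text \<open>\<open>coef1\<close> and \<open>coef2\<close> are the Cramer numerators for the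
  coefficients of \<open>fund l 1\<close> and \<open>fund l 2\<close> that correct
  \<open>part l g\<close> to meet the boundary conditions.\<close>

definition coef1 :: "complex \<Rightarrow> (real \<Rightarrow> complex^2) \<Rightarrow> complex" where
  "coef1 l g = bform A 2 (part l g) * bform A 1 (fund l 2) - bform A 1 (part l g) * bform A 2 (fund l 2)"

definition coef2 :: "complex \<Rightarrow> (real \<Rightarrow> complex^2) \<Rightarrow> complex" where
  "coef2 l g = bform A 1 (part l g) * bform A 2 (fund l 1) - bform A 2 (part l g) * bform A 1 (fund l 1)"

text \<open>\<open>numer l g / char_det l\<close> is the resolvent applied to \<open>g\<close>, by Cramer's rule.\<close>

definition numer :: "complex \<Rightarrow> (real \<Rightarrow> complex^2) \<Rightarrow> real \<Rightarrow> complex^2" where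
  "numer l g = (\<lambda>t. 1 *s (char_det l *s part l g t + coef1 l g *s fund l 1 t) + coef2 l g *s fund l 2 t)"

lemma integrable_zero: "(\<lambda>t. 0 :: complex^2) absolutely_integrable_on {0..pi}" by simp

lemma fund: "dirac_solution l (\<lambda>t. 0) (fund l j)" "fund l j 0 = axis j 1"
  unfolding fund_def using sol[OF integrable_zero] by auto

lemma part:
  assumes "g absolutely_integrable_on {0..pi}"
  shows "dirac_solution l g (part l g)" "part l g 0 = 0"
  unfolding part_def using sol[OF assms] by auto

lemma bform_linear: "bform A j (\<lambda>t. a *s y t + b *s z t) = a * bform A j y + b * bform A j z"
  by (simp add: bform_def algebra_simps)

lemma numer:
  assumes g: "g absolutely_integrable_on {0..pi}"
  shows "dirac_solution l (\<lambda>t. char_det l *s g t) (numer l g)" "bform A j (numer l g) = 0"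
proof -
  show "dirac_solution l (\<lambda>t. char_det l *s g t) (numer l g)"
    using dirac_solution_linear[OF dirac_solution_linear[OF part(1)[OF g, of l] fund(1)[of l 1], of "char_det l" "coef1 l g"] fund(1)[of l 2], of 1 "coef2 l g"]
    by (simp add: numer_def)
  have "\<forall>j. bform A j (numer l g) = 0"
    unfolding forall_2 numer_def bform_linear char_det_def coef1_def coef2_def by (simp add: algebra_simps)
  then show "bform A j (numer l g) = 0" by blast
qed

text \<open>Cramer's rule without division: it is valid at zeros of the determinant too, where it
  says that \<open>numer\<close> vanishes as soon as the problem with source \<open>g\<close> is
  solvable.\<close>

lemma bvp_solution_eq_numer:
  assumes y: "dirac_solution l g y" and bc: "\<And>j. bform A j y = 0" and g: "g absolutely_integrable_on {0..pi}"
  shows "numer l g = (\<lambda>t. char_det l *s y t)"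
proof -
  define a b where "a = y 0 $ 1" and "b = y 0 $ 2"
  define z where "z = (\<lambda>t. 1 *s (1 *s part l g t + a *s fund l 1 t) + b *s fund l 2 t)"
  have z: "dirac_solution l g z"
    using dirac_solution_linear[OF dirac_solution_linear[OF part(1)[OF g, of l] fund(1)[of l 1], of 1 a] fund(1)[of l 2], of 1 b]
    by (simp add: z_def)
  have "z 0 = y 0"
    by (simp add: z_def part(2)[OF g] fund(2) a_def b_def vec_eq_iff forall_2 axis_def)
  then have yz: "y = z" using dirac_solution_unique[OF y z] by simp
  have m: "bform A j (part l g) + a * bform A j (fund l 1) + b * bform A j (fund l 2) = 0" for j
    using bc[of j] unfolding yz z_def bform_linear by simp
  have c1: "coef1 l g = char_det l * a"
    using m[of 1] m[of 2] unfolding coef1_def char_det_def by algebra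
  have c2: "coef2 l g = char_det l * b"
    using m[of 1] m[of 2] unfolding coef2_def char_det_def by algebra
  show ?thesis
    unfolding yz numer_def z_def c1 c2 by (simp add: fun_eq_iff vec_eq_iff algebra_simps)
qed

lemma bform_fund_holomorphic: "(\<lambda>l. L (fund l j)) holomorphic_on UNIV" if "sup_functional L" for L
  unfolding fund_def by (rule sol_holomorphic[OF that integrable_zero])

lemma part_holomorphic: "(\<lambda>l. L (part l g)) holomorphic_on UNIV"
  if "sup_functional L" "g absolutely_integrable_on {0..pi}" for L
  unfolding part_def by (rule sol_holomorphic[OF that])

lemma char_det_holomorphic: "char_det holomorphic_on UNIV"
  unfolding char_det_def[abs_def]
  by (intro holomorphic_intros bform_fund_holomorphic sup_functional_bform)

lemma coef_holomorphic:
  assumes g: "g absolutely_integrable_on {0..pi}"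
  shows "(\<lambda>l. coef1 l g) holomorphic_on UNIV" "(\<lambda>l. coef2 l g) holomorphic_on UNIV"
  unfolding coef1_def[abs_def] coef2_def[abs_def]
  by (intro holomorphic_intros bform_fund_holomorphic part_holomorphic sup_functional_bform g)+

lemma functional_numer:
  assumes L: "sup_functional L" and g: "g absolutely_integrable_on {0..pi}"
  shows "L (numer l g) = char_det l * L (part l g) + coef1 l g * L (fund l 1) + coef2 l g * L (fund l 2)"
proof -
  have s: "dirac_solution l (\<lambda>t. char_det l *s g t + coef1 l g *s 0) (\<lambda>t. char_det l *s part l g t + coef1 l g *s fund l 1 t)"
    by (rule dirac_solution_linear[OF part(1)[OF g] fund(1)])
  show ?thesis
    unfolding numer_def sup_functional_linear[OF L s fund(1)] sup_functional_linear[OF L part(1)[OF g] fund(1)] by simp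
qed

lemma numer_holomorphic:
  assumes L: "sup_functional L" and g: "g absolutely_integrable_on {0..pi}"
  shows "(\<lambda>l. L (numer l g)) holomorphic_on UNIV"
  unfolding functional_numer[OF assms]
  by (intro holomorphic_intros char_det_holomorphic coef_holomorphic bform_fund_holomorphic part_holomorphic L g)

section \<open>Taylor coefficients of the numerator\<close>

text \<open>A coefficient of the Cauchy product of a scalar power series with a power series of
  functions.\<close>

definition conv_coeff :: "(nat \<Rightarrow> complex) \<Rightarrow> (nat \<Rightarrow> real \<Rightarrow> complex^2) \<Rightarrow> nat \<Rightarrow> real \<Rightarrow> complex^2" where
  "conv_coeff a Y k = (\<lambda>t. \<Sum>i\<in>{0..k}. a i *s Y (k - i) t)"

lemma conv_coeff_solution:
  assumes Y: "\<And>n. dirac_solution m (if n = 0 then g else Y (n-1)) (Y n)"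
  shows "dirac_solution m (\<lambda>t. a k *s g t + (if k = 0 then 0 else conv_coeff a Y (k-1) t)) (conv_coeff a Y k)"
proof -
  have "dirac_solution m (\<lambda>t. \<Sum>i\<in>{0..k}. a i *s (if k - i = 0 then g else Y (k - i - 1)) t) (conv_coeff a Y k)"
    unfolding conv_coeff_def by (rule dirac_solution_sum[OF finite_atLeastAtMost]) (rule Y)
  moreover have "(\<Sum>i\<in>{0..k}. a i *s (if k - i = 0 then g else Y (k - i - 1)) t) = a k *s g t + (if k = 0 then 0 else conv_coeff a Y (k-1) t)" for t
  proof (cases k)
    case (Suc n)
    have "(\<Sum>i\<in>{0..n}. a i *s (if Suc n - i = 0 then g else Y (Suc n - i - 1)) t) = (\<Sum>i\<in>{0..n}. a i *s Y (n - i) t)"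
      by (intro sum.cong refl) auto
    then show ?thesis using Suc by (simp add: conv_coeff_def)
  qed simp
  ultimately show ?thesis by simp
qed

text \<open>The Taylor coefficients are themselves functions, each the source of the next, apart
  from a multiple of \<open>g\<close>. Below the order of the zero of \<open>char_det\<close> that
  multiple vanishes and they form a chain of root functions.\<close>

lemma numer_taylor:
  assumes g: "g absolutely_integrable_on {0..pi}"
  obtains z where
    "\<And>k. dirac_solution m (\<lambda>t. fps_nth (fps_expansion char_det m) k *s g t + (if k = 0 then 0 else z (k-1) t)) (z k)"
    "\<And>k j. bform A j (z k) = 0"
    "\<And>L. sup_functional L \<Longrightarrow> (\<lambda>w. L (numer (m + w) g)) has_fps_expansion Abs_fps (\<lambda>k. L (z k))"
proof -
  define d where "d = fps_nth (fps_expansion char_det m)"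
  define c1 c2 where "c1 = fps_nth (fps_expansion (\<lambda>l. coef1 l g) m)" and "c2 = fps_nth (fps_expansion (\<lambda>l. coef2 l g) m)"
  have ex: "(\<lambda>w. f (m + w)) has_fps_expansion fps_expansion f m" if "f holomorphic_on UNIV" for f
    using that by (intro analytic_at_imp_has_fps_expansion) (auto intro: holomorphic_on_imp_analytic_at)
  have exd: "(\<lambda>w. char_det (m + w)) has_fps_expansion Abs_fps d"
    using ex[OF char_det_holomorphic] by (simp add: d_def fps_nth_inverse)
  have ex1: "(\<lambda>w. coef1 (m + w) g) has_fps_expansion Abs_fps c1" "(\<lambda>w. coef2 (m + w) g) has_fps_expansion Abs_fps c2"
    using ex[OF coef_holomorphic(1)[OF g]] ex[OF coef_holomorphic(2)[OF g]] by (simp_all add: c1_def c2_def fps_nth_inverse)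
  define Y where "Y = sol_coeff m 0 g"
  define F where "F j = sol_coeff m (axis j 1) (\<lambda>t. 0)" for j :: 2
  have Y: "dirac_solution m (if n = 0 then g else Y (n-1)) (Y n)" for n
    unfolding Y_def by (rule sol_coeff(1)[OF g])
  have F: "dirac_solution m (if n = 0 then (\<lambda>t. 0) else F j (n-1)) (F j n)" for n j
    unfolding F_def by (rule sol_coeff(1)[OF integrable_zero])
  define z where "z k = (\<lambda>t. 1 *s (1 *s conv_coeff d Y k t + 1 *s conv_coeff c1 (F 1) k t) + 1 *s conv_coeff c2 (F 2) k t)" for k
  let ?src = "\<lambda>a h Y k t. a k *s h t + (if k = 0 then 0 else conv_coeff a Y (k-1) t)"
  have src1: "dirac_solution m (\<lambda>t. 1 *s ?src d g Y k t + 1 *s ?src c1 (\<lambda>t. 0) (F 1) k t) (\<lambda>t. 1 *s conv_coeff d Y k t + 1 *s conv_coeff c1 (F 1) k t)" for k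
    by (rule dirac_solution_linear[OF conv_coeff_solution[OF Y] conv_coeff_solution[OF F]])
  have zsol: "dirac_solution m (\<lambda>t. 1 *s (1 *s ?src d g Y k t + 1 *s ?src c1 (\<lambda>t. 0) (F 1) k t) + 1 *s ?src c2 (\<lambda>t. 0) (F 2) k t) (z k)" for k
    unfolding z_def by (rule dirac_solution_linear[OF src1 conv_coeff_solution[OF F]])
  have conv: "L (conv_coeff a W k) = (\<Sum>i\<in>{0..k}. a i * L (W (k - i)))"
    if L: "sup_functional L" and W: "\<And>n. dirac_solution m (if n = 0 then h else W (n-1)) (W n)" for L a W k h
    unfolding conv_coeff_def by (rule sup_functional_sum[OF L finite_atLeastAtMost W])
  have exp: "(\<lambda>w. L (numer (m + w) g)) has_fps_expansion Abs_fps (\<lambda>k. L (z k))" if L: "sup_functional L" for L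
  proof -
    have e: "(\<lambda>w. L (part (m + w) g)) has_fps_expansion Abs_fps (\<lambda>n. L (Y n))"
       "(\<lambda>w. L (fund (m + w) j)) has_fps_expansion Abs_fps (\<lambda>n. L (F j n))" for j
      unfolding part_def fund_def Y_def F_def by (intro sol_has_fps_expansion L g integrable_zero)+
    have "(\<lambda>w. L (numer (m + w) g)) has_fps_expansion
        (Abs_fps d * Abs_fps (\<lambda>n. L (Y n)) + Abs_fps c1 * Abs_fps (\<lambda>n. L (F 1 n)) + Abs_fps c2 * Abs_fps (\<lambda>n. L (F 2 n)))"
      unfolding functional_numer[OF L g] by (intro has_fps_expansion_add has_fps_expansion_mult exd ex1 e)
    moreover have "L (z k) = L (conv_coeff d Y k) + L (conv_coeff c1 (F 1) k) + L (conv_coeff c2 (F 2) k)" for k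
      unfolding z_def sup_functional_linear[OF L src1 conv_coeff_solution[OF F]]
        sup_functional_linear[OF L conv_coeff_solution[OF Y] conv_coeff_solution[OF F]] by simp
    then have "Abs_fps (\<lambda>k. L (z k)) = Abs_fps d * Abs_fps (\<lambda>n. L (Y n)) + Abs_fps c1 * Abs_fps (\<lambda>n. L (F 1 n)) + Abs_fps c2 * Abs_fps (\<lambda>n. L (F 2 n))"
      by (simp add: fps_eq_iff fps_mult_nth conv[OF L Y] conv[OF L F])
    ultimately show ?thesis by simp
  qed
  show ?thesis
  proof (rule that[of z])
    show "dirac_solution m (\<lambda>t. fps_nth (fps_expansion char_det m) k *s g t + (if k = 0 then 0 else z (k-1) t)) (z k)" for k
      by (rule dirac_solution_cong[OF zsol]) (auto simp: z_def d_def)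
    show "bform A j (z k) = 0" for k j
    proof -
      have "(\<lambda>w. bform A j (numer (m + w) g)) has_fps_expansion Abs_fps (\<lambda>k. bform A j (z k))"
        by (rule exp[OF sup_functional_bform])
      then have "(\<lambda>w. 0) has_fps_expansion Abs_fps (\<lambda>k. bform A j (z k))"
        by (simp add: numer(2)[OF g])
      then have "Abs_fps (\<lambda>k. bform A j (z k)) = 0"
        using fps_expansion_unique_complex has_fps_expansion_0 by blast
      then show ?thesis by (simp add: fps_eq_iff)
    qed
  qed (rule exp)
qed

section \<open>Exponential type of the determinant and the numerator\<close>

lemma growth_factor_exp_type: "growth_factor l = (4 * exp (growth_offset * pi)) * exp ((8 * pi) * norm l)"
  by (simp add: growth_factor_def growth_rate_def algebra_simps flip: exp_add)

lemma integral_norm_nonneg: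
  "g absolutely_integrable_on {0..pi} \<Longrightarrow> 0 \<le> integral {0..pi} (\<lambda>t. norm (g t))"
  for g :: "real \<Rightarrow> complex^2"
  using absolutely_integrable_norm[of "{0..pi}" g] by (intro integral_nonneg) (auto simp: absolutely_integrable_on_def o_def)

lemma functional_fund_bound:
  assumes "sup_functional L"
  shows "\<exists>K\<ge>0. \<forall>l j. norm (L (fund l j)) \<le> K * exp ((8 * pi) * norm l)"
proof -
  obtain C where C: "C \<ge> 0" "\<And>l g y M. dirac_solution l g y \<Longrightarrow> (\<And>x. x \<in> {0..pi} \<Longrightarrow> norm (y x) \<le> M) \<Longrightarrow> norm (L y) \<le> C * M"
    using sup_functional_bound[OF assms] by blast
  have "norm (L (fund l j)) \<le> C * (growth_factor l * (norm (axis j (1::complex)) + 0))" for l j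
    by (rule C(2)[OF fund(1)]) (use dirac_solution_bound'[OF fund(1) integrable_zero] fund(2) in fastforce)
  then show ?thesis using C(1)
    by (intro exI[of _ "C * (4 * exp (growth_offset * pi))"]) (simp add: growth_factor_exp_type mult_ac)
qed

lemma functional_part_bound:
  assumes "sup_functional L"
  shows "\<exists>K\<ge>0. \<forall>l g. g absolutely_integrable_on {0..pi} \<longrightarrow>
     norm (L (part l g)) \<le> (K * integral {0..pi} (\<lambda>t. norm (g t))) * exp ((8 * pi) * norm l)"
proof -
  obtain C where C: "C \<ge> 0" "\<And>l g y M. dirac_solution l g y \<Longrightarrow> (\<And>x. x \<in> {0..pi} \<Longrightarrow> norm (y x) \<le> M) \<Longrightarrow> norm (L y) \<le> C * M"
    using sup_functional_bound[OF assms] by blast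
  have "norm (L (part l g)) \<le> C * (growth_factor l * integral {0..pi} (\<lambda>t. norm (g t)))"
    if g: "g absolutely_integrable_on {0..pi}" for l g
    by (rule C(2)[OF part(1)[OF g]]) (use dirac_solution_bound'[OF part(1)[OF g] g] part(2)[OF g] in fastforce)
  then show ?thesis using C(1)
    by (intro exI[of _ "C * (4 * exp (growth_offset * pi))"]) (simp add: growth_factor_exp_type mult_ac)
qed

lemma exp_type_mult:
  fixes a b :: complex
  assumes "norm a \<le> K * exp (c * r)" "norm b \<le> M * exp (d * r)" "K \<ge> 0"
  shows "norm (a * b) \<le> (K * M) * exp ((c + d) * r)"
proof -
  have "norm a * norm b \<le> (K * exp (c * r)) * (M * exp (d * r))"
    using assms by (intro mult_mono) auto
  then show ?thesis by (simp add: norm_mult ring_distribs exp_add mult_ac)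
qed

lemma char_det_bound: "\<exists>K\<ge>0. \<forall>l. norm (char_det l) \<le> K * exp ((16 * pi) * norm l)"
proof -
  obtain K where K: "K \<ge> 0" "\<And>l j. norm (bform A 1 (fund l j)) \<le> K * exp ((8 * pi) * norm l)"
    using functional_fund_bound[OF sup_functional_bform] by blast
  obtain M where M: "M \<ge> 0" "\<And>l j. norm (bform A 2 (fund l j)) \<le> M * exp ((8 * pi) * norm l)"
    using functional_fund_bound[OF sup_functional_bform] by blast
  have "norm (char_det l) \<le> (K * M) * exp ((8 * pi + 8 * pi) * norm l) + (K * M) * exp ((8 * pi + 8 * pi) * norm l)" for l
    unfolding char_det_def by (intro norm_triangle_le_diff add_mono exp_type_mult K M)
  then show ?thesis using K M by (intro exI[of _ "2 * (K * M)"]) (auto simp: mult.assoc)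
qed

text \<open>The type 24 pi counts three factors of type 8 pi in every term of the Cramer formula.
  The dependence on \<open>g\<close> through its L1 norm makes the jets bounded functionals later
  on.\<close>

lemma functional_numer_bound:
  assumes L: "sup_functional L"
  shows "\<exists>K\<ge>0. \<forall>l g. g absolutely_integrable_on {0..pi} \<longrightarrow>
     norm (L (numer l g)) \<le> (K * integral {0..pi} (\<lambda>t. norm (g t))) * exp ((24 * pi) * norm l)"
proof -
  obtain K1 where K1: "K1 \<ge> 0" "\<And>l j. norm (bform A 1 (fund l j)) \<le> K1 * exp ((8 * pi) * norm l)"
    using functional_fund_bound[OF sup_functional_bform] by blast
  obtain K2 where K2: "K2 \<ge> 0" "\<And>l j. norm (bform A 2 (fund l j)) \<le> K2 * exp ((8 * pi) * norm l)"
    using functional_fund_bound[OF sup_functional_bform] by blast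
  obtain K3 where K3: "K3 \<ge> 0" "\<And>l j. norm (L (fund l j)) \<le> K3 * exp ((8 * pi) * norm l)"
    using functional_fund_bound[OF L] by blast
  obtain D where D: "D \<ge> 0" "\<And>l. norm (char_det l) \<le> D * exp ((16 * pi) * norm l)"
    using char_det_bound by blast
  obtain M1 where M1: "M1 \<ge> 0" "\<And>l g. g absolutely_integrable_on {0..pi} \<Longrightarrow>
     norm (bform A 1 (part l g)) \<le> (M1 * integral {0..pi} (\<lambda>t. norm (g t))) * exp ((8 * pi) * norm l)"
    using functional_part_bound[OF sup_functional_bform] by blast
  obtain M2 where M2: "M2 \<ge> 0" "\<And>l g. g absolutely_integrable_on {0..pi} \<Longrightarrow>
     norm (bform A 2 (part l g)) \<le> (M2 * integral {0..pi} (\<lambda>t. norm (g t))) * exp ((8 * pi) * norm l)"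
    using functional_part_bound[OF sup_functional_bform] by blast
  obtain M3 where M3: "M3 \<ge> 0" "\<And>l g. g absolutely_integrable_on {0..pi} \<Longrightarrow>
     norm (L (part l g)) \<le> (M3 * integral {0..pi} (\<lambda>t. norm (g t))) * exp ((8 * pi) * norm l)"
    using functional_part_bound[OF L] by blast
  define C where "C = D * M3 + 2 * ((M2 * K1 + M1 * K2) * K3)"
  have "norm (L (numer l g)) \<le> (C * integral {0..pi} (\<lambda>t. norm (g t))) * exp ((24 * pi) * norm l)"
    if g: "g absolutely_integrable_on {0..pi}" for l g
  proof -
    let ?G = "integral {0..pi} (\<lambda>t. norm (g t))"
    let ?e = "\<lambda>c. exp (c * norm l)"
    have G: "?G \<ge> 0" by (rule integral_norm_nonneg[OF g])
    have c1: "norm (coef1 l g) \<le> ((M2 * K1 + M1 * K2) * ?G) * ?e (8 * pi + 8 * pi)"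
    proof -
      have "norm (coef1 l g) \<le> ((M2 * ?G) * K1) * ?e (8 * pi + 8 * pi) + ((M1 * ?G) * K2) * ?e (8 * pi + 8 * pi)"
        unfolding coef1_def by (intro norm_triangle_le_diff add_mono exp_type_mult K1 K2 M1(2)[OF g] M2(2)[OF g] mult_nonneg_nonneg M1(1) M2(1) G)
      then show ?thesis by (simp add: algebra_simps)
    qed
    have c2: "norm (coef2 l g) \<le> ((M2 * K1 + M1 * K2) * ?G) * ?e (8 * pi + 8 * pi)"
    proof -
      have "norm (coef2 l g) \<le> ((M1 * ?G) * K2) * ?e (8 * pi + 8 * pi) + ((M2 * ?G) * K1) * ?e (8 * pi + 8 * pi)"
        unfolding coef2_def by (intro norm_triangle_le_diff add_mono exp_type_mult K1 K2 M1(2)[OF g] M2(2)[OF g] mult_nonneg_nonneg M1(1) M2(1) G)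
      then show ?thesis by (simp add: algebra_simps)
    qed
    have n0: "0 \<le> (M2 * K1 + M1 * K2) * ?G" using M1 M2 K1 K2 G by simp
    have "norm (L (numer l g)) \<le> norm (char_det l * L (part l g)) + norm (coef1 l g * L (fund l 1)) + norm (coef2 l g * L (fund l 2))"
      unfolding functional_numer[OF L g] by (intro norm_triangle_le add_mono) auto
    also have "\<dots> \<le> (D * (M3 * ?G)) * ?e (16 * pi + 8 * pi) + (((M2 * K1 + M1 * K2) * ?G) * K3) * ?e ((8 * pi + 8 * pi) + 8 * pi)
        + (((M2 * K1 + M1 * K2) * ?G) * K3) * ?e ((8 * pi + 8 * pi) + 8 * pi)"
      by (intro add_mono exp_type_mult D M3(2)[OF g] c1 c2 K3 n0)
    also have "\<dots> = (C * ?G) * ?e (24 * pi)"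
    proof -
      have "16 * pi + 8 * pi = 24 * pi" "(8 * pi + 8 * pi) + 8 * pi = 24 * pi" by auto
      then show ?thesis by (simp only: C_def) (simp add: algebra_simps)
    qed
    finally show ?thesis .
  qed
  moreover have "C \<ge> 0" unfolding C_def using D M1 M2 M3 K1 K2 K3 by (intro add_nonneg_nonneg mult_nonneg_nonneg) auto
  ultimately show ?thesis by blast
qed

end

section \<open>Entire functions of exponential type\<close>

lemma entire_eq_zero_factor:
  assumes "f holomorphic_on UNIV" "f a = 0"
  obtains E where "E holomorphic_on UNIV" "\<And>z. f z = (z - a) * E z"
proof -
  define E where "E z = (if z = a then deriv f a else (f z - f a) / (z - a))" for z
  have "E holomorphic_on UNIV" unfolding E_def[abs_def] by (rule pole_lemma[OF assms(1)]) simp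
  moreover have "f z = (z - a) * E z" for z using assms(2) by (simp add: E_def)
  ultimately show ?thesis using that by blast
qed

lemma norm_le_sphere_imp_cball:
  assumes "f holomorphic_on UNIV" "R > 0" "\<And>z. norm z = R \<Longrightarrow> norm (f z) \<le> M" "norm z \<le> R"
  shows "norm (f z) \<le> M"
proof (rule maximum_modulus_frontier[where f=f and S="cball 0 R"])
  show "f holomorphic_on interior (cball 0 R)" using assms(1) holomorphic_on_subset by blast
  show "continuous_on (closure (cball 0 R)) f"
    using holomorphic_on_imp_continuous_on[OF assms(1)] continuous_on_subset by blast
qed (use assms in \<open>auto simp: frontier_def\<close>)

text \<open>The Borel--Caratheodory estimate for a branch of \<open>ln f\<close>, obtained from Schwarz' lemma
  applied to \<open>L / (2 A - L)\<close>.\<close>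

lemma nonvanishing_lower_bound:
  assumes f: "f holomorphic_on UNIV" and \<rho>: "\<rho> > 0" and nz: "\<And>z. norm z < \<rho> \<Longrightarrow> f z \<noteq> 0"
    and M: "\<And>z. norm z < \<rho> \<Longrightarrow> norm (f z) \<le> M" and z: "norm z \<le> (2/3) * \<rho>"
  shows "norm (f 0) * exp (- 4 * (ln (M / norm (f 0)) + 1)) \<le> norm (f z)"
proof -
  have f0: "f 0 \<noteq> 0" using nz \<rho> by simp
  have M0: "norm (f 0) \<le> M" using M \<rho> by simp
  have Mp: "M > 0" using M0 f0 by (meson less_le_trans zero_less_norm_iff)
  \<comment> \<open>The summand 1 makes the bound on the real part strict and \<open>A\<close>
    positive, as the Schwarz lemma needs.\<close>
  define A where "A = ln (M / norm (f 0)) + 1"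
  have A: "A \<ge> 1" using M0 f0 by (simp add: A_def)
  have "simply_connected (ball (0::complex) \<rho>)" by (simp add: convex_imp_simply_connected)
  then obtain g where g: "g holomorphic_on ball 0 \<rho>" "\<And>z. z \<in> ball 0 \<rho> \<Longrightarrow> f z = exp (g z)"
    unfolding simply_connected_eq_holomorphic_log[OF open_ball]
    using holomorphic_on_subset[OF f, of "ball 0 \<rho>"] nz by (metis mem_ball_0 subset_UNIV)
  define L where "L w = g w - g 0" for w
  have fL: "f w = f 0 * exp (L w)" if "norm w < \<rho>" for w
    using g(2)[of w] g(2)[of 0] that \<rho> by (simp add: L_def exp_diff)
  have LA: "Re (L w) < A" if "norm w < \<rho>" for w
  proof -
    have "norm (f 0) * exp (Re (L w)) \<le> M" using M[OF that] fL[OF that] by (simp add: norm_mult)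
    then have "exp (Re (L w)) \<le> M / norm (f 0)" using f0 by (simp add: field_simps)
    then have "Re (L w) \<le> ln (M / norm (f 0))" using Mp f0 by (subst ln_ge_iff) auto
    then show ?thesis by (simp add: A_def)
  qed
  have lt: "norm (L w) < norm (2 * A - L w)" if "norm w < \<rho>" for w
  proof -
    have "(norm (2 * A - L w))\<^sup>2 - (norm (L w))\<^sup>2 = 4 * A * (A - Re (L w))"
      unfolding cmod_power2 by (simp add: power2_eq_square algebra_simps)
    also have "\<dots> > 0" using LA[OF that] A by simp
    finally have "(norm (L w))\<^sup>2 < (norm (2 * A - L w))\<^sup>2" by simp
    then show ?thesis by (rule power_less_imp_less_base) simp
  qed
  define \<phi> where "\<phi> u = L (\<rho> * u) / (2 * A - L (\<rho> * u))" for u :: complex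
  have in_ball: "norm (complex_of_real \<rho> * u) < \<rho>" if "norm u < 1" for u
    using that \<rho> by (simp add: norm_mult)
  have \<phi>h: "\<phi> holomorphic_on ball 0 1"
  proof -
    have "(\<lambda>u. L (\<rho> * u)) holomorphic_on ball 0 1"
      unfolding L_def
      by (intro holomorphic_intros holomorphic_on_compose_gen[OF _ g(1), unfolded o_def]) (use in_ball in auto)
    moreover have "2 * complex_of_real A - L (\<rho> * u) \<noteq> 0" if "u \<in> ball 0 1" for u :: complex
      using lt[OF in_ball, of u] that by auto
    ultimately show ?thesis unfolding \<phi>_def by (intro holomorphic_intros) auto
  qed
  have \<phi>1: "norm (\<phi> u) < 1" if "norm u < 1" for u
    using lt[OF in_ball[OF that]] unfolding \<phi>_def norm_divide
    by (metis divide_less_eq_1_pos norm_ge_zero order_le_less_trans)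
  define u where "u = z / \<rho>"
  have u: "norm u \<le> 2/3" using z \<rho> by (simp add: u_def norm_divide field_simps)
  have zr: "norm z < \<rho>" using z \<rho> by simp
  have "norm (\<phi> u) \<le> norm u"
    by (rule Schwarz_Lemma(1)[OF \<phi>h _ \<phi>1]) (use u in \<open>auto simp: \<phi>_def L_def\<close>)
  moreover have "\<phi> u = L z / (2 * A - L z)" using \<rho> by (simp add: \<phi>_def u_def)
  ultimately have "norm (L z) / norm (2 * A - L z) \<le> 2/3"
    using order_trans[OF _ u, of "norm (\<phi> u)"] by (simp only: norm_divide)
  moreover have "0 < norm (2 * A - L z)" using lt[OF zr] norm_ge_zero order_le_less_trans by blast
  ultimately have "3 * norm (L z) \<le> 2 * norm (2 * A - L z)" by (simp add: field_simps)
  also have "\<dots> \<le> 2 * (2 * A + norm (L z))"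
    using norm_triangle_ineq4[of "2 * complex_of_real A" "L z"] A by simp
  finally have "norm (L z) \<le> 4 * A" by simp
  then have "- 4 * A \<le> Re (L z)" using abs_Re_le_cmod[of "L z"] by linarith
  then have "norm (f 0) * exp (- 4 * A) \<le> norm (f 0) * exp (Re (L z))" by (intro mult_left_mono) auto
  also have "\<dots> = norm (f z)" using fL[OF zr] by (simp add: norm_mult)
  finally show ?thesis by (simp add: A_def)
qed

text \<open>Dividing \<open>D\<close> by the Blaschke factor of a zero in the disc of radius \<open>3R/4\<close> keeps its modulus on
  the circle of radius \<open>R\<close> and multiplies \<open>|D 0|\<close> by at least \<open>4/3\<close>, so it can happen finitely often only.\<close>

lemma quotient_bound_on_disc:
  assumes "D holomorphic_on UNIV" "H holomorphic_on UNIV" "R > 0" "\<delta> > 0" "\<delta> \<le> norm (D 0)"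
    and "\<And>z. norm z = R \<Longrightarrow> norm (D z) \<le> M" "\<And>z. norm z = R \<Longrightarrow> norm (D z * H z) \<le> M'"
    and "M < norm (D 0) * (4/3)^k" and "norm z \<le> R / 2"
  shows "norm (H z) \<le> M' * exp 4 * (M / \<delta>)^4 / \<delta>"
  using assms(1,5-8)
proof (induction k arbitrary: D)
  case 0
  have "norm (D 0) \<le> M" by (rule norm_le_sphere_imp_cball[OF 0(1) assms(3) 0(3)]) (use assms(3) in auto)
  then show ?case using 0 by simp
next
  case (Suc k)
  have M: "norm (D w) \<le> M" if "norm w \<le> R" for w
    by (rule norm_le_sphere_imp_cball[OF Suc.prems(1) assms(3) Suc.prems(3) that])
  show ?case
  proof (cases "\<exists>a. norm a < 3/4 * R \<and> D a = 0")
    case True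
    then obtain a where a: "norm a < 3/4 * R" "D a = 0" by blast
    obtain E where E: "E holomorphic_on UNIV" "\<And>z. D z = (z - a) * E z"
      using entire_eq_zero_factor[OF Suc.prems(1) a(2)] by blast
    \<comment> \<open>The zero at \<open>a\<close> is exchanged for its mirror image in the circle.
      On |z| = R the factors |R^2 - cnj a z| and R |z - a| agree, so the modulus there is
      unchanged.\<close>
    define D1 where "D1 z = E z * (R\<^sup>2 - cnj a * z) / R" for z
    have a0: "a \<noteq> 0" using a(2) Suc.prems(2) assms(4) by auto
    have sph: "norm (D1 w) = norm (D w)" if w: "norm w = R" for w
    proof -
      have "complex_of_real (R\<^sup>2) = w * cnj w" using w by (simp add: complex_norm_square[symmetric])
      then have "complex_of_real (R\<^sup>2) - cnj a * w = w * cnj (w - a)" by (simp add: algebra_simps)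
      then have "norm (complex_of_real (R\<^sup>2) - cnj a * w) = R * norm (w - a)"
        using w by (simp add: norm_mult del: complex_cnj_diff)
      then show ?thesis unfolding D1_def E(2)[of w] norm_divide norm_mult using assms(3) by simp
    qed
    have D10: "norm (D1 0) * norm a = norm (D 0) * R"
      unfolding D1_def E(2)[of 0] using assms(3) by (simp add: norm_mult norm_divide power2_eq_square)
    have ge: "norm (D 0) * (4/3) \<le> norm (D1 0)"
    proof -
      have "norm (D 0) * (4/3) * norm a \<le> norm (D 0) * R"
        using a(1) mult_left_mono[of "4/3 * norm a" R "norm (D 0)"] by (simp add: mult_ac)
      also have "\<dots> = norm (D1 0) * norm a" using D10 by simp
      finally show ?thesis using a0 by simp
    qed
    show ?thesis
    proof (rule Suc.IH)
      show "D1 holomorphic_on UNIV" unfolding D1_def using assms(3) by (intro holomorphic_intros E(1)) auto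
      show "\<delta> \<le> norm (D1 0)" using ge Suc.prems(2) norm_ge_zero[of "D 0"] by linarith
      show "norm (D1 w) \<le> M" if "norm w = R" for w using sph[OF that] Suc.prems(3)[OF that] by simp
      show "norm (D1 w * H w) \<le> M'" if "norm w = R" for w
        using sph[OF that] Suc.prems(4)[OF that] by (simp add: norm_mult)
      have "norm (D 0) * (4/3) * (4/3)^k \<le> norm (D1 0) * (4/3)^k" using ge by (intro mult_right_mono) auto
      then show "M < norm (D1 0) * (4/3)^k" using Suc.prems(5) by (simp only: power_Suc mult.assoc)
    qed
  next
    case False
    \<comment> \<open>No zeros remain with |z| < 3R/4, and |z| \<le> R/2 is two thirds of that
      radius: the setting of the lower bound for nonvanishing functions.\<close>
    have d0: "D 0 \<noteq> 0" using Suc.prems(2) assms(4) by auto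
    have MD: "norm (D 0) \<le> M" using M[of 0] assms(3) by simp
    have Mp: "M > 0" using MD d0 by (meson less_le_trans zero_less_norm_iff)
    have "norm (D 0) * exp (- 4 * (ln (M / norm (D 0)) + 1)) \<le> norm (D z)"
      by (rule nonvanishing_lower_bound[OF Suc.prems(1), of "3/4 * R"]) (use False M assms(3,9) in auto)
    moreover have "\<delta> * exp (- 4 * (ln (M / \<delta>) + 1)) \<le> norm (D 0) * exp (- 4 * (ln (M / norm (D 0)) + 1))"
    proof (intro mult_mono Suc.prems(2))
      have "M / norm (D 0) \<le> M / \<delta>" using Suc.prems(2) assms(4) Mp by (intro divide_left_mono mult_pos_pos) (use d0 in auto)
      then have "ln (M / norm (D 0)) \<le> ln (M / \<delta>)" using Mp d0 assms(4) by (subst ln_le_cancel_iff) auto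
      then show "exp (- 4 * (ln (M / \<delta>) + 1)) \<le> exp (- 4 * (ln (M / norm (D 0)) + 1))" by simp
    qed auto
    ultimately have lower: "\<delta> * exp (- 4 * (ln (M / \<delta>) + 1)) \<le> norm (D z)" by linarith
    have e: "\<delta> * exp (- 4 * (ln (M / \<delta>) + 1)) = \<delta> / (exp 4 * (M / \<delta>)^4)"
    proof -
      have "exp (4 * ln (M / \<delta>)) = (M / \<delta>)^4"
        using Mp assms(4) exp_of_nat_mult[of 4 "ln (M / \<delta>)"] by simp
      then have e4: "exp (4 * (ln (M / \<delta>) + 1)) = exp 4 * (M / \<delta>)^4" by (simp add: ring_distribs exp_add mult.commute)
      have "exp (- 4 * (ln (M / \<delta>) + 1)) = inverse (exp (4 * (ln (M / \<delta>) + 1)))" by (simp flip: exp_minus)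
      then show ?thesis unfolding e4 by (simp only: divide_inverse)
    qed
    have p: "0 < \<delta> / (exp 4 * (M / \<delta>)^4)" using Mp assms(4) by simp
    have "norm (D z * H z) \<le> M'"
      by (rule norm_le_sphere_imp_cball[OF _ assms(3)])
        (use Suc.prems(1,4) assms(2,3,9) in \<open>auto intro!: holomorphic_intros\<close>)
    then have "norm (D z) * norm (H z) \<le> M'" by (simp add: norm_mult)
    moreover have "(\<delta> / (exp 4 * (M / \<delta>)^4)) * norm (H z) \<le> norm (D z) * norm (H z)"
      using lower unfolding e by (intro mult_right_mono) auto
    ultimately have "(\<delta> / (exp 4 * (M / \<delta>)^4)) * norm (H z) \<le> M'" by linarith
    then have "norm (H z) \<le> M' / (\<delta> / (exp 4 * (M / \<delta>)^4))" using p by (simp only: pos_le_divide_eq mult.commute)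
    then show ?thesis by (simp add: mult_ac)
  qed
qed

text \<open>The disc estimate is applied about \<open>z0\<close>, with a radius that grows linearly
  in |z|. The factor 10 is 5 times 2: one exponential comes from the product, four from the fourth
  power of the bound on \<open>D\<close>, and the radius is about 2 |z|.\<close>

lemma exponential_type_quotient:
  assumes D: "D holomorphic_on UNIV" and H: "H holomorphic_on UNIV" and z0: "D z0 \<noteq> 0"
    and bD: "\<And>z. norm (D z) \<le> K * exp (c * norm z)" and bN: "\<And>z. norm (D z * H z) \<le> K' * exp (c * norm z)"
    and c: "c \<ge> 0"
  obtains C where "\<And>z. norm (H z) \<le> C * exp (10 * c * norm z)"
proof -
  define \<delta> where "\<delta> = norm (D z0)"
  have \<delta>: "\<delta> > 0" using z0 by (simp add: \<delta>_def)
  have K: "K > 0"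
  proof -
    have "0 < K * exp (c * norm z0)" using bD[of z0] z0 by (meson less_le_trans zero_less_norm_iff)
    then show ?thesis by (simp add: zero_less_mult_iff)
  qed
  have K': "K' \<ge> 0"
  proof -
    have "0 \<le> K' * exp (c * norm (0::complex))" using bN[of 0] norm_ge_zero order_trans by blast
    then show ?thesis by simp
  qed
  define r0 where "r0 = norm z0"
  have main: "norm (H z) \<le> (K' * exp 4 * (K / \<delta>)^4 / \<delta>) * exp (5 * c * (2 * norm z + 3 * r0 + 1))" for z
  proof -
    \<comment> \<open>Chosen so that \<open>z\<close> lies in the disc of half the radius about
      \<open>z0\<close>.\<close>
    define R where "R = 2 * (norm z + r0) + 1"
    have R: "R > 0" unfolding R_def r0_def by (simp add: add_nonneg_pos)
    define E where "E = exp (c * (R + r0))"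
    have le: "K * exp (c * norm (z0 + w)) \<le> K * E" "K' * exp (c * norm (z0 + w)) \<le> K' * E" if "norm w = R" for w
    proof -
      have "norm (z0 + w) \<le> R + r0" using norm_triangle_ineq[of z0 w] that by (simp add: r0_def)
      then have "exp (c * norm (z0 + w)) \<le> E" unfolding E_def using c by (simp add: mult_left_mono)
      then show "K * exp (c * norm (z0 + w)) \<le> K * E" "K' * exp (c * norm (z0 + w)) \<le> K' * E"
        using K K' by (auto intro: mult_left_mono)
    qed
    obtain k where k: "(K * E) / \<delta> < (4/3)^k" using real_arch_pow[of "4/3" "(K * E) / \<delta>"] by auto
    have "norm ((\<lambda>w. H (z0 + w)) (z - z0)) \<le> K' * E * exp 4 * ((K * E) / \<delta>)^4 / \<delta>"
    proof (rule quotient_bound_on_disc[where D="\<lambda>w. D (z0 + w)" and H="\<lambda>w. H (z0 + w)" and z="z - z0" and R=R and k=k])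
      show "(\<lambda>w. D (z0 + w)) holomorphic_on UNIV"
        by (intro holomorphic_on_compose_gen[OF _ D, unfolded o_def] holomorphic_intros) auto
      show "(\<lambda>w. H (z0 + w)) holomorphic_on UNIV"
        by (intro holomorphic_on_compose_gen[OF _ H, unfolded o_def] holomorphic_intros) auto
      show "norm (D (z0 + w)) \<le> K * E" if "norm w = R" for w using bD le(1)[OF that] order_trans by blast
      show "norm (D (z0 + w) * H (z0 + w)) \<le> K' * E" if "norm w = R" for w using bN le(2)[OF that] order_trans by blast
      show "K * E < norm (D (z0 + 0)) * (4/3)^k" using k \<delta> by (simp add: field_simps \<delta>_def)
      show "norm (z - z0) \<le> R / 2" using norm_triangle_ineq4[of z z0] by (simp add: R_def r0_def field_simps)
    qed (use R \<delta> in \<open>auto simp: \<delta>_def\<close>)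
    also have "\<dots> = (K' * exp 4 * (K / \<delta>)^4 / \<delta>) * E^5" by (simp add: field_simps power_mult_distrib eval_nat_numeral)
    also have "E^5 = exp (5 * c * (2 * norm z + 3 * r0 + 1))"
      unfolding E_def R_def by (simp flip: exp_of_nat_mult)
    finally show ?thesis by simp
  qed
  show ?thesis
  proof (rule that)
    fix z
    show "norm (H z) \<le> ((K' * exp 4 * (K / \<delta>)^4 / \<delta>) * exp (5 * c * (3 * r0 + 1))) * exp (10 * c * norm z)"
      using main[of z] by (simp add: algebra_simps flip: exp_add)
  qed
qed

text \<open>Phragmen--Lindelof with the multiplier \<open>exp (- e w powr (3/2))\<close>, \<open>w = 1 + z exp (- i \<pi>/4)\<close>.\<close>

lemma phragmen_lindelof_quadrant:
  assumes f: "f holomorphic_on {z. Re z > -1}"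
    and growth: "\<And>z. Re z \<ge> 0 \<Longrightarrow> Im z \<ge> 0 \<Longrightarrow> norm (f z) \<le> C * exp (c * norm z)"
    and M: "M > 0"
    and real: "\<And>x. x \<ge> 0 \<Longrightarrow> norm (f (of_real x)) \<le> M" and imag: "\<And>y. y \<ge> 0 \<Longrightarrow> norm (f (\<i> * of_real y)) \<le> M"
    and z: "Re z \<ge> 0" "Im z \<ge> 0"
  shows "norm (f z) \<le> M"
proof -
  define r where "r = sqrt 2 / 2"
  have r: "r > 0" "r\<^sup>2 = 1/2" by (auto simp: r_def power_divide)
  define W where "W z = 1 + z * Complex r (- r)" for z
  have ReW: "Re (W z) = 1 + r * (Re z + Im z)" and ImW: "Im (W z) = r * (Im z - Re z)" for z
    by (auto simp: W_def algebra_simps)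
  \<comment> \<open>\<open>W\<close> maps the quadrant into the sector |arg| \<le> pi/4, where the
    argument of the 3/2-th power is at most 3 pi/8; \<kappa> is the least cosine there.\<close>
  define \<kappa> where "\<kappa> = cos (3 * pi / 8)"
  have \<kappa>: "\<kappa> > 0" unfolding \<kappa>_def by (rule cos_gt_zero) auto
  have W: "Re (W z) \<ge> 1" "norm (W z) \<ge> norm z" "\<kappa> * norm (W z) powr (3/2) \<le> Re (W z powr (3/2))"
    if "Re z \<ge> 0" "Im z \<ge> 0" for z
  proof -
    show W1: "Re (W z) \<ge> 1" using that r by (simp add: ReW)
    have "(norm (W z))\<^sup>2 = 1 + 2 * r * (Re z + Im z) + 2 * r\<^sup>2 * (norm z)\<^sup>2"
      unfolding cmod_power2 ReW ImW by (simp add: power2_eq_square algebra_simps)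
    then have "(norm z)\<^sup>2 \<le> (norm (W z))\<^sup>2" using r that by simp
    then show "norm (W z) \<ge> norm z" by (rule power2_le_imp_le) simp
    have W0: "W z \<noteq> 0" using W1 by auto
    have "\<bar>Im (W z)\<bar> \<le> Re (W z)" unfolding ReW ImW using r that
      by (auto simp: abs_le_iff algebra_simps)
    then have "\<bar>Arg (W z)\<bar> \<le> pi/4"
    proof -
      have a: "Arg (W z) = arctan (Im (W z) / Re (W z))" using W1 by (intro arg_conv_arctan) auto
      have "\<bar>Im (W z) / Re (W z)\<bar> \<le> 1" using \<open>\<bar>Im (W z)\<bar> \<le> Re (W z)\<close> W1 by (simp add: abs_divide)
      then have h: "Im (W z) / Re (W z) \<le> 1" "-1 \<le> Im (W z) / Re (W z)" by linarith+
      have "arctan (Im (W z) / Re (W z)) \<le> arctan 1" "arctan (-1) \<le> arctan (Im (W z) / Re (W z))"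
        by (rule arctan_monotone'[OF h(1)], rule arctan_monotone'[OF h(2)])
      then show ?thesis by (simp add: a arctan_one arctan_minus)
    qed
    then have "\<bar>3/2 * Arg (W z)\<bar> \<le> 3 * pi / 8" by simp
    then have "\<kappa> \<le> cos (3/2 * Arg (W z))"
      unfolding \<kappa>_def using cos_monotone_0_pi_le[of "\<bar>3/2 * Arg (W z)\<bar>" "3 * pi / 8"] by (simp add: abs_if split: if_splits)
    moreover have "Re (W z powr (3/2)) = norm (W z) powr (3/2) * cos (3/2 * Arg (W z))"
    proof -
      have "W z powr (complex_of_real (3/2)) = exp (complex_of_real (3/2) * Ln (W z))" using W0 by (simp add: powr_def)
      also have "Re \<dots> = exp (3/2 * ln (norm (W z))) * cos (3/2 * Arg (W z))"
        unfolding Re_exp using W0 by (simp add: Arg_def)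
      also have "exp (3/2 * ln (norm (W z))) = norm (W z) powr (3/2)" using W0 by (simp add: powr_def)
      finally show ?thesis by simp
    qed
    ultimately show "\<kappa> * norm (W z) powr (3/2) \<le> Re (W z powr (3/2))"
      using mult_left_mono[of \<kappa> "cos (3/2 * Arg (W z))" "norm (W z) powr (3/2)"] by (simp add: mult.commute)
  qed
  have cont: "continuous_on {z. Re z \<ge> 0 \<and> Im z \<ge> 0} (\<lambda>z. W z powr (3/2))"
    and hol: "(\<lambda>z. W z powr (3/2)) holomorphic_on {z. Re z \<ge> 0 \<and> Im z \<ge> 0}"
  proof -
    show h: "(\<lambda>z. W z powr (3/2)) holomorphic_on {z. Re z \<ge> 0 \<and> Im z \<ge> 0}"
    proof (rule holomorphic_on_powr)
      show "W holomorphic_on {z. Re z \<ge> 0 \<and> Im z \<ge> 0}" unfolding W_def by (intro holomorphic_intros)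
      show "(\<lambda>x. 3 / 2) holomorphic_on {z. 0 \<le> Re z \<and> 0 \<le> Im z}" by (rule holomorphic_on_const)
      show "W z \<notin> \<real>\<^sub>\<le>\<^sub>0" if "z \<in> {z. Re z \<ge> 0 \<and> Im z \<ge> 0}" for z
        using W(1)[of z] that by (auto simp: complex_nonpos_Reals_iff)
    qed
    show "continuous_on {z. Re z \<ge> 0 \<and> Im z \<ge> 0} (\<lambda>z. W z powr (3/2))" by (rule holomorphic_on_imp_continuous_on[OF h])
  qed
  have step: "norm (f z) \<le> M * exp (\<epsilon> * Re (W z powr (3/2)))" if \<epsilon>: "\<epsilon> > 0" for \<epsilon>
  proof -
    define g where "g z = f z * exp (- of_real \<epsilon> * (W z powr (3/2)))" for z
    have ng: "norm (g z) = norm (f z) * exp (- \<epsilon> * Re (W z powr (3/2)))" for z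
      by (simp add: g_def norm_mult)
    define \<eta> where "\<eta> = \<epsilon> * \<kappa>"
    have \<eta>: "\<eta> > 0" using \<epsilon> \<kappa> by (simp add: \<eta>_def)
    \<comment> \<open>The exponent 3/2 lies above the order 1 of \<open>f\<close>, so the multiplier
      wins on large arcs, and below 2, so its exponent keeps a positive real part on the
      quadrant.\<close>
    have "filterlim (\<lambda>R. \<eta> * R powr (3/2) - \<bar>c\<bar> * R) at_top at_top"
      using \<eta> by (cases "\<bar>c\<bar> > 0") real_asymp+
    then have "filterlim (\<lambda>R. \<eta> * R powr (3/2) - c * R) at_top at_top"
    proof (rule filterlim_at_top_mono)
      show "\<forall>\<^sub>F R in at_top. \<eta> * R powr (3/2) - \<bar>c\<bar> * R \<le> \<eta> * R powr (3/2) - c * R"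
        using eventually_ge_at_top[of 0] by eventually_elim (simp add: mult_right_mono)
    qed
    then have "filterlim (\<lambda>R. \<epsilon> * \<kappa> * R powr (3/2) - c * R) at_top at_top" by (simp add: \<eta>_def)
    then have "((\<lambda>R. exp (- (\<epsilon> * \<kappa> * R powr (3/2) - c * R))) \<longlongrightarrow> 0) at_top"
      by (intro filterlim_compose[OF exp_at_bot] filterlim_compose[OF filterlim_uminus_at_bot_at_top])
    then have "((\<lambda>R. \<bar>C\<bar> * exp (- (\<epsilon> * \<kappa> * R powr (3/2) - c * R))) \<longlongrightarrow> \<bar>C\<bar> * 0) at_top"
      by (intro tendsto_intros)
    then have "\<forall>\<^sub>F R in at_top. \<bar>C\<bar> * exp (- (\<epsilon> * \<kappa> * R powr (3/2) - c * R)) < M"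
      using M by (intro order_tendstoD) auto
    then have "\<forall>\<^sub>F R in at_top. \<bar>C\<bar> * exp (- (\<epsilon> * \<kappa> * R powr (3/2) - c * R)) < M \<and> R > norm z"
      using eventually_gt_at_top by (rule eventually_conj)
    then obtain R where R: "\<bar>C\<bar> * exp (- (\<epsilon> * \<kappa> * R powr (3/2) - c * R)) < M" "R > norm z"
      using eventually_happens'[OF trivial_limit_at_top_linorder] by blast
    define S where "S = {w. Re w \<ge> 0 \<and> Im w \<ge> 0 \<and> norm w \<le> R}"
    have clS: "closed S"
      unfolding S_def by (intro closed_Collect_conj closed_Collect_le continuous_intros)
    have sub: "S \<subseteq> {z. Re z \<ge> 0 \<and> Im z \<ge> 0}" "S \<subseteq> {z. Re z > -1}" by (auto simp: S_def)
    have gh: "g holomorphic_on S"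
      unfolding g_def by (intro holomorphic_intros holomorphic_on_subset[OF f sub(2)] holomorphic_on_subset[OF hol sub(1)])
    have "norm (g z) \<le> M"
    proof (rule maximum_modulus_frontier[where f=g and S=S])
      show "g holomorphic_on interior S" using gh interior_subset holomorphic_on_subset by blast
      show "continuous_on (closure S) g" using gh clS holomorphic_on_imp_continuous_on by simp
      show "bounded S" by (rule bounded_subset[of "cball 0 R"]) (auto simp: S_def)
      show "z \<in> S" using z R by (auto simp: S_def)
      fix w assume w: "w \<in> frontier S"
      have wS: "w \<in> S" using w clS by (auto simp: frontier_def)
      then have wq: "Re w \<ge> 0" "Im w \<ge> 0" by (auto simp: S_def)
      have le1: "norm (g w) \<le> norm (f w)"
      proof -
        have "0 \<le> Re (W w powr (3/2))" using W(3)[OF wq] \<kappa> by (smt (verit) mult_nonneg_nonneg powr_ge_zero)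
        then have "exp (- \<epsilon> * Re (W w powr (3/2))) \<le> 1" using \<epsilon> by simp
        then show ?thesis unfolding ng using mult_left_mono[of _ 1 "norm (f w)"] by fastforce
      qed
      consider "Im w = 0" | "Re w = 0" | "norm w = R" | "Re w > 0" "Im w > 0" "norm w < R"
        using wS by (fastforce simp: S_def)
      then show "norm (g w) \<le> M"
      proof cases
        case 1
        then have "w = of_real (Re w)" by (simp add: complex_eq_iff)
        then show ?thesis using real[OF wq(1)] le1 by simp
      next
        case 2
        then have "w = \<i> * of_real (Im w)" by (simp add: complex_eq_iff)
        then show ?thesis using imag[OF wq(2)] le1 by (metis order_trans)
      next
        case 3
        have R0: "R \<ge> 0" using 3 by auto
        have "\<kappa> * R powr (3/2) \<le> \<kappa> * norm (W w) powr (3/2)"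
          using W(2)[OF wq] 3 R0 \<kappa> by (intro mult_left_mono powr_mono2) auto
        also have "\<dots> \<le> Re (W w powr (3/2))" by (rule W(3)[OF wq])
        finally have "\<epsilon> * \<kappa> * R powr (3/2) \<le> \<epsilon> * Re (W w powr (3/2))" using \<epsilon> by simp
        then have "norm (g w) \<le> (\<bar>C\<bar> * exp (c * R)) * exp (- (\<epsilon> * \<kappa> * R powr (3/2)))"
          unfolding ng using growth[OF wq] 3
          by (intro mult_mono) (auto intro: order_trans[OF _ mult_right_mono[OF abs_ge_self]])
        also have "\<dots> = \<bar>C\<bar> * exp (- (\<epsilon> * \<kappa> * R powr (3/2) - c * R))" by (simp add: mult.assoc flip: exp_add)
        finally show ?thesis using R(1) by simp
      next
        case 4
        have "open {w. Re w > 0 \<and> Im w > 0 \<and> norm w < R}"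
          by (intro open_Collect_conj open_Collect_less continuous_intros)
        moreover have "{w. Re w > 0 \<and> Im w > 0 \<and> norm w < R} \<subseteq> S" by (auto simp: S_def)
        ultimately have "w \<in> interior S" using 4 by (auto simp: interior_def)
        then show ?thesis using w by (simp add: frontier_def)
      qed
    qed
    then have "norm (f z) * exp (- \<epsilon> * Re (W z powr (3/2))) \<le> M" by (simp add: ng)
    then show ?thesis by (simp add: exp_minus field_simps)
  qed
  show ?thesis
  proof (rule tendsto_le[OF trivial_limit_at_right_real])
    have "((\<lambda>\<epsilon>. M * exp (\<epsilon> * Re (W z powr (3/2)))) \<longlongrightarrow> M * exp (0 * Re (W z powr (3/2)))) (at_right 0)"
      by (intro tendsto_intros)
    then show "((\<lambda>\<epsilon>. M * exp (\<epsilon> * Re (W z powr (3/2)))) \<longlongrightarrow> M) (at_right 0)" by simp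
    show "((\<lambda>\<epsilon>. norm (f z)) \<longlongrightarrow> norm (f z)) (at_right 0)" by simp
    show "\<forall>\<^sub>F \<epsilon> in at_right 0. norm (f z) \<le> M * exp (\<epsilon> * Re (W z powr (3/2)))"
      unfolding eventually_at_right_field using step by (intro exI[of _ 1]) auto
  qed
qed

text \<open>Division by (1 + z)^N reduces polynomial to constant bounds: on the quadrant |1 + z| is
  comparable with 1 + |z|, and the pole at -1 is the reason for the half plane Re z > -1 in the
  preceding result.\<close>

lemma phragmen_lindelof_quadrant_poly:
  assumes f: "f holomorphic_on UNIV"
    and growth: "\<And>z. norm (f z) \<le> C * exp (c * norm z)"
    and C: "C' \<ge> 0"
    and real: "\<And>x. x \<ge> 0 \<Longrightarrow> norm (f (of_real x)) \<le> C' * (1 + x) ^ N"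
    and imag: "\<And>y. y \<ge> 0 \<Longrightarrow> norm (f (\<i> * of_real y)) \<le> C' * (1 + y) ^ N"
    and z: "Re z \<ge> 0" "Im z \<ge> 0"
  shows "norm (f z) \<le> ((C' + 1) * 2 ^ N) * (1 + norm z) ^ N"
proof -
  have ge: "1 \<le> norm (1 + w)" "(1 + norm w) \<le> 2 * norm (1 + w)" if "Re w \<ge> 0" for w
  proof -
    show 1: "1 \<le> norm (1 + w)" using complex_Re_le_cmod[of "1 + w"] that by simp
    have "(norm w)\<^sup>2 \<le> (norm (1 + w))\<^sup>2" unfolding cmod_power2 using that by (simp add: power2_eq_square algebra_simps)
    then have "norm w \<le> norm (1 + w)" by (rule power2_le_imp_le) simp
    with 1 show "(1 + norm w) \<le> 2 * norm (1 + w)" by simp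
  qed
  have nz: "1 + w \<noteq> 0" if "Re w > -1" for w using that by (auto simp: complex_eq_iff)
  have bound: "norm (f w / (1 + w) ^ N) \<le> (C' + 1) * 2 ^ N" if "norm (f w) \<le> C' * (1 + norm w) ^ N" "Re w \<ge> 0" for w
  proof -
    have p: "0 < norm (1 + w) ^ N" using ge(1)[OF that(2)] by (intro zero_less_power) linarith
    have "norm (f w) \<le> C' * (2 * norm (1 + w)) ^ N"
      using that C ge(2)[OF that(2)] by (intro order_trans[OF that(1)] mult_left_mono power_mono) auto
    also have "\<dots> \<le> (C' + 1) * 2 ^ N * norm (1 + w) ^ N" using p by (simp add: power_mult_distrib algebra_simps)
    finally show ?thesis using p by (simp add: norm_divide norm_power field_simps)
  qed
  have "norm (f z / (1 + z) ^ N) \<le> (C' + 1) * 2 ^ N"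
  proof (rule phragmen_lindelof_quadrant[where f="\<lambda>z. f z / (1 + z) ^ N" and C=C and c=c])
    show "(\<lambda>z. f z / (1 + z) ^ N) holomorphic_on {z. - 1 < Re z}"
      by (intro holomorphic_intros holomorphic_on_subset[OF f]) (use nz in auto)
    show "norm (f z / (1 + z) ^ N) \<le> C * exp (c * norm z)" if "Re z \<ge> 0" for z
    proof -
      have "norm (f z / (1 + z) ^ N) \<le> norm (f z)"
        using one_le_power[OF ge(1)[OF that], of N]
        by (simp add: norm_divide norm_power divide_le_eq mult_left_le less_le_trans[OF zero_less_one])
           (metis mult.right_neutral mult_left_mono norm_ge_zero)
      then show ?thesis using growth order_trans by blast
    qed
    show "0 < (C' + 1) * 2 ^ N" using C by simp
    show "norm (f (complex_of_real x) / (1 + complex_of_real x) ^ N) \<le> (C' + 1) * 2 ^ N" if "x \<ge> 0" for x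
      by (rule bound) (use real[OF that] that in auto)
    show "norm (f (\<i> * complex_of_real y) / (1 + \<i> * complex_of_real y) ^ N) \<le> (C' + 1) * 2 ^ N" if "y \<ge> 0" for y
      by (rule bound) (use imag[OF that] that in \<open>auto simp: norm_mult\<close>)
  qed (use z in auto)
  then have "norm (f z) \<le> (C' + 1) * 2 ^ N * norm (1 + z) ^ N"
    using nz[of z] z by (simp add: norm_divide norm_power field_simps)
  also have "\<dots> \<le> (C' + 1) * 2 ^ N * (1 + norm z) ^ N"
    using C norm_triangle_ineq[of 1 z] by (intro mult_left_mono power_mono) auto
  finally show ?thesis .
qed

section \<open>From growth along rays to vanishing\<close>

text \<open>Below the line Im z = t0 the downward ray splits the half plane into two quadrants, with
  polynomial bounds on all edges. Phragmen-Lindelof in both makes \<open>h\<close> a polynomial by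
  Liouville, and the limit 0 along the upper imaginary axis leaves only the zero polynomial.\<close>

lemma entire_vanishing:
  assumes h: "h holomorphic_on UNIV"
    and growth: "\<And>z. norm (h z) \<le> K * exp (c * norm z)"
    and upper: "\<And>z. Im z \<ge> t0 \<Longrightarrow> norm (h z) \<le> C"
    and lower: "\<And>t. t \<ge> T \<Longrightarrow> norm (h (- \<i> * of_real t)) \<le> C * t ^ N"
    and lim: "((\<lambda>t. h (\<i> * of_real t)) \<longlongrightarrow> 0) at_top"
    and t0: "t0 > 0" and T: "T \<ge> 1" and c: "c \<ge> 0"
  shows "h z = 0"
proof -
  have C0: "C \<ge> 0" by (rule order_trans[OF norm_ge_zero upper[of "\<i> * t0"]]) simp
  have K0: "K \<ge> 0"
  proof -
    have "0 \<le> K * exp (c * norm (0::complex))" using growth[of 0] norm_ge_zero order_trans by blast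
    then show ?thesis by simp
  qed
  have "continuous_on {0..t0 + T} (\<lambda>x::real. h (\<i> * (of_real t0 - of_real x)))"
    by (rule continuous_on_compose2[OF holomorphic_on_imp_continuous_on[OF h]]) (auto intro!: continuous_intros)
  then have "bounded ((\<lambda>x::real. h (\<i> * (of_real t0 - of_real x))) ` {0..t0 + T})"
    by (intro compact_imp_bounded compact_continuous_image) auto
  then obtain B where B: "B > 0" "\<And>x. 0 \<le> x \<Longrightarrow> x \<le> t0 + T \<Longrightarrow> norm (h (\<i> * (of_real t0 - of_real x))) \<le> B"
    unfolding bounded_pos by fastforce
  define C' where "C' = C + B"
  have C': "C' \<ge> 0" using C0 B by (simp add: C'_def)
  have ray: "norm (h (\<i> * (of_real t0 - of_real x))) \<le> C' * (1 + x) ^ N" if x: "x \<ge> 0" for x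
  proof (cases "x \<le> t0 + T")
    case True
    have "norm (h (\<i> * (of_real t0 - of_real x))) \<le> C'" using B(2)[OF x True] C0 by (simp add: C'_def)
    also have "\<dots> \<le> C' * (1 + x) ^ N" using C' x mult_left_mono[of 1 "(1 + x) ^ N" C'] by simp
    finally show ?thesis .
  next
    case False
    have e: "\<i> * (of_real t0 - of_real x) = - \<i> * of_real (x - t0)" by (simp add: algebra_simps)
    have "norm (h (\<i> * (of_real t0 - of_real x))) \<le> C * (x - t0) ^ N"
      unfolding e by (rule lower) (use False in auto)
    also have "\<dots> \<le> C' * (1 + x) ^ N"
      using False t0 T C0 B(1) by (intro mult_mono power_mono) (auto simp: C'_def)
    finally show ?thesis .
  qed
  have top: "norm (h (\<i> * of_real t0 + of_real x)) \<le> C' * (1 + \<bar>x\<bar>) ^ N" for x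
  proof -
    have "norm (h (\<i> * of_real t0 + of_real x)) \<le> C" by (rule upper) simp
    also have "\<dots> \<le> C' * 1" using B by (simp add: C'_def)
    also have "\<dots> \<le> C' * (1 + \<bar>x\<bar>) ^ N" using C' by (intro mult_left_mono) auto
    finally show ?thesis .
  qed
  have growth': "norm (h (\<i> * of_real t0 + u * w)) \<le> (K * exp (c * t0)) * exp (c * norm w)" if "norm u = 1" for u w
  proof -
    have "norm (\<i> * of_real t0 + u * w) \<le> t0 + norm w"
      using norm_triangle_ineq[of "\<i> * of_real t0" "u * w"] that t0 by (simp add: norm_mult)
    then have "exp (c * norm (\<i> * of_real t0 + u * w)) \<le> exp (c * (t0 + norm w))" using c by (simp add: mult_left_mono)
    then have "norm (h (\<i> * of_real t0 + u * w)) \<le> K * exp (c * (t0 + norm w))"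
      using growth K0 mult_left_mono order_trans by blast
    then show ?thesis by (simp add: ring_distribs exp_add mult.assoc)
  qed
  have hol: "(\<lambda>w. h (\<i> * of_real t0 + u * w)) holomorphic_on UNIV" for u
    by (intro holomorphic_on_compose_gen[OF _ h, unfolded o_def] holomorphic_intros) auto
  define Q where "Q = (C' + 1) * 2 ^ N"
  have Q: "norm (h (\<i> * of_real t0 + w)) \<le> Q * (1 + norm w) ^ N" for w
  proof -
    consider "Im w \<ge> 0" | "Im w \<le> 0" "Re w \<ge> 0" | "Im w \<le> 0" "Re w \<le> 0" by linarith
    then show ?thesis
    proof cases
      case 1
      have "norm (h (\<i> * of_real t0 + w)) \<le> C" by (rule upper) (use 1 in simp)
      also have "\<dots> \<le> (C' + 1) * 1" using B by (simp add: C'_def)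
      also have "\<dots> \<le> (C' + 1) * (2 ^ N * (1 + norm w) ^ N)"
        using C' by (intro mult_left_mono) (auto simp flip: power_mult_distrib intro!: one_le_power) 
      finally show ?thesis by (simp add: Q_def mult.assoc)
    next
      case 2
      \<comment> \<open>The rotation by -i moves the first quadrant to the lower right one: its real
        edge becomes the downward ray, its imaginary edge the right half of the line Im z =
        t0.\<close>
      have "norm (h (\<i> * of_real t0 + (- \<i>) * (\<i> * w))) \<le> ((C' + 1) * 2 ^ N) * (1 + norm (\<i> * w)) ^ N"
      proof (rule phragmen_lindelof_quadrant_poly[where f="\<lambda>w. h (\<i> * of_real t0 + (- \<i>) * w)", OF hol growth' C'])
        show "norm (h (\<i> * complex_of_real t0 + - \<i> * complex_of_real x)) \<le> C' * (1 + x) ^ N" if "x \<ge> 0" for x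
          using ray[OF that] by (simp add: algebra_simps)
        show "norm (h (\<i> * complex_of_real t0 + - \<i> * (\<i> * complex_of_real y))) \<le> C' * (1 + y) ^ N" if "y \<ge> 0" for y
          using top[of y] that by (simp flip: mult.assoc)
      qed (use 2 in auto)
      then show ?thesis by (simp add: Q_def norm_mult flip: mult.assoc)
    next
      case 3
      \<comment> \<open>For the lower left quadrant a half turn is used, which exchanges the roles
        of the two edges.\<close>
      have "norm (h (\<i> * of_real t0 + (- 1) * (- w))) \<le> ((C' + 1) * 2 ^ N) * (1 + norm (- w)) ^ N"
      proof (rule phragmen_lindelof_quadrant_poly[where f="\<lambda>w. h (\<i> * of_real t0 + (- 1) * w)", OF hol growth' C'])
        show "norm (h (\<i> * complex_of_real t0 + - 1 * complex_of_real x)) \<le> C' * (1 + x) ^ N" if "x \<ge> 0" for x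
          using top[of "- x"] that by simp
        show "norm (h (\<i> * complex_of_real t0 + - 1 * (\<i> * complex_of_real y))) \<le> C' * (1 + y) ^ N" if "y \<ge> 0" for y
          using ray[OF that] by (simp add: algebra_simps)
      qed (use 3 in auto)
      then show ?thesis by (simp add: Q_def)
    qed
  qed
  have Q0: "Q \<ge> 0" using C' by (simp add: Q_def)
  have poly: "h w = (\<Sum>k\<le>N. (deriv ^^ k) h 0 / fact k * w ^ k)" for w
  proof (rule Liouville_polynomial[OF h, of 1 "Q * (2 + t0) ^ N"])
    fix w :: complex assume w: "1 \<le> norm w"
    have "norm (h w) \<le> Q * (1 + norm (w - \<i> * of_real t0)) ^ N" using Q[of "w - \<i> * of_real t0"] by simp
    also have "\<dots> \<le> Q * ((2 + t0) * norm w) ^ N"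
    proof (intro mult_left_mono power_mono Q0)
      have "norm (w - \<i> * of_real t0) \<le> norm w + t0"
        using norm_triangle_ineq4[of w "\<i> * of_real t0"] t0 by (simp add: norm_mult)
      moreover have "t0 \<le> t0 * norm w" using t0 w by simp
      ultimately show "1 + norm (w - \<i> * of_real t0) \<le> (2 + t0) * norm w" using w by (simp add: algebra_simps)
    qed auto
    finally show "norm (h w) \<le> Q * (2 + t0) ^ N * norm w ^ N" by (simp add: power_mult_distrib mult_ac)
  qed
  have it: "filterlim (\<lambda>t. \<i> * complex_of_real t) at_infinity at_top"
    unfolding filterlim_at_infinity_conv_norm_at_top by (rule filterlim_at_top_mono[OF filterlim_ident]) (auto simp: norm_mult intro!: always_eventually)
  have c0: "(deriv ^^ k) h 0 / fact k = 0" if k: "1 \<le> k" "k \<le> N" for k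
  proof (rule ccontr)
    assume "(deriv ^^ k) h 0 / fact k \<noteq> 0"
    from Limits.polyfun_extremal[where c="\<lambda>k. (deriv ^^ k) h 0 / fact k" and B=1, OF this k]
 have "\<forall>\<^sub>F w in at_infinity. 1 \<le> norm (h w)" unfolding poly[symmetric] .
    then have "\<forall>\<^sub>F t in at_top. 1 \<le> norm (h (\<i> * complex_of_real t))" by (rule eventually_compose_filterlim[OF _ it])
    moreover have "\<forall>\<^sub>F t in at_top. norm (h (\<i> * complex_of_real t)) < 1"
      using tendstoD[OF lim, of 1] by simp
    ultimately have "\<forall>\<^sub>F t::real in at_top. False" by eventually_elim simp
    then show False by simp
  qed
  have const: "h w = h 0" for w
  proof -
    have "h w = (\<Sum>k\<in>{0}. (deriv ^^ k) h 0 / fact k * w ^ k)"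
      unfolding poly[of w] by (rule sum.mono_neutral_right) (use c0 in auto)
    then show ?thesis by simp
  qed
  then have "((\<lambda>t::real. h 0) \<longlongrightarrow> 0) at_top" using lim by (simp add: const[of "\<i> * _"])
  then show ?thesis using const by (simp add: tendsto_const_iff)
qed

text \<open>The order condition makes every singularity of N / D removable; at a zero of
  \<open>D\<close> the value is the coefficient of \<open>N\<close> at the order of
  \<open>D\<close>, divided by the leading coefficient of \<open>D\<close>.\<close>

lemma entire_quotient:
  assumes D: "D holomorphic_on UNIV" and N: "N holomorphic_on UNIV" and z0: "D z0 \<noteq> 0"
    and ord: "\<And>m k. k < subdegree (fps_expansion D m) \<Longrightarrow> fps_nth (fps_expansion N m) k = 0"
  obtains H where "H holomorphic_on UNIV" "\<And>z. D z * H z = N z"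
\<comment> \<open>The zero function is set apart because the zero power series has
  \<open>subdegree\<close> 0 by convention, which would spoil the comparison of orders.\<close>
proof (cases "\<forall>z. N z = 0")
  case True
  then show ?thesis using that[of "\<lambda>z. 0"] by simp
next
  case False
  then obtain z1 where z1: "N z1 \<noteq> 0" by blast
  have ex: "(\<lambda>w. f (m + w)) has_fps_expansion fps_expansion f m" if "f holomorphic_on UNIV" for f m
    using that by (intro analytic_at_imp_has_fps_expansion) (auto intro: holomorphic_on_imp_analytic_at)
  have iso: "\<forall>\<^sub>F w in nhds 0. w \<noteq> 0 \<longrightarrow> f (m + w) \<noteq> 0" if f: "f holomorphic_on UNIV" "f u \<noteq> 0" for f u m
  proof (cases "f m = 0")
    case True
    obtain r where r: "0 < r" "\<And>z. z \<in> ball m r - {m} \<Longrightarrow> f z \<noteq> 0"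
      using isolated_zeros[OF f(1) open_UNIV connected_UNIV _ True _ f(2)] by auto
    then show ?thesis unfolding eventually_nhds_metric by (intro exI[of _ r]) (auto simp: dist_norm)
  next
    case False
    have "isCont (\<lambda>w. f (m + w)) 0"
      using ex[OF f(1), of m] has_fps_expansion_imp_continuous by blast
    then have "((\<lambda>w. f (m + w)) \<longlongrightarrow> f (m + 0)) (nhds 0)"
      by (simp add: isCont_def tendsto_nhds_iff)
    then have "\<forall>\<^sub>F w in nhds 0. f (m + w) \<noteq> 0" by (rule tendsto_imp_eventually_ne) (use False in simp)
    then show ?thesis by eventually_elim simp
  qed
  have nz: "fps_expansion f m \<noteq> 0" if f: "f holomorphic_on UNIV" "f u \<noteq> 0" for f u m
  proof
    assume "fps_expansion f m = 0"
    then have "\<forall>\<^sub>F w in nhds 0. f (m + w) = 0" using ex[OF f(1), of m] by (simp add: has_fps_expansion_0_iff)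
    then have "\<forall>\<^sub>F w in nhds (0::complex). w = 0" using iso[OF f, of m] by eventually_elim auto
    then have "\<forall>\<^sub>F w in at (0::complex). w = 0" by (simp add: eventually_nhds_conv_at)
    moreover have "\<forall>\<^sub>F w in at (0::complex). w \<noteq> 0" by (rule eventually_neq_at_within)
    ultimately have "\<forall>\<^sub>F w in at (0::complex). False" by eventually_elim simp
    then show False by simp
  qed
  define H where "H m = fps_nth (fps_expansion N m) (subdegree (fps_expansion D m)) / fps_nth (fps_expansion D m) (subdegree (fps_expansion D m))" for m
  have e0: "fps_nth (fps_expansion f m) 0 = f m" for f m by (simp add: fps_expansion_def)
  have H1: "H m = N m / D m" if "D m \<noteq> 0" for m
  proof -
    have "subdegree (fps_expansion D m) = 0" using that e0[of D m] by (intro subdegreeI) auto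
    then show ?thesis by (simp add: H_def e0)
  qed
  have "H analytic_on {m}" for m
  proof (rule has_fps_expansion_imp_analytic)
    have "(\<lambda>w. if w = 0 then H m else N (m + w) / D (m + w)) has_fps_expansion (fps_expansion N m / fps_expansion D m)"
    proof (rule has_fps_expansion_divide[OF ex[OF N] ex[OF D]])
      show "subdegree (fps_expansion D m) \<le> subdegree (fps_expansion N m)"
        using nz[OF N z1, of m] ord[of _ m] by (meson leI nth_subdegree_nonzero)
    qed (use nz[OF D z0] H_def in auto)
    moreover have "\<forall>\<^sub>F w in nhds 0. (if w = 0 then H m else N (m + w) / D (m + w)) = H (m + w)"
      using iso[OF D z0, of m] by eventually_elim (auto simp: H1)
    ultimately show "(\<lambda>w. H (m + w)) has_fps_expansion (fps_expansion N m / fps_expansion D m)"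
      by (subst has_fps_expansion_cong[OF _ refl, symmetric])
  qed
  then have hol: "H holomorphic_on UNIV" using analytic_imp_holomorphic analytic_on_analytic_at by blast
  have "D z * H z = N z" for z
  proof (cases "D z = 0")
    case False then show ?thesis by (simp add: H1)
  next
    case True
    have "0 < subdegree (fps_expansion D z)"
    proof (rule ccontr)
      assume "\<not> ?thesis"
      then have "subdegree (fps_expansion D z) = 0" by simp
      then have "D z \<noteq> 0" using nth_subdegree_nonzero[OF nz[OF D z0, of z]] e0[of D z] by (simp only:) simp
      then show False using True by simp
    qed
    from ord[OF this] have "N z = 0" by (simp add: e0)
    then show ?thesis using True by simp
  qed
  with hol show ?thesis using that by blast
qed

section \<open>Estimates in a half plane and on the opposite ray\<close>

lemma has_integral_flip:
  fixes f :: "real \<Rightarrow> 'a::euclidean_space"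
  assumes "(f has_integral I) {a..b}"
  shows "((\<lambda>t. f (c - t)) has_integral I) {c - b..c - a}"
proof -
  have "((\<lambda>x. f ((-1) *\<^sub>R x + c)) has_integral (1 / (\<bar>-1\<bar> ^ DIM(real))) *\<^sub>R I) ((\<lambda>x. (1 / (-1)) *\<^sub>R x + -((1 / (-1)) *\<^sub>R c)) ` cbox a b)"
    by (rule has_integral_affinity) (use assms in auto)
  moreover have "(\<lambda>x. (1 / (-1)) *\<^sub>R x + -((1 / (-1)) *\<^sub>R c)) ` cbox a b = {c - b..c - a}"
  proof -
    have "(\<lambda>x. (1 / (-1)) *\<^sub>R x + -((1 / (-1)) *\<^sub>R c)) ` cbox a b = (\<lambda>x. c - x) ` {a..b}" by (intro image_cong) auto
    then show ?thesis by simp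
  qed
  ultimately show ?thesis by simp
qed

lemma integrable_flip:
  fixes f :: "real \<Rightarrow> 'a::euclidean_space"
  assumes "f integrable_on {a..b}"
  shows "(\<lambda>t. f (c - t)) integrable_on {c - b..c - a}" "integral {c - b..c - a} (\<lambda>t. f (c - t)) = integral {a..b} f"
  using has_integral_flip[OF integrable_integral[OF assms], of c] by (auto simp: integral_unique)

lemma absolutely_integrable_flip:
  fixes f :: "real \<Rightarrow> 'a::euclidean_space"
  assumes "f absolutely_integrable_on {0..c}"
  shows "(\<lambda>t. f (c - t)) absolutely_integrable_on {0..c}"
  using assms integrable_flip(1)[of f 0 c c] integrable_flip(1)[of "\<lambda>t. norm (f t)" 0 c c]
  by (simp add: absolutely_integrable_on_def)

lemma has_ac_deriv_flip:
  assumes "has_ac_deriv f f' 0 c"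
  shows "has_ac_deriv (\<lambda>x. f (c - x)) (\<lambda>x. - f' (c - x)) 0 c"
  unfolding has_ac_deriv_def
proof (intro conjI ballI)
  have ai: "f' absolutely_integrable_on {0..c}" using assms by (simp add: has_ac_deriv_def)
  show "(\<lambda>x. - f' (c - x)) absolutely_integrable_on {0..c}"
    using absolutely_integrable_linear[OF absolutely_integrable_flip[OF ai] bounded_linear_minus[OF bounded_linear_ident]] by (simp add: o_def)
  fix x assume x: "x \<in> {0..c}"
  have "(f' has_integral (f c - f (c - x))) {c - x..c}"
    using x by (intro has_ac_deriv_diff[OF assms]) auto
  from has_integral_flip[OF this, of c] have "((\<lambda>t. f' (c - t)) has_integral (f c - f (c - x))) {0..x}" by simp
  from has_integral_neg[OF this] show "((\<lambda>x. - f' (c - x)) has_integral f (c - x) - f (c - 0)) {0..x}" by simp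
qed

section \<open>Kernel bounds for coupled first order systems\<close>

text \<open>Both directions at once: the damped component is integrated from the left end, the
  growing one from the right. As \<open>s\<close> grows this measure of a source tends to 0, and it
  never exceeds the L1 norm; both facts are used.\<close>

definition kernel_bound :: "real \<Rightarrow> (real \<Rightarrow> complex) \<Rightarrow> real \<Rightarrow> bool" where
  "kernel_bound s k K \<longleftrightarrow> (\<forall>x\<in>{0..pi}. integral {0..x} (\<lambda>t. exp (- s * (x - t)) * norm (k t)) \<le> K \<and>
     integral {x..pi} (\<lambda>t. exp (- s * (t - x)) * norm (k t)) \<le> K)"

lemma kernel_integrable:
  fixes k :: "real \<Rightarrow> complex"
  assumes k: "k absolutely_integrable_on {0..pi}" and ab: "0 \<le> a" "b \<le> pi" and c: "continuous_on {a..b} g"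
  shows "(\<lambda>t. g t * norm (k t)) integrable_on {a..b}"
proof -
  have "(\<lambda>t. norm (k t)) absolutely_integrable_on {a..b}"
    using absolutely_integrable_norm[OF absolutely_integrable_on_subinterval[OF k, of a b]] ab by (auto simp: o_def)
  from absolutely_integrable_mult_continuous_real[OF this c] show ?thesis
    by (simp add: absolutely_integrable_on_def mult.commute)
qed

lemma kernel_bound_small:
  assumes k: "k absolutely_integrable_on {0..pi}" and e: "\<epsilon> > 0"
  obtains s0 where "s0 > 0" "\<And>s. s \<ge> s0 \<Longrightarrow> kernel_bound s k \<epsilon>"
proof -
  have nk: "(\<lambda>t. norm (k t)) absolutely_integrable_on {0..pi}"
    using absolutely_integrable_norm[OF k] by (simp add: o_def)
  obtain s1 where s1: "s1 > 0" "\<And>s x. s \<ge> s1 \<Longrightarrow> x \<in> {0..pi} \<Longrightarrow> integral {0..x} (\<lambda>t. exp (- s * (x - t)) * norm (k t)) \<le> \<epsilon>"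
    by (rule weighted_kernel_small[OF nk _ e]) auto
  obtain s2 where s2: "s2 > 0" "\<And>s x. s \<ge> s2 \<Longrightarrow> x \<in> {0..pi} \<Longrightarrow> integral {0..x} (\<lambda>t. exp (- s * (x - t)) * norm (k (pi - t))) \<le> \<epsilon>"
    by (rule weighted_kernel_small[OF absolutely_integrable_flip[OF nk] _ e]) auto
  show ?thesis
  proof (rule that[of "max s1 s2"])
    fix s assume s: "max s1 s2 \<le> s"
    show "kernel_bound s k \<epsilon>"
      unfolding kernel_bound_def
    proof (intro ballI conjI)
      fix x assume x: "x \<in> {0..pi}"
      show "integral {0..x} (\<lambda>t. exp (- s * (x - t)) * norm (k t)) \<le> \<epsilon>" using s1(2) s x by simp
      have "(\<lambda>t. exp (- s * (t - x)) * norm (k t)) integrable_on {x..pi}"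
        using x by (intro kernel_integrable[OF k] continuous_intros) auto
      from integrable_flip(2)[OF this, of pi]
      have "integral {x..pi} (\<lambda>t. exp (- s * (t - x)) * norm (k t)) = integral {0..pi - x} (\<lambda>t. exp (- s * (pi - x - t)) * norm (k (pi - t)))"
        by (simp add: algebra_simps)
      also have "\<dots> \<le> \<epsilon>" using s2(2)[of s "pi - x"] s x by simp
      finally show "integral {x..pi} (\<lambda>t. exp (- s * (t - x)) * norm (k t)) \<le> \<epsilon>" .
    qed
  qed (use s1 in auto)
qed

lemma kernel_bound_L1:
  assumes k: "k absolutely_integrable_on {0..pi}" and s: "s \<ge> 0"
  shows "kernel_bound s k (integral {0..pi} (\<lambda>t. norm (k t)))"
  unfolding kernel_bound_def
proof (intro ballI conjI)
  have nk: "(\<lambda>t. norm (k t)) integrable_on {a..b}" if "0 \<le> a" "b \<le> pi" for a b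
    using kernel_integrable[OF k that, of "\<lambda>_. 1"] by simp
  fix x assume x: "x \<in> {0..pi}"
  have "integral {0..x} (\<lambda>t. exp (- s * (x - t)) * norm (k t)) \<le> integral {0..x} (\<lambda>t. norm (k t))"
    using x s by (intro integral_le kernel_integrable[OF k] nk continuous_intros)
      (auto intro!: mult_left_le_one_le)
  also have "\<dots> \<le> integral {0..pi} (\<lambda>t. norm (k t))" using x by (intro integral_subset_le nk) auto
  finally show "integral {0..x} (\<lambda>t. exp (- s * (x - t)) * norm (k t)) \<le> integral {0..pi} (\<lambda>t. norm (k t))" .
  have "integral {x..pi} (\<lambda>t. exp (- s * (t - x)) * norm (k t)) \<le> integral {x..pi} (\<lambda>t. norm (k t))"
    using x s by (intro integral_le kernel_integrable[OF k] nk continuous_intros)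
      (auto intro!: mult_left_le_one_le)
  also have "\<dots> \<le> integral {0..pi} (\<lambda>t. norm (k t))" using x by (intro integral_subset_le nk) auto
  finally show "integral {x..pi} (\<lambda>t. exp (- s * (t - x)) * norm (k t)) \<le> integral {0..pi} (\<lambda>t. norm (k t))" .
qed

lemma has_ac_deriv_C1:
  fixes f :: "real \<Rightarrow> complex"
  assumes d: "\<And>x. (f has_vector_derivative f' x) (at x)" and c: "continuous_on UNIV f'" and "a \<le> b"
  shows "has_ac_deriv f f' a b"
  unfolding has_ac_deriv_def
proof (intro conjI ballI)
  show "f' absolutely_integrable_on {a..b}"
    by (intro absolutely_integrable_continuous_real continuous_on_subset[OF c]) auto
  show "(f' has_integral f x - f a) {a..x}" if "x \<in> {a..b}" for x
    by (rule fundamental_theorem_of_calculus) (use that in \<open>auto intro: has_vector_derivative_at_within[OF d]\<close>)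
qed

lemma has_ac_deriv_exp:
  "a \<le> b \<Longrightarrow> has_ac_deriv (\<lambda>x. exp (\<omega> * of_real x)) (\<lambda>x. \<omega> * exp (\<omega> * of_real x)) a b" for \<omega> :: complex
proof (rule has_ac_deriv_C1)
  show "((\<lambda>x. exp (\<omega> * of_real x)) has_vector_derivative \<omega> * exp (\<omega> * of_real x)) (at x)" for x
  proof -
    have "((\<lambda>z. exp (\<omega> * z)) has_field_derivative \<omega> * exp (\<omega> * of_real x)) (at (of_real x))"
      by (auto intro!: derivative_eq_intros)
    from has_vector_derivative_real_field[OF this] show ?thesis .
  qed
qed (auto intro!: continuous_intros)

lemma has_ac_deriv_cong:
  assumes "has_ac_deriv f f' a b" "\<And>x. x \<in> {a..b} \<Longrightarrow> f' x = g' x"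
  shows "has_ac_deriv f g' a b"
  unfolding has_ac_deriv_def
proof (intro conjI ballI)
  have "f' absolutely_integrable_on {a..b}" using assms by (simp add: has_ac_deriv_def)
  then show "g' absolutely_integrable_on {a..b}"
    by (rule absolutely_integrable_spike[where S="{}"]) (use assms(2) in auto)
  fix x assume x: "x \<in> {a..b}"
  show "(g' has_integral f x - f a) {a..x}"
    by (rule has_integral_eq[of "{a..x}" f']) (use assms x in \<open>auto simp: has_ac_deriv_def\<close>)
qed

lemma variation_of_constants:
  fixes u f :: "real \<Rightarrow> complex"
  assumes "has_ac_deriv u (\<lambda>t. \<omega> * u t + f t) 0 pi"
  shows "has_ac_deriv (\<lambda>x. exp (- \<omega> * of_real x) * u x) (\<lambda>t. exp (- \<omega> * of_real t) * f t) 0 pi"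
  by (rule has_ac_deriv_cong[OF has_ac_deriv_mult[OF has_ac_deriv_exp[of 0 pi "- \<omega>"] assms]]) (auto simp: algebra_simps)

lemma forward_bound:
  assumes u: "has_ac_deriv u (\<lambda>t. - \<sigma> * u t + f t) 0 pi" and f: "f absolutely_integrable_on {0..pi}" and x: "x \<in> {0..pi}"
  shows "norm (u x) \<le> exp (- Re \<sigma> * x) * norm (u 0) + integral {0..x} (\<lambda>t. exp (- Re \<sigma> * (x - t)) * norm (f t))"
proof -
  have "((\<lambda>t. exp (\<sigma> * of_real t) * f t) has_integral (exp (\<sigma> * of_real x) * u x - u 0)) {0..x}"
    using variation_of_constants[OF u] x by (auto simp: has_ac_deriv_def)
  from has_integral_mult_right[OF this, of "exp (- \<sigma> * of_real x)"]
  have i: "((\<lambda>t. exp (- \<sigma> * of_real (x - t)) * f t) has_integral (u x - exp (- \<sigma> * of_real x) * u 0)) {0..x}"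
    by (simp add: algebra_simps exp_diff exp_add exp_minus) (simp add: field_simps)
  have "norm (u x - exp (- \<sigma> * of_real x) * u 0) \<le> integral {0..x} (\<lambda>t. exp (- Re \<sigma> * (x - t)) * norm (f t))"
    unfolding integral_unique[OF i, symmetric]
    using x by (intro integral_norm_bound_integral[OF has_integral_integrable[OF i]] kernel_integrable[OF f] continuous_intros)
      (auto simp: norm_mult simp del: of_real_diff)
  then show ?thesis
    using norm_triangle_ineq[of "u x - exp (- \<sigma> * of_real x) * u 0" "exp (- \<sigma> * of_real x) * u 0"] by (simp add: norm_mult)
qed

text \<open>Reflection of the interval turns growth into decay and reduces the claim to the forward
  estimate.\<close>

lemma backward_bound:
  assumes u: "has_ac_deriv u (\<lambda>t. \<sigma> * u t + f t) 0 pi" and f: "f absolutely_integrable_on {0..pi}" and x: "x \<in> {0..pi}"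
  shows "norm (u x) \<le> exp (- Re \<sigma> * (pi - x)) * norm (u pi) + integral {x..pi} (\<lambda>t. exp (- Re \<sigma> * (t - x)) * norm (f t))"
proof -
  let ?v = "\<lambda>x. u (pi - x)" and ?g = "\<lambda>t. - f (pi - t)"
  have "has_ac_deriv ?v (\<lambda>t. - \<sigma> * ?v t + ?g t) 0 pi"
    by (rule has_ac_deriv_cong[OF has_ac_deriv_flip[OF u]]) auto
  moreover have "?g absolutely_integrable_on {0..pi}"
    using absolutely_integrable_linear[OF absolutely_integrable_flip[OF f] bounded_linear_minus[OF bounded_linear_ident]] by (simp add: o_def)
  ultimately have "norm (?v (pi - x)) \<le> exp (- Re \<sigma> * (pi - x)) * norm (?v 0) + integral {0..pi - x} (\<lambda>t. exp (- Re \<sigma> * (pi - x - t)) * norm (?g t))"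
    by (rule forward_bound) (use x in auto)
  moreover have "(\<lambda>t. exp (- Re \<sigma> * (t - x)) * norm (f t)) integrable_on {x..pi}"
    using x by (intro kernel_integrable[OF f] continuous_intros) auto
  from integrable_flip(2)[OF this, of pi]
  have "integral {0..pi - x} (\<lambda>t. exp (- Re \<sigma> * (pi - x - t)) * norm (f (pi - t))) = integral {x..pi} (\<lambda>t. exp (- Re \<sigma> * (t - x)) * norm (f t))"
    by (simp add: algebra_simps)
  ultimately show ?thesis by simp
qed

lemma kernel_bound_perturb:
  assumes r: "r absolutely_integrable_on {0..pi}" and k: "k absolutely_integrable_on {0..pi}" and b: "continuous_on {0..pi} b"
    and R: "kernel_bound s r \<kappa>" and K: "kernel_bound s k K" and m: "\<And>t. t \<in> {0..pi} \<Longrightarrow> norm (b t) \<le> m"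
  shows "kernel_bound s (\<lambda>t. r t * b t + k t) (\<kappa> * m + K)"
proof -
  have m0: "m \<ge> 0" by (rule order_trans[OF norm_ge_zero m[of 0]]) simp
  have f: "(\<lambda>t. r t * b t + k t) absolutely_integrable_on {0..pi}"
    by (intro set_integral_add absolutely_integrable_mult_continuous r k b)
  have main: "integral {u..v} (\<lambda>t. g t * norm (r t * b t + k t)) \<le> integral {u..v} (\<lambda>t. g t * norm (r t)) * m + integral {u..v} (\<lambda>t. g t * norm (k t))"
    if uv: "0 \<le> u" "v \<le> pi" and g: "continuous_on {u..v} g" "\<And>t. 0 \<le> g t" for u v g
  proof -
    have i: "(\<lambda>t. g t * norm (r t) * m) integrable_on {u..v}" "(\<lambda>t. g t * norm (k t)) integrable_on {u..v}"
      by (intro integrable_on_mult_left kernel_integrable r k uv g)+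
    have "integral {u..v} (\<lambda>t. g t * norm (r t * b t + k t)) \<le> integral {u..v} (\<lambda>t. g t * norm (r t) * m + g t * norm (k t))"
    proof (intro integral_le integrable_add i kernel_integrable[OF f uv g(1)])
      fix t assume "t \<in> {u..v}"
      then have t: "t \<in> {0..pi}" using uv by auto
      have "norm (r t * b t + k t) \<le> norm (r t) * m + norm (k t)"
        using norm_triangle_ineq[of "r t * b t" "k t"] mult_left_mono[OF m[OF t] norm_ge_zero[of "r t"]] by (simp add: norm_mult)
      from mult_left_mono[OF this g(2)[of t]] show "g t * norm (r t * b t + k t) \<le> g t * norm (r t) * m + g t * norm (k t)"
        by (simp add: algebra_simps)
    qed
    then show ?thesis by (simp add: integral_add[OF i])
  qed
  show ?thesis
    unfolding kernel_bound_def
  proof (intro ballI conjI)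
    fix x assume x: "x \<in> {0..pi}"
    have "integral {0..x} (\<lambda>t. exp (- s * (x - t)) * norm (r t * b t + k t)) \<le> integral {0..x} (\<lambda>t. exp (- s * (x - t)) * norm (r t)) * m + integral {0..x} (\<lambda>t. exp (- s * (x - t)) * norm (k t))"
      using x by (intro main continuous_intros) auto
    also have "\<dots> \<le> \<kappa> * m + K" using R K x m0 by (intro add_mono mult_right_mono) (auto simp: kernel_bound_def)
    finally show "integral {0..x} (\<lambda>t. exp (- s * (x - t)) * norm (r t * b t + k t)) \<le> \<kappa> * m + K" .
    have "integral {x..pi} (\<lambda>t. exp (- s * (t - x)) * norm (r t * b t + k t)) \<le> integral {x..pi} (\<lambda>t. exp (- s * (t - x)) * norm (r t)) * m + integral {x..pi} (\<lambda>t. exp (- s * (t - x)) * norm (k t))"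
      using x by (intro main continuous_intros) auto
    also have "\<dots> \<le> \<kappa> * m + K" using R K x m0 by (intro add_mono mult_right_mono) (auto simp: kernel_bound_def)
    finally show "integral {x..pi} (\<lambda>t. exp (- s * (t - x)) * norm (r t * b t + k t)) \<le> \<kappa> * m + K" .
  qed
qed

lemma sup_norm_attained:
  fixes a b :: "real \<Rightarrow> complex"
  assumes "continuous_on {0..pi} a" "continuous_on {0..pi} b"
  obtains m where "m \<ge> 0" "\<And>x. x \<in> {0..pi} \<Longrightarrow> norm (a x) \<le> m" "\<And>x. x \<in> {0..pi} \<Longrightarrow> norm (b x) \<le> m"
    "(\<exists>x\<in>{0..pi}. m = norm (a x)) \<or> (\<exists>x\<in>{0..pi}. m = norm (b x))"
proof -
  have "continuous_on {0..pi} (\<lambda>x. max (norm (a x)) (norm (b x)))" using assms by (intro continuous_intros)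
  then obtain x0 where x0: "x0 \<in> {0..pi}" "\<And>x. x \<in> {0..pi} \<Longrightarrow> max (norm (a x)) (norm (b x)) \<le> max (norm (a x0)) (norm (b x0))"
    using continuous_attains_sup[of "{0..pi}" "\<lambda>x. max (norm (a x)) (norm (b x))"] by auto
  show ?thesis
  proof (rule that[of "max (norm (a x0)) (norm (b x0))"])
    show "(\<exists>x\<in>{0..pi}. max (norm (a x0)) (norm (b x0)) = norm (a x)) \<or> (\<exists>x\<in>{0..pi}. max (norm (a x0)) (norm (b x0)) = norm (b x))"
      using x0(1) by (auto simp: max_def)
    show "0 \<le> max (norm (a x0)) (norm (b x0))" by (rule max.coboundedI1) simp
    show "norm (a x) \<le> max (norm (a x0)) (norm (b x0))" if "x \<in> {0..pi}" for x
      by (rule order_trans[OF max.cobounded1 x0(2)[OF that]])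
    show "norm (b x) \<le> max (norm (a x0)) (norm (b x0))" if "x \<in> {0..pi}" for x
      by (rule order_trans[OF max.cobounded2 x0(2)[OF that]])
  qed
qed

text \<open>Each component is a scalar equation whose source contains the other one; with \<kappa>
  \<le> 1/2 the coupling is absorbed into the common supremum m. The bounds for a(pi) and b(0) keep
  their exponential factor, since the boundary conditions act on these values.\<close>

lemma system_estimate:
  assumes a: "has_ac_deriv a (\<lambda>t. - \<sigma> * a t + (r t * b t + k t)) 0 pi"
    and b: "has_ac_deriv b (\<lambda>t. \<sigma> * b t + (r' t * a t + k' t)) 0 pi"
    and int: "r absolutely_integrable_on {0..pi}" "r' absolutely_integrable_on {0..pi}"
      "k absolutely_integrable_on {0..pi}" "k' absolutely_integrable_on {0..pi}"
    and \<kappa>: "kernel_bound (Re \<sigma>) r \<kappa>" "kernel_bound (Re \<sigma>) r' \<kappa>" and K: "kernel_bound (Re \<sigma>) k K" "kernel_bound (Re \<sigma>) k' K"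
    and small: "\<kappa> \<le> 1/2" and s: "Re \<sigma> \<ge> 0"
  obtains m where "m \<ge> 0" "\<And>x. x \<in> {0..pi} \<Longrightarrow> norm (a x) \<le> m" "\<And>x. x \<in> {0..pi} \<Longrightarrow> norm (b x) \<le> m"
    "norm (a pi) \<le> exp (- Re \<sigma> * pi) * norm (a 0) + (\<kappa> * m + K)"
    "norm (b 0) \<le> exp (- Re \<sigma> * pi) * norm (b pi) + (\<kappa> * m + K)"
    "m \<le> 2 * (max (norm (a 0)) (norm (b pi)) + K)"
proof -
  have ca: "continuous_on {0..pi} a" and cb: "continuous_on {0..pi} b" using a b has_ac_deriv_continuous_on by blast+
  obtain m where m: "m \<ge> 0" "\<And>x. x \<in> {0..pi} \<Longrightarrow> norm (a x) \<le> m" "\<And>x. x \<in> {0..pi} \<Longrightarrow> norm (b x) \<le> m"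
    "(\<exists>x\<in>{0..pi}. m = norm (a x)) \<or> (\<exists>x\<in>{0..pi}. m = norm (b x))"
    using sup_norm_attained[OF ca cb] by blast
  have kb: "kernel_bound (Re \<sigma>) (\<lambda>t. r t * b t + k t) (\<kappa> * m + K)" by (rule kernel_bound_perturb[OF int(1,3) cb \<kappa>(1) K(1) m(3)])
  have ka: "kernel_bound (Re \<sigma>) (\<lambda>t. r' t * a t + k' t) (\<kappa> * m + K)" by (rule kernel_bound_perturb[OF int(2,4) ca \<kappa>(2) K(2) m(2)])
  have ib: "(\<lambda>t. r t * b t + k t) absolutely_integrable_on {0..pi}" by (intro set_integral_add absolutely_integrable_mult_continuous int cb)
  have ia: "(\<lambda>t. r' t * a t + k' t) absolutely_integrable_on {0..pi}" by (intro set_integral_add absolutely_integrable_mult_continuous int ca)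
  have A: "norm (a x) \<le> exp (- Re \<sigma> * x) * norm (a 0) + (\<kappa> * m + K)" if "x \<in> {0..pi}" for x
  proof -
    have "integral {0..x} (\<lambda>t. exp (- Re \<sigma> * (x - t)) * norm (r t * b t + k t)) \<le> \<kappa> * m + K"
      using kb that unfolding kernel_bound_def by blast
    with forward_bound[OF a ib that] show ?thesis by linarith
  qed
  have B: "norm (b x) \<le> exp (- Re \<sigma> * (pi - x)) * norm (b pi) + (\<kappa> * m + K)" if "x \<in> {0..pi}" for x
  proof -
    have "integral {x..pi} (\<lambda>t. exp (- Re \<sigma> * (t - x)) * norm (r' t * a t + k' t)) \<le> \<kappa> * m + K"
      using ka that unfolding kernel_bound_def by blast
    with backward_bound[OF b ia that] show ?thesis by linarith
  qed
  have e1: "exp (- Re \<sigma> * x) * y \<le> y" if "x \<ge> 0" "y \<ge> 0" for x y :: real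
    using that s by (intro mult_left_le_one_le) auto
  have "m \<le> max (norm (a 0)) (norm (b pi)) + (\<kappa> * m + K)"
    using m(4)
  proof (elim disjE bexE)
    fix x assume x: "x \<in> {0..pi}" "m = norm (a x)"
    then show ?thesis using A[OF x(1)] e1[of x "norm (a 0)"] by auto
  next
    fix x assume x: "x \<in> {0..pi}" "m = norm (b x)"
    then show ?thesis using B[OF x(1)] e1[of "pi - x" "norm (b pi)"] by auto
  qed
  moreover have "\<kappa> * m \<le> 1/2 * m" using small m(1) by (intro mult_right_mono)
  ultimately have "m \<le> 2 * (max (norm (a 0)) (norm (b pi)) + K)" by (simp add: algebra_simps)
  then show ?thesis using that m A[of pi] B[of 0] by auto
qed

text \<open>The system in scalar form, with free \<omega> and free coefficients: \<omega> = i l in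
  the given order of components, \<omega> = - i l after exchanging them. Both cases of the theorem
  thus use the same estimates.\<close>

definition dirac_system :: "complex \<Rightarrow> (real \<Rightarrow> complex) \<Rightarrow> (real \<Rightarrow> complex) \<Rightarrow> (real \<Rightarrow> complex) \<Rightarrow> (real \<Rightarrow> complex) \<Rightarrow> (real \<Rightarrow> complex) \<Rightarrow> (real \<Rightarrow> complex) \<Rightarrow> bool" where
  "dirac_system \<omega> p q k1 k2 u1 u2 \<longleftrightarrow>
     has_ac_deriv u1 (\<lambda>t. \<omega> * u1 t + (p t * u2 t + k1 t)) 0 pi \<and>
     has_ac_deriv u2 (\<lambda>t. - \<omega> * u2 t + (q t * u1 t + k2 t)) 0 pi"

lemma dirac_system_linear:
  assumes "dirac_system \<omega> p q k1 k2 u1 u2" "dirac_system \<omega> p q l1 l2 v1 v2"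
  shows "dirac_system \<omega> p q (\<lambda>t. k1 t + c * l1 t) (\<lambda>t. k2 t + c * l2 t) (\<lambda>t. u1 t + c * v1 t) (\<lambda>t. u2 t + c * v2 t)"
  unfolding dirac_system_def
proof
  show "has_ac_deriv (\<lambda>t. u1 t + c * v1 t) (\<lambda>t. \<omega> * (u1 t + c * v1 t) + (p t * (u2 t + c * v2 t) + (k1 t + c * l1 t))) 0 pi"
    by (rule has_ac_deriv_cong[OF has_ac_deriv_add[OF _ has_ac_deriv_linear[OF _ bounded_linear_mult_right[of c]]]])
      (use assms in \<open>auto simp: dirac_system_def algebra_simps\<close>)
  show "has_ac_deriv (\<lambda>t. u2 t + c * v2 t) (\<lambda>t. - \<omega> * (u2 t + c * v2 t) + (q t * (u1 t + c * v1 t) + (k2 t + c * l2 t))) 0 pi"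
    by (rule has_ac_deriv_cong[OF has_ac_deriv_add[OF _ has_ac_deriv_linear[OF _ bounded_linear_mult_right[of c]]]])
      (use assms in \<open>auto simp: dirac_system_def algebra_simps\<close>)
qed

text \<open>For Re \<omega> very negative the conditions return end values already damped by exp (Re
  \<omega> pi). This feedback is a contraction once the damping beats max (|\<alpha>|,
  |\<beta>|).\<close>

lemma half_plane_estimate:
  assumes p: "p absolutely_integrable_on {0..pi}" and q: "q absolutely_integrable_on {0..pi}"
  obtains s0 C where "s0 > 0" "C \<ge> 0"
    "\<And>\<omega> k1 k2 u1 u2 K x. Re \<omega> \<le> - s0 \<Longrightarrow> dirac_system \<omega> p q k1 k2 u1 u2 \<Longrightarrow>
       k1 absolutely_integrable_on {0..pi} \<Longrightarrow> k2 absolutely_integrable_on {0..pi} \<Longrightarrow>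
       kernel_bound (- Re \<omega>) k1 K \<Longrightarrow> kernel_bound (- Re \<omega>) k2 K \<Longrightarrow>
       u1 0 = \<alpha> * u1 pi \<Longrightarrow> u2 pi = \<beta> * u2 0 \<Longrightarrow> x \<in> {0..pi} \<Longrightarrow> norm (u1 x) \<le> C * K \<and> norm (u2 x) \<le> C * K"
proof -
  define \<gamma> where "\<gamma> = max (norm \<alpha>) (norm \<beta>)"
  have \<gamma>: "norm \<alpha> \<le> \<gamma>" "norm \<beta> \<le> \<gamma>" "\<gamma> \<ge> 0" by (auto simp: \<gamma>_def le_max_iff_disj)
  \<comment> \<open>Chosen for 4 \<gamma> \<kappa> \<le> 1/2, the coefficient of \<open>m\<close> in
    the final inequality.\<close>
  define \<kappa> where "\<kappa> = 1 / (8 * (\<gamma> + 1))"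
  have \<kappa>: "\<kappa> > 0" "\<kappa> \<le> 1/2" "4 * \<gamma> * \<kappa> \<le> 1/2" using \<gamma>(3) by (auto simp: \<kappa>_def field_simps)
  obtain s1 where s1: "s1 > 0" "\<And>s. s \<ge> s1 \<Longrightarrow> kernel_bound s p \<kappa>" using kernel_bound_small[OF p \<kappa>(1)] by blast
  obtain s2 where s2: "s2 > 0" "\<And>s. s \<ge> s2 \<Longrightarrow> kernel_bound s q \<kappa>" using kernel_bound_small[OF q \<kappa>(1)] by blast
  show ?thesis
  proof (rule that[of "max (max s1 s2) (2 * \<gamma> + 1)" "8 * \<gamma> + 4"])
    fix \<omega> k1 k2 u1 u2 K x
    assume \<omega>: "Re \<omega> \<le> - max (max s1 s2) (2 * \<gamma> + 1)" and sys: "dirac_system \<omega> p q k1 k2 u1 u2"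
      and k: "k1 absolutely_integrable_on {0..pi}" "k2 absolutely_integrable_on {0..pi}"
        "kernel_bound (- Re \<omega>) k1 K" "kernel_bound (- Re \<omega>) k2 K"
      and bc: "u1 0 = \<alpha> * u1 pi" "u2 pi = \<beta> * u2 0" and x: "x \<in> {0..pi}"
    define s where "s = - Re \<omega>"
    have s: "s \<ge> s1" "s \<ge> s2" "s \<ge> 2 * \<gamma> + 1" using \<omega> by (auto simp: s_def)
    have s0: "s \<ge> 0" using s(3) \<gamma>(3) by simp
    have small: "\<gamma> * exp (- s * pi) \<le> 1/2"
    proof -
      have "s * 1 \<le> s * pi" using s0 pi_ge_two by (intro mult_left_mono) auto
      then have "2 * \<gamma> \<le> exp (s * pi)" using exp_ge_add_one_self[of "s * pi"] s(3) \<gamma>(3) by linarith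
      then show ?thesis by (simp add: exp_minus field_simps)
    qed
    obtain m where m: "m \<ge> 0" "\<And>x. x \<in> {0..pi} \<Longrightarrow> norm (u1 x) \<le> m" "\<And>x. x \<in> {0..pi} \<Longrightarrow> norm (u2 x) \<le> m"
      "norm (u1 pi) \<le> exp (- s * pi) * norm (u1 0) + (\<kappa> * m + K)"
      "norm (u2 0) \<le> exp (- s * pi) * norm (u2 pi) + (\<kappa> * m + K)"
      "m \<le> 2 * (max (norm (u1 0)) (norm (u2 pi)) + K)"
      using system_estimate[of u1 "- \<omega>" p u2 k1 q k2 \<kappa> K] sys p q k s1(2)[OF s(1)] s2(2)[OF s(2)] \<kappa>(2) s0
      unfolding dirac_system_def by (auto simp: s_def)
    \<comment> \<open>The feedback loop: once around, a boundary value returns multiplied by at most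
      1/2, plus the contribution of the source.\<close>
    have half: "y \<le> 2 * \<gamma> * X" if "y \<le> \<gamma> * z" "z \<le> exp (- s * pi) * y + X" "y \<ge> 0" for y z X
    proof -
      have "\<gamma> * z \<le> \<gamma> * exp (- s * pi) * y + \<gamma> * X"
        using mult_left_mono[OF that(2) \<gamma>(3)] by (simp add: algebra_simps)
      moreover have "\<gamma> * exp (- s * pi) * y \<le> 1/2 * y" using small that(3) by (intro mult_right_mono)
      ultimately show ?thesis using that(1) by simp
    qed
    have a0: "norm (u1 0) \<le> 2 * \<gamma> * (\<kappa> * m + K)"
      by (rule half[OF _ m(4)]) (use bc(1) \<gamma> in \<open>auto simp: norm_mult mult_right_mono\<close>)
    have b0: "norm (u2 pi) \<le> 2 * \<gamma> * (\<kappa> * m + K)"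
      by (rule half[OF _ m(5)]) (use bc(2) \<gamma> in \<open>auto simp: norm_mult mult_right_mono\<close>)
    have "m \<le> 2 * (2 * \<gamma> * (\<kappa> * m + K) + K)" using m(6) a0 b0 by simp
    also have "\<dots> = (4 * \<gamma> * \<kappa>) * m + (4 * \<gamma> + 2) * K" by (simp add: algebra_simps)
    also have "(4 * \<gamma> * \<kappa>) * m \<le> 1/2 * m" using \<kappa>(3) m(1) by (intro mult_right_mono)
    finally have "m \<le> (8 * \<gamma> + 4) * K" by (simp add: algebra_simps)
    then show "norm (u1 x) \<le> (8 * \<gamma> + 4) * K \<and> norm (u2 x) \<le> (8 * \<gamma> + 4) * K"
      using m(2,3)[OF x] by simp
  qed (use s1 \<gamma> in auto)
qed

section \<open>Laplace transforms of functions with a power law at an end point\<close>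

lemma primitive_has_ac_deriv:
  fixes p :: "real \<Rightarrow> complex"
  assumes "p absolutely_integrable_on {0..pi}"
  shows "has_ac_deriv (\<lambda>x. integral {0..x} p) p 0 pi"
  unfolding has_ac_deriv_def
proof (intro conjI ballI assms)
  fix x assume "x \<in> {0..pi}"
  then have "p integrable_on {0..x}"
    using absolutely_integrable_on_subinterval[OF assms, of 0 x] by (auto simp: absolutely_integrable_on_def)
  then show "(p has_integral integral {0..x} p - integral {0..0} p) {0..x}" by (simp add: integrable_integral)
qed

lemma powr_le_exp:
  fixes \<rho> s :: real
  assumes "\<rho> > 0" "s \<ge> 0"
  shows "s powr \<rho> \<le> (\<rho> powr \<rho>) * exp s"
proof -
  have "s / \<rho> \<le> exp (s / \<rho>)" using exp_ge_add_one_self[of "s / \<rho>"] by linarith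
  then have "(s / \<rho>) powr \<rho> \<le> exp (s / \<rho>) powr \<rho>" using assms by (intro powr_mono2) auto
  also have "\<dots> = exp s" using assms by (simp add: powr_def)
  finally show ?thesis using assms by (simp add: powr_divide field_simps)
qed

lemma exp_integral_le:
  assumes "0 \<le> t" "t \<le> T" "(s::real) > 0"
  shows "((\<lambda>r. exp (- s * r)) has_integral (exp (- s * t) / s - exp (- s * T) / s)) {t..T}"
proof -
  have "((\<lambda>r. exp (- s * r)) has_integral (- exp (- s * T) / s - - exp (- s * t) / s)) {t..T}"
    using assms by (intro fundamental_theorem_of_calculus)
      (auto intro!: derivative_eq_intros simp: has_real_derivative_iff_has_vector_derivative[symmetric])
  then show ?thesis by simp
qed

text \<open>The hypotheses concern the primitive of \<open>p\<close>, not \<open>p\<close> itself;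
  integration by parts transfers the Laplace transform to it.\<close>

lemma laplace_by_parts:
  fixes p :: "real \<Rightarrow> complex"
  assumes p: "p absolutely_integrable_on {0..pi}" and t: "t \<in> {0..pi}"
  shows "integral {t..pi} (\<lambda>r. complex_of_real (exp (- 2 * \<tau> * r)) * p r) =
     complex_of_real (exp (- 2 * \<tau> * pi)) * integral {0..pi} p - complex_of_real (exp (- 2 * \<tau> * t)) * integral {0..t} p
     + 2 * \<tau> * integral {t..pi} (\<lambda>r. complex_of_real (exp (- 2 * \<tau> * r)) * integral {0..r} p)"
proof -
  define \<omega> where "\<omega> = complex_of_real (- 2 * \<tau>)"
  let ?P = "\<lambda>x. integral {0..x} p"
  let ?e = "\<lambda>r. complex_of_real (exp (- 2 * \<tau> * r))"
  have e: "exp (\<omega> * of_real r) = ?e r" for r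
  proof -
    have "\<omega> * of_real r = complex_of_real (- 2 * \<tau> * r)" by (simp add: \<omega>_def)
    then show ?thesis by (simp only: exp_of_real)
  qed
  have P: "has_ac_deriv ?P p 0 pi" by (rule primitive_has_ac_deriv[OF p])
  have "has_ac_deriv (\<lambda>x. ?e x * ?P x) (\<lambda>t. \<omega> * ?e t * ?P t + ?e t * p t) 0 pi"
    using has_ac_deriv_mult[OF has_ac_deriv_exp[of 0 pi \<omega>] P] by (simp add: e)
  from has_ac_deriv_diff[OF this, of t pi] t
  have i: "((\<lambda>r. \<omega> * ?e r * ?P r + ?e r * p r) has_integral (?e pi * ?P pi - ?e t * ?P t)) {t..pi}" by simp
  have c: "continuous_on {0..pi} ?P" by (rule has_ac_deriv_continuous_on[OF P])
  have j: "(\<lambda>r. \<omega> * ?e r * ?P r) integrable_on {t..pi}"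
    by (intro integrable_continuous_real continuous_intros continuous_on_subset[OF c]) (use t in auto)
  from has_integral_diff[OF i integrable_integral[OF j]]
  have "integral {t..pi} (\<lambda>r. ?e r * p r) = ?e pi * ?P pi - ?e t * ?P t - integral {t..pi} (\<lambda>r. \<omega> * ?e r * ?P r)"
    by (simp add: integral_unique)
  moreover have "integral {t..pi} (\<lambda>r. \<omega> * ?e r * ?P r) = \<omega> * integral {t..pi} (\<lambda>r. ?e r * ?P r)"
    by (simp add: mult.assoc)
  ultimately show ?thesis by (simp add: \<omega>_def)
qed

text \<open>One half of the exponent 2 \<tau> r absorbs the power of \<open>r\<close> at the cost of
  \<tau>^(-\<rho>), the other half keeps the integral of order 1/\<tau>. Uniformity in
  \<open>t\<close> is what the later perturbation argument requires.\<close>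

lemma laplace_upper:
  fixes p :: "real \<Rightarrow> complex"
  assumes p: "p absolutely_integrable_on {0..pi}" and \<rho>: "\<rho> > 0" and C: "C \<ge> 0"
    and P: "\<And>x. x \<in> {0..pi} \<Longrightarrow> norm (integral {0..x} p) \<le> C * x powr \<rho>" and t: "t \<in> {0..pi}" and \<tau>: "\<tau> > 0"
  shows "norm (integral {t..pi} (\<lambda>r. complex_of_real (exp (- 2 * \<tau> * r)) * p r)) \<le> (4 * C * \<rho> powr \<rho>) * \<tau> powr (- \<rho>)"
proof -
  define M where "M = C * \<rho> powr \<rho> * \<tau> powr (- \<rho>)"
  have M: "M \<ge> 0" using C by (simp add: M_def)
  have b: "norm (complex_of_real (exp (- 2 * \<tau> * r)) * integral {0..r} p) \<le> M * exp (- \<tau> * r)" if r: "r \<in> {0..pi}" for r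
  proof -
    have "(\<tau> * r) powr \<rho> \<le> \<rho> powr \<rho> * exp (\<tau> * r)" using \<rho> \<tau> r by (intro powr_le_exp) auto
    then have "r powr \<rho> \<le> \<rho> powr \<rho> * exp (\<tau> * r) * \<tau> powr (- \<rho>)"
      using \<tau> r by (simp add: powr_mult powr_minus field_simps)
    then have "C * r powr \<rho> \<le> C * (\<rho> powr \<rho> * exp (\<tau> * r) * \<tau> powr (- \<rho>))" using C by (intro mult_left_mono)
    also have "\<dots> = M * exp (\<tau> * r)" by (simp add: M_def)
    finally have "norm (integral {0..r} p) \<le> M * exp (\<tau> * r)" using P[OF r] by linarith
    then have "exp (- 2 * \<tau> * r) * norm (integral {0..r} p) \<le> exp (- 2 * \<tau> * r) * (M * exp (\<tau> * r))"
      by (intro mult_left_mono) auto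
    also have "\<dots> = M * (exp (- 2 * \<tau> * r) * exp (\<tau> * r))" by simp
    also have "exp (- 2 * \<tau> * r) * exp (\<tau> * r) = exp (- \<tau> * r)" by (simp flip: exp_add)
    finally show ?thesis by (simp add: norm_mult)
  qed
  have b': "norm (complex_of_real (exp (- 2 * \<tau> * r)) * integral {0..r} p) \<le> M" if r: "r \<in> {0..pi}" for r
  proof -
    have "M * exp (- \<tau> * r) \<le> M * 1" using \<tau> r M by (intro mult_left_mono) auto
    then show ?thesis using b[OF r] by simp
  qed
  have E: "((\<lambda>r. M * exp (- \<tau> * r)) has_integral M * (exp (- \<tau> * t) / \<tau> - exp (- \<tau> * pi) / \<tau>)) {t..pi}"
    by (rule has_integral_mult_right[OF exp_integral_le]) (use t \<tau> in auto)
  have c: "continuous_on {0..pi} (\<lambda>x. integral {0..x} p)"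
    by (rule has_ac_deriv_continuous_on[OF primitive_has_ac_deriv[OF p]])
  have "norm (integral {t..pi} (\<lambda>r. complex_of_real (exp (- 2 * \<tau> * r)) * integral {0..r} p)) \<le> integral {t..pi} (\<lambda>r. M * exp (- \<tau> * r))"
  proof (rule integral_norm_bound_integral)
    show "(\<lambda>r. complex_of_real (exp (- 2 * \<tau> * r)) * integral {0..r} p) integrable_on {t..pi}"
      by (intro integrable_continuous_real continuous_intros continuous_on_subset[OF c]) (use t in auto)
    show "(\<lambda>r. M * exp (- \<tau> * r)) integrable_on {t..pi}" using E by blast
  qed (use b t in auto)
  also have "\<dots> = M * (exp (- \<tau> * t) / \<tau> - exp (- \<tau> * pi) / \<tau>)" by (rule integral_unique[OF E])
  also have "\<dots> \<le> M * (1 / \<tau>)"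
  proof (intro mult_left_mono M)
    have "exp (- \<tau> * t) / \<tau> \<le> 1 / \<tau>" using \<tau> t by (intro divide_right_mono) auto
    moreover have "0 \<le> exp (- \<tau> * pi) / \<tau>" using \<tau> by simp
    ultimately show "exp (- \<tau> * t) / \<tau> - exp (- \<tau> * pi) / \<tau> \<le> 1 / \<tau>" by linarith
  qed
  finally have "2 * \<tau> * norm (integral {t..pi} (\<lambda>r. complex_of_real (exp (- 2 * \<tau> * r)) * integral {0..r} p)) \<le> 2 * \<tau> * (M * (1 / \<tau>))"
    using \<tau> by (intro mult_left_mono) auto
  then have i: "norm (2 * \<tau> * integral {t..pi} (\<lambda>r. complex_of_real (exp (- 2 * \<tau> * r)) * integral {0..r} p)) \<le> 2 * M"
    using \<tau> by (simp add: norm_mult)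
  have "norm (integral {t..pi} (\<lambda>r. complex_of_real (exp (- 2 * \<tau> * r)) * p r)) \<le> M + M + 2 * M"
    unfolding laplace_by_parts[OF p t]
    by (intro norm_triangle_le add_mono norm_triangle_le_diff b' t) (use i in auto)
  then show ?thesis by (simp add: M_def mult_ac)
qed

text \<open>Near 0 both bounds express that the quotient lies within |\<nu>|/2 of its limit. Beyond
  \<open>h\<close> the L1 norm serves as upper bound, rescaled by the value of the power at
  \<open>h\<close>.\<close>

lemma power_growth_at_zero:
  fixes p :: "real \<Rightarrow> complex"
  assumes p: "p absolutely_integrable_on {0..pi}" and \<rho>: "\<rho> > 0" and \<nu>: "\<nu> \<noteq> 0"
    and lim: "((\<lambda>h. integral {0..h} p / complex_of_real (h powr \<rho>)) \<longlongrightarrow> \<nu>) (at_right 0)"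
  obtains C h where "C > 0" "\<And>x. x \<in> {0..pi} \<Longrightarrow> norm (integral {0..x} p) \<le> C * x powr \<rho>"
    "0 < h" "h \<le> pi" "\<And>x. x \<in> {0..h} \<Longrightarrow> x powr \<rho> / 2 \<le> Re (integral {0..x} p / \<nu>)"
proof -
  have "\<forall>\<^sub>F h in at_right 0. dist (integral {0..h} p / complex_of_real (h powr \<rho>)) \<nu> < norm \<nu> / 2"
    using tendstoD[OF lim, of "norm \<nu> / 2"] \<nu> by simp
  then obtain b where b: "b > 0" "\<And>h. 0 < h \<Longrightarrow> h < b \<Longrightarrow> dist (integral {0..h} p / complex_of_real (h powr \<rho>)) \<nu> < norm \<nu> / 2"
    unfolding eventually_at_right_field by blast
  define h where "h = min (b / 2) pi"
  have h: "0 < h" "h \<le> pi" "h < b" using b(1) by (auto simp: h_def)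
  have near: "norm (integral {0..x} p - \<nu> * x powr \<rho>) \<le> norm \<nu> / 2 * x powr \<rho>" if x: "x \<in> {0..h}" for x
  proof (cases "x = 0")
    case False
    then have x0: "0 < x" "x < b" using x h by auto
    have "norm (integral {0..x} p / complex_of_real (x powr \<rho>) - \<nu>) * norm (complex_of_real (x powr \<rho>)) \<le> norm \<nu> / 2 * norm (complex_of_real (x powr \<rho>))"
      using b(2)[OF x0] by (intro mult_right_mono) (auto simp: dist_norm)
    moreover have "(integral {0..x} p / complex_of_real (x powr \<rho>) - \<nu>) * complex_of_real (x powr \<rho>) = integral {0..x} p - \<nu> * x powr \<rho>"
      using x0 by (simp add: field_simps)
    ultimately have "norm (integral {0..x} p - \<nu> * x powr \<rho>) \<le> norm \<nu> / 2 * norm (complex_of_real (x powr \<rho>))"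
      by (simp only: norm_mult[symmetric])
    then show ?thesis by simp
  qed simp
  define I where "I = integral {0..pi} (\<lambda>t. norm (p t))"
  define C where "C = 2 * norm \<nu> + I / h powr \<rho>"
  have np: "(\<lambda>t. norm (p t)) integrable_on {0..pi}"
    using absolutely_integrable_norm[OF p] by (simp add: o_def absolutely_integrable_on_def)
  have I: "I \<ge> 0" unfolding I_def by (intro integral_nonneg np) auto
  show ?thesis
  proof (rule that[of C h])
    show "C > 0" using \<nu> I h by (simp add: C_def add_pos_nonneg)
    show "norm (integral {0..x} p) \<le> C * x powr \<rho>" if x: "x \<in> {0..pi}" for x
    proof (cases "x \<le> h")
      case True
      have "norm (integral {0..x} p) \<le> norm \<nu> / 2 * x powr \<rho> + norm (\<nu> * x powr \<rho>)"
        using near[of x] True x norm_triangle_ineq[of "integral {0..x} p - \<nu> * x powr \<rho>" "\<nu> * x powr \<rho>"] by simp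
      also have "\<dots> \<le> 2 * norm \<nu> * x powr \<rho>" by (simp add: norm_mult)
      also have "\<dots> \<le> C * x powr \<rho>" using I h by (intro mult_right_mono) (auto simp: C_def)
      finally show ?thesis .
    next
      case False
      have pi': "p integrable_on {0..x}" "(\<lambda>t. norm (p t)) integrable_on {0..x}"
        using absolutely_integrable_on_subinterval[OF p, of 0 x] x by (auto simp: absolutely_integrable_on_def)
      have "norm (integral {0..x} p) \<le> integral {0..x} (\<lambda>t. norm (p t))"
        by (rule integral_norm_bound_integral[OF pi']) simp
      also have "\<dots> \<le> I" unfolding I_def using x by (intro integral_subset_le pi' np) auto
      also have "\<dots> = I / h powr \<rho> * h powr \<rho>" using h by simp
      also have "\<dots> \<le> I / h powr \<rho> * x powr \<rho>" using False h \<rho> I by (intro mult_left_mono powr_mono2) auto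
      also have "\<dots> \<le> C * x powr \<rho>" by (intro mult_right_mono) (auto simp: C_def)
      finally show ?thesis .
    qed
    show "x powr \<rho> / 2 \<le> Re (integral {0..x} p / \<nu>)" if x: "x \<in> {0..h}" for x
    proof -
      have "norm (integral {0..x} p / \<nu> - x powr \<rho>) = norm (integral {0..x} p - \<nu> * x powr \<rho>) / norm \<nu>"
        using \<nu> by (simp add: field_simps flip: norm_divide)
      also have "\<dots> \<le> x powr \<rho> / 2" using near[OF x] \<nu> by (simp add: field_simps)
      finally have "\<bar>Re (integral {0..x} p / \<nu> - x powr \<rho>)\<bar> \<le> x powr \<rho> / 2" using abs_Re_le_cmod order_trans by blast
      then have "\<bar>Re (integral {0..x} p / \<nu>) - x powr \<rho>\<bar> \<le> x powr \<rho> / 2" by (simp only: minus_complex.simps Re_complex_of_real)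
      then show ?thesis by linarith
    qed
  qed (use h in auto)
qed

text \<open>After division by \<nu> the primitive has nonnegative real part on [0, h], so nothing
  cancels there: the piece [1/(2\<tau>), 1/\<tau>] alone gives the power of \<tau>, while everything
  beyond \<open>h\<close> is exponentially small.\<close>

lemma laplace_lower:
  fixes p :: "real \<Rightarrow> complex"
  assumes p: "p absolutely_integrable_on {0..pi}" and \<rho>: "\<rho> > 0" and \<nu>: "\<nu> \<noteq> 0"
    and C: "C > 0" "\<And>x. x \<in> {0..pi} \<Longrightarrow> norm (integral {0..x} p) \<le> C * x powr \<rho>"
    and h: "0 < h" "h \<le> pi" "\<And>x. x \<in> {0..h} \<Longrightarrow> x powr \<rho> / 2 \<le> Re (integral {0..x} p / \<nu>)"
  obtains c T where "c > 0" "T > 0"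
    "\<And>\<tau>. \<tau> \<ge> T \<Longrightarrow> c * \<tau> powr (- \<rho>) \<le> norm (integral {0..pi} (\<lambda>r. complex_of_real (exp (- 2 * \<tau> * r)) * p r))"
proof -
  have re: "Re (complex_of_real a * w) = a * Re w" for a w by simp
  define D where "D = C * pi powr \<rho> / norm \<nu>"
  have D: "D > 0" using C \<nu> by (simp add: D_def)
  \<comment> \<open>The exponential is at least exp (-2) on the chosen piece, and the power law is
    at least (2\<tau>)^(-\<rho>)/2; the length 1/(2\<tau>) cancels the factor 2\<tau> from the
    integration by parts.\<close>
  define c0 where "c0 = exp (- 2) * 2 powr (- \<rho>) / 2"
  have c0: "c0 > 0" by (simp add: c0_def)
  have PD: "norm (integral {0..r} p / \<nu>) \<le> D" if r: "r \<in> {0..pi}" for r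
  proof -
    have "norm (integral {0..r} p) \<le> C * pi powr \<rho>"
      using C(2)[OF r] C(1) r \<rho> by (meson atLeastAtMost_iff less_imp_le mult_left_mono order_trans powr_mono2)
    then show ?thesis using \<nu> by (simp add: D_def norm_divide divide_right_mono)
  qed
  have c: "continuous_on {0..pi} (\<lambda>x. integral {0..x} p)"
    by (rule has_ac_deriv_continuous_on[OF primitive_has_ac_deriv[OF p]])
  have main: "c0 * \<tau> powr (- \<rho>) - 2 * D * exp (- 2 * \<tau> * h) \<le> Re (integral {0..pi} (\<lambda>r. complex_of_real (exp (- 2 * \<tau> * r)) * p r) / \<nu>)"
    if \<tau>: "\<tau> > 0" "1 / \<tau> \<le> h" for \<tau>
  proof -
    define g where "g r = exp (- 2 * \<tau> * r) * Re (integral {0..r} p / \<nu>)" for r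
    have gc: "continuous_on {0..pi} g" unfolding g_def by (intro continuous_intros c) (use \<nu> in auto)
    have gi: "g integrable_on {a..b}" if "0 \<le> a" "b \<le> pi" for a b
      by (intro integrable_continuous_real continuous_on_subset[OF gc]) (use that in auto)
    have ci: "(\<lambda>r. complex_of_real (exp (- 2 * \<tau> * r)) * integral {0..r} p) integrable_on {0..pi}"
      by (intro integrable_continuous_real continuous_intros c)
    have "Re (integral {0..pi} (\<lambda>r. complex_of_real (exp (- 2 * \<tau> * r)) * integral {0..r} p) / \<nu>) = integral {0..pi} g"
    proof -
      have bl: "bounded_linear (\<lambda>z. Re (z / \<nu>))"
        by (rule bounded_linear_compose[OF bounded_linear_Re bounded_linear_divide])
      have "integral {0..pi} ((\<lambda>z. Re (z / \<nu>)) \<circ> (\<lambda>r. complex_of_real (exp (- 2 * \<tau> * r)) * integral {0..r} p)) = Re (integral {0..pi} (\<lambda>r. complex_of_real (exp (- 2 * \<tau> * r)) * integral {0..r} p) / \<nu>)"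
        by (rule integral_linear[OF ci bl])
      moreover have "(\<lambda>z. Re (z / \<nu>)) \<circ> (\<lambda>r. complex_of_real (exp (- 2 * \<tau> * r)) * integral {0..r} p) = g"
      proof
        fix r
        have "complex_of_real (exp (- 2 * \<tau> * r)) * integral {0..r} p / \<nu> = complex_of_real (exp (- 2 * \<tau> * r)) * (integral {0..r} p / \<nu>)" by simp
        then show "((\<lambda>z. Re (z / \<nu>)) \<circ> (\<lambda>r. complex_of_real (exp (- 2 * \<tau> * r)) * integral {0..r} p)) r = g r"
          unfolding g_def o_def by (simp only: re)
      qed
      ultimately show ?thesis by simp
    qed
    moreover have "integral {0..pi} g = integral {0..h} g + integral {h..pi} g"
      using Henstock_Kurzweil_Integration.integral_combine[of 0 h pi g] gi[of 0 pi] h by simp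
    moreover have "integral {1/(2*\<tau>)..1/\<tau>} g \<le> integral {0..h} g"
    proof (rule integral_subset_le)
      show "{1/(2*\<tau>)..1/\<tau>} \<subseteq> {0..h}" using \<tau> by auto
      show "g integrable_on {1/(2*\<tau>)..1/\<tau>}" "g integrable_on {0..h}" using \<tau> h by (auto intro!: gi)
      show "\<forall>r\<in>{0..h}. 0 \<le> g r"
      proof
        fix r assume r: "r \<in> {0..h}"
        have "0 \<le> Re (integral {0..r} p / \<nu>)" using h(3)[OF r] powr_ge_zero[of r \<rho>] by linarith
        then show "0 \<le> g r" unfolding g_def by (intro mult_nonneg_nonneg) auto
      qed
    qed
    moreover have "exp (- 2) * ((2 * \<tau>) powr (- \<rho>) / 2) * (1 / (2 * \<tau>)) \<le> integral {1/(2*\<tau>)..1/\<tau>} g"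
    proof -
      have "integral {1/(2*\<tau>)..1/\<tau>} (\<lambda>r. exp (- 2) * ((2 * \<tau>) powr (- \<rho>) / 2)) \<le> integral {1/(2*\<tau>)..1/\<tau>} g"
      proof (rule integral_le)
        show "g integrable_on {1/(2*\<tau>)..1/\<tau>}" using \<tau> h by (auto intro!: gi)
        fix r assume r: "r \<in> {1/(2*\<tau>)..1/\<tau>}"
        have "exp (- 2) \<le> exp (- 2 * \<tau> * r)" using r \<tau> by (simp add: field_simps)
        moreover have "(2 * \<tau>) powr (- \<rho>) / 2 \<le> Re (integral {0..r} p / \<nu>)"
        proof -
          have "(2 * \<tau>) powr (- \<rho>) = (1 / (2 * \<tau>)) powr \<rho>" using \<tau> by (simp add: powr_minus_divide powr_divide)
          also have "\<dots> \<le> r powr \<rho>" using r \<tau> \<rho> by (intro powr_mono2) auto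
          finally have 1: "(2 * \<tau>) powr (- \<rho>) \<le> r powr \<rho>" .
          have "0 \<le> 1 / (2 * \<tau>)" using \<tau> by simp
          then have "0 \<le> r" "r \<le> h" using r \<tau>(2) by (meson atLeastAtMost_iff order_trans)+
          then show ?thesis using h(3)[of r] 1 by simp
        qed
        ultimately show "exp (- 2) * ((2 * \<tau>) powr (- \<rho>) / 2) \<le> g r"
          unfolding g_def by (intro mult_mono) auto
      qed (intro integrable_continuous_real continuous_intros)
      moreover have "1/\<tau> - 1/(2*\<tau>) = 1/(2*\<tau>)" using \<tau> by (simp add: field_simps)
      ultimately show ?thesis using \<tau> by (simp add: field_simps)
    qed
    moreover have "- (D * (exp (- 2 * \<tau> * h) / (2 * \<tau>))) \<le> integral {h..pi} g"
    proof -
      have E: "((\<lambda>r. D * exp (- (2 * \<tau>) * r)) has_integral D * (exp (- (2 * \<tau>) * h) / (2 * \<tau>) - exp (- (2 * \<tau>) * pi) / (2 * \<tau>))) {h..pi}"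
        by (rule has_integral_mult_right[OF exp_integral_le]) (use \<tau> h in auto)
      have "norm (integral {h..pi} g) \<le> integral {h..pi} (\<lambda>r. D * exp (- (2 * \<tau>) * r))"
      proof (rule integral_norm_bound_integral)
        show "g integrable_on {h..pi}" using h by (auto intro!: gi)
        show "(\<lambda>r. D * exp (- (2 * \<tau>) * r)) integrable_on {h..pi}" using E by blast
        fix r assume r: "r \<in> {h..pi}"
        have "\<bar>Re (integral {0..r} p / \<nu>)\<bar> \<le> D" using PD[of r] r h abs_Re_le_cmod order_trans by (metis atLeastAtMost_iff less_imp_le)
        then show "norm (g r) \<le> D * exp (- (2 * \<tau>) * r)"
          unfolding g_def by (simp add: abs_mult mult.commute)
      qed
      also have "\<dots> = D * (exp (- (2 * \<tau>) * h) / (2 * \<tau>) - exp (- (2 * \<tau>) * pi) / (2 * \<tau>))" by (rule integral_unique[OF E])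
      also have "\<dots> \<le> D * (exp (- (2 * \<tau>) * h) / (2 * \<tau>))" using D \<tau> by (intro mult_left_mono) auto
      finally show ?thesis by (simp add: abs_le_iff)
    qed
    ultimately have I: "exp (- 2) * ((2 * \<tau>) powr (- \<rho>) / 2) * (1 / (2 * \<tau>)) - D * (exp (- 2 * \<tau> * h) / (2 * \<tau>)) \<le>
        Re (integral {0..pi} (\<lambda>r. complex_of_real (exp (- 2 * \<tau> * r)) * integral {0..r} p) / \<nu>)" by linarith
    have J: "c0 * \<tau> powr (- \<rho>) - D * exp (- 2 * \<tau> * h) \<le>
        2 * \<tau> * Re (integral {0..pi} (\<lambda>r. complex_of_real (exp (- 2 * \<tau> * r)) * integral {0..r} p) / \<nu>)"
    proof -
      have "2 * \<tau> * (exp (- 2) * ((2 * \<tau>) powr (- \<rho>) / 2) * (1 / (2 * \<tau>)) - D * (exp (- 2 * \<tau> * h) / (2 * \<tau>))) =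
          exp (- 2) * ((2 * \<tau>) powr (- \<rho>) / 2) - D * exp (- 2 * \<tau> * h)"
        using \<tau> by (simp add: right_diff_distrib)
      moreover have "exp (- 2) * ((2 * \<tau>) powr (- \<rho>) / 2) = c0 * \<tau> powr (- \<rho>)"
        using \<tau> by (simp add: c0_def powr_mult)
      ultimately have "c0 * \<tau> powr (- \<rho>) - D * exp (- 2 * \<tau> * h) =
          2 * \<tau> * (exp (- 2) * ((2 * \<tau>) powr (- \<rho>) / 2) * (1 / (2 * \<tau>)) - D * (exp (- 2 * \<tau> * h) / (2 * \<tau>)))"
        by (simp only:)
      also have "\<dots> \<le> 2 * \<tau> * Re (integral {0..pi} (\<lambda>r. complex_of_real (exp (- 2 * \<tau> * r)) * integral {0..r} p) / \<nu>)"
        by (rule mult_left_mono[OF I]) (use \<tau> in simp)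
      finally show ?thesis .
    qed
    have "\<bar>Re (integral {0..pi} p / \<nu>)\<bar> \<le> D"
      using PD[of pi] abs_Re_le_cmod[of "integral {0..pi} p / \<nu>"] by simp
    then have "\<bar>Re (complex_of_real (exp (- 2 * \<tau> * pi)) * (integral {0..pi} p / \<nu>))\<bar> \<le> exp (- 2 * \<tau> * pi) * D"
      unfolding re abs_mult by simp
    moreover have "exp (- 2 * \<tau> * pi) * D \<le> exp (- 2 * \<tau> * h) * D" using D \<tau> h by (intro mult_right_mono) auto
    ultimately have B: "- (D * exp (- 2 * \<tau> * h)) \<le> Re (complex_of_real (exp (- 2 * \<tau> * pi)) * (integral {0..pi} p / \<nu>))" by (simp add: mult.commute abs_le_iff)
    have "integral {0..pi} (\<lambda>r. complex_of_real (exp (- 2 * \<tau> * r)) * p r) / \<nu> = complex_of_real (exp (- 2 * \<tau> * pi)) * (integral {0..pi} p / \<nu>)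
         + complex_of_real (2 * \<tau>) * (integral {0..pi} (\<lambda>r. complex_of_real (exp (- 2 * \<tau> * r)) * integral {0..r} p) / \<nu>)"
      using laplace_by_parts[OF p, of 0 \<tau>] \<nu> by (simp add: field_simps)
    then have "Re (integral {0..pi} (\<lambda>r. complex_of_real (exp (- 2 * \<tau> * r)) * p r) / \<nu>) = Re (complex_of_real (exp (- 2 * \<tau> * pi)) * (integral {0..pi} p / \<nu>))
         + 2 * \<tau> * Re (integral {0..pi} (\<lambda>r. complex_of_real (exp (- 2 * \<tau> * r)) * integral {0..r} p) / \<nu>)"
      by (simp only: plus_complex.simps re)
    then show ?thesis using J B by linarith
  qed
  \<comment> \<open>The exponentially small remainder, one D from the tail of the integral and one
    from the boundary term at pi, eventually falls below half of the main term.\<close>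
  have "((\<lambda>\<tau>. 2 * D * exp (- 2 * \<tau> * h) * \<tau> powr \<rho>) \<longlongrightarrow> 0) at_top"
    using h(1) \<rho> by real_asymp
  then have "\<forall>\<^sub>F \<tau> in at_top. 2 * D * exp (- 2 * \<tau> * h) * \<tau> powr \<rho> < c0 / 2"
    using c0 by (intro order_tendstoD) auto
  then obtain T0 where T0: "\<And>\<tau>. \<tau> \<ge> T0 \<Longrightarrow> 2 * D * exp (- 2 * \<tau> * h) * \<tau> powr \<rho> < c0 / 2"
    unfolding eventually_at_top_linorder by blast
  show ?thesis
  proof (rule that[of "norm \<nu> * (c0 / 2)" "max T0 (max 1 (1 / h))"])
    fix \<tau> assume \<tau>: "\<tau> \<ge> max T0 (max 1 (1 / h))"
    then have t: "\<tau> > 0" "1 / \<tau> \<le> h" "\<tau> \<ge> T0" using h(1) by (auto simp: field_simps)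
    have "2 * D * exp (- 2 * \<tau> * h) \<le> c0 / 2 * \<tau> powr (- \<rho>)"
      using T0[OF t(3)] t(1) by (simp add: powr_minus field_simps)
    then have "c0 / 2 * \<tau> powr (- \<rho>) \<le> Re (integral {0..pi} (\<lambda>r. complex_of_real (exp (- 2 * \<tau> * r)) * p r) / \<nu>)"
      using main[OF t(1,2)] by linarith
    also have "\<dots> \<le> norm (integral {0..pi} (\<lambda>r. complex_of_real (exp (- 2 * \<tau> * r)) * p r)) / norm \<nu>"
      using complex_Re_le_cmod by (metis norm_divide)
    finally show "norm \<nu> * (c0 / 2) * \<tau> powr (- \<rho>) \<le> norm (integral {0..pi} (\<lambda>r. complex_of_real (exp (- 2 * \<tau> * r)) * p r))"
      using \<nu> by (simp add: field_simps)
  qed (use c0 \<nu> in auto)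
qed

text \<open>With \<open>G x = \<integral>\<^bsub>x\<^esub>\<^bsup>\<pi>\<^esup> exp (-2 \<tau> t) p t dt\<close> one has
  \<open>u 0 = - G 0 - \<integral> G q u\<close>; here \<open>G = O(\<tau> powr - \<rho>)\<close> uniformly and \<open>u\<close> tends to 0 uniformly,
  so \<open>- G 0\<close> is the leading term.\<close>

lemma weyl_coefficient_lower_bound:
  fixes p q :: "real \<Rightarrow> complex"
  assumes p: "p absolutely_integrable_on {0..pi}" and q: "q absolutely_integrable_on {0..pi}"
    and \<rho>: "\<rho> > 0" and \<nu>: "\<nu> \<noteq> 0"
    and lim: "((\<lambda>h. integral {0..h} p / complex_of_real (h powr \<rho>)) \<longlongrightarrow> \<nu>) (at_right 0)"
  obtains c T where "c > 0" "T > 0"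
    "\<And>\<tau> u v. \<tau> \<ge> T \<Longrightarrow> has_ac_deriv u (\<lambda>t. of_real (2 * \<tau>) * u t + p t * v t) 0 pi \<Longrightarrow>
       has_ac_deriv v (\<lambda>t. q t * u t) 0 pi \<Longrightarrow> v 0 = 1 \<Longrightarrow> u pi = 0 \<Longrightarrow>
       c * \<tau> powr (- \<rho>) \<le> norm (u 0) \<and> norm (u 0) \<le> 1 \<and> norm (v pi) \<le> 2"
proof -
  obtain C h where Ch: "C > 0" "\<And>x. x \<in> {0..pi} \<Longrightarrow> norm (integral {0..x} p) \<le> C * x powr \<rho>"
    "0 < h" "h \<le> pi" "\<And>x. x \<in> {0..h} \<Longrightarrow> x powr \<rho> / 2 \<le> Re (integral {0..x} p / \<nu>)"
    using power_growth_at_zero[OF p \<rho> \<nu> lim] by blast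
  obtain c T0 where cT: "c > 0" "T0 > 0"
    "\<And>\<tau>. \<tau> \<ge> T0 \<Longrightarrow> c * \<tau> powr (- \<rho>) \<le> norm (integral {0..pi} (\<lambda>r. complex_of_real (exp (- 2 * \<tau> * r)) * p r))"
    using laplace_lower[OF p \<rho> \<nu> Ch] by blast
  define C1 where "C1 = 4 * C * \<rho> powr \<rho>"
  have C1: "C1 \<ge> 0" using Ch(1) by (simp add: C1_def)
  have nq: "(\<lambda>t. norm (q t)) integrable_on {a..b}" if "0 \<le> a" "b \<le> pi" for a b
    using kernel_integrable[OF q that, of "\<lambda>_. 1"] by simp
  define I where "I = integral {0..pi} (\<lambda>t. norm (q t))"
  have I: "I \<ge> 0" unfolding I_def by (intro integral_nonneg nq) auto
  have Ile: "integral {a..b} (\<lambda>t. norm (q t)) \<le> I" if "0 \<le> a" "b \<le> pi" for a b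
    unfolding I_def using that by (intro integral_subset_le nq) auto
  \<comment> \<open>The first bound makes the coupling a contraction with \<open>u\<close> of size
    at most 2\<kappa>; the second keeps the error term below half of the leading term.\<close>
  define \<kappa> where "\<kappa> = min (1 / (2 * (I + 1))) (c / (4 * (C1 * I + 1)))"
  have \<kappa>: "\<kappa> > 0" using I C1 cT(1) by (simp add: \<kappa>_def add_nonneg_pos)
  have \<kappa>I: "\<kappa> * I \<le> 1/2" "\<kappa> \<le> 1/2" "C1 * I * (2 * \<kappa>) \<le> c / 2"
  proof -
    have k1: "\<kappa> \<le> 1 / (2 * (I + 1))" by (simp add: \<kappa>_def)
    have "\<kappa> * I \<le> 1 / (2 * (I + 1)) * I" using k1 I by (intro mult_right_mono)
    also have "\<dots> \<le> 1/2" using I by (simp add: field_simps)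
    finally show "\<kappa> * I \<le> 1/2" .
    have "1 / (2 * (I + 1)) \<le> 1/2" using I by (simp add: field_simps)
    then show "\<kappa> \<le> 1/2" using k1 by linarith
    have CI: "0 \<le> C1 * I" using C1 I by simp
    have "\<kappa> \<le> c / (4 * (C1 * I + 1))" by (simp add: \<kappa>_def)
    then have "\<kappa> * (4 * (C1 * I + 1)) \<le> c" using CI by (simp add: pos_le_divide_eq)
    then show "C1 * I * (2 * \<kappa>) \<le> c / 2" using \<kappa> by (simp add: algebra_simps)
  qed
  obtain s0 where s0: "s0 > 0" "\<And>s. s \<ge> s0 \<Longrightarrow> kernel_bound s p \<kappa>" using kernel_bound_small[OF p \<kappa>] by blast
  show ?thesis
  proof (rule that[of "c / 2" "max T0 s0"])
    fix \<tau> u v assume \<tau>: "\<tau> \<ge> max T0 s0" and u: "has_ac_deriv u (\<lambda>t. of_real (2 * \<tau>) * u t + p t * v t) 0 pi"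
      and v: "has_ac_deriv v (\<lambda>t. q t * u t) 0 pi" and v0: "v 0 = 1" and upi: "u pi = 0"
    have \<tau>0: "\<tau> > 0" "\<tau> \<ge> T0" "2 * \<tau> \<ge> s0" using \<tau> cT(2) by auto
    have kp: "kernel_bound (2 * \<tau>) p \<kappa>" by (rule s0(2)[OF \<tau>0(3)])
    have cu: "continuous_on {0..pi} u" and cv: "continuous_on {0..pi} v" using u v has_ac_deriv_continuous_on by blast+
    obtain x0 where x0: "x0 \<in> {0..pi}" "\<And>x. x \<in> {0..pi} \<Longrightarrow> norm (u x) \<le> norm (u x0)"
      using continuous_attains_sup[OF compact_Icc _ continuous_on_norm[OF cu]] by auto
    define mu where "mu = norm (u x0)"
    have mu: "mu \<ge> 0" "\<And>x. x \<in> {0..pi} \<Longrightarrow> norm (u x) \<le> mu" using x0(2) by (simp_all add: mu_def)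
    have vb: "norm (v x) \<le> 1 + I * mu" if x: "x \<in> {0..pi}" for x
    proof -
      have i: "((\<lambda>t. q t * u t) has_integral (v x - v 0)) {0..x}" using v x by (auto simp: has_ac_deriv_def)
      have "norm (v x - v 0) \<le> integral {0..x} (\<lambda>t. norm (q t) * mu)"
        unfolding integral_unique[OF i, symmetric]
      proof (rule integral_norm_bound_integral[OF has_integral_integrable[OF i]])
        show "(\<lambda>t. norm (q t) * mu) integrable_on {0..x}" using x by (intro integrable_on_mult_left nq) auto
        show "norm (q t * u t) \<le> norm (q t) * mu" if "t \<in> {0..x}" for t
          using mu(2)[of t] that x by (simp add: norm_mult mult_left_mono)
      qed
      also have "\<dots> = integral {0..x} (\<lambda>t. norm (q t)) * mu" by simp
      also have "\<dots> \<le> I * mu" using x by (intro mult_right_mono Ile mu) auto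
      finally show ?thesis using v0 norm_triangle_ineq[of "v x - v 0" "v 0"] by simp
    qed
    have pv: "(\<lambda>t. p t * v t) absolutely_integrable_on {0..pi}" by (intro absolutely_integrable_mult_continuous p cv)
    have kpv: "kernel_bound (2 * \<tau>) (\<lambda>t. p t * v t) (\<kappa> * (1 + I * mu))"
    proof -
      have "kernel_bound (2 * \<tau>) (\<lambda>t. 0) 0" by (simp add: kernel_bound_def)
      from kernel_bound_perturb[OF p absolutely_integrable_zero cv kp this vb] show ?thesis by simp
    qed
    have ub: "norm (u x) \<le> \<kappa> * (1 + I * mu)" if x: "x \<in> {0..pi}" for x
    proof -
      have "norm (u x) \<le> exp (- Re (of_real (2 * \<tau>)) * (pi - x)) * norm (u pi) + integral {x..pi} (\<lambda>t. exp (- Re (of_real (2 * \<tau>)) * (t - x)) * norm (p t * v t))"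
        by (rule backward_bound[OF u pv x])
      also have "\<dots> = integral {x..pi} (\<lambda>t. exp (- (2 * \<tau>) * (t - x)) * norm (p t * v t))" using upi by simp
      also have "\<dots> \<le> \<kappa> * (1 + I * mu)" using kpv x unfolding kernel_bound_def by blast
      finally show ?thesis .
    qed
    have "mu \<le> \<kappa> * (1 + I * mu)" using ub[OF x0(1)] by (simp add: mu_def)
    also have "\<dots> = \<kappa> + (\<kappa> * I) * mu" by (simp add: algebra_simps)
    also have "(\<kappa> * I) * mu \<le> 1/2 * mu" using \<kappa>I(1) mu(1) by (intro mult_right_mono)
    finally have mu2: "mu \<le> 2 * \<kappa>" by simp
    have "I * mu \<le> I * (2 * \<kappa>)" using mu2 I by (intro mult_left_mono)
    then have Imu: "I * mu \<le> 1" using \<kappa>I(1) by (simp add: mult_ac)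
    define e where "e r = complex_of_real (exp (- 2 * \<tau> * r))" for r
    have ee: "exp (- of_real (2 * \<tau>) * of_real r) = e r" for r
    proof -
      have "- of_real (2 * \<tau>) * of_real r = complex_of_real (- 2 * \<tau> * r)" by simp
      then show ?thesis unfolding e_def by (simp only: exp_of_real)
    qed
    have ec: "continuous_on S e" for S unfolding e_def by (intro continuous_intros)
    define g where "g r = e r * p r" for r
    have g: "g absolutely_integrable_on {0..pi}" unfolding g_def by (intro absolutely_integrable_mult_continuous p ec)
    define G where "G x = integral {0..pi} g - integral {0..x} g" for x
    have G': "has_ac_deriv G (\<lambda>x. 0 - g x) 0 pi"
      unfolding G_def
      by (rule has_ac_deriv_diff'[OF has_ac_deriv_C1 primitive_has_ac_deriv[OF g]]) (auto intro: has_vector_derivative_const)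
    have Gx: "G x = integral {x..pi} g" if x: "x \<in> {0..pi}" for x
    proof -
      have "integral {0..x} g + integral {x..pi} g = integral {0..pi} g"
        using x g by (intro Henstock_Kurzweil_Integration.integral_combine) (auto simp: absolutely_integrable_on_def)
      then show ?thesis unfolding G_def by (metis add_diff_cancel_left')
    qed
    have Gb: "norm (G x) \<le> C1 * \<tau> powr (- \<rho>)" if x: "x \<in> {0..pi}" for x
      unfolding Gx[OF x] g_def e_def C1_def by (rule laplace_upper[OF p \<rho> less_imp_le[OF Ch(1)] Ch(2) x \<tau>0(1)])
    have Gc: "continuous_on {0..pi} G" by (rule has_ac_deriv_continuous_on[OF G'])
    have Z: "has_ac_deriv (\<lambda>x. e x * u x) (\<lambda>t. e t * (p t * v t)) 0 pi"
      using variation_of_constants[OF u] unfolding ee .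
    \<comment> \<open>In the derivative the terms with \<open>p\<close> cancel, since the derivative
      of \<open>G\<close> is minus the weighted \<open>p\<close>. What remains is the product of two
      small factors, \<open>G\<close> and \<open>u\<close>.\<close>
    have W: "has_ac_deriv (\<lambda>x. e x * u x + G x * v x) (\<lambda>t. G t * (q t * u t)) 0 pi"
      by (rule has_ac_deriv_cong[OF has_ac_deriv_add[OF Z has_ac_deriv_mult[OF G' v]]]) (auto simp: g_def algebra_simps)
    have "((\<lambda>t. G t * (q t * u t)) has_integral ((e pi * u pi + G pi * v pi) - (e 0 * u 0 + G 0 * v 0))) {0..pi}"
      using W by (simp add: has_ac_deriv_def)
    then have i: "((\<lambda>t. G t * (q t * u t)) has_integral - (u 0 + G 0)) {0..pi}"
      using upi v0 by (simp add: G_def e_def)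
    have "norm (- (u 0 + G 0)) \<le> integral {0..pi} (\<lambda>t. C1 * \<tau> powr (- \<rho>) * mu * norm (q t))"
      unfolding integral_unique[OF i, symmetric]
    proof (rule integral_norm_bound_integral[OF has_integral_integrable[OF i]])
      show "(\<lambda>t. C1 * \<tau> powr (- \<rho>) * mu * norm (q t)) integrable_on {0..pi}" by (intro integrable_on_mult_right nq) auto
      fix t assume t: "t \<in> {0..pi}"
      have "norm (G t) * (norm (q t) * norm (u t)) \<le> (C1 * \<tau> powr (- \<rho>)) * (norm (q t) * mu)"
        using Gb[OF t] mu(2)[OF t] C1 by (intro mult_mono) auto
      then show "norm (G t * (q t * u t)) \<le> C1 * \<tau> powr (- \<rho>) * mu * norm (q t)" by (simp add: norm_mult mult_ac)
    qed
    also have "\<dots> = C1 * I * mu * \<tau> powr (- \<rho>)" by (simp add: I_def)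
    also have "\<dots> \<le> C1 * I * (2 * \<kappa>) * \<tau> powr (- \<rho>)" using mu2 C1 I by (intro mult_right_mono mult_left_mono) auto
    also have "\<dots> \<le> c / 2 * \<tau> powr (- \<rho>)" using \<kappa>I(3) by (intro mult_right_mono) auto
    finally have err: "norm (u 0 + G 0) \<le> c / 2 * \<tau> powr (- \<rho>)" by (simp only: norm_minus_cancel)
    have "c * \<tau> powr (- \<rho>) \<le> norm (G 0)"
      using cT(3)[OF \<tau>0(2)] unfolding Gx[of 0, simplified] g_def e_def .
    moreover have "norm (G 0) \<le> norm (u 0 + G 0) + norm (u 0)"
      using norm_triangle_ineq4[of "u 0 + G 0" "u 0"] by simp
    ultimately have "c / 2 * \<tau> powr (- \<rho>) \<le> norm (u 0)" using err by (simp add: algebra_simps)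
    moreover have "norm (u 0) \<le> 1" using mu(2)[of 0] mu2 \<kappa>I(2) by simp
    moreover have "norm (v pi) \<le> 2" using vb[of pi] Imu by simp
    ultimately show "c / 2 * \<tau> powr (- \<rho>) \<le> norm (u 0) \<and> norm (u 0) \<le> 1 \<and> norm (v pi) \<le> 2" by blast
  qed (use cT in auto)
qed

text \<open>For \<tau> > 0 the stable data are u1(pi) and u2(0). Relative to the basis adapted to
  them the boundary conditions form a 2 x 2 system whose determinant lacks the term \<alpha>
  \<beta>; since a1(0) and d2(pi) are exponentially small, the product d1(0) a2(pi) of reflection
  coefficients dominates, and Cramer's rule loses only a power of \<tau>.\<close>

lemma ray_estimate:
  fixes p q :: "real \<Rightarrow> complex"
  assumes p: "p absolutely_integrable_on {0..pi}" and q: "q absolutely_integrable_on {0..pi}"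
    and \<rho>: "\<rho> > 0" "\<rho>' > 0" and \<nu>: "\<nu> \<noteq> 0" "\<nu>' \<noteq> 0"
    and lim: "((\<lambda>h. integral {0..h} p / complex_of_real (h powr \<rho>)) \<longlongrightarrow> \<nu>) (at_right 0)"
    and lim': "((\<lambda>h. integral {pi - h..pi} q / complex_of_real (h powr \<rho>')) \<longlongrightarrow> \<nu>') (at_right 0)"
    and ab: "\<alpha> * \<beta> = 0"
    and ivp: "\<And>\<tau>::real. \<exists>f1 f2. dirac_system (of_real \<tau>) p q (\<lambda>t. 0) (\<lambda>t. 0) f1 f2 \<and> f1 0 = 1 \<and> f2 0 = 0"
      "\<And>\<tau>::real. \<exists>f1 f2. dirac_system (of_real \<tau>) p q (\<lambda>t. 0) (\<lambda>t. 0) f1 f2 \<and> f1 0 = 0 \<and> f2 0 = 1"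
  obtains T C N where "T \<ge> 1" "C \<ge> 0"
    "\<And>(\<tau>::real) k1 k2 u1 u2 K x. \<tau> \<ge> T \<Longrightarrow> dirac_system (of_real \<tau>) p q k1 k2 u1 u2 \<Longrightarrow>
       k1 absolutely_integrable_on {0..pi} \<Longrightarrow> k2 absolutely_integrable_on {0..pi} \<Longrightarrow>
       kernel_bound \<tau> k1 K \<Longrightarrow> kernel_bound \<tau> k2 K \<Longrightarrow> K \<ge> 0 \<Longrightarrow>
       u1 0 = \<alpha> * u1 pi \<Longrightarrow> u2 pi = \<beta> * u2 0 \<Longrightarrow> x \<in> {0..pi} \<Longrightarrow>
       norm (u1 x) \<le> C * \<tau> ^ N * K \<and> norm (u2 x) \<le> C * \<tau> ^ N * K"
proof -
  obtain c T1 where c: "c > 0" "T1 > 0"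
    "\<And>\<tau> u v. \<tau> \<ge> T1 \<Longrightarrow> has_ac_deriv u (\<lambda>t. of_real (2 * \<tau>) * u t + p t * v t) 0 pi \<Longrightarrow>
       has_ac_deriv v (\<lambda>t. q t * u t) 0 pi \<Longrightarrow> v 0 = 1 \<Longrightarrow> u pi = 0 \<Longrightarrow>
       c * \<tau> powr (- \<rho>) \<le> norm (u 0) \<and> norm (u 0) \<le> 1 \<and> norm (v pi) \<le> 2"
    using weyl_coefficient_lower_bound[OF p q \<rho>(1) \<nu>(1) lim] by blast
  let ?q = "\<lambda>t. - q (pi - t)" and ?p = "\<lambda>t. - p (pi - t)"
  have neg: "(\<lambda>t. - f (pi - t)) absolutely_integrable_on {0..pi}" if "f absolutely_integrable_on {0..pi}" for f :: "real \<Rightarrow> complex"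
    using absolutely_integrable_linear[OF absolutely_integrable_flip[OF that] bounded_linear_minus[OF bounded_linear_ident]] by (simp add: o_def)
  have limq: "((\<lambda>h. integral {0..h} ?q / complex_of_real (h powr \<rho>')) \<longlongrightarrow> - \<nu>') (at_right 0)"
  proof (rule Lim_transform_eventually[OF tendsto_minus[OF lim']])
    show "\<forall>\<^sub>F h in at_right 0. - (integral {pi - h..pi} q / complex_of_real (h powr \<rho>')) = integral {0..h} ?q / complex_of_real (h powr \<rho>')"
      unfolding eventually_at_right_field
    proof (intro exI[of _ pi] conjI allI impI)
      fix h :: real assume h: "0 < h" "h < pi"
      have "q integrable_on {pi - h..pi}"
        using absolutely_integrable_on_subinterval[OF q, of "pi - h" pi] h by (auto simp: absolutely_integrable_on_def)
      from integrable_flip(2)[OF this, of pi]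
      show "- (integral {pi - h..pi} q / complex_of_real (h powr \<rho>')) = integral {0..h} ?q / complex_of_real (h powr \<rho>')" by simp
    qed simp
  qed
  have nu': "- \<nu>' \<noteq> 0" using \<nu>(2) by simp
  obtain c' T2 where c': "c' > 0" "T2 > 0"
    "\<And>\<tau> u v. \<tau> \<ge> T2 \<Longrightarrow> has_ac_deriv u (\<lambda>t. of_real (2 * \<tau>) * u t + ?q t * v t) 0 pi \<Longrightarrow>
       has_ac_deriv v (\<lambda>t. ?p t * u t) 0 pi \<Longrightarrow> v 0 = 1 \<Longrightarrow> u pi = 0 \<Longrightarrow>
       c' * \<tau> powr (- \<rho>') \<le> norm (u 0) \<and> norm (u 0) \<le> 1 \<and> norm (v pi) \<le> 2"
    using weyl_coefficient_lower_bound[OF neg[OF q] neg[OF p] \<rho>(2) nu' limq] by blast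
  obtain s1 where s1: "s1 > 0" "\<And>s. s \<ge> s1 \<Longrightarrow> kernel_bound s p (1/2)" using kernel_bound_small[OF p, of "1/2"] by auto
  obtain s2 where s2: "s2 > 0" "\<And>s. s \<ge> s2 \<Longrightarrow> kernel_bound s q (1/2)" using kernel_bound_small[OF q, of "1/2"] by auto
  define B where "B = norm \<alpha> + norm \<beta>"
  have B: "B \<ge> 0" by (simp add: B_def)
  \<comment> \<open>An integer above \<rho> + \<rho>', the order to which the determinant may
    decay.\<close>
  define N where "N = nat \<lceil>\<rho> + \<rho>'\<rceil>"
  have Nge: "\<rho> + \<rho>' \<le> real N" unfolding N_def using \<rho> by linarith
  have "((\<lambda>\<tau>. (4 + 2 * B) * exp (- \<tau> * pi) * \<tau> powr (\<rho> + \<rho>')) \<longlongrightarrow> 0) at_top"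
    using \<rho> by real_asymp
  then have "\<forall>\<^sub>F \<tau> in at_top. (4 + 2 * B) * exp (- \<tau> * pi) * \<tau> powr (\<rho> + \<rho>') < c * c' / 2"
    using c(1) c'(1) by (intro order_tendstoD) auto
  then obtain T3 where T3: "\<And>\<tau>. \<tau> \<ge> T3 \<Longrightarrow> (4 + 2 * B) * exp (- \<tau> * pi) * \<tau> powr (\<rho> + \<rho>') < c * c' / 2"
    unfolding eventually_at_top_linorder by blast
  define T where "T = Max {1, T1, T2, T3, s1, s2}"
  define c0 where "c0 = c * c' / 2"
  have c0: "c0 > 0" using c(1) c'(1) by (simp add: c0_def)
  define C where "C = 2 + 2 * (2 * ((3 + B) * 2 / c0))"
  have main: "norm (u1 x) \<le> C * \<tau> ^ N * K \<and> norm (u2 x) \<le> C * \<tau> ^ N * K"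
    if \<tau>T: "\<tau> \<ge> T" and sys: "dirac_system (of_real \<tau>) p q k1 k2 u1 u2"
      and k: "k1 absolutely_integrable_on {0..pi}" "k2 absolutely_integrable_on {0..pi}" "kernel_bound \<tau> k1 K" "kernel_bound \<tau> k2 K" "K \<ge> 0"
      and bc: "u1 0 = \<alpha> * u1 pi" "u2 pi = \<beta> * u2 0" and x: "x \<in> {0..pi}" for \<tau> :: real and k1 k2 u1 u2 K x
  proof -
    have \<tau>: "\<tau> \<ge> 1" "\<tau> \<ge> T1" "\<tau> \<ge> T2" "\<tau> \<ge> T3" "\<tau> \<ge> s1" "\<tau> \<ge> s2" using \<tau>T by (auto simp: T_def)
    have est: "norm (f1 x) \<le> 2 * (max (norm (f2 0)) (norm (f1 pi)) + L) \<and> norm (f2 x) \<le> 2 * (max (norm (f2 0)) (norm (f1 pi)) + L)"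
      if "dirac_system (of_real \<tau>) p q l1 l2 f1 f2" "l1 absolutely_integrable_on {0..pi}" "l2 absolutely_integrable_on {0..pi}"
        "kernel_bound \<tau> l1 L" "kernel_bound \<tau> l2 L" "x \<in> {0..pi}" for l1 l2 f1 f2 L x
    proof -
      have f: "has_ac_deriv f2 (\<lambda>t. - complex_of_real \<tau> * f2 t + (q t * f1 t + l2 t)) 0 pi"
        "has_ac_deriv f1 (\<lambda>t. complex_of_real \<tau> * f1 t + (p t * f2 t + l1 t)) 0 pi"
        using that(1) by (simp_all add: dirac_system_def)
      show ?thesis
      proof (rule system_estimate[OF f q p that(3) that(2), of "1/2" L])
        fix m assume "\<And>x. x \<in> {0..pi} \<Longrightarrow> norm (f2 x) \<le> m" "\<And>x. x \<in> {0..pi} \<Longrightarrow> norm (f1 x) \<le> m"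
          "m \<le> 2 * (max (norm (f2 0)) (norm (f1 pi)) + L)"
        then show ?thesis using that(6) by (meson order_trans)
      qed (use that s1(2)[OF \<tau>(5)] s2(2)[OF \<tau>(6)] \<tau>(1) in auto)
    qed
    have k0: "kernel_bound \<tau> (\<lambda>t. 0) 0" by (simp add: kernel_bound_def)
    have est0: "norm (f1 x) \<le> 2 * max (norm (f2 0)) (norm (f1 pi)) \<and> norm (f2 x) \<le> 2 * max (norm (f2 0)) (norm (f1 pi))"
      if "dirac_system (of_real \<tau>) p q (\<lambda>t. 0) (\<lambda>t. 0) f1 f2" "x \<in> {0..pi}" for f1 f2 x
      using est[OF that(1) absolutely_integrable_zero absolutely_integrable_zero k0 k0 that(2)] by simp
    have scale: "dirac_system (of_real \<tau>) p q (\<lambda>t. 0) (\<lambda>t. 0) (\<lambda>t. f1 t + d * g1 t) (\<lambda>t. f2 t + d * g2 t)"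
      if "dirac_system (of_real \<tau>) p q (\<lambda>t. 0) (\<lambda>t. 0) f1 f2" "dirac_system (of_real \<tau>) p q (\<lambda>t. 0) (\<lambda>t. 0) g1 g2" for f1 f2 g1 g2 d
      using dirac_system_linear[OF that, of d] by simp
    have zero: "dirac_system (of_real \<tau>) p q (\<lambda>t. 0) (\<lambda>t. 0) (\<lambda>t. 0) (\<lambda>t. 0)" by (simp add: dirac_system_def has_ac_deriv_def)
    obtain f1 f2 where f: "dirac_system (of_real \<tau>) p q (\<lambda>t. 0) (\<lambda>t. 0) f1 f2" "f1 0 = 1" "f2 0 = 0" using ivp(1) by blast
    obtain g1 g2 where g: "dirac_system (of_real \<tau>) p q (\<lambda>t. 0) (\<lambda>t. 0) g1 g2" "g1 0 = 0" "g2 0 = 1" using ivp(2) by blast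
    \<comment> \<open>With both stable data zero the estimate would force the solution to vanish,
      against f1(0) = 1.\<close>
    have f1pi: "f1 pi \<noteq> 0"
    proof
      assume "f1 pi = 0"
      then show False using est0[OF f(1), of 0] f(2,3) by simp
    qed
    define a1 a2 where "a1 t = 0 + 1 / f1 pi * f1 t" and "a2 t = 0 + 1 / f1 pi * f2 t" for t
    have a: "dirac_system (of_real \<tau>) p q (\<lambda>t. 0) (\<lambda>t. 0) a1 a2" unfolding a1_def a2_def by (rule scale[OF zero f(1)])
    have abc: "a1 pi = 1" "a2 0 = 0" using f1pi f(3) by (simp_all add: a1_def a2_def)
    define d1 d2 where "d1 t = g1 t + (- g1 pi) * a1 t" and "d2 t = g2 t + (- g1 pi) * a2 t" for t
    have d: "dirac_system (of_real \<tau>) p q (\<lambda>t. 0) (\<lambda>t. 0) d1 d2" unfolding d1_def d2_def by (rule scale[OF g(1) a])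
    have dbc: "d1 pi = 0" "d2 0 = 1" using abc g by (simp_all add: d1_def d2_def)
    have ab2: "norm (a1 x) \<le> 2" "norm (a2 x) \<le> 2" "norm (d1 x) \<le> 2" "norm (d2 x) \<le> 2" if "x \<in> {0..pi}" for x
      using est0[OF a that] est0[OF d that] abc dbc by auto
    \<comment> \<open>Multiplication by exp (\<tau> x) removes the diagonal term of the second
      component and doubles that of the first: the normal form in which the reflection coefficient
      was estimated.\<close>
    define E where "E x = exp (of_real \<tau> * complex_of_real x)" for x
    have E': "has_ac_deriv E (\<lambda>x. of_real \<tau> * E x) 0 pi" unfolding E_def by (rule has_ac_deriv_exp) simp
    have nE: "norm (E x) = exp (\<tau> * x)" for x by (simp add: E_def)
    have minus: "c * \<tau> powr (- \<rho>) \<le> norm (d1 0) \<and> norm (d1 0) \<le> 1 \<and> norm (E pi * d2 pi) \<le> 2"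
    proof -
      have "c * \<tau> powr (- \<rho>) \<le> norm (E 0 * d1 0) \<and> norm (E 0 * d1 0) \<le> 1 \<and> norm (E pi * d2 pi) \<le> 2"
      proof (rule c(3)[OF \<tau>(2), of "\<lambda>x. E x * d1 x" "\<lambda>x. E x * d2 x"])
        show "has_ac_deriv (\<lambda>x. E x * d1 x) (\<lambda>t. complex_of_real (2 * \<tau>) * (E t * d1 t) + p t * (E t * d2 t)) 0 pi"
          by (rule has_ac_deriv_cong[OF has_ac_deriv_mult[OF E']]) (use d in \<open>auto simp: dirac_system_def algebra_simps\<close>)
        show "has_ac_deriv (\<lambda>x. E x * d2 x) (\<lambda>t. q t * (E t * d1 t)) 0 pi"
          by (rule has_ac_deriv_cong[OF has_ac_deriv_mult[OF E']]) (use d in \<open>auto simp: dirac_system_def algebra_simps\<close>)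
      qed (use dbc in \<open>auto simp: E_def\<close>)
      then show ?thesis by (simp add: E_def)
    qed
    \<comment> \<open>The coefficient at the right end is the same quantity for the reflected
      interval, where q takes the place of p and both change sign.\<close>
    have plus: "c' * \<tau> powr (- \<rho>') \<le> norm (a2 pi) \<and> norm (a2 pi) \<le> 1 \<and> norm (E pi * a1 0) \<le> 2"
    proof -
      have fl: "has_ac_deriv (\<lambda>x. a1 (pi - x)) (\<lambda>t. - (of_real \<tau> * a1 (pi - t) + (p (pi - t) * a2 (pi - t) + 0))) 0 pi"
          "has_ac_deriv (\<lambda>x. a2 (pi - x)) (\<lambda>t. - (- of_real \<tau> * a2 (pi - t) + (q (pi - t) * a1 (pi - t) + 0))) 0 pi"
        using has_ac_deriv_flip a unfolding dirac_system_def by blast+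
      have "c' * \<tau> powr (- \<rho>') \<le> norm (E 0 * a2 (pi - 0)) \<and> norm (E 0 * a2 (pi - 0)) \<le> 1 \<and> norm (E pi * a1 (pi - pi)) \<le> 2"
      proof (rule c'(3)[OF \<tau>(3), of "\<lambda>x. E x * a2 (pi - x)" "\<lambda>x. E x * a1 (pi - x)"])
        show "has_ac_deriv (\<lambda>x. E x * a2 (pi - x)) (\<lambda>t. complex_of_real (2 * \<tau>) * (E t * a2 (pi - t)) + - q (pi - t) * (E t * a1 (pi - t))) 0 pi"
          by (rule has_ac_deriv_cong[OF has_ac_deriv_mult[OF E' fl(2)]]) (auto simp: algebra_simps)
        show "has_ac_deriv (\<lambda>x. E x * a1 (pi - x)) (\<lambda>t. - p (pi - t) * (E t * a2 (pi - t))) 0 pi"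
          by (rule has_ac_deriv_cong[OF has_ac_deriv_mult[OF E' fl(1)]]) (auto simp: algebra_simps)
      qed (use abc in \<open>auto simp: E_def\<close>)
      then show ?thesis by (simp add: E_def)
    qed
    define \<epsilon> where "\<epsilon> = 2 * exp (- \<tau> * pi)"
    have small: "norm (a1 0) \<le> \<epsilon>" "norm (d2 pi) \<le> \<epsilon>" "\<epsilon> \<ge> 0" "\<epsilon> \<le> 2"
    proof -
      have "norm (E pi * z) \<le> 2 \<Longrightarrow> norm z \<le> \<epsilon>" for z
        by (simp add: norm_mult nE \<epsilon>_def exp_minus field_simps)
      then show "norm (a1 0) \<le> \<epsilon>" "norm (d2 pi) \<le> \<epsilon>" using minus plus by blast+
      show "\<epsilon> \<ge> 0" "\<epsilon> \<le> 2" using \<tau>(1) by (auto simp: \<epsilon>_def)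
    qed
    define D where "D = (a1 0 - \<alpha>) * (d2 pi - \<beta>) - d1 0 * a2 pi"
    have Dlow: "c0 * \<tau> powr (- (\<rho> + \<rho>')) \<le> norm D"
    proof -
      have D': "d1 0 * a2 pi = (a1 0 * d2 pi - a1 0 * \<beta> - \<alpha> * d2 pi) - D"
        using ab by (simp add: D_def algebra_simps)
      have "norm (d1 0 * a2 pi) \<le> norm (a1 0 * d2 pi - a1 0 * \<beta> - \<alpha> * d2 pi) + norm D"
        unfolding D' by (rule norm_triangle_ineq4)
      also have "norm (a1 0 * d2 pi - a1 0 * \<beta> - \<alpha> * d2 pi) \<le> \<epsilon> * 2 + \<epsilon> * norm \<beta> + norm \<alpha> * \<epsilon>"
        unfolding norm_mult[symmetric]
        by (intro norm_triangle_le_diff add_mono) (use small in \<open>auto simp: norm_mult intro!: mult_mono\<close>)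
      also have "\<epsilon> * 2 + \<epsilon> * norm \<beta> + norm \<alpha> * \<epsilon> = (4 + 2 * B) * exp (- \<tau> * pi)" by (simp add: \<epsilon>_def B_def algebra_simps)
      also have "\<dots> \<le> c0 * \<tau> powr (- (\<rho> + \<rho>'))"
      proof -
        have "(4 + 2 * B) * exp (- \<tau> * pi) * \<tau> powr (\<rho> + \<rho>') \<le> c0" using T3[OF \<tau>(4)] by (simp add: c0_def)
        from mult_right_mono[OF this, of "\<tau> powr (- (\<rho> + \<rho>'))"]
        have "(4 + 2 * B) * exp (- \<tau> * pi) * (\<tau> powr (\<rho> + \<rho>') * \<tau> powr (- (\<rho> + \<rho>'))) \<le> c0 * \<tau> powr (- (\<rho> + \<rho>'))"
          by (simp add: mult.assoc)
        moreover have "\<tau> powr (\<rho> + \<rho>') * \<tau> powr (- (\<rho> + \<rho>')) = 1" using \<tau>(1) by (simp flip: powr_add)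
        ultimately show ?thesis by (simp only: mult_1_right)
      qed
      finally have "norm (d1 0 * a2 pi) \<le> c0 * \<tau> powr (- (\<rho> + \<rho>')) + norm D" by simp
      moreover have "(c * \<tau> powr (- \<rho>)) * (c' * \<tau> powr (- \<rho>')) \<le> norm (d1 0 * a2 pi)"
        unfolding norm_mult using minus plus c(1) c'(1) by (intro mult_mono) auto
      moreover have "(c * \<tau> powr (- \<rho>)) * (c' * \<tau> powr (- \<rho>')) = 2 * c0 * \<tau> powr (- (\<rho> + \<rho>'))"
        using powr_add[of \<tau> "- \<rho>" "- \<rho>'"] by (simp add: c0_def)
      ultimately show ?thesis by simp
    qed
    have Dpos: "c0 / \<tau> ^ N \<le> norm D"
    proof -
      have "\<tau> powr (- real N) \<le> \<tau> powr (- (\<rho> + \<rho>'))" using Nge \<tau>(1) by (intro powr_mono) auto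
      then have "c0 * (1 / \<tau> ^ N) \<le> c0 * \<tau> powr (- (\<rho> + \<rho>'))"
        using c0 \<tau>(1) by (intro mult_left_mono) (auto simp: powr_minus powr_realpow divide_inverse)
      then show ?thesis using Dlow by simp
    qed
    define b1 b2 where "b1 = u1 pi" and "b2 = u2 0"
    \<comment> \<open>What is left after removing the adapted basis has zero stable data, hence is
      bounded by the source alone.\<close>
    define w1 w2 where "w1 t = (u1 t + (- b1) * a1 t) + (- b2) * d1 t" and "w2 t = (u2 t + (- b1) * a2 t) + (- b2) * d2 t" for t
    have w: "dirac_system (of_real \<tau>) p q k1 k2 w1 w2"
      using dirac_system_linear[OF dirac_system_linear[OF sys a, of "- b1"] d, of "- b2"] unfolding w1_def w2_def by simp
    have wbc: "w2 0 = 0" "w1 pi = 0" using abc dbc by (simp_all add: w1_def w2_def b1_def b2_def)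
    have wb: "norm (w1 x) \<le> 2 * K" "norm (w2 x) \<le> 2 * K" if "x \<in> {0..pi}" for x
      using est[OF w k(1-4) that] wbc by auto
    have r1: "(a1 0 - \<alpha>) * b1 + d1 0 * b2 = - w1 0" using bc(1) by (simp add: w1_def b1_def algebra_simps)
    have r2: "a2 pi * b1 + (d2 pi - \<beta>) * b2 = - w2 pi" using bc(2) by (simp add: w2_def b2_def algebra_simps)
    have c1: "D * b1 = d1 0 * w2 pi - (d2 pi - \<beta>) * w1 0" using r1 r2 unfolding D_def by algebra
    have c2: "D * b2 = a2 pi * w1 0 - (a1 0 - \<alpha>) * w2 pi" using r1 r2 unfolding D_def by algebra
    have n1: "norm (d2 pi - \<beta>) \<le> 2 + B" "norm (a1 0 - \<alpha>) \<le> 2 + B"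
      using norm_triangle_ineq4[of "d2 pi" \<beta>] norm_triangle_ineq4[of "a1 0" \<alpha>] small
        norm_ge_zero[of \<alpha>] norm_ge_zero[of \<beta>] unfolding B_def by linarith+
    have rhs: "norm (D * b1) \<le> (3 + B) * (2 * K)" "norm (D * b2) \<le> (3 + B) * (2 * K)"
    proof -
      have t: "norm (d1 0 * w2 pi) \<le> 1 * (2 * K)" "norm (a2 pi * w1 0) \<le> 1 * (2 * K)"
        "norm ((d2 pi - \<beta>) * w1 0) \<le> (2 + B) * (2 * K)" "norm ((a1 0 - \<alpha>) * w2 pi) \<le> (2 + B) * (2 * K)"
        unfolding norm_mult using minus plus wb[of 0] wb[of pi] n1 k(5) B by (intro mult_mono; simp)+
      have "norm (D * b1) \<le> 1 * (2 * K) + (2 + B) * (2 * K)"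
        unfolding c1 by (intro norm_triangle_le_diff add_mono t)
      then show "norm (D * b1) \<le> (3 + B) * (2 * K)" by (simp add: algebra_simps)
      have "norm (D * b2) \<le> 1 * (2 * K) + (2 + B) * (2 * K)"
        unfolding c2 by (intro norm_triangle_le_diff add_mono t)
      then show "norm (D * b2) \<le> (3 + B) * (2 * K)" by (simp add: algebra_simps)
    qed
    have tN: "\<tau> ^ N \<ge> 1" using \<tau>(1) by simp
    have bb: "norm z \<le> ((3 + B) * 2 / c0) * \<tau> ^ N * K" if "norm (D * z) \<le> (3 + B) * (2 * K)" for z
    proof -
      have "c0 / \<tau> ^ N * norm z \<le> (3 + B) * (2 * K)"
        using that mult_right_mono[OF Dpos norm_ge_zero[of z]] by (simp add: norm_mult)
      then show ?thesis using c0 tN by (simp add: field_simps)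
    qed
    have fin: "norm y \<le> C * \<tau> ^ N * K" if y: "norm y \<le> 2 * K + norm b1 * 2 + norm b2 * 2" for y :: complex
    proof -
      have "2 * K \<le> 2 * \<tau> ^ N * K" using tN k(5) by (simp add: mult_right_mono)
      then have "norm y \<le> 2 * \<tau> ^ N * K + (((3 + B) * 2 / c0) * \<tau> ^ N * K) * 2 + (((3 + B) * 2 / c0) * \<tau> ^ N * K) * 2"
        using y bb[OF rhs(1)] bb[OF rhs(2)] by linarith
      also have "\<dots> = C * \<tau> ^ N * K" by (simp add: C_def algebra_simps)
      finally show ?thesis .
    qed
    have "u1 x = w1 x + b1 * a1 x + b2 * d1 x" "u2 x = w2 x + b1 * a2 x + b2 * d2 x" by (simp_all add: w1_def w2_def)
    moreover have "norm (w1 x + b1 * a1 x + b2 * d1 x) \<le> 2 * K + norm b1 * 2 + norm b2 * 2"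
      "norm (w2 x + b1 * a2 x + b2 * d2 x) \<le> 2 * K + norm b1 * 2 + norm b2 * 2"
      using ab2[OF x] wb[OF x] by (auto intro!: norm_triangle_le add_mono mult_left_mono simp: norm_mult)
    ultimately show ?thesis using fin[of "u1 x"] fin[of "u2 x"] by simp
  qed
  show ?thesis
    by (rule that[of T C N]) (use main B c0 in \<open>auto simp: T_def C_def\<close>)
qed

section \<open>Bounded functionals on the Hilbert space\<close>

abbreviation Leb :: "real measure" where "Leb \<equiv> lebesgue_on {0..pi}"

lemma Leb_finite: "finite_measure Leb"
  by (rule finite_measureI) (simp add: emeasure_restrict_space)

lemma integrable_Leb_const [simp]: "integrable Leb (\<lambda>x. c :: real)"
  using finite_measure.integrable_const[OF Leb_finite] .

lemma L2_space_iff: "f \<in> L2_space \<longleftrightarrow> f \<in> borel_measurable Leb \<and> integrable Leb (\<lambda>x. (norm (f x))\<^sup>2)"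
  by (simp add: L2_space_def)

lemma borel_measurable_smult_vec:
  fixes f :: "real \<Rightarrow> complex^2"
  assumes "f \<in> borel_measurable M"
  shows "(\<lambda>x. c *s f x) \<in> borel_measurable M"
proof -
  have "continuous_on UNIV (\<lambda>v::complex^2. c *s v)"
    using bounded_linear.continuous_on[OF bounded_linear_smult_vec continuous_on_id] by simp
  from borel_measurable_continuous_on[OF this assms] show ?thesis .
qed

lemma L2_space_linear:
  assumes f: "f \<in> L2_space" and g: "g \<in> L2_space"
  shows "(\<lambda>x. a *s f x + b *s g x) \<in> L2_space"
  unfolding L2_space_iff
proof
  have m: "f \<in> borel_measurable Leb" "g \<in> borel_measurable Leb" using f g by (auto simp: L2_space_iff)
  show 1: "(\<lambda>x. a *s f x + b *s g x) \<in> borel_measurable Leb"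
    by (intro borel_measurable_add borel_measurable_smult_vec m)
  show "integrable Leb (\<lambda>x. (norm (a *s f x + b *s g x))\<^sup>2)"
  proof (rule Bochner_Integration.integrable_bound)
    show "integrable Leb (\<lambda>x. 2 * (norm a)\<^sup>2 * (norm (f x))\<^sup>2 + 2 * (norm b)\<^sup>2 * (norm (g x))\<^sup>2)"
      using f g by (auto simp: L2_space_iff)
    show "(\<lambda>x. (norm (a *s f x + b *s g x))\<^sup>2) \<in> borel_measurable Leb" using 1 by measurable
    show "AE x in Leb. norm ((norm (a *s f x + b *s g x))\<^sup>2) \<le> norm (2 * (norm a)\<^sup>2 * (norm (f x))\<^sup>2 + 2 * (norm b)\<^sup>2 * (norm (g x))\<^sup>2)"
    proof (intro AE_I2)
      fix x
      have "norm (a *s f x + b *s g x) \<le> norm a * norm (f x) + norm b * norm (g x)"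
        using norm_triangle_ineq[of "a *s f x" "b *s g x"] by (simp add: norm_smult_vec2)
      then have "(norm (a *s f x + b *s g x))\<^sup>2 \<le> (norm a * norm (f x) + norm b * norm (g x))\<^sup>2" by (intro power_mono) auto
      also have "\<dots> \<le> 2 * (norm a * norm (f x))\<^sup>2 + 2 * (norm b * norm (g x))\<^sup>2"
        using sum_squares_bound[of "norm a * norm (f x)" "norm b * norm (g x)"] by (simp add: power2_sum)
      finally show "norm ((norm (a *s f x + b *s g x))\<^sup>2) \<le> norm (2 * (norm a)\<^sup>2 * (norm (f x))\<^sup>2 + 2 * (norm b)\<^sup>2 * (norm (g x))\<^sup>2)"
        by (simp add: power_mult_distrib)
    qed
  qed
qed

lemma L2_space_diff: "f \<in> L2_space \<Longrightarrow> g \<in> L2_space \<Longrightarrow> (\<lambda>x. f x - g x) \<in> L2_space"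
  using L2_space_linear[of f g 1 "-1"] by simp

lemma L2_space_zero: "(\<lambda>x. 0) \<in> L2_space"
  by (simp add: L2_space_iff)

lemma L2_space_continuous:
  assumes "continuous_on {0..pi} f"
  shows "f \<in> L2_space"
  unfolding L2_space_iff
proof
  show "f \<in> borel_measurable Leb" by (intro continuous_imp_measurable_on_sets_lebesgue assms) auto
  show "integrable Leb (\<lambda>x. (norm (f x))\<^sup>2)"
    by (intro continuous_imp_integrable_real continuous_intros assms)
qed

section \<open>Inner product and separation by functionals\<close>

text \<open>The real inner product, that is, the real part of the Hermitian one; complex linearity
  is restored at the end of the separation argument.\<close>

definition L2_inner :: "(real \<Rightarrow> complex^2) \<Rightarrow> (real \<Rightarrow> complex^2) \<Rightarrow> real" where
  "L2_inner f g = (LINT x|Leb. f x \<bullet> g x)"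

lemma integrable_inner:
  assumes "f \<in> L2_space" "g \<in> L2_space"
  shows "integrable Leb (\<lambda>x. f x \<bullet> g x)"
proof (rule Bochner_Integration.integrable_bound)
  show "integrable Leb (\<lambda>x. (norm (f x))\<^sup>2 + (norm (g x))\<^sup>2)" using assms by (auto simp: L2_space_iff)
  show "(\<lambda>x. f x \<bullet> g x) \<in> borel_measurable Leb" using assms by (auto simp: L2_space_iff)
  show "AE x in Leb. norm (f x \<bullet> g x) \<le> norm ((norm (f x))\<^sup>2 + (norm (g x))\<^sup>2)"
  proof (intro AE_I2)
    fix x
    have "\<bar>f x \<bullet> g x\<bar> \<le> norm (f x) * norm (g x)" by (rule Cauchy_Schwarz_ineq2)
    also have "\<dots> \<le> (norm (f x))\<^sup>2 + (norm (g x))\<^sup>2"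
      using sum_squares_bound[of "norm (f x)" "norm (g x)"] mult_nonneg_nonneg[OF norm_ge_zero[of "f x"] norm_ge_zero[of "g x"]] by linarith
    finally show "norm (f x \<bullet> g x) \<le> norm ((norm (f x))\<^sup>2 + (norm (g x))\<^sup>2)" by simp
  qed
qed

lemma L2_inner_commute: "L2_inner f g = L2_inner g f"
  by (simp add: L2_inner_def inner_commute)

lemma L2_inner_add:
  assumes "f \<in> L2_space" "g \<in> L2_space" "h \<in> L2_space"
  shows "L2_inner (\<lambda>x. complex_of_real a *s f x + complex_of_real b *s g x) h = a * L2_inner f h + b * L2_inner g h"
proof -
  have e: "complex_of_real c *s v = c *\<^sub>R v" for c and v :: "complex^2"
    unfolding vec_eq_iff vector_smult_component vector_scaleR_component by (simp add: scaleR_conv_of_real)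
  have "L2_inner (\<lambda>x. complex_of_real a *s f x + complex_of_real b *s g x) h = (LINT x|Leb. a * (f x \<bullet> h x) + b * (g x \<bullet> h x))"
    by (simp add: L2_inner_def e inner_add_left)
  also have "\<dots> = a * L2_inner f h + b * L2_inner g h"
    using integrable_inner[OF assms(1,3)] integrable_inner[OF assms(2,3)] by (simp add: L2_inner_def)
  finally show ?thesis .
qed

lemma l2_norm_sq: "(l2_norm f)\<^sup>2 = L2_inner f f" "L2_inner f f \<ge> 0" "l2_norm f = sqrt (L2_inner f f)" "l2_norm f \<ge> 0"
proof -
  have e: "(norm (f x))\<^sup>2 = f x \<bullet> f x" for x by (simp add: power2_norm_eq_inner)
  show 1: "L2_inner f f \<ge> 0" unfolding L2_inner_def by (intro integral_nonneg_AE) auto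
  show 2: "l2_norm f = sqrt (L2_inner f f)" by (simp add: l2_norm_def L2_inner_def e)
  show "(l2_norm f)\<^sup>2 = L2_inner f f" "l2_norm f \<ge> 0" using 1 by (simp_all add: 2)
qed

lemma L2_inner_sub_scaled:
  assumes "f \<in> L2_space" "v \<in> L2_space"
  shows "L2_inner (\<lambda>x. f x - complex_of_real t *s v x) (\<lambda>x. f x - complex_of_real t *s v x) = L2_inner f f - 2 * t * L2_inner v f + t\<^sup>2 * L2_inner v v"
proof -
  let ?w = "\<lambda>x. complex_of_real 1 *s f x + complex_of_real (- t) *s v x"
  have w: "?w = (\<lambda>x. f x - complex_of_real t *s v x)" by (simp add: vec_eq_iff fun_eq_iff)
  have wL: "?w \<in> L2_space" by (rule L2_space_linear[OF assms])
  have "L2_inner ?w ?w = L2_inner f ?w - t * L2_inner v ?w" unfolding L2_inner_add[OF assms wL] by simp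
  also have "L2_inner f ?w = L2_inner f f - t * L2_inner v f"
    unfolding L2_inner_commute[of f ?w] L2_inner_add[OF assms assms(1)] by simp
  also have "L2_inner v ?w = L2_inner v f - t * L2_inner v v"
    unfolding L2_inner_commute[of v ?w] L2_inner_add[OF assms assms(2)] by (simp add: L2_inner_commute)
  finally show ?thesis unfolding w by (simp add: algebra_simps power2_eq_square)
qed

text \<open>The discriminant criterion. The case a = 0 must be included, as functions that vanish
  almost everywhere have norm 0.\<close>

lemma quadratic_nonneg_imp:
  fixes a b c :: real
  assumes "\<And>t. c - 2 * t * b + t\<^sup>2 * a \<ge> 0" "a \<ge> 0"
  shows "b\<^sup>2 \<le> a * c"
proof (cases "a = 0")
  case True
  have "b = 0"
  proof (rule ccontr)
    assume b: "b \<noteq> 0"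
    have "c - 2 * ((c + 1) / (2 * b)) * b \<ge> 0" using assms(1)[of "(c + 1) / (2 * b)"] True by simp
    then show False using b by simp
  qed
  then show ?thesis using True by simp
next
  case False
  have "c - 2 * (b / a) * b + (b / a)\<^sup>2 * a \<ge> 0" by (rule assms(1))
  also have "c - 2 * (b / a) * b + (b / a)\<^sup>2 * a = c - b\<^sup>2 / a" using False by (simp add: field_simps power2_eq_square)
  finally show ?thesis using assms(2) False by (simp add: field_simps)
qed

lemma L2_Cauchy_Schwarz:
  assumes "f \<in> L2_space" "v \<in> L2_space"
  shows "\<bar>L2_inner v f\<bar> \<le> l2_norm v * l2_norm f"
proof -
  have "(L2_inner v f)\<^sup>2 \<le> L2_inner v v * L2_inner f f"
  proof (rule quadratic_nonneg_imp)
    show "0 \<le> L2_inner f f - 2 * t * L2_inner v f + t\<^sup>2 * L2_inner v v" for t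
      unfolding L2_inner_sub_scaled[OF assms, symmetric] by (rule l2_norm_sq(2))
  qed (rule l2_norm_sq(2))
  then have "(L2_inner v f)\<^sup>2 \<le> (l2_norm v * l2_norm f)\<^sup>2" by (simp add: power_mult_distrib l2_norm_sq(1))
  then have "\<bar>L2_inner v f\<bar> \<le> \<bar>l2_norm v * l2_norm f\<bar>" by (simp add: abs_le_square_iff)
  then show ?thesis using l2_norm_sq(4)[of v] l2_norm_sq(4)[of f] by simp
qed

text \<open>A vector at positive distance from a subspace is separated from it by a bounded functional: along a
  minimizing sequence \<open>s n\<close> the numbers \<open>L2_inner g (g0 - s n)\<close> converge, so that completeness of the
  space is not needed.\<close>

lemma separating_functional:
  assumes S: "S \<subseteq> L2_space" and g0: "g0 \<in> L2_space" "g0 \<notin> l2_closure (cfun.span S)"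
  obtains L C where
    "\<And>f g a b. f \<in> L2_space \<Longrightarrow> g \<in> L2_space \<Longrightarrow> L (\<lambda>x. a *s f x + b *s g x) = a * L f + b * L g"
    "\<And>f. f \<in> L2_space \<Longrightarrow> norm (L f) \<le> C * l2_norm f"
    "\<And>s. s \<in> cfun.span S \<Longrightarrow> L s = (0::complex)" "L g0 \<noteq> 0"
proof -
  let ?V = "cfun.span S"
  have VL: "s \<in> L2_space" if "s \<in> ?V" for s
    using that
  proof (induction rule: cfun.span_induct_alt)
    case base then show ?case using L2_space_zero by (simp add: zero_fun_def)
  next
    case (step c x y)
    then show ?case using L2_space_linear[of x y c 1] S by (auto simp: fun_scale_def plus_fun_def)
  qed
  have Vlin: "(\<lambda>x. a *s f x + b *s g x) \<in> ?V" if "f \<in> ?V" "g \<in> ?V" for f g a b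
    using cfun.span_add[OF cfun.span_scale[OF that(1), of a] cfun.span_scale[OF that(2), of b]] by (simp add: fun_scale_def plus_fun_def)
  have "\<not> (\<forall>\<epsilon>>0. \<exists>s\<in>?V. l2_norm (g0 - s) < \<epsilon>)"
    using g0 by (simp add: l2_closure_def)
  then obtain \<epsilon> where "\<epsilon> > 0" "\<forall>s\<in>?V. \<not> l2_norm (g0 - s) < \<epsilon>" by blast
  then have \<epsilon>: "\<epsilon> > 0" "\<And>s. s \<in> ?V \<Longrightarrow> \<epsilon> \<le> l2_norm (\<lambda>x. g0 x - s x)"
    unfolding fun_diff_def by (simp_all add: not_less)
  define D where "D s = L2_inner (\<lambda>x. g0 x - s x) (\<lambda>x. g0 x - s x)" for s
  have DE: "\<epsilon>\<^sup>2 \<le> D s" if "s \<in> ?V" for s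
    unfolding D_def l2_norm_sq(1)[symmetric] using \<epsilon> that by (intro power_mono) auto
  define d where "d = Inf (D ` ?V)"
  have ne: "D ` ?V \<noteq> {}" using cfun.span_zero by blast
  have bdd: "bdd_below (D ` ?V)" using DE by (intro bdd_belowI[of _ "\<epsilon>\<^sup>2"]) auto
  have dle: "d \<le> D s" if "s \<in> ?V" for s unfolding d_def using that bdd by (intro cInf_lower) auto
  have d0: "d > 0"
  proof -
    have "\<epsilon>\<^sup>2 \<le> d" unfolding d_def using ne DE by (intro cInf_greatest) auto
    then show ?thesis using zero_less_power[OF \<epsilon>(1), of 2] by linarith
  qed
  \<comment> \<open>Tolerances are squared because \<open>D\<close> is a squared distance;
    orthogonality will then hold up to their roots \<open>r n\<close>.\<close>
  have "\<exists>s\<in>?V. D s < d + (1 / (real n + 1))\<^sup>2" for n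
  proof -
    have "Inf (D ` ?V) < d + (1 / (real n + 1))\<^sup>2" by (simp add: d_def)
    then show ?thesis unfolding cInf_less_iff[OF ne bdd] by blast
  qed
  then have "\<forall>n. \<exists>s. s \<in> ?V \<and> D s < d + (1 / (real n + 1))\<^sup>2" by blast
  from choice[OF this] obtain s where "\<forall>n. s n \<in> ?V \<and> D (s n) < d + (1 / (real n + 1))\<^sup>2" ..
  then have s: "\<And>n. s n \<in> ?V" "\<And>n. D (s n) < d + (1 / (real n + 1))\<^sup>2" by simp_all
  define r where "r n = 1 / (real n + 1)" for n
  have r: "r n > 0" "r \<longlonglongrightarrow> 0" for n unfolding r_def using LIMSEQ_inverse_real_of_nat by (auto simp: inverse_eq_divide add.commute)
  define f where "f n = (\<lambda>x. g0 x - s n x)" for n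
  have fL: "f n \<in> L2_space" for n unfolding f_def by (intro L2_space_diff g0 VL s)
  \<comment> \<open>Moving from \<open>s n\<close> in the direction \<open>v\<close> cannot bring
    the squared distance below \<open>d\<close>, which undercuts the current value by less than (r
    n)^2. The discriminant of this parabola bounds the inner product.\<close>
  have key: "\<bar>L2_inner v (f n)\<bar> \<le> l2_norm v * r n" if v: "v \<in> ?V" for v n
  proof -
    have "(L2_inner v (f n))\<^sup>2 \<le> L2_inner v v * (r n)\<^sup>2"
    proof (rule quadratic_nonneg_imp)
      fix t
      have "(\<lambda>x. 1 *s s n x + complex_of_real t *s v x) \<in> ?V" by (rule Vlin[OF s(1) v])
      then have "d \<le> D (\<lambda>x. 1 *s s n x + complex_of_real t *s v x)" by (rule dle)
      also have "\<dots> = L2_inner (\<lambda>x. f n x - complex_of_real t *s v x) (\<lambda>x. f n x - complex_of_real t *s v x)"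
        by (simp add: D_def f_def algebra_simps)
      also have "\<dots> = D (s n) - 2 * t * L2_inner v (f n) + t\<^sup>2 * L2_inner v v"
        unfolding L2_inner_sub_scaled[OF fL VL[OF v]] by (simp add: D_def f_def)
      finally show "0 \<le> (r n)\<^sup>2 - 2 * t * L2_inner v (f n) + t\<^sup>2 * L2_inner v v" using s(2)[of n] by (simp add: r_def)
    qed (rule l2_norm_sq(2))
    then have "(L2_inner v (f n))\<^sup>2 \<le> (l2_norm v * r n)\<^sup>2" by (simp add: power_mult_distrib l2_norm_sq(1))
    then have "\<bar>L2_inner v (f n)\<bar> \<le> \<bar>l2_norm v * r n\<bar>" by (simp add: abs_le_square_iff)
    then show ?thesis using l2_norm_sq(4)[of v] r(1)[of n] by simp
  qed
  have diff: "l2_norm (\<lambda>x. s m x - s n x) \<le> r n + r m" for m n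
  proof -
    let ?v = "\<lambda>x. s m x - s n x"
    have v: "?v \<in> ?V" using Vlin[OF s(1)[of m] s(1)[of n], of 1 "-1"] by simp
    have "L2_inner (\<lambda>x. complex_of_real 1 *s f n x + complex_of_real (-1) *s f m x) ?v = 1 * L2_inner (f n) ?v + (-1) * L2_inner (f m) ?v"
      by (rule L2_inner_add[OF fL fL VL[OF v]])
    moreover have "(\<lambda>x. complex_of_real 1 *s f n x + complex_of_real (-1) *s f m x) = ?v" by (simp add: f_def fun_eq_iff)
    ultimately have "(l2_norm ?v)\<^sup>2 = L2_inner ?v (f n) - L2_inner ?v (f m)" by (simp add: l2_norm_sq(1) L2_inner_commute[of ?v "f n"] L2_inner_commute[of ?v "f m"])
    also have "\<dots> \<le> l2_norm ?v * r n + l2_norm ?v * r m" using key[OF v, of n] key[OF v, of m] by linarith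
    finally have "l2_norm ?v * l2_norm ?v \<le> l2_norm ?v * (r n + r m)" by (simp add: power2_eq_square algebra_simps)
    then show ?thesis using l2_norm_sq(4)[of ?v] r(1)[of n] r(1)[of m] by (cases "l2_norm ?v = 0") (auto simp: mult_le_cancel_left)
  qed
  have conv: "convergent (\<lambda>n. L2_inner g (f n))" if g: "g \<in> L2_space" for g
  proof (rule Cauchy_convergent, rule metric_CauchyI)
    fix e :: real assume e: "e > 0"
    have "(\<lambda>n. l2_norm g * (r n + r n)) \<longlonglongrightarrow> l2_norm g * (0 + 0)" by (intro tendsto_intros r)
    then have "\<forall>\<^sub>F n in sequentially. l2_norm g * (r n + r n) < e" by (rule order_tendstoD) (use e in simp)
    then obtain M where M: "l2_norm g * (r M + r M) < e" by (auto simp: eventually_sequentially)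
    have mono: "r n \<le> r M" if "n \<ge> M" for n using that by (simp add: r_def frac_le)
    show "\<exists>M. \<forall>m\<ge>M. \<forall>n\<ge>M. dist (L2_inner g (f m)) (L2_inner g (f n)) < e"
    proof (intro exI[of _ M] allI impI)
      fix m n assume mn: "m \<ge> M" "n \<ge> M"
      let ?v = "\<lambda>x. s n x - s m x"
      have vL: "?v \<in> L2_space" by (intro L2_space_diff VL s)
      have "L2_inner (\<lambda>x. complex_of_real 1 *s f m x + complex_of_real (-1) *s f n x) g = 1 * L2_inner (f m) g + (-1) * L2_inner (f n) g"
        by (rule L2_inner_add[OF fL fL g])
      moreover have "(\<lambda>x. complex_of_real 1 *s f m x + complex_of_real (-1) *s f n x) = ?v" by (simp add: f_def fun_eq_iff)
      ultimately have "L2_inner g (f m) - L2_inner g (f n) = L2_inner g ?v" by (simp add: L2_inner_commute[of g])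
      then have "dist (L2_inner g (f m)) (L2_inner g (f n)) \<le> l2_norm g * l2_norm ?v"
        using L2_Cauchy_Schwarz[OF vL g] by (simp add: dist_real_def)
      also have "\<dots> \<le> l2_norm g * (r M + r M)"
        using diff[of n m] mono[OF mn(1)] mono[OF mn(2)] by (intro mult_left_mono l2_norm_sq(4)) auto
      finally show "dist (L2_inner g (f m)) (L2_inner g (f n)) < e" using M by simp
    qed
  qed
  define R where "R g = lim (\<lambda>n. L2_inner g (f n))" for g
  have R: "(\<lambda>n. L2_inner g (f n)) \<longlonglongrightarrow> R g" if "g \<in> L2_space" for g
    using conv[OF that] by (simp add: R_def convergent_LIMSEQ_iff)
  have Rlin: "R (\<lambda>x. complex_of_real a *s u x + complex_of_real b *s v x) = a * R u + b * R v" if uv: "u \<in> L2_space" "v \<in> L2_space" for u v a b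
  proof (rule LIMSEQ_unique[OF R[OF L2_space_linear[OF uv]]])
    show "(\<lambda>n. L2_inner (\<lambda>x. complex_of_real a *s u x + complex_of_real b *s v x) (f n)) \<longlonglongrightarrow> a * R u + b * R v"
      unfolding L2_inner_add[OF uv fL] by (intro tendsto_intros R uv)
  qed
  have fbound: "l2_norm (f n) \<le> sqrt (d + 1)" for n
  proof -
    have "L2_inner (f n) (f n) \<le> d + 1"
    proof -
      have "(1 / (real n + 1))\<^sup>2 \<le> 1" by (simp add: power_le_one_iff field_simps)
      then show ?thesis using s(2)[of n] by (simp add: D_def f_def)
    qed
    then show ?thesis unfolding l2_norm_sq(3) by simp
  qed
  have Rbound: "\<bar>R g\<bar> \<le> l2_norm g * sqrt (d + 1)" if g: "g \<in> L2_space" for g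
  proof (rule LIMSEQ_le_const2[OF tendsto_rabs[OF R[OF g]]])
    show "\<exists>N. \<forall>n\<ge>N. \<bar>L2_inner g (f n)\<bar> \<le> l2_norm g * sqrt (d + 1)"
      using order_trans[OF L2_Cauchy_Schwarz[OF fL g] mult_left_mono[OF fbound l2_norm_sq(4)]] by blast
  qed
  have RV: "R v = 0" if v: "v \<in> ?V" for v
  proof (rule LIMSEQ_unique[OF R[OF VL[OF v]]])
    have lim: "(\<lambda>n. l2_norm v * r n) \<longlonglongrightarrow> 0" using tendsto_mult[OF tendsto_const r(2), of "l2_norm v"] by simp
    show "(\<lambda>n. L2_inner v (f n)) \<longlonglongrightarrow> 0"
      by (rule Lim_null_comparison[OF always_eventually[OF allI] lim]) (use key[OF v] in simp)
  qed
  have Rg0: "R g0 > 0"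
  proof -
    have "R g0 = R (f 0)"
    proof -
      have "R (\<lambda>x. complex_of_real 1 *s f 0 x + complex_of_real 1 *s s 0 x) = 1 * R (f 0) + 1 * R (s 0)" by (rule Rlin[OF fL VL[OF s(1)]])
      moreover have "(\<lambda>x. complex_of_real 1 *s f 0 x + complex_of_real 1 *s s 0 x) = g0" by (simp add: f_def fun_eq_iff)
      ultimately show ?thesis using RV[OF s(1)[of 0]] by simp
    qed
    \<comment> \<open>Since g0 = f n + s n, the inner product of g0 with f n is the squared
      distance, at least \<open>d\<close>, plus an error that tends to 0 by almost
      orthogonality.\<close>
    have "d \<le> R g0"
    proof (rule LIMSEQ_le_const)
      have sn: "\<bar>L2_inner (s n) (f n)\<bar> \<le> (l2_norm (s 0) + 2) * r n" for n
      proof -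
        have "l2_norm (s n) \<le> l2_norm (s 0) + 2"
        proof -
          let ?v = "\<lambda>x. s n x - s 0 x"
          have "L2_inner (s n) (s n) = L2_inner (\<lambda>x. s 0 x - complex_of_real (-1) *s ?v x) (\<lambda>x. s 0 x - complex_of_real (-1) *s ?v x)" by simp
          also have "\<dots> = L2_inner (s 0) (s 0) + 2 * L2_inner ?v (s 0) + L2_inner ?v ?v"
            by (subst L2_inner_sub_scaled) (auto intro: VL s L2_space_diff)
          also have "\<dots> \<le> (l2_norm (s 0))\<^sup>2 + 2 * (l2_norm ?v * l2_norm (s 0)) + (l2_norm ?v)\<^sup>2"
            using L2_Cauchy_Schwarz[OF VL[OF s(1)[of 0]] L2_space_diff[OF VL[OF s(1)[of n]] VL[OF s(1)[of 0]]]] by (simp add: l2_norm_sq(1))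
          also have "\<dots> = (l2_norm (s 0) + l2_norm ?v)\<^sup>2" by (simp add: power2_sum)
          finally have "(l2_norm (s n))\<^sup>2 \<le> (l2_norm (s 0) + l2_norm ?v)\<^sup>2" by (simp add: l2_norm_sq(1))
          then have "l2_norm (s n) \<le> l2_norm (s 0) + l2_norm ?v" by (rule power2_le_imp_le) (simp add: l2_norm_sq(4))
          moreover have "r 0 \<le> 1" "r n \<le> 1" by (auto simp: r_def)
          ultimately show ?thesis using diff[of n 0] by linarith
        qed
        then have "l2_norm (s n) * r n \<le> (l2_norm (s 0) + 2) * r n" using less_imp_le[OF r(1)[of n]] by (rule mult_right_mono)
        then show ?thesis using key[OF s(1)[of n], of n] by linarith
      qed
      have "(\<lambda>n. L2_inner g0 (f n) + (l2_norm (s 0) + 2) * r n) \<longlonglongrightarrow> R g0 + (l2_norm (s 0) + 2) * 0"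
        by (intro tendsto_intros R g0 r)
      then show "(\<lambda>n. L2_inner g0 (f n) + (l2_norm (s 0) + 2) * r n) \<longlonglongrightarrow> R g0" by simp
      have "d \<le> L2_inner g0 (f n) + (l2_norm (s 0) + 2) * r n" for n
      proof -
        have "L2_inner (\<lambda>x. complex_of_real 1 *s f n x + complex_of_real 1 *s s n x) (f n) = 1 * L2_inner (f n) (f n) + 1 * L2_inner (s n) (f n)"
          by (rule L2_inner_add[OF fL VL[OF s(1)] fL])
        moreover have "(\<lambda>x. complex_of_real 1 *s f n x + complex_of_real 1 *s s n x) = g0" by (simp add: f_def fun_eq_iff)
        moreover have "d \<le> L2_inner (f n) (f n)" using dle[OF s(1)[of n]] by (simp add: D_def f_def)
        ultimately show ?thesis using sn[of n] by simp
      qed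
      then show "\<exists>N. \<forall>n\<ge>N. d \<le> L2_inner g0 (f n) + (l2_norm (s 0) + 2) * r n" by blast
    qed
    then show ?thesis using d0 by simp
  qed
  \<comment> \<open>The complex linear functional with real part \<open>R\<close>, namely R g - i
    R(i g).\<close>
  define L where "L g = Complex (R g) (- R (\<lambda>x. \<i> *s g x))" for g
  have iL: "(\<lambda>x. c *s g x) \<in> L2_space" if "g \<in> L2_space" for g c
    using L2_space_linear[OF that that, of c 0] by simp
  have iV: "(\<lambda>x. c *s g x) \<in> ?V" if "g \<in> ?V" for g c
    using Vlin[OF that that, of c 0] by simp
  have Radd: "R (\<lambda>x. u x + v x) = R u + R v" if "u \<in> L2_space" "v \<in> L2_space" for u v
    using Rlin[OF that, of 1 1] by simp
  have Rc: "R (\<lambda>x. c *s g x) = Re c * R g + Im c * R (\<lambda>x. \<i> *s g x)" if g: "g \<in> L2_space" for g c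
  proof -
    have "R (\<lambda>x. of_real (Re c) *s g x + of_real (Im c) *s (\<i> *s g x)) = Re c * R g + Im c * R (\<lambda>x. \<i> *s g x)"
      by (rule Rlin[OF g iL[OF g]])
    moreover have "of_real (Re c) *s v + of_real (Im c) *s (\<i> *s v) = c *s v" for v :: "complex^2"
      by (simp add: vec_eq_iff complex_eq_iff)
    ultimately show ?thesis by simp
  qed
  show ?thesis
  proof (rule that[of L "2 * sqrt (d + 1)"])
    fix u v a b assume uv: "u \<in> L2_space" "v \<in> L2_space"
    have 1: "R (\<lambda>x. a *s u x + b *s v x) = Re a * R u + Im a * R (\<lambda>x. \<i> *s u x) + (Re b * R v + Im b * R (\<lambda>x. \<i> *s v x))"
      using Radd[OF iL[OF uv(1), of a] iL[OF uv(2), of b]] Rc[OF uv(1), of a] Rc[OF uv(2), of b] by linarith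
    have "(\<lambda>x. \<i> *s (a *s u x + b *s v x)) = (\<lambda>x. (\<i> * a) *s u x + (\<i> * b) *s v x)"
      by (simp add: vec_eq_iff fun_eq_iff algebra_simps)
    moreover have "Re (\<i> * a) = - Im a" "Im (\<i> * a) = Re a" "Re (\<i> * b) = - Im b" "Im (\<i> * b) = Re b" by simp_all
    ultimately have 2: "R (\<lambda>x. \<i> *s (a *s u x + b *s v x)) = - Im a * R u + Re a * R (\<lambda>x. \<i> *s u x) + (- Im b * R v + Re b * R (\<lambda>x. \<i> *s v x))"
      using Radd[OF iL[OF uv(1), of "\<i> * a"] iL[OF uv(2), of "\<i> * b"]] Rc[OF uv(1), of "\<i> * a"] Rc[OF uv(2), of "\<i> * b"] by simp
    show "L (\<lambda>x. a *s u x + b *s v x) = a * L u + b * L v"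
      unfolding L_def 1 2 by (simp add: complex_eq_iff algebra_simps)
  next
    fix g assume g: "g \<in> L2_space"
    have "L2_inner (\<lambda>x. \<i> *s g x) (\<lambda>x. \<i> *s g x) = L2_inner g g"
      unfolding L2_inner_def power2_norm_eq_inner[symmetric] by (simp add: norm_smult_vec2)
    then have n: "l2_norm (\<lambda>x. \<i> *s g x) = l2_norm g" by (simp add: l2_norm_sq(3))
    have "norm (L g) \<le> \<bar>R g\<bar> + \<bar>R (\<lambda>x. \<i> *s g x)\<bar>" using cmod_le[of "L g"] by (simp add: L_def)
    then show "norm (L g) \<le> 2 * sqrt (d + 1) * l2_norm g"
      using Rbound[OF g] Rbound[OF iL[OF g, of \<i>]] unfolding n by (simp add: mult.commute)
  next
    fix v assume v: "v \<in> ?V"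
    then show "L v = 0" using RV[OF v] RV[OF iV[OF v, of \<i>]] by (simp add: L_def complex_eq_iff)
  next
    show "L g0 \<noteq> 0" using Rg0 by (simp add: L_def complex_eq_iff)
  qed
qed

section \<open>Norm comparisons and density arguments\<close>

lemma L2_space_bounded:
  assumes "f \<in> borel_measurable Leb" "\<And>x. x \<in> {0..pi} \<Longrightarrow> norm (f x) \<le> M"
  shows "f \<in> L2_space"
  unfolding L2_space_iff
proof
  show "integrable Leb (\<lambda>x. (norm (f x))\<^sup>2)"
  proof (rule Bochner_Integration.integrable_bound[OF integrable_Leb_const[of "M\<^sup>2"]])
    show "(\<lambda>x. (norm (f x))\<^sup>2) \<in> borel_measurable Leb" using assms(1) by measurable
    show "AE x in Leb. norm ((norm (f x))\<^sup>2) \<le> norm (M\<^sup>2)"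
      by (intro AE_I2) (auto simp: power_mono assms(2))
  qed
qed (rule assms(1))

lemma integrable_Leb_iff:
  fixes f :: "real \<Rightarrow> 'a::euclidean_space"
  shows "integrable Leb f \<longleftrightarrow> f absolutely_integrable_on {0..pi}"
  by (simp add: set_integrable_def integrable_restrict_space)

text \<open>Places the scalar function |f| in the first component, so that the Cauchy-Schwarz
  inequality for vector functions bounds the L1 norm of \<open>f\<close>.\<close>

lemma L2_norm_axis:
  assumes "f \<in> L2_space"
  shows "(\<lambda>x. axis 1 (complex_of_real (norm (f x)))) \<in> L2_space"
    "l2_norm (\<lambda>x. axis 1 (complex_of_real (norm (f x)))) = l2_norm f"
proof -
  have n: "norm (axis 1 c :: complex^2) = norm c" for c by (simp add: norm_vec_def L2_set_def sum_2 axis_def)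
  show "l2_norm (\<lambda>x. axis 1 (complex_of_real (norm (f x)))) = l2_norm f" by (simp add: l2_norm_def n)
  have c: "continuous_on UNIV (\<lambda>v::complex^2. axis 1 (complex_of_real (norm v)) :: complex^2)"
    by (intro bounded_linear.continuous_on[OF bounded_linear_axis] continuous_intros)
  show "(\<lambda>x. axis 1 (complex_of_real (norm (f x)))) \<in> L2_space"
    using assms borel_measurable_continuous_on[OF c, of f] by (simp add: L2_space_iff n)
qed

lemma L2_absolutely_integrable:
  assumes f: "f \<in> L2_space"
  shows "f absolutely_integrable_on {0..pi}" "integral {0..pi} (\<lambda>x. norm (f x)) \<le> sqrt pi * l2_norm f"
proof -
  have i: "integrable Leb f"
  proof (rule Bochner_Integration.integrable_bound)
    show "integrable Leb (\<lambda>x. 1 + (norm (f x))\<^sup>2)" using f by (auto simp: L2_space_iff)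
    show "f \<in> borel_measurable Leb" using f by (simp add: L2_space_iff)
    show "AE x in Leb. norm (f x) \<le> norm (1 + (norm (f x))\<^sup>2)"
    proof (intro AE_I2)
      fix x
      have "2 * norm (f x) * 1 \<le> (norm (f x))\<^sup>2 + 1\<^sup>2" by (rule sum_squares_bound)
      then have "norm (f x) \<le> 1 + (norm (f x))\<^sup>2" using norm_ge_zero[of "f x"] unfolding power_one mult_1_right by linarith
      then show "norm (f x) \<le> norm (1 + (norm (f x))\<^sup>2)" by simp
    qed
  qed
  then show a: "f absolutely_integrable_on {0..pi}" by (simp only: integrable_Leb_iff)
  let ?e = "\<lambda>x::real. axis 1 1 :: complex^2" and ?f = "\<lambda>x. axis 1 (complex_of_real (norm (f x))) :: complex^2"
  have e: "?e \<in> L2_space" by (rule L2_space_continuous) simp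
  have "\<bar>L2_inner ?e ?f\<bar> \<le> l2_norm ?e * l2_norm ?f" by (rule L2_Cauchy_Schwarz[OF L2_norm_axis(1)[OF f] e])
  moreover have "L2_inner ?e ?f = (LINT x|Leb. norm (f x))" by (simp add: L2_inner_def inner_axis_axis inner_complex_def)
  moreover have "(LINT x|Leb. norm (f x)) = integral {0..pi} (\<lambda>x. norm (f x))"
    by (rule lebesgue_integral_eq_integral) (use i in auto)
  moreover have "l2_norm ?e = sqrt pi"
  proof -
    have "norm (axis 1 1 :: complex^2) = 1" by (simp add: norm_vec_def L2_set_def sum_2 axis_def)
    moreover have "(LINT x|Leb. 1::real) = pi" by (simp add: measure_restrict_space)
    ultimately show ?thesis by (simp add: l2_norm_def)
  qed
  ultimately show "integral {0..pi} (\<lambda>x. norm (f x)) \<le> sqrt pi * l2_norm f" using L2_norm_axis(2)[OF f] by simp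
qed

lemma l2_norm_bounded:
  assumes "f \<in> L2_space" "\<And>x. x \<in> {0..pi} \<Longrightarrow> norm (f x) \<le> M" "M \<ge> 0"
  shows "l2_norm f \<le> sqrt pi * M"
proof -
  have "(LINT x|Leb. (norm (f x))\<^sup>2) \<le> (LINT x|Leb. M\<^sup>2)"
    by (rule integral_mono) (use assms in \<open>auto simp: L2_space_iff intro: power_mono\<close>)
  also have "\<dots> = pi * M\<^sup>2" by (simp add: measure_restrict_space)
  finally show ?thesis
    unfolding l2_norm_def using real_sqrt_le_mono[of _ "pi * M\<^sup>2"] assms(3) by (fastforce simp: real_sqrt_mult)
qed

lemma AE_Leb_I:
  assumes "negligible N" "\<And>x. x \<in> {0<..<pi} - N \<Longrightarrow> R x"
  shows "AE x in Leb. R x"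
proof -
  have "negligible (N \<union> {0, pi})" using assms(1) by simp
  then have "AE x in lebesgue. x \<notin> N \<union> {0, pi}"
    by (intro AE_not_in) (simp add: negligible_iff_null_sets)
  then have "AE x in lebesgue. x \<in> {0..pi} \<longrightarrow> R x"
  proof (rule eventually_mono, intro impI)
    fix x assume x: "x \<notin> N \<union> {0, pi}" "x \<in> {0..pi}"
    then have "x \<in> {0<..<pi} - N" by (auto simp: less_le)
    then show "R x" by (rule assms(2))
  qed
  then show ?thesis by (subst AE_restrict_space_iff) auto
qed

lemma AE_Leb_negligible:
  assumes "AE x in Leb. R x"
  obtains N where "negligible N" "\<And>x. x \<in> {0..pi} - N \<Longrightarrow> R x"
proof -
  have "AE x in lebesgue. x \<in> {0..pi} \<longrightarrow> R x"
    using assms by (subst (asm) AE_restrict_space_iff) auto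
  then show ?thesis
  proof (rule AE_E3)
    fix N assume "\<And>x. x \<in> space lebesgue - N \<Longrightarrow> x \<in> {0..pi} \<longrightarrow> R x" "N \<in> null_sets lebesgue"
    then show ?thesis by (intro that[of N]) (auto simp: negligible_iff_null_sets)
  qed
qed

locale L2_functional =
  fixes L :: "(real \<Rightarrow> complex^2) \<Rightarrow> complex" and C :: real
  assumes lin: "\<And>f g a b. f \<in> L2_space \<Longrightarrow> g \<in> L2_space \<Longrightarrow> L (\<lambda>x. a *s f x + b *s g x) = a * L f + b * L g"
    and bound: "\<And>f. f \<in> L2_space \<Longrightarrow> norm (L f) \<le> C * l2_norm f"
begin

lemma vanish_limit:
  assumes f: "f \<in> L2_space" and u: "\<And>n. u n \<in> L2_space" "\<And>n. L (u n) = 0"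
    and c: "AE x in Leb. (\<lambda>n. u n x) \<longlonglongrightarrow> f x" and w: "integrable Leb w"
    and d: "\<And>n. AE x in Leb. (norm (f x - u n x))\<^sup>2 \<le> w x"
  shows "L f = 0"
proof -
  have fu: "(\<lambda>x. f x - u n x) \<in> L2_space" for n by (rule L2_space_diff[OF f u(1)])
  have "(\<lambda>n. LINT x|Leb. (norm (f x - u n x))\<^sup>2) \<longlonglongrightarrow> (LINT x|Leb. (0::real))"
  proof (rule integral_dominated_convergence[where w = w])
    show "(\<lambda>x. (norm (f x - u n x))\<^sup>2) \<in> borel_measurable Leb" for n
      using fu[of n] by (intro borel_measurable_integrable) (simp add: L2_space_iff)
    show "AE x in Leb. (\<lambda>n. (norm (f x - u n x))\<^sup>2) \<longlonglongrightarrow> 0"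
      using c
    proof eventually_elim
      fix x assume "(\<lambda>n. u n x) \<longlonglongrightarrow> f x"
      then have "(\<lambda>n. (norm (f x - u n x))\<^sup>2) \<longlonglongrightarrow> (norm (f x - f x))\<^sup>2" by (intro tendsto_intros)
      then show "(\<lambda>n. (norm (f x - u n x))\<^sup>2) \<longlonglongrightarrow> 0" by simp
    qed
    show "AE x in Leb. norm ((norm (f x - u n x))\<^sup>2) \<le> w x" for n using d[of n] by simp
  qed (use w in auto)
  then have "(\<lambda>n. C * sqrt (LINT x|Leb. (norm (f x - u n x))\<^sup>2)) \<longlonglongrightarrow> C * sqrt (LINT x|Leb. (0::real))"
    by (intro tendsto_intros)
  then have lim: "(\<lambda>n. C * l2_norm (\<lambda>x. f x - u n x)) \<longlonglongrightarrow> 0" by (simp add: l2_norm_def)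
  have "norm (L f) \<le> C * l2_norm (\<lambda>x. f x - u n x)" for n
    using bound[OF fu[of n]] lin[OF f u(1), of 1 "-1" n] u(2)[of n] by simp
  then have "norm (L f) \<le> 0" by (intro LIMSEQ_le_const[OF lim]) blast
  then show ?thesis by simp
qed

text \<open>A bounded function is approximated by its Steklov means, multiplied by a cutoff which enforces the
  zero boundary values.\<close>

lemma vanish_bounded:
  assumes van: "\<And>y y'. \<lbrakk>has_ac_deriv y y' 0 pi; y 0 = 0; y pi = 0; \<And>x. x \<notin> {0..pi} \<Longrightarrow> y x = 0\<rbrakk> \<Longrightarrow> L y = 0"
    and g: "g \<in> L2_space" "\<And>x. x \<in> {0..pi} \<Longrightarrow> norm (g x) \<le> M"
  shows "L g = 0"
proof -
  \<comment> \<open>Extension by zero, because averages over [x, x + h] reach beyond pi.\<close>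
  define G where "G x = (if x \<in> {0..pi} then g x else 0)" for x
  have gi: "g absolutely_integrable_on {0..pi}" by (rule L2_absolutely_integrable[OF g(1)])
  have "G absolutely_integrable_on UNIV"
    unfolding G_def using gi by (subst absolutely_integrable_restrict_UNIV) simp
  then have Ga: "G absolutely_integrable_on {a..b}" for a b
    by (rule set_integrable_subset) auto
  have Gi: "G integrable_on {a..b}" for a b using Ga set_lebesgue_integral_eq_integral(1) by blast
  have M0: "M \<ge> 0" using order_trans[OF norm_ge_zero g(2)[of 0]] by simp
  have GM: "norm (G x) \<le> M" for x using g(2) M0 by (simp add: G_def)
  obtain N where N: "negligible N" "\<And>x. x \<notin> N \<Longrightarrow> ((\<lambda>h. integral {x..x+h} G /\<^sub>R h) \<longlongrightarrow> G x) (at_right 0)"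
    using indefinite_integral_right_derivative_ae[OF Gi] by blast
  define v where "v h x = integral {x..x+h} G /\<^sub>R h" for h x
  have vM: "norm (v h x) \<le> M" if "h > 0" for h x
  proof -
    have "norm (integral {x..x+h} G) \<le> M * (x + h - x)"
      using has_integral_bound_real[OF M0 finite.emptyI integrable_integral[OF Gi[of x "x + h"]]] that GM by simp
    then show ?thesis using that by (simp add: v_def field_simps)
  qed
  have vac: "has_ac_deriv (v h) (\<lambda>t. (G (t + h) - G t) /\<^sub>R h) 0 pi" if h: "h > 0" for h
    unfolding has_ac_deriv_def
  proof (intro conjI ballI)
    have sh: "((\<lambda>t. G (t + h)) has_integral integral {a + h..b + h} G) {a..b}" if "a \<le> b" for a b
    proof -
      have "(G has_integral integral {a + h..b + h} G) (cbox (a + h) (b + h))" using Gi[of "a+h" "b+h"] by (simp add: integrable_integral)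
      from has_integral_affinity'[OF this, of 1 h] show ?thesis by simp
    qed
    have sa: "(\<lambda>t. G (t + h)) absolutely_integrable_on {0..pi}"
    proof (rule absolutely_integrable_integrable_bound)
      show "(\<lambda>t. G (t + h)) integrable_on {0..pi}" using sh[of 0 pi] by (auto simp: integrable_on_def)
      show "(\<lambda>t::real. M) integrable_on {0..pi}" by (simp add: integrable_const_ivl)
    qed (rule GM)
    then show "(\<lambda>t. (G (t + h) - G t) /\<^sub>R h) absolutely_integrable_on {0..pi}"
      using Ga by (intro absolutely_integrable_scaleR_left set_integral_diff)
    fix x assume x: "x \<in> {0..pi}"
    have "((\<lambda>t. G (t + h) - G t) has_integral integral {0 + h..x + h} G - integral {0..x} G) {0..x}"
      using x by (intro has_integral_diff sh integrable_integral Gi) auto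
    moreover have "integral {0 + h..x + h} G - integral {0..x} G = integral {x..x + h} G - integral {0..0+h} G"
    proof -
      have "integral {0..h} G + integral {h..x + h} G = integral {0..x + h} G"
        by (rule Henstock_Kurzweil_Integration.integral_combine) (use x h Gi in auto)
      moreover have "integral {0..x} G + integral {x..x + h} G = integral {0..x + h} G"
        by (rule Henstock_Kurzweil_Integration.integral_combine) (use x h Gi in auto)
      ultimately show ?thesis by (simp add: algebra_simps)
    qed
    ultimately have "((\<lambda>t. G (t + h) - G t) has_integral integral {x..x + h} G - integral {0..0+h} G) {0..x}" by simp
    from has_integral_cmul[OF this, of "inverse h"]
    show "((\<lambda>t. (G (t + h) - G t) /\<^sub>R h) has_integral v h x - v h 0) {0..x}"
      by (simp add: v_def scaleR_diff_right)
  qed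
  \<comment> \<open>A cutoff that vanishes at 0 and pi and tends to 1 at all interior points, since
    0 \<le> 1 - sin x < 1 there.\<close>
  define \<phi> where "\<phi> n x = 1 - (1 - sin x) ^ n" for n and x :: real
  have \<phi>01: "0 \<le> \<phi> n x" "\<phi> n x \<le> 1" if "x \<in> {0..pi}" for n x
    using sin_ge_zero[of x] sin_le_one[of x] that by (auto simp: \<phi>_def power_le_one)
  have \<phi>ac: "has_ac_deriv (\<lambda>x. complex_of_real (\<phi> n x)) (\<lambda>x. complex_of_real (real n * (1 - sin x) ^ (n - 1) * cos x)) 0 pi" for n
    by (rule has_ac_deriv_C1)
      (auto simp: \<phi>_def has_real_derivative_iff_has_vector_derivative[symmetric] simp del: of_real_mult of_real_power of_real_diff
         intro!: has_vector_derivative_of_real continuous_intros derivative_eq_intros)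
  define u where "u n x = (if x \<in> {0..pi} then complex_of_real (\<phi> n x) *s v (1 / real (Suc n)) x else 0)" for n x
  have uac: "\<exists>u'. has_ac_deriv (u n) u' 0 pi" for n
  proof -
    let ?h = "1 / real (Suc n)"
    have h: "?h > 0" by simp
    have c: "has_ac_deriv (\<lambda>x. complex_of_real (\<phi> n x) * (v ?h x $ i))
       (\<lambda>x. complex_of_real (real n * (1 - sin x) ^ (n - 1) * cos x) * (v ?h x $ i) + complex_of_real (\<phi> n x) * (((G (x + ?h) - G x) /\<^sub>R ?h) $ i)) 0 pi" for i
      using pi_gt_zero by (rule has_ac_deriv_mult[OF \<phi>ac has_ac_deriv_linear[OF vac[OF h] bounded_linear_vec_nth]])
    have "has_ac_deriv (\<lambda>x. complex_of_real (\<phi> n x) *s v ?h x) (\<lambda>x. \<chi> i. complex_of_real (real n * (1 - sin x) ^ (n - 1) * cos x) * (v ?h x $ i) + complex_of_real (\<phi> n x) * (((G (x + ?h) - G x) /\<^sub>R ?h) $ i)) 0 pi"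
      by (rule has_ac_deriv_vec2) (use c[of 1] c[of 2] in simp_all)
    then show ?thesis by (auto simp: has_ac_deriv_def u_def)
  qed
  have uc: "continuous_on {0..pi} (u n)" for n using uac has_ac_deriv_continuous_on by blast
  show ?thesis
  proof (rule vanish_limit[where u = u and w = "\<lambda>x. (2 * M)\<^sup>2"])
    show "g \<in> L2_space" by (rule g)
    show "u n \<in> L2_space" for n by (rule L2_space_continuous[OF uc])
    show "L (u n) = 0" for n
    proof -
      obtain u' where u': "has_ac_deriv (u n) u' 0 pi" using uac[of n] by blast
      show ?thesis by (rule van[OF u']) (auto simp: u_def \<phi>_def)
    qed
    show "AE x in Leb. (\<lambda>n. u n x) \<longlonglongrightarrow> g x"
    proof (rule AE_Leb_I[OF N(1)])
      fix x assume x: "x \<in> {0<..<pi} - N"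
      have hn: "filterlim (\<lambda>n. 1 / real (Suc n)) (at_right 0) sequentially" by real_asymp
      have "(\<lambda>n. v (1 / real (Suc n)) x) \<longlonglongrightarrow> G x"
        unfolding v_def by (rule filterlim_compose[OF N(2) hn]) (use x in simp)
      moreover have "(\<lambda>n. \<phi> n x) \<longlonglongrightarrow> 1 - 0"
      proof -
        have "sin x > 0" using x by (intro sin_gt_zero) auto
        then show ?thesis unfolding \<phi>_def using sin_le_one[of x] by (intro tendsto_intros LIMSEQ_power_zero) simp
      qed
      ultimately have "(\<lambda>n. \<phi> n x *\<^sub>R v (1 / real (Suc n)) x) \<longlonglongrightarrow> (1 - 0) *\<^sub>R G x" by (rule tendsto_scaleR[rotated])
      moreover have "complex_of_real a *s w = a *\<^sub>R w" for a and w :: "complex^2"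
        unfolding vec_eq_iff vector_smult_component vector_scaleR_component by (simp add: scaleR_conv_of_real)
      ultimately show "(\<lambda>n. u n x) \<longlonglongrightarrow> g x" using x by (simp add: u_def G_def)
    qed
    show "AE x in Leb. (norm (g x - u n x))\<^sup>2 \<le> (2 * M)\<^sup>2" for n
    proof (rule AE_Leb_I[OF negligible_empty])
      fix x :: real assume x: "x \<in> {0<..<pi} - {}"
      have "norm (u n x) \<le> 1 * M"
        using x \<phi>01[of x n] mult_mono[of "\<phi> n x" 1 "norm (v (1 / real (Suc n)) x)" M] vM[of "1 / real (Suc n)" x]
        by (simp add: u_def norm_smult_vec2)
      then have "norm (g x - u n x) \<le> 2 * M" using g(2)[of x] x norm_triangle_ineq4[of "g x" "u n x"] by simp
      then show "(norm (g x - u n x))\<^sup>2 \<le> (2 * M)\<^sup>2" by (intro power_mono) auto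
    qed
  qed simp
qed

text \<open>Truncation by the size of the values reduces to bounded functions, with |g|^2 as
  dominating function.\<close>

lemma vanish:
  assumes van: "\<And>y y'. \<lbrakk>has_ac_deriv y y' 0 pi; y 0 = 0; y pi = 0; \<And>x. x \<notin> {0..pi} \<Longrightarrow> y x = 0\<rbrakk> \<Longrightarrow> L y = 0"
    and g: "g \<in> L2_space"
  shows "L g = 0"
proof -
  define u where "u n x = (if norm (g x) \<le> real n then g x else 0)" for n x
  have gm: "g \<in> borel_measurable Leb" using g by (simp add: L2_space_iff)
  have um: "u n \<in> borel_measurable Leb" for n unfolding u_def using gm by measurable
  have uL: "u n \<in> L2_space" for n by (rule L2_space_bounded[OF um, of _ "real n"]) (simp add: u_def)
  show ?thesis
  proof (rule vanish_limit[where u = u and w = "\<lambda>x. (norm (g x))\<^sup>2", OF g uL])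
    show "L (u n) = 0" for n by (rule vanish_bounded[OF van uL, where M = "real n"]) (auto simp: u_def)
    show "AE x in Leb. (\<lambda>n. u n x) \<longlonglongrightarrow> g x"
    proof (intro AE_I2)
      fix x
      obtain k where k: "norm (g x) \<le> real k" using real_arch_simple by blast
      have "\<forall>\<^sub>F n in sequentially. g x = u n x"
        using eventually_ge_at_top[of k] by eventually_elim (use k in \<open>auto simp: u_def\<close>)
      then show "(\<lambda>n. u n x) \<longlonglongrightarrow> g x" by (rule Lim_transform_eventually[OF tendsto_const])
    qed
    show "integrable Leb (\<lambda>x. (norm (g x))\<^sup>2)" using g by (simp add: L2_space_iff)
    show "AE x in Leb. (norm (g x - u n x))\<^sup>2 \<le> (norm (g x))\<^sup>2" for n
      by (intro AE_I2) (simp add: u_def)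
  qed
qed

end

section \<open>Completeness\<close>

context dirac_potential
begin

section \<open>The operator domain and the integral form of the equation\<close>

lemma dirac_expr_eq:
  assumes "vector_derivative y (at x) = dirac_rhs P Q l x (y x) + inv_B v"
  shows "dirac_expr P Q y x - l *s y x = v"
  unfolding dirac_expr_def assms
  by (simp add: vec_eq_iff forall_2 B_mat_def V_mat_def matrix_vector_mult_def sum_2 algebra_simps)

lemma dirac_expr_eq_imp:
  assumes "dirac_expr P Q y x - l *s y x = v"
  shows "vector_derivative y (at x) = dirac_rhs P Q l x (y x) + inv_B v"
  unfolding assms[symmetric] dirac_expr_def
  by (simp add: vec_eq_iff forall_2 B_mat_def V_mat_def matrix_vector_mult_def sum_2 algebra_simps)

lemma has_ac_deriv_spike:
  assumes f: "has_ac_deriv f f' a b" and N: "negligible N" and eq: "\<And>x. x \<in> {a..b} - N \<Longrightarrow> h x = f' x"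
  shows "has_ac_deriv f h a b"
  unfolding has_ac_deriv_def
proof (intro conjI ballI)
  show "h absolutely_integrable_on {a..b}"
    by (rule absolutely_integrable_spike[OF _ N]) (use f eq in \<open>auto simp: has_ac_deriv_def\<close>)
  show "(h has_integral f x - f a) {a..x}" if "x \<in> {a..b}" for x
    by (rule has_integral_spike[OF N]) (use f eq that in \<open>auto simp: has_ac_deriv_def\<close>)
qed

lemma dirac_solution_AE:
  assumes y: "dirac_solution l z y"
  shows "AE x in Leb. dirac_expr P Q y x - l *s y x = z x"
proof -
  have "has_ac_deriv y (\<lambda>t. dirac_rhs P Q l t (y t) + inv_B (z t)) 0 pi" using y by (simp add: dirac_solution_def)
  then obtain N where N: "negligible N"
    "\<And>x. x \<in> {0<..<pi} - N \<Longrightarrow> (y has_vector_derivative dirac_rhs P Q l x (y x) + inv_B (z x)) (at x)"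
    by (rule has_ac_deriv_ae_derivative) blast
  show ?thesis
    by (rule AE_Leb_I[OF N(1)]) (intro dirac_expr_eq vector_derivative_at N(2))
qed

lemma dirac_solution_domain:
  assumes y: "dirac_solution l z y" and z: "continuous_on {0..pi} z" and bc: "\<And>j. bform A j y = 0"
  shows "y \<in> dirac_domain P Q A"
  unfolding dirac_domain_def
proof (intro CollectI conjI allI impI bc)
  have ac: "has_ac_deriv y (\<lambda>t. dirac_rhs P Q l t (y t) + inv_B (z t)) 0 pi" using y by (simp add: dirac_solution_def)
  show "absolutely_continuous_on_interval 0 pi (\<lambda>x. y x $ i)" for i
    by (rule has_ac_deriv_imp_absolutely_continuous[OF has_ac_deriv_linear[OF ac bounded_linear_vec_nth]])
  show "y x = 0" if "x \<notin> {0..pi}" for x using y that by (simp add: dirac_solution_def)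
  let ?w = "\<lambda>x. 1 *s z x + l *s y x"
  have w: "?w \<in> L2_space"
    by (intro L2_space_linear L2_space_continuous z dirac_solution_continuous[OF y])
  have ae: "AE x in Leb. ?w x = dirac_expr P Q y x"
    using dirac_solution_AE[OF y] by eventually_elim (simp add: algebra_simps)
  \<comment> \<open>\<open>dirac_expr\<close> is arbitrary where the derivative fails to exist. It
    agrees almost everywhere with a measurable function, and completeness of Lebesgue measure makes
    it measurable; the indicator moves the argument to \<open>lebesgue\<close>.\<close>
  have m: "dirac_expr P Q y \<in> borel_measurable Leb"
  proof -
    have "AE x in lebesgue. indicator {0..pi} x *\<^sub>R ?w x = indicator {0..pi} x *\<^sub>R dirac_expr P Q y x"
      using ae by (subst (asm) AE_restrict_space_iff) (auto elim!: eventually_mono simp: indicator_def)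
    moreover have "(\<lambda>x. indicator {0..pi} x *\<^sub>R ?w x) \<in> borel_measurable lebesgue"
      using w by (simp add: L2_space_iff borel_measurable_restrict_space_iff)
    ultimately show ?thesis by (subst borel_measurable_restrict_space_iff) (auto intro: borel_measurable_AE)
  qed
  show "dirac_expr P Q y \<in> L2_space"
    unfolding L2_space_iff
  proof
    show "integrable Leb (\<lambda>x. (norm (dirac_expr P Q y x))\<^sup>2)"
    proof (rule integrable_cong_AE_imp)
      show "integrable Leb (\<lambda>x. (norm (?w x))\<^sup>2)" using w by (simp add: L2_space_iff)
      show "(\<lambda>x. (norm (dirac_expr P Q y x))\<^sup>2) \<in> borel_measurable Leb" using m by measurable
      show "AE x in Leb. (norm (?w x))\<^sup>2 = (norm (dirac_expr P Q y x))\<^sup>2" using ae by eventually_elim simp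
    qed
  qed (rule m)
qed

text \<open>Here the epsilon-delta condition is converted: each component has a density, which
  equals the pointwise derivative almost everywhere, so the differential equation identifies
  it.\<close>

lemma domain_dirac_solution:
  assumes y: "y \<in> dirac_domain P Q A" and z: "AE x in Leb. dirac_expr P Q y x - l *s y x = z x"
  shows "dirac_solution l z y"
proof -
  have ac: "\<exists>f'. has_ac_deriv (\<lambda>x. y x $ i) f' 0 pi" for i
    using y pi_gt_zero by (intro absolutely_continuous_has_ac_deriv) (auto simp: dirac_domain_def)
  obtain f1 where f1: "has_ac_deriv (\<lambda>x. y x $ 1) f1 0 pi" using ac[of 1] by blast
  obtain f2 where f2: "has_ac_deriv (\<lambda>x. y x $ 2) f2 0 pi" using ac[of 2] by blast
  define f where "f x = (vector [f1 x, f2 x] :: complex^2)" for x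
  have f: "has_ac_deriv y f 0 pi" by (rule has_ac_deriv_vec2) (use f1 f2 in \<open>simp_all add: f_def\<close>)
  obtain N where N: "negligible N" "\<And>x. x \<in> {0<..<pi} - N \<Longrightarrow> (y has_vector_derivative f x) (at x)"
    by (rule has_ac_deriv_ae_derivative[OF f]) blast
  obtain M where M: "negligible M" "\<And>x. x \<in> {0..pi} - M \<Longrightarrow> dirac_expr P Q y x - l *s y x = z x"
    by (rule AE_Leb_negligible[OF z]) blast
  have "has_ac_deriv y (\<lambda>t. dirac_rhs P Q l t (y t) + inv_B (z t)) 0 pi"
  proof (rule has_ac_deriv_spike[OF f])
    show "negligible (N \<union> M \<union> {0, pi})" using N(1) M(1) by simp
    fix x assume "x \<in> {0..pi} - (N \<union> M \<union> {0, pi})"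
    then have x: "x \<in> {0<..<pi} - N" "x \<in> {0..pi} - M" by (auto simp: less_le)
    show "dirac_rhs P Q l x (y x) + inv_B (z x) = f x"
      using dirac_expr_eq_imp[OF M(2)[OF x(2)]] vector_derivative_at[OF N(2)[OF x(1)]] by simp
  qed
  then show ?thesis using y by (simp add: dirac_solution_def dirac_domain_def)
qed

lemma dirac_system_upper:
  fixes g y :: "real \<Rightarrow> complex^2"
  assumes "dirac_solution l g y"
  shows "dirac_system (\<i> * l) (\<lambda>t. - \<i> * P t) (\<lambda>t. \<i> * Q t) (\<lambda>t. \<i> * g t $ 1) (\<lambda>t. - \<i> * g t $ 2) (\<lambda>t. y t $ 1) (\<lambda>t. y t $ 2)"
  unfolding dirac_system_def
proof
  have y: "has_ac_deriv y (\<lambda>t. dirac_rhs P Q l t (y t) + inv_B (g t)) 0 pi" using assms by (simp add: dirac_solution_def)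
  show "has_ac_deriv (\<lambda>t. y t $ 1) (\<lambda>t. \<i> * l * y t $ 1 + (- \<i> * P t * y t $ 2 + \<i> * g t $ 1)) 0 pi"
    by (rule has_ac_deriv_cong[OF has_ac_deriv_linear[OF y bounded_linear_vec_nth]]) (simp add: algebra_simps)
  show "has_ac_deriv (\<lambda>t. y t $ 2) (\<lambda>t. - (\<i> * l) * y t $ 2 + (\<i> * Q t * y t $ 1 + - \<i> * g t $ 2)) 0 pi"
    by (rule has_ac_deriv_cong[OF has_ac_deriv_linear[OF y bounded_linear_vec_nth]]) (simp add: algebra_simps)
qed

text \<open>Exchanging the components reverses the sign of \<omega>; the lower half plane is thereby
  treated as the upper one.\<close>

lemma dirac_system_lower:
  fixes g y :: "real \<Rightarrow> complex^2"
  assumes "dirac_solution l g y"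
  shows "dirac_system (- \<i> * l) (\<lambda>t. \<i> * Q t) (\<lambda>t. - \<i> * P t) (\<lambda>t. - \<i> * g t $ 2) (\<lambda>t. \<i> * g t $ 1) (\<lambda>t. y t $ 2) (\<lambda>t. y t $ 1)"
  using dirac_system_upper[OF assms] by (simp add: dirac_system_def)

end

section \<open>Resolvent estimates for the boundary value problem\<close>

lemma kernel_bound_unit:
  assumes "kernel_bound s k K" "norm c = 1"
  shows "kernel_bound s (\<lambda>t. c * k t) K"
  using assms by (simp add: kernel_bound_def norm_mult)

lemma kernel_bound_mono: "kernel_bound s k K \<Longrightarrow> K \<le> K' \<Longrightarrow> kernel_bound s k K'"
  unfolding kernel_bound_def by (meson order_trans)

lemma kernel_bound_zero: "kernel_bound s (\<lambda>t. 0) 0"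
  by (simp add: kernel_bound_def)

text \<open>The sign \<open>\<sigma>\<close> selects the half plane in which the resolvent is bounded; on the opposite imaginary
  half axis it grows at most polynomially.\<close>

locale dirac_estimates = dirac_problem +
  fixes \<sigma> :: real
  assumes sign: "\<sigma> = 1 \<or> \<sigma> = -1"
    and half_plane: "\<exists>s0>0. \<exists>C\<ge>0. \<forall>l g y K. \<sigma> * Im l \<ge> s0 \<longrightarrow> dirac_solution l g y \<longrightarrow> (\<forall>j. bform A j y = 0) \<longrightarrow>
       g absolutely_integrable_on {0..pi} \<longrightarrow> (\<forall>i. kernel_bound (\<sigma> * Im l) (\<lambda>t. g t $ i) K) \<longrightarrow>
       (\<forall>x\<in>{0..pi}. norm (y x) \<le> C * K)"
    and ray: "\<exists>T\<ge>1. \<exists>C\<ge>0. \<exists>N::nat. \<forall>\<tau> g y K. \<tau> \<ge> T \<longrightarrow> dirac_solution (- \<i> * of_real (\<sigma> * \<tau>)) g y \<longrightarrow> (\<forall>j. bform A j y = 0) \<longrightarrow>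
       g absolutely_integrable_on {0..pi} \<longrightarrow> (\<forall>i. kernel_bound \<tau> (\<lambda>t. g t $ i) K) \<longrightarrow> K \<ge> 0 \<longrightarrow>
       (\<forall>x\<in>{0..pi}. norm (y x) \<le> C * \<tau> ^ N * K)"

text \<open>The components \<open>a\<close>, \<open>b\<close> and the sign \<sigma> are left free so
  that both cases of the theorem are instances; \<open>system\<close> says that in this order the
  scalar form has \<omega> = i \<sigma> l.\<close>

lemma (in dirac_problem) estimates_system:
  fixes a b :: 2
  assumes sign: "\<sigma> = 1 \<or> \<sigma> = -1" and ab: "a \<noteq> b" and c: "norm c1 = 1" "norm c2 = 1"
    and system: "\<And>l g y. dirac_solution l g y \<Longrightarrow>
      dirac_system (\<i> * of_real \<sigma> * l) p q (\<lambda>t. c1 * g t $ a) (\<lambda>t. c2 * g t $ b) (\<lambda>t. y t $ a) (\<lambda>t. y t $ b)"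
    and p: "p absolutely_integrable_on {0..pi}" and q: "q absolutely_integrable_on {0..pi}"
    and bc: "\<And>y :: real \<Rightarrow> complex^2. (\<forall>j. bform A j y = 0) \<Longrightarrow> y 0 $ a = \<alpha> * y pi $ a \<and> y pi $ b = \<beta> * y 0 $ b"
    and \<alpha>\<beta>: "\<alpha> * \<beta> = 0"
    and \<rho>: "\<rho> > 0" "\<rho>' > 0" and \<nu>: "\<nu> \<noteq> 0" "\<nu>' \<noteq> 0"
    and lim: "((\<lambda>h. integral {0..h} p / complex_of_real (h powr \<rho>)) \<longlongrightarrow> \<nu>) (at_right 0)"
    and lim': "((\<lambda>h. integral {pi - h..pi} q / complex_of_real (h powr \<rho>')) \<longlongrightarrow> \<nu>') (at_right 0)"
  shows "dirac_estimates P Q A \<sigma>"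
proof unfold_locales
  have split: "norm (y x) \<le> 2 * M" if "norm (y x $ a) \<le> M \<and> norm (y x $ b) \<le> M" for y :: "real \<Rightarrow> complex^2" and x M
    using norm_vec2_le[of "y x"] that ab exhaust_2[of a] exhaust_2[of b] by auto
  have g: "(\<lambda>t. c1 * g t $ a) absolutely_integrable_on {0..pi}" "(\<lambda>t. c2 * g t $ b) absolutely_integrable_on {0..pi}"
    if "g absolutely_integrable_on {0..pi}" for g :: "real \<Rightarrow> complex^2"
    by (rule set_integrable_mult_right, rule absolutely_integrable_vec_nth[OF that])+
  have kb: "kernel_bound s (\<lambda>t. c1 * g t $ a) K" "kernel_bound s (\<lambda>t. c2 * g t $ b) K"
    if "\<forall>i. kernel_bound s (\<lambda>t. g t $ i) K" for s K and g :: "real \<Rightarrow> complex^2"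
    using that c by (auto intro: kernel_bound_unit)
  have \<sigma>2: "complex_of_real \<sigma> * complex_of_real \<sigma> = 1" using sign by auto
  obtain s0 C where s0: "s0 > 0" "C \<ge> 0"
    "\<And>\<omega> k1 k2 u1 u2 K x. Re \<omega> \<le> - s0 \<Longrightarrow> dirac_system \<omega> p q k1 k2 u1 u2 \<Longrightarrow>
       k1 absolutely_integrable_on {0..pi} \<Longrightarrow> k2 absolutely_integrable_on {0..pi} \<Longrightarrow>
       kernel_bound (- Re \<omega>) k1 K \<Longrightarrow> kernel_bound (- Re \<omega>) k2 K \<Longrightarrow>
       u1 0 = \<alpha> * u1 pi \<Longrightarrow> u2 pi = \<beta> * u2 0 \<Longrightarrow> x \<in> {0..pi} \<Longrightarrow> norm (u1 x) \<le> C * K \<and> norm (u2 x) \<le> C * K"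
    by (rule half_plane_estimate[OF p q, where \<alpha> = \<alpha> and \<beta> = \<beta>]) (rule that; assumption)
  show "\<exists>s0>0. \<exists>C\<ge>0. \<forall>l g y K. \<sigma> * Im l \<ge> s0 \<longrightarrow> dirac_solution l g y \<longrightarrow> (\<forall>j. bform A j y = 0) \<longrightarrow>
       g absolutely_integrable_on {0..pi} \<longrightarrow> (\<forall>i. kernel_bound (\<sigma> * Im l) (\<lambda>t. g t $ i) K) \<longrightarrow>
       (\<forall>x\<in>{0..pi}. norm (y x) \<le> C * K)"
  proof (rule exI[of _ s0], rule conjI, rule s0, rule exI[of _ "2 * C"], intro conjI allI impI ballI)
    fix l :: complex and g y :: "real \<Rightarrow> complex^2" and K x :: real
    assume l: "\<sigma> * Im l \<ge> s0" and y: "dirac_solution l g y" and b: "\<forall>j. bform A j y = 0" and gi: "g absolutely_integrable_on {0..pi}"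
      and k: "\<forall>i. kernel_bound (\<sigma> * Im l) (\<lambda>t. g t $ i) K" and x: "x \<in> {0..pi}"
    have "norm (y x $ a) \<le> C * K \<and> norm (y x $ b) \<le> C * K"
      by (rule s0(3)[OF _ system[OF y] g[OF gi]]) (use l bc[OF b] x kb[OF k] in auto)
    then show "norm (y x) \<le> 2 * C * K" using split[of y x "C * K"] by simp
  qed (use s0 in simp)
  have f: "\<exists>f1 f2. dirac_system (of_real \<tau>) p q (\<lambda>t. 0) (\<lambda>t. 0) f1 f2 \<and> f1 0 = axis j 1 $ a \<and> f2 0 = axis j 1 $ b" for \<tau> :: real and j :: 2
  proof -
    let ?l = "- \<i> * of_real (\<sigma> * \<tau>)"
    have "\<i> * of_real \<sigma> * ?l = of_real \<tau>" using \<sigma>2 by (simp add: algebra_simps)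
    then show ?thesis using system[OF fund(1)[of ?l j]] fund(2)[of ?l j]
      by (intro exI[of _ "\<lambda>t. fund ?l j t $ a"] exI[of _ "\<lambda>t. fund ?l j t $ b"]) simp
  qed
  have f1: "\<exists>f1 f2. dirac_system (of_real \<tau>) p q (\<lambda>t. 0) (\<lambda>t. 0) f1 f2 \<and> f1 0 = 1 \<and> f2 0 = 0" for \<tau> :: real
    using f[of \<tau> a] ab by (simp add: axis_def)
  have f2: "\<exists>f1 f2. dirac_system (of_real \<tau>) p q (\<lambda>t. 0) (\<lambda>t. 0) f1 f2 \<and> f1 0 = 0 \<and> f2 0 = 1" for \<tau> :: real
    using f[of \<tau> b] ab by (simp add: axis_def)
  obtain T C N where T: "T \<ge> 1" "C \<ge> 0"
    "\<And>(\<tau>::real) k1 k2 u1 u2 K x. \<tau> \<ge> T \<Longrightarrow> dirac_system (of_real \<tau>) p q k1 k2 u1 u2 \<Longrightarrow>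
       k1 absolutely_integrable_on {0..pi} \<Longrightarrow> k2 absolutely_integrable_on {0..pi} \<Longrightarrow>
       kernel_bound \<tau> k1 K \<Longrightarrow> kernel_bound \<tau> k2 K \<Longrightarrow> K \<ge> 0 \<Longrightarrow>
       u1 0 = \<alpha> * u1 pi \<Longrightarrow> u2 pi = \<beta> * u2 0 \<Longrightarrow> x \<in> {0..pi} \<Longrightarrow>
       norm (u1 x) \<le> C * \<tau> ^ N * K \<and> norm (u2 x) \<le> C * \<tau> ^ N * K"
    by (rule ray_estimate[OF p q \<rho> \<nu> lim lim' \<alpha>\<beta> f1 f2]) (rule that; assumption)
  show "\<exists>T\<ge>1. \<exists>C\<ge>0. \<exists>N::nat. \<forall>\<tau> g y K. \<tau> \<ge> T \<longrightarrow> dirac_solution (- \<i> * of_real (\<sigma> * \<tau>)) g y \<longrightarrow> (\<forall>j. bform A j y = 0) \<longrightarrow>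
       g absolutely_integrable_on {0..pi} \<longrightarrow> (\<forall>i. kernel_bound \<tau> (\<lambda>t. g t $ i) K) \<longrightarrow> K \<ge> 0 \<longrightarrow>
       (\<forall>x\<in>{0..pi}. norm (y x) \<le> C * \<tau> ^ N * K)"
  proof (rule exI[of _ T], rule conjI, rule T, rule exI[of _ "2 * C"], rule conjI, use T in simp, rule exI[of _ N], intro allI impI ballI)
    fix \<tau> K x :: real and g y :: "real \<Rightarrow> complex^2"
    assume l: "\<tau> \<ge> T" and y: "dirac_solution (- \<i> * of_real (\<sigma> * \<tau>)) g y" and b: "\<forall>j. bform A j y = 0" and gi: "g absolutely_integrable_on {0..pi}"
      and k: "\<forall>i. kernel_bound \<tau> (\<lambda>t. g t $ i) K" and K: "K \<ge> 0" and x: "x \<in> {0..pi}"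
    have ds: "dirac_system (of_real \<tau>) p q (\<lambda>t. c1 * g t $ a) (\<lambda>t. c2 * g t $ b) (\<lambda>t. y t $ a) (\<lambda>t. y t $ b)"
    proof -
      have "\<i> * of_real \<sigma> * (- \<i> * of_real (\<sigma> * \<tau>)) = complex_of_real \<tau>" using \<sigma>2 by (simp add: algebra_simps)
      then show ?thesis using system[OF y] by simp
    qed
    have "norm (y x $ a) \<le> C * \<tau> ^ N * K \<and> norm (y x $ b) \<le> C * \<tau> ^ N * K"
      by (rule T(3)[OF l ds g[OF gi] kb[OF k] K]) (use bc[OF b] x in auto)
    then show "norm (y x) \<le> 2 * C * \<tau> ^ N * K" using split[of y x "C * \<tau> ^ N * K"] by (simp add: mult.assoc)
  qed
qed (rule sign)

lemma (in dirac_problem) estimates_upper: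
  assumes bc: "\<And>y :: real \<Rightarrow> complex^2. (\<forall>j. bform A j y = 0) \<Longrightarrow> y 0 $ 1 = \<alpha> * y pi $ 1 \<and> y pi $ 2 = \<beta> * y 0 $ 2" and ab: "\<alpha> * \<beta> = 0"
    and \<rho>: "\<rho> > 0" "\<rho>' > 0" and \<nu>: "\<nu> \<noteq> 0" "\<nu>' \<noteq> 0"
    and lim: "((\<lambda>h. integral {0..h} P / complex_of_real (h powr \<rho>)) \<longlongrightarrow> \<nu>) (at_right 0)"
    and lim': "((\<lambda>h. integral {pi - h..pi} Q / complex_of_real (h powr \<rho>')) \<longlongrightarrow> \<nu>') (at_right 0)"
  shows "dirac_estimates P Q A 1"
proof (rule estimates_system[OF _ _ _ _ _ _ _ bc ab \<rho>])
  show "((\<lambda>h. integral {0..h} (\<lambda>t. - \<i> * P t) / complex_of_real (h powr \<rho>)) \<longlongrightarrow> - \<i> * \<nu>) (at_right 0)"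
    using tendsto_mult_left[OF lim, of "- \<i>"] by simp
  show "((\<lambda>h. integral {pi - h..pi} (\<lambda>t. \<i> * Q t) / complex_of_real (h powr \<rho>')) \<longlongrightarrow> \<i> * \<nu>') (at_right 0)"
    using tendsto_mult_left[OF lim', of "\<i>"] by simp
  show "dirac_system (\<i> * of_real 1 * l) (\<lambda>t. - \<i> * P t) (\<lambda>t. \<i> * Q t) (\<lambda>t. \<i> * g t $ 1) (\<lambda>t. - \<i> * g t $ 2) (\<lambda>t. y t $ 1) (\<lambda>t. y t $ 2)"
    if "dirac_solution l g y" for l and g y :: "real \<Rightarrow> complex^2" using dirac_system_upper[OF that] by simp
  show "(\<lambda>t. - \<i> * P t) absolutely_integrable_on {0..pi}" "(\<lambda>t. \<i> * Q t) absolutely_integrable_on {0..pi}"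
    by (rule set_integrable_mult_right, rule P Q)+
qed (use \<nu> in auto)

lemma (in dirac_problem) estimates_lower:
  assumes bc: "\<And>y :: real \<Rightarrow> complex^2. (\<forall>j. bform A j y = 0) \<Longrightarrow> y 0 $ 2 = \<alpha> * y pi $ 2 \<and> y pi $ 1 = \<beta> * y 0 $ 1" and ab: "\<alpha> * \<beta> = 0"
    and \<rho>: "\<rho> > 0" "\<rho>' > 0" and \<nu>: "\<nu> \<noteq> 0" "\<nu>' \<noteq> 0"
    and lim: "((\<lambda>h. integral {0..h} Q / complex_of_real (h powr \<rho>)) \<longlongrightarrow> \<nu>) (at_right 0)"
    and lim': "((\<lambda>h. integral {pi - h..pi} P / complex_of_real (h powr \<rho>')) \<longlongrightarrow> \<nu>') (at_right 0)"
  shows "dirac_estimates P Q A (-1)"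
proof (rule estimates_system[OF _ _ _ _ _ _ _ bc ab \<rho>])
  show "((\<lambda>h. integral {0..h} (\<lambda>t. \<i> * Q t) / complex_of_real (h powr \<rho>)) \<longlongrightarrow> \<i> * \<nu>) (at_right 0)"
    using tendsto_mult_left[OF lim, of "\<i>"] by simp
  show "((\<lambda>h. integral {pi - h..pi} (\<lambda>t. - \<i> * P t) / complex_of_real (h powr \<rho>')) \<longlongrightarrow> - \<i> * \<nu>') (at_right 0)"
    using tendsto_mult_left[OF lim', of "- \<i>"] by simp
  show "dirac_system (\<i> * of_real (-1) * l) (\<lambda>t. \<i> * Q t) (\<lambda>t. - \<i> * P t) (\<lambda>t. - \<i> * g t $ 2) (\<lambda>t. \<i> * g t $ 1) (\<lambda>t. y t $ 2) (\<lambda>t. y t $ 1)"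
    if "dirac_solution l g y" for l and g y :: "real \<Rightarrow> complex^2" using dirac_system_lower[OF that] by simp
  show "(\<lambda>t. \<i> * Q t) absolutely_integrable_on {0..pi}" "(\<lambda>t. - \<i> * P t) absolutely_integrable_on {0..pi}"
    by (rule set_integrable_mult_right, rule P Q)+
qed (use \<nu> in auto)

section \<open>Root functions and zeros of the determinant\<close>

context dirac_problem
begin

lemma root_kernel_solution:
  assumes "\<And>k. k < n \<Longrightarrow> dirac_solution l (if k = 0 then (\<lambda>t. 0) else z (k - 1)) (z k)"
    and bc: "\<And>k j. k < n \<Longrightarrow> bform A j (z k) = 0" and "k < n"
  shows "z k \<in> root_kernel P Q A l (Suc k)"
  using assms(3)
proof (induction k)
  case 0
  have y: "dirac_solution l (\<lambda>t. 0) (z 0)" using assms(1)[OF 0] by simp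
  have "z 0 \<in> dirac_domain P Q A" by (rule dirac_solution_domain[OF y]) (simp_all add: bc[OF 0])
  then show ?case using dirac_solution_AE[OF y] by (simp add: zero_fun_def)
next
  case (Suc k)
  have y: "dirac_solution l (z k) (z (Suc k))" using assms(1)[OF Suc.prems] by simp
  have c: "continuous_on {0..pi} (z k)" using dirac_solution_continuous assms(1)[of k] Suc.prems by simp
  have "z (Suc k) \<in> dirac_domain P Q A" by (rule dirac_solution_domain[OF y c]) (simp add: bc[OF Suc.prems])
  then show ?case using dirac_solution_AE[OF y] Suc.IH Suc.prems unfolding root_kernel.simps(2)[of P Q A l "Suc k"] by auto
qed

text \<open>Covers zeros of the determinant in the chain argument without identifying them with
  eigenvalues: away from \<open>eigenvalues\<close> every chain is zero, and a functional vanishes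
  on it trivially.\<close>

lemma root_kernel_not_eigenvalue:
  assumes "l \<notin> eigenvalues P Q A" "y \<in> root_kernel P Q A l n"
  shows "y = 0"
  using assms(2)
proof (induction n arbitrary: y)
  case 0 then show ?case by simp
next
  case (Suc n)
  then obtain z where z: "y \<in> dirac_domain P Q A" "z \<in> root_kernel P Q A l n"
    "AE x in Leb. dirac_expr P Q y x - l *s y x = z x" by auto
  have "z = 0" by (rule Suc.IH[OF z(2)])
  then have "AE x in Leb. dirac_expr P Q y x = l *s y x" using z(3) by simp
  then show ?case using assms(1) z(1) unfolding eigenvalues_def by blast
qed

text \<open>Below the order of the determinant the Taylor coefficients of the numerator lose the
  contribution of \<open>g\<close> and form a chain of root functions, on which \<open>L\<close> is
  zero by assumption.\<close>

lemma numer_coeff_root_function: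
  assumes g: "g absolutely_integrable_on {0..pi}" and L: "sup_functional L"
    and van: "\<And>l y. l \<in> eigenvalues P Q A \<Longrightarrow> y \<in> root_subspace P Q A l \<Longrightarrow> L y = 0"
    and k: "k < subdegree (fps_expansion char_det m)"
  shows "fps_nth (fps_expansion (\<lambda>l. L (numer l g)) m) k = 0"
proof -
  obtain z where z:
    "\<And>k. dirac_solution m (\<lambda>t. fps_nth (fps_expansion char_det m) k *s g t + (if k = 0 then 0 else z (k-1) t)) (z k)"
    "\<And>k j. bform A j (z k) = 0"
    "\<And>L. sup_functional L \<Longrightarrow> (\<lambda>w. L (numer (m + w) g)) has_fps_expansion Abs_fps (\<lambda>k. L (z k))"
    using numer_taylor[OF g, of m] by blast
  have zk: "z k \<in> root_kernel P Q A m (Suc k)"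
  proof (rule root_kernel_solution[OF _ z(2) k])
    fix i assume "i < subdegree (fps_expansion char_det m)"
    then have "fps_nth (fps_expansion char_det m) i = 0" by (rule nth_less_subdegree_zero)
    then have "(\<lambda>t. fps_nth (fps_expansion char_det m) i *s g t + (if i = 0 then 0 else z (i-1) t)) = (if i = 0 then (\<lambda>t. 0) else z (i - 1))"
      by (auto simp: fun_eq_iff)
    then show "dirac_solution m (if i = 0 then (\<lambda>t. 0) else z (i - 1)) (z i)" using z(1)[of i] by simp
  qed
  have "L (z k) = 0"
  proof (cases "m \<in> eigenvalues P Q A")
    case True then show ?thesis using zk by (intro van[OF True]) (auto simp: root_subspace_def simp del: root_kernel.simps)
  next
    case False
    then have "z k = 0" using zk by (rule root_kernel_not_eigenvalue)
    then show ?thesis using sup_functional_zero[OF L] by (simp add: zero_fun_def)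
  qed
  moreover have "(\<lambda>w. L (numer (m + w) g)) has_fps_expansion fps_expansion (\<lambda>l. L (numer l g)) m"
    using numer_holomorphic[OF L g] by (intro analytic_at_imp_has_fps_expansion) (auto intro: holomorphic_on_imp_analytic_at)
  then have "fps_expansion (\<lambda>l. L (numer l g)) m = Abs_fps (\<lambda>k. L (z k))"
    using z(3)[OF L] fps_expansion_unique_complex by blast
  ultimately show ?thesis by (simp add: fps_nth_inverse)
qed

lemma char_det_zero_solution:
  assumes "char_det l = 0"
  obtains y where "dirac_solution l (\<lambda>t. 0) y" "\<And>j. bform A j y = 0" "y 0 \<noteq> 0"
proof -
  let ?m = "\<lambda>j k. bform A j (fund l k)"
  have det: "?m 1 1 * ?m 2 2 = ?m 1 2 * ?m 2 1" using assms by (simp add: char_det_def)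
  note result = that
  have sol: thesis if c: "\<And>j. c1 * ?m j 1 + c2 * ?m j 2 = 0" "c1 \<noteq> 0 \<or> c2 \<noteq> 0" for c1 c2
  proof (rule result[where y = "\<lambda>t. c1 *s fund l 1 t + c2 *s fund l 2 t"])
    show "dirac_solution l (\<lambda>t. 0) (\<lambda>t. c1 *s fund l 1 t + c2 *s fund l 2 t)"
      using dirac_solution_linear[OF fund(1)[of l 1] fund(1)[of l 2], of c1 c2] by simp
    show "bform A j (\<lambda>t. c1 *s fund l 1 t + c2 *s fund l 2 t) = 0" for j unfolding bform_linear by (rule c)
    show "c1 *s fund l 1 0 + c2 *s fund l 2 0 \<noteq> 0" using c(2) by (auto simp: fund(2) vec_eq_iff forall_2 axis_def)
  qed
  consider "?m 1 1 \<noteq> 0 \<or> ?m 1 2 \<noteq> 0" | "?m 1 1 = 0" "?m 1 2 = 0" "?m 2 1 \<noteq> 0 \<or> ?m 2 2 \<noteq> 0"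
    | "?m 1 1 = 0" "?m 1 2 = 0" "?m 2 1 = 0" "?m 2 2 = 0" by blast
  then show thesis
  proof cases
    case 1
    show ?thesis
    proof (rule sol[of "?m 1 2" "- ?m 1 1"])
      show "?m 1 2 * ?m j 1 + - ?m 1 1 * ?m j 2 = 0" for j using exhaust_2[of j] det by (auto simp: algebra_simps)
    qed (use 1 in auto)
  next
    case 2
    show ?thesis
    proof (rule sol[of "?m 2 2" "- ?m 2 1"])
      show "?m 2 2 * ?m j 1 + - ?m 2 1 * ?m j 2 = 0" for j using exhaust_2[of j] 2 by (auto simp: algebra_simps)
    qed (use 2 in auto)
  next
    case 3
    show ?thesis
    proof (rule sol[of 1 0])
      show "1 * ?m j 1 + 0 * ?m j 2 = 0" for j using exhaust_2[of j] 3 by auto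
    qed simp
  qed
qed

lemma solution_of_numer:
  assumes g: "g absolutely_integrable_on {0..pi}" and D: "char_det l \<noteq> 0"
  obtains y where "dirac_solution l g y" "\<And>j. bform A j y = 0" "numer l g = (\<lambda>t. char_det l *s y t)"
proof (rule that)
  let ?y = "\<lambda>t. (1 / char_det l) *s numer l g t + 0 *s numer l g t"
  have "dirac_solution l (\<lambda>t. (1 / char_det l) *s (char_det l *s g t) + 0 *s (char_det l *s g t)) ?y"
    by (rule dirac_solution_linear[OF numer(1)[OF g] numer(1)[OF g]])
  then show "dirac_solution l g ?y" using D by simp
  show "bform A j ?y = 0" for j unfolding bform_linear numer(2)[OF g] by simp
  show "numer l g = (\<lambda>t. char_det l *s ?y t)" using D by simp
qed

end

context L2_functional
begin

lemma sup_functional: "dirac_potential P Q \<Longrightarrow> dirac_potential.sup_functional L"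
  unfolding dirac_potential.sup_functional_def
proof (intro conjI allI impI exI)
  fix y z :: "real \<Rightarrow> complex^2" and a b
  assume "continuous_on {0..pi} y" "continuous_on {0..pi} z"
  then show "L (\<lambda>t. a *s y t + b *s z t) = a * L y + b * L z" by (intro lin L2_space_continuous)
next
  fix y :: "real \<Rightarrow> complex^2" and M
  assume y: "continuous_on {0..pi} y" and M: "\<forall>x\<in>{0..pi}. norm (y x) \<le> M"
  have M0: "M \<ge> 0" using order_trans[OF norm_ge_zero, of "y 0" M] M by simp
  have yL: "y \<in> L2_space" by (rule L2_space_continuous[OF y])
  have "norm (L y) \<le> C * l2_norm y" by (rule bound[OF yL])
  also have "\<dots> \<le> \<bar>C\<bar> * l2_norm y" by (intro mult_right_mono l2_norm_sq(4)) simp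
  also have "\<dots> \<le> \<bar>C\<bar> * (sqrt pi * M)" using M M0 by (intro mult_left_mono l2_norm_bounded yL) auto
  finally show "norm (L y) \<le> \<bar>C\<bar> * sqrt pi * M" by (simp add: mult.assoc)
qed

end

section \<open>Annihilating functionals and completeness\<close>

context dirac_estimates
begin

lemma numer_vanishes:
  assumes g: "g absolutely_integrable_on {0..pi}" and L: "sup_functional L"
    and van: "\<And>l y. l \<in> eigenvalues P Q A \<Longrightarrow> y \<in> root_subspace P Q A l \<Longrightarrow> L y = 0"
  shows "L (numer l g) = 0" "\<exists>z0. char_det z0 \<noteq> 0"
proof -
  obtain s0 B where s0: "s0 > 0" "B \<ge> 0" and half: "\<forall>l g y K. \<sigma> * Im l \<ge> s0 \<longrightarrow> dirac_solution l g y \<longrightarrow> (\<forall>j. bform A j y = 0) \<longrightarrow>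
       g absolutely_integrable_on {0..pi} \<longrightarrow> (\<forall>i. kernel_bound (\<sigma> * Im l) (\<lambda>t. g t $ i) K) \<longrightarrow>
       (\<forall>x\<in>{0..pi}. norm (y x) \<le> B * K)"
    using half_plane by (elim exE conjE) (rule that; assumption)
  obtain T B' N where T: "T \<ge> 1" "B' \<ge> 0" and ray': "\<forall>\<tau> g y K. \<tau> \<ge> T \<longrightarrow> dirac_solution (- \<i> * of_real (\<sigma> * \<tau>)) g y \<longrightarrow> (\<forall>j. bform A j y = 0) \<longrightarrow>
       g absolutely_integrable_on {0..pi} \<longrightarrow> (\<forall>i. kernel_bound \<tau> (\<lambda>t. g t $ i) K) \<longrightarrow> K \<ge> 0 \<longrightarrow>
       (\<forall>x\<in>{0..pi}. norm (y x) \<le> B' * \<tau> ^ N * K)"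
    using ray by (elim exE conjE) (rule that; assumption)
  have halfE: "norm (y x) \<le> B * K" if "\<sigma> * Im l \<ge> s0" "dirac_solution l g y" "\<And>j. bform A j y = 0"
       "g absolutely_integrable_on {0..pi}" "\<And>i. kernel_bound (\<sigma> * Im l) (\<lambda>t. g t $ i) K" "x \<in> {0..pi}" for l K x and g y :: "real \<Rightarrow> complex^2"
    using half[rule_format, of l g y K x] that by simp
  have rayE: "norm (y x) \<le> B' * \<tau> ^ N * K" if "\<tau> \<ge> T" "dirac_solution (- \<i> * of_real (\<sigma> * \<tau>)) g y" "\<And>j. bform A j y = 0"
       "g absolutely_integrable_on {0..pi}" "\<And>i. kernel_bound \<tau> (\<lambda>t. g t $ i) K" "K \<ge> 0" "x \<in> {0..pi}" for \<tau> K x and g y :: "real \<Rightarrow> complex^2"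
    using ray'[rule_format, of \<tau> "g" y K x] that by simp
  \<comment> \<open>A zero of the determinant gives a nontrivial solution with zero source, for
    which the estimate with K = 0 forces zero.\<close>
  have nz1: "char_det l \<noteq> 0" if l: "\<sigma> * Im l \<ge> s0" for l
  proof
    assume "char_det l = 0"
    then obtain y where y: "dirac_solution l (\<lambda>t. 0) y" "\<And>j. bform A j y = 0" "y 0 \<noteq> 0" by (rule char_det_zero_solution) blast
    have "norm (y 0) \<le> B * 0" by (rule halfE[OF l y(1,2) integrable_zero]) (simp_all add: kernel_bound_zero)
    then show False using y(3) by simp
  qed
  have nz2: "char_det (- \<i> * of_real (\<sigma> * \<tau>)) \<noteq> 0" if l: "\<tau> \<ge> T" for \<tau>
  proof
    assume "char_det (- \<i> * of_real (\<sigma> * \<tau>)) = 0"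
    then obtain y where y: "dirac_solution (- \<i> * of_real (\<sigma> * \<tau>)) (\<lambda>t. 0) y" "\<And>j. bform A j y = 0" "y 0 \<noteq> 0" by (rule char_det_zero_solution) blast
    have "norm (y 0) \<le> B' * \<tau> ^ N * 0" by (rule rayE[OF l y(1,2) integrable_zero]) (simp_all add: kernel_bound_zero)
    then show False using y(3) by simp
  qed
  define z0 where "z0 = \<i> * of_real (\<sigma> * s0)"
  have \<sigma>2: "\<sigma> * \<sigma> = 1" using sign by auto
  have z0: "char_det z0 \<noteq> 0" by (rule nz1) (use \<sigma>2 in \<open>simp add: z0_def flip: mult.assoc\<close>)
  then show "\<exists>z0. char_det z0 \<noteq> 0" by blast
  obtain CL where CL: "CL \<ge> 0" "\<And>l g y M. dirac_solution l g y \<Longrightarrow> (\<And>x. x \<in> {0..pi} \<Longrightarrow> norm (y x) \<le> M) \<Longrightarrow> norm (L y) \<le> CL * M"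
    using sup_functional_bound[OF L] by blast
  obtain H where H: "H holomorphic_on UNIV" "\<And>z. char_det z * H z = L (numer z g)"
  proof (rule entire_quotient[OF char_det_holomorphic numer_holomorphic[OF L g] z0])
    show "fps_nth (fps_expansion (\<lambda>l. L (numer l g)) m) k = 0" if "k < subdegree (fps_expansion char_det m)" for m k
      by (rule numer_coeff_root_function[OF g L _ that]) (erule (1) van)
  qed (rule that; assumption)
  \<comment> \<open>Off the zeros of the determinant H(l) is \<open>L\<close> applied to the
    resolvent of \<open>g\<close>, so every bound for solutions is a bound for
    \<open>H\<close>.\<close>
  have Hy: "norm (H l) \<le> CL * M" if D: "char_det l \<noteq> 0"
    and M: "\<And>y x. \<lbrakk>dirac_solution l g y; \<And>j. bform A j y = 0; x \<in> {0..pi}\<rbrakk> \<Longrightarrow> norm (y x) \<le> M" for l M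
  proof -
    obtain y where y: "dirac_solution l g y" "\<And>j. bform A j y = 0" "numer l g = (\<lambda>t. char_det l *s y t)"
      using solution_of_numer[OF g D] by blast
    have "char_det l * H l = L (\<lambda>t. char_det l *s y t + 0 *s y t)" unfolding H(2) y(3) by simp
    also have "\<dots> = char_det l * L y" using sup_functional_linear[OF L y(1) y(1), of "char_det l" 0] by simp
    finally have "H l = L y" using D by simp
    then show ?thesis using CL(2)[OF y(1)] M[OF y(1,2)] by simp
  qed
  have gi: "(\<lambda>t. g t $ i) absolutely_integrable_on {0..pi}" for i by (rule absolutely_integrable_vec_nth[OF g])
  define G where "G i = integral {0..pi} (\<lambda>t. norm (g t $ i))" for i
  have G0: "G i \<ge> 0" for i unfolding G_def
    using gi[of i] by (intro integral_nonneg) (auto simp: absolutely_integrable_on_def)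
  define K where "K = G 1 + G 2"
  have K: "K \<ge> 0" "G i \<le> K" for i using G0[of 1] G0[of 2] exhaust_2[of i] by (auto simp: K_def)
  have kbK: "kernel_bound s (\<lambda>t. g t $ i) K" if "s \<ge> 0" for s i
    by (rule kernel_bound_mono[OF kernel_bound_L1[OF gi that] K(2)[unfolded G_def]])
  \<comment> \<open>Turned so that the half plane of boundedness is the upper one for both
    signs.\<close>
  define h where "h z = H (of_real \<sigma> * z)" for z
  have sgn_cases: "complex_of_real \<sigma> = 1 \<or> complex_of_real \<sigma> = -1" using sign by auto
  obtain K1 where K1: "K1 \<ge> 0" "\<And>l. norm (char_det l) \<le> K1 * exp ((16 * pi) * norm l)" using char_det_bound by blast
  obtain K2 where K2: "\<And>l. norm (L (numer l g)) \<le> (K2 * integral {0..pi} (\<lambda>t. norm (g t))) * exp ((24 * pi) * norm l)"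
    using functional_numer_bound[OF L] g by blast
  have "norm (char_det l) \<le> K1 * exp ((24 * pi) * norm l)" for l
    using K1(2)[of l] mult_left_mono[OF _ K1(1), of "exp ((16 * pi) * norm l)" "exp ((24 * pi) * norm l)"]
    by (simp add: mult_right_mono)
  then obtain C where C: "\<And>z. norm (H z) \<le> C * exp (10 * (24 * pi) * norm z)"
    by (rule exponential_type_quotient[OF char_det_holomorphic H(1) z0, of K1 "24 * pi" "K2 * integral {0..pi} (\<lambda>t. norm (g t))"])
      (use K2 H(2) in auto)
  have up: "norm (h z) \<le> CL * (B * M)" if z: "Im z \<ge> s0" and M: "\<And>i. kernel_bound (Im z) (\<lambda>t. g t $ i) M" for z M
  proof -
    have im: "\<sigma> * Im (of_real \<sigma> * z) = Im z" using \<sigma>2 by (simp flip: mult.assoc)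
    show ?thesis unfolding h_def
    proof (rule Hy)
      show "char_det (of_real \<sigma> * z) \<noteq> 0" by (rule nz1) (unfold im, rule z)
      show "norm (y x) \<le> B * M" if "dirac_solution (of_real \<sigma> * z) g y" "\<And>j. bform A j y = 0" "x \<in> {0..pi}" for y x
        by (rule halfE[OF _ that(1,2) g _ that(3)]; unfold im; rule z M)
    qed
  qed
  have h0: "h z = 0" for z
  proof (rule entire_vanishing[where h = h and ?t0.0 = s0 and T = T and N = N])
    show "h holomorphic_on UNIV" unfolding h_def
      by (rule holomorphic_on_compose_gen[OF _ H(1), unfolded o_def]) (auto intro: holomorphic_intros)
    show "norm (h z) \<le> C * exp (10 * (24 * pi) * norm z)" for z
      using C[of "of_real \<sigma> * z"] sign by (auto simp: h_def norm_mult)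
    have nn: "CL * (B * K) \<ge> 0" "CL * (B' * K) \<ge> 0" using CL(1) s0(2) T(2) K(1) by simp_all
    show "norm (h z) \<le> CL * (B * K) + CL * (B' * K)" if z: "Im z \<ge> s0" for z
    proof -
      have "norm (h z) \<le> CL * (B * K)" by (rule up[OF z kbK]) (use z s0 in simp)
      then show ?thesis using nn by linarith
    qed
    show "norm (h (- \<i> * of_real t)) \<le> (CL * (B * K) + CL * (B' * K)) * t ^ N" if t: "t \<ge> T" for t
    proof -
      have eq: "of_real \<sigma> * (- \<i> * of_real t) = - \<i> * of_real (\<sigma> * t)" by simp
      have "norm (H (- \<i> * of_real (\<sigma> * t))) \<le> CL * (B' * t ^ N * K)"
        by (rule Hy[OF nz2[OF t]]) (rule rayE[OF t _ _ g kbK K(1)], use t T in auto)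
      also have "\<dots> = (CL * (B' * K)) * t ^ N" by (simp add: mult_ac)
      also have "\<dots> \<le> (CL * (B * K) + CL * (B' * K)) * t ^ N" using nn t T(1) by (intro mult_right_mono) auto
      finally show ?thesis unfolding h_def eq .
    qed
    show "((\<lambda>t. h (\<i> * of_real t)) \<longlongrightarrow> 0) at_top"
    proof (rule tendstoI)
      fix e :: real assume e: "e > 0"
      \<comment> \<open>Along the good half axis the kernel bound of the fixed \<open>g\<close>
        itself tends to 0, not merely stays bounded; this yields the limit. The \<open>+ 1\<close>
        allows CL * B = 0.\<close>
      define d where "d = e / (CL * B + 1)"
      have pos: "CL * B + 1 > 0" using mult_nonneg_nonneg[OF CL(1) s0(2)] by simp
      have d: "d > 0" using e pos by (simp add: d_def)
      obtain s1 where s1: "\<And>s. s \<ge> s1 \<Longrightarrow> kernel_bound s (\<lambda>t. g t $ 1) d" using kernel_bound_small[OF gi d, of 1] by blast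
      obtain s2 where s2: "\<And>s. s \<ge> s2 \<Longrightarrow> kernel_bound s (\<lambda>t. g t $ 2) d" using kernel_bound_small[OF gi d, of 2] by blast
      have "dist (h (\<i> * of_real t)) 0 < e" if t: "t \<ge> Max {s0, s1, s2}" for t
      proof -
        have "kernel_bound t (\<lambda>t. g t $ i) d" for i using s1[of t] s2[of t] t exhaust_2[of i] by auto
        then have "norm (h (\<i> * of_real t)) \<le> CL * (B * d)" using up[of "\<i> * of_real t" d] t by simp
        also have "\<dots> < (CL * B + 1) * d" using d by (simp add: algebra_simps)
        also have "\<dots> = e" using pos by (simp add: d_def)
        finally show ?thesis by simp
      qed
      then show "\<forall>\<^sub>F t in at_top. dist (h (\<i> * of_real t)) 0 < e" unfolding eventually_at_top_linorder by blast
    qed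
  qed (use s0 T in auto)
  have "H l = h (of_real \<sigma> * l)" using sgn_cases by (auto simp: h_def)
  then show "L (numer l g) = 0" using H(2)[of l] h0 by simp
qed

lemma complete:
  assumes S: "S \<subseteq> L2_space" and sub: "\<And>l. l \<in> eigenvalues P Q A \<Longrightarrow> root_subspace P Q A l \<subseteq> cfun.span S"
  shows "L2_space \<subseteq> l2_closure (cfun.span S)"
proof (rule subsetI, rule ccontr)
  fix g0 assume g0: "g0 \<in> L2_space" "g0 \<notin> l2_closure (cfun.span S)"
  obtain L C where L:
    "\<And>f g a b. f \<in> L2_space \<Longrightarrow> g \<in> L2_space \<Longrightarrow> L (\<lambda>x. a *s f x + b *s g x) = a * L f + b * L g"
    "\<And>f. f \<in> L2_space \<Longrightarrow> norm (L f) \<le> C * l2_norm f"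
    "\<And>s. s \<in> cfun.span S \<Longrightarrow> L s = (0::complex)" "L g0 \<noteq> 0"
    by (rule separating_functional[OF S g0]) (rule that; assumption)
  interpret L2_functional L C by unfold_locales (rule L(1) L(2); assumption)+
  have sL: "sup_functional L" by (rule sup_functional[OF dirac_potential_axioms])
  have van: "L y = 0" if "l \<in> eigenvalues P Q A" "y \<in> root_subspace P Q A l" for l y
    using sub that L(3) by blast
  have "\<exists>z0. char_det z0 \<noteq> 0" by (rule numer_vanishes(2)[OF integrable_zero sL]) (erule (1) van)
  then obtain z0 where z0: "char_det z0 \<noteq> 0" by blast
  have "L g0 = 0"
  proof (rule vanish[OF _ g0(1)])
    fix y y' :: "real \<Rightarrow> complex^2" assume y: "has_ac_deriv y y' 0 pi" "y 0 = 0" "y pi = 0" "\<And>x. x \<notin> {0..pi} \<Longrightarrow> y x = 0"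
    \<comment> \<open>The source for which \<open>y\<close> solves the equation at
      \<open>z0\<close>. As \<open>y\<close> vanishes at both ends it satisfies the boundary
      conditions, so the numerator for this source is a nonzero multiple of
      \<open>y\<close>.\<close>
    define g where "g t = - inv_B (y' t - dirac_rhs P Q z0 t (y t))" for t
    have y'i: "y' absolutely_integrable_on {0..pi}" using y(1) by (simp add: has_ac_deriv_def)
    have g: "g absolutely_integrable_on {0..pi}"
    proof -
      have "(\<lambda>t. inv_B (dirac_rhs P Q z0 t (y t) - y' t)) absolutely_integrable_on {0..pi}"
        using has_ac_deriv_continuous_on[OF y(1)]
        by (intro absolutely_integrable_inv_B set_integral_diff dirac_rhs_integrable y'i)
      moreover have "inv_B (dirac_rhs P Q z0 t (y t) - y' t) = g t" for t
        by (simp add: g_def vec_eq_iff forall_2 algebra_simps)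
      ultimately show ?thesis by simp
    qed
    have "inv_B (- inv_B v) = v" for v by (simp add: vec_eq_iff forall_2 flip: mult.assoc)
    then have sol: "dirac_solution z0 g y" using y by (simp add: dirac_solution_def g_def)
    have "numer z0 g = (\<lambda>t. char_det z0 *s y t)"
      by (rule bvp_solution_eq_numer[OF sol _ g]) (simp add: bform_def y)
    moreover have "L (numer z0 g) = 0" by (rule numer_vanishes(1)[OF g sL]) (erule (1) van)
    ultimately have "L (\<lambda>t. char_det z0 *s y t + 0 *s y t) = 0" by simp
    then show "L y = 0" using sup_functional_linear[OF sL sol sol, of "char_det z0" 0] z0 by simp
  qed
  then show False using L(4) by simp
qed

end

section \<open>Minimality\<close>

text \<open>Induction on the number of functionals: on the kernel of \<open>e j\<close> the claim is
  known, and one vector outside that kernel fixes the remaining coefficient.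
  \<open>comb v a w\<close> abstracts v + a w, with the scalar action left unspecified.\<close>

lemma linear_combination_of_functionals:
  fixes e :: "'i \<Rightarrow> 'v \<Rightarrow> complex" and comb :: "'v \<Rightarrow> complex \<Rightarrow> 'v \<Rightarrow> 'v"
  assumes "finite I" and V: "\<And>v w a. v \<in> V \<Longrightarrow> w \<in> V \<Longrightarrow> comb v a w \<in> V"
    and e: "\<And>i v w a. i \<in> I \<Longrightarrow> v \<in> V \<Longrightarrow> w \<in> V \<Longrightarrow> e i (comb v a w) = e i v + a * e i w"
    and f: "\<And>v w a. v \<in> V \<Longrightarrow> w \<in> V \<Longrightarrow> f (comb v a w) = f v + a * f w"
    and ker: "\<And>v. v \<in> V \<Longrightarrow> (\<And>i. i \<in> I \<Longrightarrow> e i v = 0) \<Longrightarrow> f v = 0"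
  shows "\<exists>c. \<forall>v\<in>V. f v = (\<Sum>i\<in>I. c i * e i v)"
  using assms
proof (induction I arbitrary: V rule: finite_induct)
  case empty then show ?case by simp
next
  case (insert j I)
  note V = insert.prems(1) and e = insert.prems(2) and f = insert.prems(3) and ker = insert.prems(4)
  let ?W = "{v \<in> V. e j v = 0}"
  have "\<exists>c. \<forall>v\<in>?W. f v = (\<Sum>i\<in>I. c i * e i v)"
  proof (rule insert.IH)
    show "comb v a w \<in> ?W" if "v \<in> ?W" "w \<in> ?W" for v w a using that V e by auto
    show "e i (comb v a w) = e i v + a * e i w" if "i \<in> I" "v \<in> ?W" "w \<in> ?W" for i v w a
      using that e[of i v w a] by simp
    show "f (comb v a w) = f v + a * f w" if "v \<in> ?W" "w \<in> ?W" for v w a using that f by simp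
    show "f v = 0" if "v \<in> ?W" "\<And>i. i \<in> I \<Longrightarrow> e i v = 0" for v using that by (intro ker) auto
  qed
  then obtain c where c: "\<And>v. v \<in> V \<Longrightarrow> e j v = 0 \<Longrightarrow> f v = (\<Sum>i\<in>I. c i * e i v)" by auto
  have sum: "(\<Sum>i\<in>insert j I. (if i = j then d else c i) * e i v) = d * e j v + (\<Sum>i\<in>I. c i * e i v)" for d v
  proof -
    have "(\<Sum>i\<in>I. (if i = j then d else c i) * e i v) = (\<Sum>i\<in>I. c i * e i v)"
      by (rule sum.cong) (use insert.hyps in auto)
    then show ?thesis using insert.hyps by simp
  qed
  show ?case
  proof (cases "\<forall>v\<in>V. e j v = 0")
    case True
    show ?thesis
      by (rule exI[of _ "\<lambda>i. if i = j then 0 else c i"]) (unfold sum, use True c in auto)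
  next
    case False
    then obtain u where u: "u \<in> V" "e j u \<noteq> 0" by blast
    define d where "d = (f u - (\<Sum>i\<in>I. c i * e i u)) / e j u"
    show ?thesis
    proof (rule exI[of _ "\<lambda>i. if i = j then d else c i"], rule ballI, unfold sum)
      fix v assume v: "v \<in> V"
      define s where "s = - (e j v / e j u)"
      let ?w = "comb v s u"
      have "e j ?w = 0" using e[OF _ v u(1), of j s] u(2) by (simp add: s_def)
      then have "f ?w = (\<Sum>i\<in>I. c i * e i ?w)" using c[OF V[OF v u(1)]] by simp
      also have "\<dots> = (\<Sum>i\<in>I. c i * e i v + s * (c i * e i u))"
        by (rule sum.cong[OF refl]) (use e[OF _ v u(1)] in \<open>simp add: algebra_simps\<close>)
      also have "\<dots> = (\<Sum>i\<in>I. c i * e i v) + s * (\<Sum>i\<in>I. c i * e i u)" by (simp add: sum.distrib sum_distrib_left)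
      finally have "f v = (\<Sum>i\<in>I. c i * e i v) - s * (f u - (\<Sum>i\<in>I. c i * e i u))"
        using f[OF v u(1), of s] by (simp add: algebra_simps)
      also have "f u - (\<Sum>i\<in>I. c i * e i u) = d * e j u" using u(2) by (simp add: d_def)
      also have "s * (d * e j u) = - (d * e j v)" using u(2) by (simp add: s_def)
      finally show "f v = d * e j v + (\<Sum>i\<in>I. c i * e i v)" by simp
    qed
  qed
qed

section \<open>Jets of the numerator as biorthogonal functionals\<close>

context dirac_problem
begin

lemma numer_linear:
  assumes g: "g absolutely_integrable_on {0..pi}" and h: "h absolutely_integrable_on {0..pi}"
  shows "numer l (\<lambda>t. a *s g t + b *s h t) = (\<lambda>t. a *s numer l g t + b *s numer l h t)"
proof -
  let ?s = "\<lambda>t. a *s g t + b *s h t"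
  have s: "?s absolutely_integrable_on {0..pi}"
    using absolutely_integrable_linear[OF g bounded_linear_smult_vec, of a] absolutely_integrable_linear[OF h bounded_linear_smult_vec, of b]
    by (intro set_integral_add) (simp_all add: o_def)
  have p: "part l ?s = (\<lambda>t. a *s part l g t + b *s part l h t)"
    by (rule dirac_solution_unique[OF part(1)[OF s] dirac_solution_linear[OF part(1)[OF g] part(1)[OF h]]])
      (simp add: part(2)[OF s] part(2)[OF g] part(2)[OF h])
  have c: "coef1 l ?s = a * coef1 l g + b * coef1 l h" "coef2 l ?s = a * coef2 l g + b * coef2 l h"
    unfolding coef1_def coef2_def p bform_linear by (simp_all add: algebra_simps)
  show ?thesis unfolding numer_def c p by (simp add: fun_eq_iff vec_eq_iff algebra_simps)
qed

text \<open>Evaluation at 0 suffices since a solution is determined by its value there. Only the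
  coefficients below the order of the zero of \<open>char_det\<close> at \<open>m\<close> will serve
  as functionals.\<close>

definition jet :: "complex \<Rightarrow> 2 \<Rightarrow> (real \<Rightarrow> complex^2) \<Rightarrow> complex fps" where
  "jet m j g = fps_expansion (\<lambda>l. numer l g 0 $ j) m"

lemma zero_functional: "sup_functional (\<lambda>y. y 0 $ j)"
  by (rule sup_functional_nth) simp

lemma jet: "g absolutely_integrable_on {0..pi} \<Longrightarrow> (\<lambda>w. numer (m + w) g 0 $ j) has_fps_expansion jet m j g"
  unfolding jet_def using numer_holomorphic[OF zero_functional, of g j]
  by (intro analytic_at_imp_has_fps_expansion) (auto intro: holomorphic_on_imp_analytic_at)

lemma jet_linear:
  assumes g: "g absolutely_integrable_on {0..pi}" and h: "h absolutely_integrable_on {0..pi}"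
  shows "jet m j (\<lambda>t. a *s g t + b *s h t) = fps_const a * jet m j g + fps_const b * jet m j h"
proof (rule fps_expansion_unique_complex)
  have "(\<lambda>t. a *s g t + b *s h t) absolutely_integrable_on {0..pi}"
    using absolutely_integrable_linear[OF g bounded_linear_smult_vec, of a] absolutely_integrable_linear[OF h bounded_linear_smult_vec, of b]
    by (intro set_integral_add) (simp_all add: o_def)
  from jet[OF this, of m j]
  show "(\<lambda>w. a * (numer (m + w) g 0 $ j) + b * (numer (m + w) h 0 $ j)) has_fps_expansion jet m j (\<lambda>t. a *s g t + b *s h t)"
    unfolding numer_linear[OF g h] by simp
  show "(\<lambda>w. a * (numer (m + w) g 0 $ j) + b * (numer (m + w) h 0 $ j)) has_fps_expansion fps_const a * jet m j g + fps_const b * jet m j h"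
    by (intro has_fps_expansion_add has_fps_expansion_cmult_left jet g h)
qed

text \<open>Cauchy's inequality on the unit circle about \<open>m\<close>; the numerator is bounded
  there by a constant times the L1 norm of \<open>g\<close>.\<close>

lemma jet_bound:
  "\<exists>K\<ge>0. \<forall>g. g absolutely_integrable_on {0..pi} \<longrightarrow> norm (fps_nth (jet m j g) k) \<le> K * integral {0..pi} (\<lambda>t. norm (g t))"
proof -
  obtain K where K: "K \<ge> 0" "\<forall>l g. g absolutely_integrable_on {0..pi} \<longrightarrow>
     norm (numer l g 0 $ j) \<le> (K * integral {0..pi} (\<lambda>t. norm (g t))) * exp ((24 * pi) * norm l)"
    using functional_numer_bound[OF zero_functional[of j]] by blast
  let ?c = "exp ((24 * pi) * (norm m + 1))"
  have "norm (fps_nth (jet m j g) k) \<le> K * ?c * integral {0..pi} (\<lambda>t. norm (g t))" if g: "g absolutely_integrable_on {0..pi}" for g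
  proof -
    let ?f = "\<lambda>l. numer l g 0 $ j"
    let ?B = "(K * integral {0..pi} (\<lambda>t. norm (g t))) * ?c"
    have i0: "integral {0..pi} (\<lambda>t. norm (g t)) \<ge> 0" by (rule integral_norm_nonneg[OF g])
    have hol: "?f holomorphic_on UNIV" by (rule numer_holomorphic[OF zero_functional g])
    have "norm ((deriv ^^ k) ?f m) \<le> fact k * ?B / 1 ^ k"
    proof (rule Cauchy_inequality)
      show "?f holomorphic_on ball m 1" "continuous_on (cball m 1) ?f"
        using holomorphic_on_subset[OF hol] holomorphic_on_imp_continuous_on[OF holomorphic_on_subset[OF hol]] by auto
      fix z assume z: "norm (m - z) = 1"
      have "norm z \<le> norm m + 1" using norm_triangle_ineq2[of z m] z by (simp add: norm_minus_commute)
      then have "exp ((24 * pi) * norm z) \<le> ?c" by simp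
      then have "(K * integral {0..pi} (\<lambda>t. norm (g t))) * exp ((24 * pi) * norm z) \<le> ?B"
        using K(1) i0 by (intro mult_left_mono) auto
      then show "norm (?f z) \<le> ?B" using K(2)[rule_format, OF g, of z] by linarith
    qed simp
    then have "norm ((deriv ^^ k) ?f m) / fact k \<le> ?B" by (simp add: field_simps)
    then show ?thesis by (simp add: jet_def fps_expansion_def norm_divide mult_ac)
  qed
  then show ?thesis using K(1) by (intro exI[of _ "K * ?c"]) auto
qed

text \<open>The resolvent identity with denominators cleared: \<open>y\<close> solves the equation
  at m + w with source z - (m - n + w) y, hence the numerator of that source is the determinant
  times \<open>y\<close>.\<close>

lemma jet_solution:
  assumes y: "dirac_solution n z y" and bc: "\<And>j. bform A j y = 0" and z: "z absolutely_integrable_on {0..pi}"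
  shows "(fps_const (m - n) + fps_X) * jet m j y = jet m j z - fps_const (y 0 $ j) * fps_expansion char_det m"
proof (rule fps_expansion_unique_complex)
  have yi: "y absolutely_integrable_on {0..pi}" by (rule dirac_solution_integrable[OF y])
  have D: "(\<lambda>w. char_det (m + w)) has_fps_expansion fps_expansion char_det m"
    using char_det_holomorphic by (intro analytic_at_imp_has_fps_expansion) (auto intro: holomorphic_on_imp_analytic_at)
  show "(\<lambda>w. ((m - n) + w) * (numer (m + w) y 0 $ j)) has_fps_expansion (fps_const (m - n) + fps_X) * jet m j y"
    by (intro has_fps_expansion_mult has_fps_expansion_add has_fps_expansion_const has_fps_expansion_fps_X jet yi)
  have "(\<lambda>w. numer (m + w) z 0 $ j - y 0 $ j * char_det (m + w)) has_fps_expansion jet m j z - fps_const (y 0 $ j) * fps_expansion char_det m"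
    by (intro has_fps_expansion_diff has_fps_expansion_cmult_left jet z D)
  moreover have "((m - n) + w) * (numer (m + w) y 0 $ j) = numer (m + w) z 0 $ j - y 0 $ j * char_det (m + w)" for w
  proof -
    let ?s = "\<lambda>t. 1 *s z t + (- (m - n + w)) *s y t"
    have s: "?s absolutely_integrable_on {0..pi}"
      using absolutely_integrable_linear[OF z bounded_linear_smult_vec, of 1] absolutely_integrable_linear[OF yi bounded_linear_smult_vec, of "- (m - n + w)"]
      by (intro set_integral_add) (simp_all add: o_def)
    have "dirac_solution (n + (m - n + w)) (\<lambda>t. z t - (m - n + w) *s y t) y"
      using y by (simp only: dirac_solution_shift[of n z y "m - n + w"])
    moreover have "(\<lambda>t. z t - (m - n + w) *s y t) = ?s" by (simp add: fun_eq_iff vec_eq_iff algebra_simps)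
    ultimately have "dirac_solution (m + w) ?s y" by simp
    from bvp_solution_eq_numer[OF this bc s]
    have "numer (m + w) z 0 + (- (m - n + w)) *s numer (m + w) y 0 = char_det (m + w) *s y 0"
      unfolding numer_linear[OF z yi] by (simp add: fun_eq_iff)
    then have "(numer (m + w) z 0 + (- (m - n + w)) *s numer (m + w) y 0) $ j = (char_det (m + w) *s y 0) $ j" by simp
    then show ?thesis by (simp add: algebra_simps)
  qed
  ultimately show "(\<lambda>w. ((m - n) + w) * (numer (m + w) y 0 $ j)) has_fps_expansion jet m j z - fps_const (y 0 $ j) * fps_expansion char_det m"
    by simp
qed

lemma root_kernel_Suc:
  assumes "y \<in> root_kernel P Q A n (Suc i)"
  obtains z where "z \<in> root_kernel P Q A n i" "dirac_solution n z y" "\<And>j. bform A j y = 0"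
proof -
  obtain z where z: "y \<in> dirac_domain P Q A" "z \<in> root_kernel P Q A n i" "AE x in Leb. dirac_expr P Q y x - n *s y x = z x"
    using assms by auto
  show ?thesis by (rule that[OF z(2) domain_dirac_solution[OF z(1,3)]]) (use z(1) in \<open>simp add: dirac_domain_def\<close>)
qed

lemma root_kernel_continuous: "y \<in> root_kernel P Q A n i \<Longrightarrow> continuous_on {0..pi} y"
proof (cases i)
  case 0
  then show "continuous_on {0..pi} y" if "y \<in> root_kernel P Q A n i" using that by (simp add: zero_fun_def)
next
  case (Suc k)
  then show "continuous_on {0..pi} y" if "y \<in> root_kernel P Q A n i"
    using that root_kernel_Suc[of y n k] dirac_solution_continuous by metis
qed

lemma root_kernel_integrable: "y \<in> root_kernel P Q A n i \<Longrightarrow> y absolutely_integrable_on {0..pi}"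
  by (intro absolutely_integrable_continuous_real root_kernel_continuous)

lemma jet_zero: "jet m j 0 = 0"
  using jet_linear[OF integrable_zero integrable_zero, of m j 0 0] by (simp add: zero_fun_def)

text \<open>For n \<noteq> m the factor m - n + X is an invertible power series, so the jet of
  \<open>y\<close> is computed coefficientwise from the jet of its predecessor in the chain; the
  determinant enters only from its order onwards.\<close>

lemma jet_other_root:
  assumes "y \<in> root_kernel P Q A n i" "n \<noteq> m" "k < subdegree (fps_expansion char_det m)"
  shows "fps_nth (jet m j y) k = 0"
  using assms(1,3)
proof (induction i arbitrary: y k)
  case 0
  then have "y = 0" by simp
  show ?case unfolding \<open>y = 0\<close> jet_zero by simp
next
  case (Suc i)
  obtain z where z: "z \<in> root_kernel P Q A n i" "dirac_solution n z y" "\<And>j. bform A j y = 0"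
    using root_kernel_Suc[OF Suc.prems(1)] by blast
  have eq: "(fps_const (m - n) + fps_X) * jet m j y = jet m j z - fps_const (y 0 $ j) * fps_expansion char_det m"
    by (rule jet_solution[OF z(2,3) root_kernel_integrable[OF z(1)]])
  show ?case
    using Suc.prems(2)
  proof (induction k)
    case 0
    have "(m - n) * fps_nth (jet m j y) 0 = fps_nth (jet m j z) 0 - y 0 $ j * fps_nth (fps_expansion char_det m) 0"
      using arg_cong[OF eq, of "\<lambda>F. fps_nth F 0"] by (simp add: distrib_right)
    then show ?case using Suc.IH[OF z(1) 0] nth_less_subdegree_zero[OF 0] assms(2) by simp
  next
    case (Suc k)
    have "(m - n) * fps_nth (jet m j y) (Suc k) + fps_nth (jet m j y) k = fps_nth (jet m j z) (Suc k) - y 0 $ j * fps_nth (fps_expansion char_det m) (Suc k)"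
      using arg_cong[OF eq, of "\<lambda>F. fps_nth F (Suc k)"] by (simp add: distrib_right)
    then show ?case using Suc.IH Suc.prems \<open>\<And>y k. y \<in> root_kernel P Q A n i \<Longrightarrow> k < subdegree (fps_expansion char_det m) \<Longrightarrow> fps_nth (jet m j y) k = 0\<close>[OF z(1) Suc.prems]
        nth_less_subdegree_zero[OF Suc.prems] assms(2) by simp
  qed
qed

text \<open>For n = m the recurrence is a shift: the jet of the predecessor \<open>z\<close>
  vanishes below the order d of the determinant, so z = 0 by induction. The coefficient of index d
  then reads y(0) times a nonzero number, and uniqueness gives y = 0.\<close>

lemma jet_injective:
  assumes "y \<in> root_kernel P Q A m i" and nz: "char_det z0 \<noteq> 0"
    and "\<And>j k. k < subdegree (fps_expansion char_det m) \<Longrightarrow> fps_nth (jet m j y) k = 0"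
  shows "y = 0"
  using assms(1,3)
proof (induction i arbitrary: y)
  case 0 then show ?case by simp
next
  case (Suc i)
  let ?D = "fps_expansion char_det m"
  obtain z where z: "z \<in> root_kernel P Q A m i" "dirac_solution m z y" "\<And>j. bform A j y = 0"
    using root_kernel_Suc[OF Suc.prems(1)] by blast
  have eq: "fps_X * jet m j y = jet m j z - fps_const (y 0 $ j) * ?D" for j
    using jet_solution[OF z(2,3) root_kernel_integrable[OF z(1)], of m j] by simp
  have eqk: "(if k = 0 then 0 else fps_nth (jet m j y) (k - 1)) = fps_nth (jet m j z) k - y 0 $ j * fps_nth ?D k" for j k
    using arg_cong[OF eq[of j], of "\<lambda>F. fps_nth F k"] by simp
  have "z = 0"
  proof (rule Suc.IH[OF z(1)])
    fix j k assume k: "k < subdegree ?D"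
    have "(if k = 0 then 0 else fps_nth (jet m j y) (k - 1)) = 0" using Suc.prems(2)[of "k - 1" j] k by simp
    then show "fps_nth (jet m j z) k = 0" using eqk[of k j] nth_less_subdegree_zero[OF k] by simp
  qed
  have D: "?D \<noteq> 0"
  proof
    assume "?D = 0"
    then have "fps_nth ?D n = 0" for n by simp
    then have "(deriv ^^ n) char_det m = 0" for n by (simp add: fps_expansion_def)
    then have "char_det z0 = 0" by (intro holomorphic_fun_eq_0_on_connected[OF char_det_holomorphic]) auto
    then show False using nz by simp
  qed
  have "y 0 $ j = 0" for j
  proof -
    \<comment> \<open>At index d the shift refers to coefficient d - 1 of the jet of
      \<open>y\<close>, the last one assumed to vanish; for d = 0 there is no such term.\<close>
    have "(if subdegree ?D = 0 then 0 else fps_nth (jet m j y) (subdegree ?D - 1)) = 0"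
      using Suc.prems(2)[of "subdegree ?D - 1" j] by simp
    then have "y 0 $ j * fps_nth ?D (subdegree ?D) = 0" using eqk[of "subdegree ?D" j] \<open>z = 0\<close> by (simp add: jet_zero)
    then show ?thesis using nth_subdegree_nonzero[OF D] by simp
  qed
  then have "y 0 = 0" by (simp add: vec_eq_iff)
  then have "y = (\<lambda>t. 0)"
    using z(2) \<open>z = 0\<close> by (intro dirac_solution_unique[OF _ dirac_solution_zero, of m]) (simp_all add: zero_fun_def)
  then show ?case by (simp add: zero_fun_def)
qed

text \<open>On the root subspace of \<open>m\<close> the coordinate along \<open>f0\<close> is a
  combination of finitely many jets, because these separate points. The same combination, taken on
  the whole space, is bounded, equals 1 at \<open>f0\<close> and vanishes at every other member of
  the system.\<close>

lemma minimal:
  assumes nz: "char_det z0 \<noteq> 0" and m: "m \<in> eigenvalues P Q A"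
    and b: "\<And>l. l \<in> eigenvalues P Q A \<Longrightarrow> cfun.independent (b l) \<and> cfun.span (b l) = root_subspace P Q A l"
    and f0: "f0 \<in> b m"
  shows "f0 \<notin> l2_closure (cfun.span ((\<Union>l\<in>eigenvalues P Q A. b l) - {f0}))"
proof
  let ?S = "(\<Union>l\<in>eigenvalues P Q A. b l) - {f0}" and ?d = "subdegree (fps_expansion char_det m)"
  assume cl: "f0 \<in> l2_closure (cfun.span ?S)"
  have ind: "cfun.independent (b m)" and sp: "cfun.span (b m) = root_subspace P Q A m" using b[OF m] by auto
  have bL2: "y \<in> L2_space" if "y \<in> root_subspace P Q A l" for y l
    using that root_kernel_continuous unfolding root_subspace_def by (auto intro: L2_space_continuous)
  have lc: "v + fun_scale a w = (\<lambda>x. 1 *s v x + a *s w x)" for a and v w :: "real \<Rightarrow> complex^2"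
    by (simp add: fun_scale_def plus_fun_def)
  define e where "e = (\<lambda>(k, j) g. fps_nth (jet m j g) k)"
  define I where "I = {..<?d} \<times> (UNIV :: 2 set)"
  have L2_lin: "v + fun_scale a w \<in> L2_space" if "v \<in> L2_space" "w \<in> L2_space" for v w a
    unfolding lc by (rule L2_space_linear[OF that])
  have e_lin: "e i (v + fun_scale a w) = e i v + a * e i w" if "v \<in> L2_space" "w \<in> L2_space" for i v w a
    unfolding lc e_def split_beta jet_linear[OF L2_absolutely_integrable(1)[OF that(1)] L2_absolutely_integrable(1)[OF that(2)]] by simp
  have "\<exists>c. \<forall>v\<in>cfun.span (b m). cfun.representation (b m) v f0 = (\<Sum>i\<in>I. c i * e i v)"
  proof (rule linear_combination_of_functionals[where comb = "\<lambda>v a w. v + fun_scale a w"])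
    show "v + fun_scale a w \<in> cfun.span (b m)" if "v \<in> cfun.span (b m)" "w \<in> cfun.span (b m)" for v w a
      using that by (intro cfun.span_add cfun.span_scale)
    show "e i (v + fun_scale a w) = e i v + a * e i w" if "v \<in> cfun.span (b m)" "w \<in> cfun.span (b m)" for i v w a
      using that by (intro e_lin bL2[of _ m]) (simp_all add: sp)
    show "cfun.representation (b m) (v + fun_scale a w) f0 = cfun.representation (b m) v f0 + a * cfun.representation (b m) w f0"
      if "v \<in> cfun.span (b m)" "w \<in> cfun.span (b m)" for v w a
      using cfun.representation_add[OF ind cfun.span_scale[OF that(2), of a] that(1)] cfun.representation_scale[OF ind that(2), of a] by simp
    show "cfun.representation (b m) v f0 = 0" if v: "v \<in> cfun.span (b m)" "\<And>i. i \<in> I \<Longrightarrow> e i v = 0" for v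
    proof -
      obtain i where "v \<in> root_kernel P Q A m i" using v(1) unfolding sp root_subspace_def by blast
      then have "v = 0" by (rule jet_injective[OF _ nz]) (use v(2) in \<open>force simp: e_def I_def\<close>)
      then show ?thesis using cfun.representation_zero by simp
    qed
  qed (simp add: I_def)
  then obtain c where c: "\<And>v. v \<in> root_subspace P Q A m \<Longrightarrow> cfun.representation (b m) v f0 = (\<Sum>i\<in>I. c i * e i v)"
    unfolding sp by blast
  define L where "L g = (\<Sum>i\<in>I. c i * e i g)" for g
  have L_lin: "L (v + fun_scale a w) = L v + a * L w" if "v \<in> L2_space" "w \<in> L2_space" for v w a
  proof -
    have "L (v + fun_scale a w) = (\<Sum>i\<in>I. c i * e i v + a * (c i * e i w))"
      unfolding L_def by (rule sum.cong[OF refl]) (simp add: e_lin[OF that] algebra_simps)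
    then show ?thesis by (simp add: L_def sum.distrib sum_distrib_left)
  qed
  have L_f0: "L f0 = 1"
    using c[of f0] cfun.representation_basis[OF ind f0] f0 cfun.span_base[OF f0] by (simp add: L_def sp)
  have L_S: "f \<in> L2_space \<and> L f = 0" if f: "f \<in> ?S" for f
  proof -
    obtain l where l: "l \<in> eigenvalues P Q A" "f \<in> b l" "f \<noteq> f0" using f by blast
    have fr: "f \<in> root_subspace P Q A l" using b[OF l(1)] cfun.span_base[OF l(2)] by simp
    have "L f = 0"
    proof (cases "l = m")
      case True
      then show ?thesis using c[of f] fr cfun.representation_basis[OF ind, of f] l by (simp add: L_def)
    next
      case False
      obtain i where i: "f \<in> root_kernel P Q A l i" using fr unfolding root_subspace_def by blast
      have "e q f = 0" if "q \<in> I" for q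
        using jet_other_root[OF i False, of "fst q" "snd q"] that by (auto simp: e_def I_def split_beta)
      then show ?thesis by (simp add: L_def)
    qed
    then show ?thesis using bL2[OF fr] by simp
  qed
  have L_span: "f \<in> L2_space \<and> L f = 0" if "f \<in> cfun.span ?S" for f
    using that
  proof (induction rule: cfun.span_induct_alt)
    case base
    have "L (0 + fun_scale 0 0) = L 0 + 0 * L 0" by (rule L_lin) (use L2_space_zero in \<open>simp_all add: zero_fun_def\<close>)
    then show ?case using L2_space_zero by (simp add: zero_fun_def L_def e_def split_beta jet_zero[unfolded zero_fun_def])
  next
    case (step a x y)
    then have "y + fun_scale a x \<in> L2_space \<and> L (y + fun_scale a x) = 0"
      using L2_lin[of y x a] L_lin[of y x a] L_S[of x] by simp
    then show ?case by (simp only: add.commute)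
  qed
  have "\<exists>K\<ge>0. \<forall>g. g \<in> L2_space \<longrightarrow> norm (e i g) \<le> K * l2_norm g" for i
  proof -
    obtain K where K: "K \<ge> 0" "\<And>g. g absolutely_integrable_on {0..pi} \<Longrightarrow> norm (fps_nth (jet m (snd i) g) (fst i)) \<le> K * integral {0..pi} (\<lambda>t. norm (g t))"
      using jet_bound[of m "snd i" "fst i"] by blast
    have "norm (e i g) \<le> K * sqrt pi * l2_norm g" if g: "g \<in> L2_space" for g
      using K(2)[OF L2_absolutely_integrable(1)[OF g]] mult_left_mono[OF L2_absolutely_integrable(2)[OF g] K(1)]
      by (simp add: e_def split_beta mult.assoc)
    then show ?thesis using K(1) by (intro exI[of _ "K * sqrt pi"]) auto
  qed
  then have "\<forall>i. \<exists>K. K \<ge> 0 \<and> (\<forall>g. g \<in> L2_space \<longrightarrow> norm (e i g) \<le> K * l2_norm g)" by blast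
  from choice[OF this] obtain K where "\<forall>i. K i \<ge> 0 \<and> (\<forall>g. g \<in> L2_space \<longrightarrow> norm (e i g) \<le> K i * l2_norm g)" ..
  then have K: "K i \<ge> 0" "g \<in> L2_space \<Longrightarrow> norm (e i g) \<le> K i * l2_norm g" for i g by blast+
  define C where "C = (\<Sum>i\<in>I. norm (c i) * K i)"
  have C0: "C \<ge> 0" unfolding C_def using K(1) by (intro sum_nonneg) simp
  have L_bound: "norm (L g) \<le> C * l2_norm g" if g: "g \<in> L2_space" for g
  proof -
    have "norm (L g) \<le> (\<Sum>i\<in>I. norm (c i * e i g))" unfolding L_def by (rule norm_sum)
    also have "\<dots> \<le> (\<Sum>i\<in>I. norm (c i) * K i * l2_norm g)"
      by (rule sum_mono) (use K(2)[OF g] in \<open>simp add: norm_mult mult.assoc mult_left_mono\<close>)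
    finally show ?thesis by (simp add: C_def sum_distrib_right)
  qed
  have "1 / (C + 1) > 0" using C0 by simp
  then obtain g where g: "g \<in> cfun.span ?S" "l2_norm (f0 - g) < 1 / (C + 1)" using cl unfolding l2_closure_def by blast
  have f0L: "f0 \<in> L2_space" using cl by (simp add: l2_closure_def)
  have eq: "f0 - g = f0 + fun_scale (-1) g" by (simp add: fun_scale_def fun_eq_iff)
  have "L (f0 - g) = 1" unfolding eq using L_lin[OF f0L, of g "-1"] L_span[OF g(1)] L_f0 by simp
  moreover have "norm (L (f0 - g)) \<le> C * l2_norm (f0 - g)" unfolding eq by (intro L_bound L2_lin f0L) (use L_span[OF g(1)] in simp)
  moreover have "C * l2_norm (f0 - g) \<le> C * (1 / (C + 1))" using g(2) C0 by (intro mult_left_mono) auto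
  moreover have "C * (1 / (C + 1)) < 1" using C0 by simp
  ultimately show False by simp
qed

end

lemma (in dirac_estimates) root_system_complete_minimal:
  assumes S: "root_function_system P Q A S"
  shows "complete_system S \<and> minimal_system S"
proof -
  obtain b where b: "\<And>l. l \<in> eigenvalues P Q A \<Longrightarrow> cfun.independent (b l) \<and> cfun.span (b l) = root_subspace P Q A l"
    and Sb: "S = (\<Union>l\<in>eigenvalues P Q A. b l)"
    using S unfolding root_function_system_def by blast
  have sL2: "S \<subseteq> L2_space"
  proof
    fix f assume "f \<in> S"
    then obtain l where l: "l \<in> eigenvalues P Q A" "f \<in> b l" unfolding Sb by blast
    then have "f \<in> root_subspace P Q A l" using b[OF l(1)] cfun.span_base[OF l(2)] by simp
    then obtain i where "f \<in> root_kernel P Q A l i" unfolding root_subspace_def by blast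
    then show "f \<in> L2_space" by (intro L2_space_continuous root_kernel_continuous)
  qed
  have "L2_space \<subseteq> l2_closure (cfun.span S)"
  proof (rule complete[OF sL2])
    fix l assume l: "l \<in> eigenvalues P Q A"
    have "cfun.span (b l) \<subseteq> cfun.span S" by (rule cfun.span_mono) (use l in \<open>auto simp: Sb\<close>)
    then show "root_subspace P Q A l \<subseteq> cfun.span S" using b[OF l] by simp
  qed
  moreover have "f \<notin> l2_closure (cfun.span (S - {f}))" if "f \<in> S" for f
  proof -
    \<comment> \<open>The zero functional annihilates everything; it is inserted only to obtain a
      point where the determinant does not vanish.\<close>
    have "\<exists>z0. char_det z0 \<noteq> 0"
      by (rule numer_vanishes(2)[OF integrable_zero, of "\<lambda>y. 0"]) (auto simp: sup_functional_def intro!: exI[of _ 0])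
    then obtain z0 where z0: "char_det z0 \<noteq> 0" by blast
    obtain l where l: "l \<in> eigenvalues P Q A" "f \<in> b l" using \<open>f \<in> S\<close> unfolding Sb by blast
    show ?thesis unfolding Sb by (rule minimal[OF z0 l(1) b l(2)])
  qed
  ultimately show ?thesis using sL2 by (simp add: complete_system_def minimal_system_def)
qed

section \<open>Boundary conditions and end point hypotheses\<close>

text \<open>Eliminating one end value at a time expresses the conditions through minors; \<alpha>
  \<beta> is A12 A34 / A14^2, and the Pluecker relation with the vanishing minors gives A12 A34 =
  0.\<close>

lemma boundary_relations_upper:
  assumes nz: "col_minor A 1 4 \<noteq> 0" and minors: "col_minor A 1 4 * col_minor A 3 2 = 0" "col_minor A 1 3 = 0" "col_minor A 2 4 = 0"
  obtains \<alpha> \<beta> where "\<alpha> * \<beta> = 0"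
    "\<And>y :: real \<Rightarrow> complex^2. (\<forall>j. bform A j y = 0) \<Longrightarrow> y 0 $ 1 = \<alpha> * y pi $ 1 \<and> y pi $ 2 = \<beta> * y 0 $ 2"
proof (rule that)
  have m: "col_minor A j k = A $ 1 $ j * A $ 2 $ k - A $ 1 $ k * A $ 2 $ j" for j k
    by (simp add: col_minor_def det_2)
  have pl: "col_minor A 1 2 * col_minor A 3 4 - col_minor A 1 3 * col_minor A 2 4 - col_minor A 1 4 * col_minor A 3 2 = 0"
    unfolding m by (simp add: algebra_simps)
  show "(- (col_minor A 3 4 / col_minor A 1 4)) * (- (col_minor A 1 2 / col_minor A 1 4)) = 0"
    using pl minors by auto
  fix y :: "real \<Rightarrow> complex^2" assume "\<forall>j. bform A j y = 0"
  then have u: "bform A 1 y = 0" "bform A 2 y = 0" by simp_all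
  have "A $ 2 $ 4 * bform A 1 y - A $ 1 $ 4 * bform A 2 y = col_minor A 1 4 * y 0 $ 1 + col_minor A 2 4 * y 0 $ 2 + col_minor A 3 4 * y pi $ 1"
    unfolding m bform_def by (simp add: algebra_simps)
  then have "col_minor A 1 4 * y 0 $ 1 = - (col_minor A 3 4 * y pi $ 1)" using u minors by (simp add: add_eq_0_iff2)
  moreover have "A $ 1 $ 1 * bform A 2 y - A $ 2 $ 1 * bform A 1 y = col_minor A 1 2 * y 0 $ 2 + col_minor A 1 3 * y pi $ 1 + col_minor A 1 4 * y pi $ 2"
    unfolding m bform_def by (simp add: algebra_simps)
  then have "col_minor A 1 4 * y pi $ 2 = - (col_minor A 1 2 * y 0 $ 2)" using u minors by (simp add: add_eq_0_iff)
  ultimately show "y 0 $ 1 = - (col_minor A 3 4 / col_minor A 1 4) * y pi $ 1 \<and> y pi $ 2 = - (col_minor A 1 2 / col_minor A 1 4) * y 0 $ 2"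
    using nz by (simp add: field_simps)
qed

lemma boundary_relations_lower:
  assumes nz: "col_minor A 3 2 \<noteq> 0" and minors: "col_minor A 1 4 * col_minor A 3 2 = 0" "col_minor A 1 3 = 0" "col_minor A 2 4 = 0"
  obtains \<alpha> \<beta> where "\<alpha> * \<beta> = 0"
    "\<And>y :: real \<Rightarrow> complex^2. (\<forall>j. bform A j y = 0) \<Longrightarrow> y 0 $ 2 = \<alpha> * y pi $ 2 \<and> y pi $ 1 = \<beta> * y 0 $ 1"
proof (rule that)
  have m: "col_minor A j k = A $ 1 $ j * A $ 2 $ k - A $ 1 $ k * A $ 2 $ j" for j k
    by (simp add: col_minor_def det_2)
  have pl: "col_minor A 1 2 * col_minor A 3 4 - col_minor A 1 3 * col_minor A 2 4 - col_minor A 1 4 * col_minor A 3 2 = 0"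
    unfolding m by (simp add: algebra_simps)
  show "(- (col_minor A 3 4 / col_minor A 3 2)) * (- (col_minor A 1 2 / col_minor A 3 2)) = 0"
    using pl minors by auto
  fix y :: "real \<Rightarrow> complex^2" assume "\<forall>j. bform A j y = 0"
  then have u: "bform A 1 y = 0" "bform A 2 y = 0" by simp_all
  have "A $ 1 $ 3 * bform A 2 y - A $ 2 $ 3 * bform A 1 y = col_minor A 3 2 * y 0 $ 2 + col_minor A 3 4 * y pi $ 2 - col_minor A 1 3 * y 0 $ 1"
    unfolding m bform_def by (simp add: algebra_simps)
  then have "col_minor A 3 2 * y 0 $ 2 = - (col_minor A 3 4 * y pi $ 2)" using u minors by (simp add: add_eq_0_iff2)
  moreover have "A $ 2 $ 2 * bform A 1 y - A $ 1 $ 2 * bform A 2 y = col_minor A 1 2 * y 0 $ 1 + col_minor A 3 2 * y pi $ 1 - col_minor A 2 4 * y pi $ 2"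
    unfolding m bform_def by (simp add: algebra_simps)
  then have "col_minor A 3 2 * y pi $ 1 = - (col_minor A 1 2 * y 0 $ 1)" using u minors by (simp add: add_eq_0_iff)
  ultimately show "y 0 $ 2 = - (col_minor A 3 4 / col_minor A 3 2) * y pi $ 2 \<and> y pi $ 1 = - (col_minor A 1 2 / col_minor A 3 2) * y 0 $ 1"
    using nz by (simp add: field_simps)
qed

lemma endpoint_limits:
  fixes f :: "real \<Rightarrow> complex"
  assumes f: "f absolutely_integrable_on {0..pi}"
  shows "((\<lambda>h. (LINT x:{0..h}|lebesgue. f x) / complex_of_real (h powr \<rho>)) \<longlongrightarrow> \<nu>) (at_right 0) \<longleftrightarrow>
      ((\<lambda>h. integral {0..h} f / complex_of_real (h powr \<rho>)) \<longlongrightarrow> \<nu>) (at_right 0)"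
    "((\<lambda>h. (LINT x:{pi-h..pi}|lebesgue. f x) / complex_of_real (h powr \<rho>)) \<longlongrightarrow> \<nu>) (at_right 0) \<longleftrightarrow>
      ((\<lambda>h. integral {pi-h..pi} f / complex_of_real (h powr \<rho>)) \<longlongrightarrow> \<nu>) (at_right 0)"
proof -
  have "\<forall>\<^sub>F h in at_right 0. h \<in> {0<..<pi}" by (rule eventually_at_right_real) simp
  then have "\<forall>\<^sub>F h in at_right 0. (LINT x:{0..h}|lebesgue. f x) = integral {0..h} f \<and> (LINT x:{pi-h..pi}|lebesgue. f x) = integral {pi-h..pi} f"
  proof eventually_elim
    fix h :: real assume h: "h \<in> {0<..<pi}"
    have "set_integrable lebesgue {0..h} f" "set_integrable lebesgue {pi-h..pi} f"
      using h by (auto intro: set_integrable_subset[OF f])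
    then show "(LINT x:{0..h}|lebesgue. f x) = integral {0..h} f \<and> (LINT x:{pi-h..pi}|lebesgue. f x) = integral {pi-h..pi} f"
      by (simp add: set_lebesgue_integral_eq_integral)
  qed
  then show "((\<lambda>h. (LINT x:{0..h}|lebesgue. f x) / complex_of_real (h powr \<rho>)) \<longlongrightarrow> \<nu>) (at_right 0) \<longleftrightarrow>
      ((\<lambda>h. integral {0..h} f / complex_of_real (h powr \<rho>)) \<longlongrightarrow> \<nu>) (at_right 0)"
    "((\<lambda>h. (LINT x:{pi-h..pi}|lebesgue. f x) / complex_of_real (h powr \<rho>)) \<longlongrightarrow> \<nu>) (at_right 0) \<longleftrightarrow>
      ((\<lambda>h. integral {pi-h..pi} f / complex_of_real (h powr \<rho>)) \<longlongrightarrow> \<nu>) (at_right 0)"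
    by (auto intro!: tendsto_cong elim!: eventually_mono)
qed

theorem theorem1:
  fixes P Q :: "real \<Rightarrow> complex" and A :: "complex^4^2" and S :: "(real \<Rightarrow> complex^2) set"
  assumes P_L1: "P absolutely_integrable_on {0..pi}"
    and Q_L1: "Q absolutely_integrable_on {0..pi}"
    and rows_A: "independent_rows A"
    and minors: "col_minor A 1 4 * col_minor A 3 2 = 0" "col_minor A 1 3 = 0" "col_minor A 2 4 = 0"
    and cases:
      "(col_minor A 1 4 \<noteq> 0 \<and>
         (\<exists>\<rho>\<^sub>5 \<rho>\<^sub>7 :: real. \<exists>\<nu>\<^sub>5 \<nu>\<^sub>7 :: complex. \<rho>\<^sub>5 > 0 \<and> \<rho>\<^sub>7 > 0 \<and> \<nu>\<^sub>5 \<noteq> 0 \<and> \<nu>\<^sub>7 \<noteq> 0 \<and>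
           ((\<lambda>h. (LINT x:{0..h}|lebesgue. P x) / complex_of_real (h powr \<rho>\<^sub>5)) \<longlongrightarrow> \<nu>\<^sub>5) (at_right 0) \<and>
           ((\<lambda>h. (LINT x:{pi-h..pi}|lebesgue. Q x) / complex_of_real (h powr \<rho>\<^sub>7)) \<longlongrightarrow> \<nu>\<^sub>7) (at_right 0)))
       \<or>
       (col_minor A 3 2 \<noteq> 0 \<and>
         (\<exists>\<rho>\<^sub>4 \<rho>\<^sub>6 :: real. \<exists>\<nu>\<^sub>4 \<nu>\<^sub>6 :: complex. \<rho>\<^sub>4 > 0 \<and> \<rho>\<^sub>6 > 0 \<and> \<nu>\<^sub>4 \<noteq> 0 \<and> \<nu>\<^sub>6 \<noteq> 0 \<and>
           ((\<lambda>h. (LINT x:{pi-h..pi}|lebesgue. P x) / complex_of_real (h powr \<rho>\<^sub>4)) \<longlongrightarrow> \<nu>\<^sub>4) (at_right 0) \<and>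
           ((\<lambda>h. (LINT x:{0..h}|lebesgue. Q x) / complex_of_real (h powr \<rho>\<^sub>6)) \<longlongrightarrow> \<nu>\<^sub>6) (at_right 0)))"
    and S: "root_function_system P Q A S"
  shows "complete_system S \<and> minimal_system S"
proof -
  interpret dirac_problem P Q A by unfold_locales (rule P_L1 Q_L1)+
  note limits = endpoint_limits[OF P_L1] endpoint_limits[OF Q_L1]
  from cases show ?thesis
  proof (elim disjE conjE exE)
    fix \<rho> \<rho>' :: real and \<nu> \<nu>' :: complex
    assume nz: "col_minor A 1 4 \<noteq> 0" and pos: "\<rho> > 0" "\<rho>' > 0" "\<nu> \<noteq> 0" "\<nu>' \<noteq> 0"
      and lim: "((\<lambda>h. (LINT x:{0..h}|lebesgue. P x) / complex_of_real (h powr \<rho>)) \<longlongrightarrow> \<nu>) (at_right 0)"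
        "((\<lambda>h. (LINT x:{pi-h..pi}|lebesgue. Q x) / complex_of_real (h powr \<rho>')) \<longlongrightarrow> \<nu>') (at_right 0)"
    obtain \<alpha> \<beta> where ab: "\<alpha> * \<beta> = 0"
      "\<And>y :: real \<Rightarrow> complex^2. (\<forall>j. bform A j y = 0) \<Longrightarrow> y 0 $ 1 = \<alpha> * y pi $ 1 \<and> y pi $ 2 = \<beta> * y 0 $ 2"
      by (rule boundary_relations_upper[OF nz minors]) (rule that; assumption)
    interpret dirac_estimates P Q A 1
      by (rule estimates_upper[OF ab(2,1) pos lim[unfolded limits]])
    show ?thesis by (rule root_system_complete_minimal[OF S])
  next
    fix \<rho> \<rho>' :: real and \<nu> \<nu>' :: complex
    assume nz: "col_minor A 3 2 \<noteq> 0" and pos: "\<rho> > 0" "\<rho>' > 0" "\<nu> \<noteq> 0" "\<nu>' \<noteq> 0"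
      and lim: "((\<lambda>h. (LINT x:{pi-h..pi}|lebesgue. P x) / complex_of_real (h powr \<rho>)) \<longlongrightarrow> \<nu>) (at_right 0)"
        "((\<lambda>h. (LINT x:{0..h}|lebesgue. Q x) / complex_of_real (h powr \<rho>')) \<longlongrightarrow> \<nu>') (at_right 0)"
    obtain \<alpha> \<beta> where ab: "\<alpha> * \<beta> = 0"
      "\<And>y :: real \<Rightarrow> complex^2. (\<forall>j. bform A j y = 0) \<Longrightarrow> y 0 $ 2 = \<alpha> * y pi $ 2 \<and> y pi $ 1 = \<beta> * y 0 $ 1"
      by (rule boundary_relations_lower[OF nz minors]) (rule that; assumption)
    \<comment> \<open>The roles are exchanged: Q at 0 now takes the place of P at 0, hence the
      swapped order of exponents and limits.\<close>
    interpret dirac_estimates P Q A "-1"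
      by (rule estimates_lower[OF ab(2,1) pos(2,1,4,3) lim(2,1)[unfolded limits]])
    show ?thesis by (rule root_system_complete_minimal[OF S])
  qed
qed

end
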